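(* Let $s\in(0,1)$, $N>2s$, $2^*_s=\frac{2N}{N-2s}$, $q\ge 2^*_s$, $A\in C(\mathbb{R}^N,\mathbb{R}^N)$ and $V_\infty>0$. Let $g\in C(\mathbb{R}_+,\mathbb{R})$, with $G(t)=\int_0^t g(\tau)\,d\tau$, satisfy: (g1) $\limsup_{t\to0^+} g(t)/t^{(2^*_s-2)/2}<+\infty$; (g2) there is $p\in(2,2^*_s)$ with $\limsup_{t\to+\infty} g(t)/t^{(p-2)/2}<+\infty$; (g3) there is $\theta\in(2,p]$ with $0<\frac{\theta}{2}G(t)\le t\,g(t)$ for all $t>0$. Then there are $\lambda_0,\Lambda_0>0$ such that the following holds for each $\lambda\in[0,\lambda_0)$ and each $\Lambda\ge\Lambda_0$. If $V\in C(\mathbb{R}^N,\mathbb{R})$ satisfies (V1) $V(x)\ge0$ for all $x\in\mathbb{R}^N$; (V2) $V(x)\le V_\infty$ for all $x\in B_1(0)$; (V3) there is $R_0>1$ such that $\frac{1}{R_0^{4s}}\inf_{|x|\ge R_0}|x|^{4s}V(x)\ge\Lambda$, then the problem $$(-\Delta)_A^s u+V(x)u=g(|u|^2)u+\lambda|u|^{q-2}u\quad\text{in }\mathbb{R}^N$$ has a nontrivial weak solution $u\in E$.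
   Context: Functions $u$ are complex valued, $\mathbb{R}_+=[0,\infty)$, $\Re$ is the real part. The fractional magnetic Laplacian is $$(-\Delta)_A^s u(x)=C_{N,s}\lim_{\varepsilon\to0}\int_{\mathbb{R}^N\setminus B_\varepsilon(x)}\frac{u(x)-u(y)e^{iA(\frac{x+y}{2})\cdot(x-y)}}{|x-y|^{N+2s}}\,dy,\quad C_{N,s}=\frac{4^s\Gamma(\frac{N+2s}{2})}{\pi^{N/2}|\Gamma(-s)|};$$ the equation is understood in the weak sense below, where the normalization constant is omitted. $\mathcal{D}^{s,2}_A(\mathbb{R}^N,\mathbb{C})$ is the completion of $C_0^\infty(\mathbb{R}^N,\mathbb{C})$ with respect to $[u]_{s,A}=\left(\iint_{\mathbb{R}^{2N}}\frac{|u(x)-u(y)e^{iA(\frac{x+y}{2})\cdot(x-y)}|^2}{|x-y|^{N+2s}}\,dx\,dy\right)^{1/2}$, characterized as $\{u\in L^{2^*_s}(\mathbb{R}^N,\mathbb{C}):[u]_{s,A}<\infty\}$, and $$E=\Big\{u\in\mathcal{D}^{s,2}_A(\mathbb{R}^N,\mathbb{C}):\int_{\mathbb{R}^N}V(x)|u|^2\,dx<\infty\Big\}.$$ A function $u\in E$ is a weak solution of the problem if for all $\phi\in E$ $$\Re\iint_{\mathbb{R}^{2N}}\frac{\big(u(x)-u(y)e^{iA(\frac{x+y}{2})\cdot(x-y)}\big)\overline{\big(\phi(x)-\phi(y)e^{iA(\frac{x+y}{2})\cdot(x-y)}\big)}}{|x-y|^{N+2s}}\,dx\,dy+\Re\Big(\int_{\mathbb{R}^N}V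 u\overline{\phi}\,dx-\int_{\mathbb{R}^N}g(|u|^2)u\overline{\phi}\,dx-\lambda\int_{\mathbb{R}^N}|u|^{q-2}u\overline{\phi}\,dx\Big)=0.$$ *)

theory Defs
  imports "HOL-Analysis.Analysis"
begin

definition sobolev_crit :: "nat \<Rightarrow> real \<Rightarrow> real" where
  "sobolev_crit N s = 2 * real N / (real N - 2 * s)"

definition mag_diff ::
  "(real^'n \<Rightarrow> real^'n) \<Rightarrow> (real^'n \<Rightarrow> complex) \<Rightarrow> real^'n \<Rightarrow> real^'n \<Rightarrow> complex" where
  "mag_diff A u x y = u x - u y * cis (A ((1/2) *\<^sub>R (x + y)) \<bullet> (x - y))"

(* On the diagonal x = y, a null set, the kernel below is 0 because division by 0 gives 0. *)

text \<open>The square of the Gagliardo seminorm, with value \<open>\<infinity>\<close> allowed.\<close>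

definition mag_seminorm_sq ::
  "real \<Rightarrow> (real^'n \<Rightarrow> real^'n) \<Rightarrow> (real^'n \<Rightarrow> complex) \<Rightarrow> ennreal" where
  "mag_seminorm_sq s A u =
     (\<integral>\<^sup>+(x, y). ennreal ((cmod (mag_diff A u x y))\<^sup>2 / norm (x - y) powr (real CARD('n) + 2 * s))
        \<partial>(lborel \<Otimes>\<^sub>M lborel))"

text \<open>The completion of the complex-valued smooth compactly supported functions with respect to
  the seminorm, realised as a function space inside the critical Lebesgue space. Elements are
  Borel representatives of almost-everywhere classes.\<close>

definition mag_sobolev_space ::
  "real \<Rightarrow> (real^'n \<Rightarrow> real^'n) \<Rightarrow> (real^'n \<Rightarrow> complex) set" where
  "mag_sobolev_space s A =
     {u. u \<in> borel_measurable lborel \<and>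
         integrable lborel (\<lambda>x. cmod (u x) powr sobolev_crit CARD('n) s) \<and>
         mag_seminorm_sq s A u < \<infinity>}"

definition energy_space ::
  "real \<Rightarrow> (real^'n \<Rightarrow> real^'n) \<Rightarrow> (real^'n \<Rightarrow> real) \<Rightarrow> (real^'n \<Rightarrow> complex) set" where
  "energy_space s A V =
     {u \<in> mag_sobolev_space s A. integrable lborel (\<lambda>x. V x * (cmod (u x))\<^sup>2)}"

definition mag_form ::
  "real \<Rightarrow> (real^'n \<Rightarrow> real^'n) \<Rightarrow> (real^'n \<Rightarrow> complex) \<Rightarrow> (real^'n \<Rightarrow> complex) \<Rightarrow> complex" where
  "mag_form s A u \<phi> =
     (\<integral>(x, y). mag_diff A u x y * cnj (mag_diff A \<phi> x y)
                 / of_real (norm (x - y) powr (real CARD('n) + 2 * s))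
        \<partial>(lborel \<Otimes>\<^sub>M lborel))"

text \<open>The Bochner integral of a non-integrable function is \<open>0\<close>, so the definition requires the
  two nonlinear terms to be integrable: for \<open>q\<close> above the critical exponent this does not follow
  from membership in the energy space. For the two quadratic terms integrability is automatic by
  Cauchy-Schwarz when \<open>V\<close> is nonnegative.\<close>

definition weak_solution ::
  "real \<Rightarrow> (real^'n \<Rightarrow> real^'n) \<Rightarrow> (real^'n \<Rightarrow> real) \<Rightarrow> (real \<Rightarrow> real) \<Rightarrow> real \<Rightarrow> real
     \<Rightarrow> (real^'n \<Rightarrow> complex) \<Rightarrow> bool" where
  "weak_solution s A V g lam q u \<longleftrightarrow>
     u \<in> energy_space s A V \<and>
     (\<forall>\<phi> \<in> energy_space s A V.
        integrable lborel (\<lambda>x. of_real (g ((cmod (u x))\<^sup>2)) * u x * cnj (\<phi> x)) \<and>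
        integrable lborel (\<lambda>x. of_real (cmod (u x) powr (q - 2)) * u x * cnj (\<phi> x)) \<and>
        Re (mag_form s A u \<phi>) +
        Re ((\<integral>x. of_real (V x) * u x * cnj (\<phi> x) \<partial>lborel)
            - (\<integral>x. of_real (g ((cmod (u x))\<^sup>2)) * u x * cnj (\<phi> x) \<partial>lborel)
            - of_real lam * (\<integral>x. of_real (cmod (u x) powr (q - 2)) * u x * cnj (\<phi> x) \<partial>lborel))
        = 0)"

end

theory Submission
  imports Defs "HOL-Complex_Analysis.Great_Picard" "HOL-Library.Function_Algebras"
begin

text \<open>The nonlinearity is modified in two places: the supercritical power is cut off at height
  \<open>M\<close>, and outside the ball \<open>|x| \<le> R0\<close> the reaction coefficient is capped by
  \<open>P(x) = B (R0/|x|)^(4s)\<close>, which by (V3) is a small multiple of \<open>V\<close>. The modified functional has a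
  mountain pass geometry, (g3) and the smallness of \<open>P/V\<close> make it coercive along almost critical
  points, and Rellich compactness on balls together with the integrability of \<open>P^(N/2s)\<close> at
  infinity gives a nontrivial critical point \<open>U\<close> whose energy is bounded independently of \<open>V\<close>, \<open>M\<close>
  and \<open>lam\<close> as long as \<open>lam M^(q-p) \<le> 1\<close>. De Giorgi iteration with the subcritical growth then bounds \<open>|U|\<close> by
  a constant depending on this energy only, which fixes \<open>M\<close> and afterwards \<open>lam0\<close>. Finally \<open>|U|\<close> is
  compared with the \<open>s\<close>-superharmonic function \<open>(R0^2 + |x|^2)^(-(N-2s)/2)\<close>. Because
  \<open>(2*_s - 2)(N - 2s) = 4s\<close>, the resulting decay shows that the cap \<open>P\<close> is never active, so \<open>U\<close>
  solves the original equation.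

  Both the kernel \<open>|z|^(-N-2s)\<close> and the comparison function are superpositions of Gaussians, so the
  potential theory reduces to convolving Gaussians.\<close>

section \<open>Gaussian superpositions\<close>

text \<open>The constants have to be fixed in an order that never looks at V, R0 or \<Lambda>. The
  endpoint of the mountain pass therefore lives in the unit ball, where V is at most Vinf and, as R0
  > 1, the cap is absent; its energy and all a priori bounds then depend on s, N, A, Vinf and the
  data of g only. The cap is a multiple of (R0/|x|)^(4s) because the decay estimate is scale
  invariant: R0 enters it only through R0/|x|, the quantity normalised in (V3), so one \<Lambda>0
  serves every R0. Two obstacles shape the rest. E is treated as a set of Borel functions without a
  completeness argument, so no deformation flow is used and limits are identified by a.e.
  convergence; nontriviality of the limit is enough, strong convergence is not sought. And
  |x-y|^(-N-2s) is not integrable near the diagonal, so the fractional Laplacian of a comparison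
  function cannot simply be integrated against a test function; cutting the Gaussian mixture at
  small times gives an integrable kernel with the right sign, and the cut is removed inside the
  quadratic form.\<close>

definition invgamma_const :: "real \<Rightarrow> ennreal" where
  "invgamma_const \<beta> = (\<integral>\<^sup>+t. ennreal (t powr (-\<beta>-1) * exp (-1/t)) * indicator {0<..} t \<partial>lborel)"

text \<open>Substituting 1/t shows that \<open>invgamma_const \<beta>\<close> is Gamma(\<beta>) for
  \<beta> > 0. The scaling is what turns a negative power of y into a mixture of the exponentials
  exp(-y/t), and with y a squared norm into a mixture of Gaussians.\<close>

lemma invgamma_scaling:
  assumes "y > 0"
  shows "(\<integral>\<^sup>+t. ennreal (t powr (-\<beta>-1) * exp (-y/t)) * indicator {0<..} t \<partial>lborel)
    = ennreal (y powr (-\<beta>)) * invgamma_const \<beta>"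
proof -
  have "(\<integral>\<^sup>+t. ennreal (t powr (-\<beta>-1) * exp (-y/t)) * indicator {0<..} t \<partial>lborel)
    = ennreal y * (\<integral>\<^sup>+t. ennreal ((0+y*t) powr (-\<beta>-1) * exp (-y/(0+y*t))) * indicator {0<..} (0+y*t) \<partial>lborel)"
    using assms by (subst nn_integral_real_affine[where c=y and t=0]) auto
  also have "\<dots> = ennreal y * (\<integral>\<^sup>+t. ennreal (y powr (-\<beta>-1)) * (ennreal (t powr (-\<beta>-1) * exp (-1/t)) * indicator {0<..} t) \<partial>lborel)"
  proof (rule arg_cong2[where f="(*)", OF refl nn_integral_cong])
    fix t :: real
    have "(y*t) powr (-\<beta>-1) * exp (-y/(y*t)) = y powr (-\<beta>-1) * (t powr (-\<beta>-1) * exp (-1/t))" if "t > 0"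
      using that assms by (simp add: powr_mult)
    thus "ennreal ((0+y*t) powr (-\<beta>-1) * exp (-y/(0+y*t))) * indicator {0<..} (0+y*t)
      = ennreal (y powr (-\<beta>-1)) * (ennreal (t powr (-\<beta>-1) * exp (-1/t)) * indicator {0<..} t)"
      using assms by (auto simp: indicator_def zero_less_mult_iff ennreal_mult[symmetric])
  qed
  also have "\<dots> = ennreal (y * y powr (-\<beta>-1)) * invgamma_const \<beta>"
    unfolding invgamma_const_def using assms
    by (subst nn_integral_cmult) (auto simp: ennreal_mult mult.assoc)
  also have "y * y powr (-\<beta>-1) = y powr (-\<beta>)"
    using assms by (simp add: powr_diff powr_minus field_simps)
  finally show ?thesis .
qed

lemma nn_integral_of_has_integral:
  fixes f :: "'a::euclidean_space \<Rightarrow> real"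
  assumes I: "(f has_integral I) S" and nn: "\<And>x. x \<in> S \<Longrightarrow> f x \<ge> 0"
    and [measurable]: "f \<in> borel_measurable borel" "S \<in> sets borel"
  shows "(\<integral>\<^sup>+x. ennreal (f x) * indicator S x \<partial>lborel) = ennreal I"
proof -
  have "((\<lambda>x. f x * indicator S x) has_integral I) UNIV"
    using I has_integral_restrict_UNIV[of S f I] by (simp add: indicator_times_eq_if)
  hence "(\<integral>\<^sup>+x. ennreal (f x * indicator S x) \<partial>lborel) = ennreal I"
    by (intro nn_integral_has_integral_lborel) (auto simp: indicator_def nn)
  moreover have "ennreal (f x * indicator S x) = ennreal (f x) * indicator S x" for x
    by (auto simp: indicator_def)
  ultimately show ?thesis by simp
qed

lemma nn_integral_powr_tail:
  assumes "e > 0" "\<beta> > 0"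
  shows "(\<integral>\<^sup>+t. ennreal (t powr (-\<beta>-1)) * indicator {e<..} t \<partial>lborel) = ennreal (e powr (-\<beta>) / \<beta>)"
proof -
  have "((\<lambda>t. t powr (-\<beta>-1)) has_integral -(e powr (-\<beta>-1+1)) / (-\<beta>-1+1)) {e..}"
    using assms by (intro has_integral_powr_to_inf) auto
  hence I: "((\<lambda>t. t powr (-\<beta>-1)) has_integral (e powr (-\<beta>)) / \<beta>) {e..}"
    by simp
  have "(\<integral>\<^sup>+t. ennreal (t powr (-\<beta>-1)) * indicator {e..} t \<partial>lborel) = ennreal (e powr (-\<beta>) / \<beta>)"
    by (intro nn_integral_of_has_integral I) auto
  moreover have "(\<integral>\<^sup>+t. ennreal (t powr (-\<beta>-1)) * indicator {e<..} t \<partial>lborel) = 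
    (\<integral>\<^sup>+t. ennreal (t powr (-\<beta>-1)) * indicator {e..} t \<partial>lborel)"
    by (intro nn_integral_cong_AE eventually_mono[OF AE_lborel_singleton[of e]]) (auto simp: indicator_def)
  ultimately show ?thesis by simp
qed

text \<open>The maximum over t sits at t = 1/\<gamma>; ln z \<le> z - 1 at z = 1/(t \<gamma>) yields
  it without differentiating.\<close>

lemma powr_exp_minus_bound:
  fixes \<gamma> t :: real assumes "\<gamma> > 0" "t > 0"
  shows "t powr (-\<gamma>) * exp (-1/t) \<le> \<gamma> powr \<gamma> * exp (-\<gamma>)"
proof -
  have "ln (1/(t*\<gamma>)) \<le> 1/(t*\<gamma>) - 1"
    using assms by (intro ln_le_minus_one) auto
  hence "- ln t - ln \<gamma> \<le> 1/(t*\<gamma>) - 1"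
    using assms by (simp add: ln_div ln_mult)
  hence "\<gamma> * (- ln t - ln \<gamma>) \<le> \<gamma> * (1/(t*\<gamma>) - 1)"
    using assms by (intro mult_left_mono) auto
  also have "\<gamma> * (1/(t*\<gamma>) - 1) = 1/t - \<gamma>" using assms by (simp add: right_diff_distrib)
  finally have "-\<gamma> * ln t - 1/t \<le> \<gamma> * ln \<gamma> - \<gamma>"
    by (simp add: algebra_simps)
  hence "exp (-\<gamma> * ln t - 1/t) \<le> exp (\<gamma> * ln \<gamma> - \<gamma>)" by simp
  moreover have "t powr (-\<gamma>) * exp (-1/t) = exp (-\<gamma> * ln t - 1/t)"
    using assms by (simp add: powr_def exp_diff exp_minus divide_inverse)
  moreover have "\<gamma> powr \<gamma> * exp (-\<gamma>) = exp (\<gamma> * ln \<gamma> - \<gamma>)"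
    using assms by (simp add: powr_def exp_diff exp_minus divide_inverse)
  ultimately show ?thesis by simp
qed

lemma invgamma_const_finite:
  assumes "\<beta> > 0" shows "invgamma_const \<beta> < \<infinity>"
proof -
  define C where "C = (\<beta>+1) powr (\<beta>+1) * exp (-(\<beta>+1))"
  have "invgamma_const \<beta> \<le> (\<integral>\<^sup>+t. ennreal C * indicator {0..1} t + ennreal (t powr (-\<beta>-1)) * indicator {1<..} t \<partial>lborel)"
    unfolding invgamma_const_def
  proof (intro nn_integral_mono)
    fix t :: real
    show "ennreal (t powr (-\<beta>-1) * exp (-1/t)) * indicator {0<..} t
      \<le> ennreal C * indicator {0..1} t + ennreal (t powr (-\<beta>-1)) * indicator {1<..} t"
    proof -
      consider "t \<le> 0" | "0 < t" "t \<le> 1" | "t > 1" by linarith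
      thus ?thesis
      proof cases
        case 1 thus ?thesis by (simp add: indicator_def)
      next
        case 2
        have "-(\<beta>+1) = -\<beta>-1" by simp
        thus ?thesis using 2 powr_exp_minus_bound[of "\<beta>+1" t] assms
          by (simp add: C_def indicator_def ennreal_leI)
      next
        case 3
        have "t powr (-\<beta>-1) * exp (-1/t) \<le> t powr (-\<beta>-1)"
          using 3 by (intro mult_left_le) auto
        thus ?thesis using 3 by (simp add: indicator_def ennreal_leI)
      qed
    qed
  qed
  also have "\<dots> = ennreal C + ennreal (1 / \<beta>)"
    using assms by (subst nn_integral_add) (auto simp: nn_integral_cmult_indicator nn_integral_powr_tail)
  also have "\<dots> < \<infinity>" by simp
  finally show ?thesis .
qed

lemma invgamma_const_pos: "invgamma_const \<beta> > 0"
proof -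
  have "invgamma_const \<beta> \<noteq> 0"
  proof
    assume "invgamma_const \<beta> = 0"
    hence "AE t in lborel. ennreal (t powr (-\<beta>-1) * exp (-1/t)) * indicator {0<..} t = 0"
      unfolding invgamma_const_def by (rule nn_integral_0_iff_AE[THEN iffD1, rotated]) measurable
    hence "AE t in lborel. t \<notin> {0<..(1::real)}" 
    proof eventually_elim
      case (elim t)
      show ?case
      proof
        assume "t \<in> {0<..1}"
        hence "t powr (-\<beta>-1) * exp (-1/t) > 0" by simp
        moreover have "t powr (-\<beta>-1) * exp (-1/t) \<le> 0"
          using elim \<open>t \<in> {0<..1}\<close> by (simp add: ennreal_eq_0_iff)
        ultimately show False by linarith
      qed
    qed
    hence "{0<..(1::real)} \<in> null_sets lborel"
      by (simp add: AE_iff_null_sets)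
    thus False by (simp add: null_sets_def)
  qed
  thus ?thesis by (simp add: zero_less_iff_neq_zero)
qed

section \<open>Gaussian integrals and the semigroup law\<close>

definition gauss_const :: "'a::euclidean_space itself \<Rightarrow> ennreal" where
  "gauss_const _ = (\<integral>\<^sup>+(x::'a). ennreal (exp (-(norm x)\<^sup>2)) \<partial>lborel)"

text \<open>The constant is pi^(n/2). Finiteness follows by factoring over coordinates and using
  exp(-x^2) \<le> x^(-2) for the one-dimensional tails.\<close>

lemma gauss_const_finite: "gauss_const TYPE('a::euclidean_space) < \<infinity>"
proof -
  have 1: "(\<integral>\<^sup>+x. ennreal (exp (-x\<^sup>2)) \<partial>lborel) < \<infinity>"
  proof -
    have "(\<integral>\<^sup>+x. ennreal (exp (-x\<^sup>2)) \<partial>lborel) \<le> (\<integral>\<^sup>+x. indicator {-1..1} x + (ennreal (x powr (-1-1)) * indicator {1<..} x)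
        + (ennreal ((-x) powr (-1-1)) * indicator {1<..} (-x)) \<partial>lborel)"
    proof (intro nn_integral_mono)
      fix x :: real
      have e: "exp (-x\<^sup>2) \<le> x powr (-1-1)" if "x > 0" for x :: real
      proof -
        have "exp (-x\<^sup>2) = 1 / exp (x\<^sup>2)" by (simp add: exp_minus divide_inverse)
        also have "\<dots> \<le> 1 / x\<^sup>2" using exp_ge_add_one_self[of "x\<^sup>2"] that by (intro divide_left_mono) (linarith, auto)
        also have "\<dots> = x powr (-1-1)" using that by (simp add: powr_minus powr_numeral divide_inverse)
        finally show ?thesis .
      qed
      consider "\<bar>x\<bar> \<le> 1" | "x > 1" | "x < -1" by linarith
      thus "ennreal (exp (-x\<^sup>2)) \<le> indicator {-1..1} x + (ennreal (x powr (-1-1)) * indicator {1<..} x)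
        + (ennreal ((-x) powr (-1-1)) * indicator {1<..} (-x))"
      proof cases
        case 1
        hence "x \<in> {-1..1}" "x \<notin> {1<..}" "-x \<notin> {1<..}" by auto
        thus ?thesis by simp
      next
        case 2 thus ?thesis using e[of x] by (simp add: indicator_def ennreal_leI)
      next
        case 3 thus ?thesis using e[of "-x"] by (simp add: indicator_def ennreal_leI)
      qed
    qed
    also have "\<dots> = emeasure lborel {-1..1::real} + ennreal 1 + ennreal 1"
    proof -
      have "(\<integral>\<^sup>+x. ennreal ((-x) powr (-1-1)) * indicator {1<..} (-x) \<partial>lborel) = (\<integral>\<^sup>+x. ennreal (x powr (-1-1)) * indicator {1<..} x \<partial>lborel)"
        by (subst (2) nn_integral_real_affine[where c="-1" and t=0]) auto
      thus ?thesis using nn_integral_powr_tail[of 1 1]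
        by (simp add: nn_integral_add nn_integral_cmult)
    qed
    also have "\<dots> < \<infinity>" by (auto simp: ennreal_mult_less_top)
    finally show ?thesis .
  qed
  have "gauss_const TYPE('a) = (\<integral>\<^sup>+(x::'a). (\<Prod>b\<in>Basis. ennreal (exp (-(x \<bullet> b)\<^sup>2))) \<partial>lborel)"
    unfolding gauss_const_def
  proof (intro nn_integral_cong)
    fix x :: 'a
    have "(norm x)\<^sup>2 = (\<Sum>b\<in>Basis. (x \<bullet> b)\<^sup>2)"
      unfolding power2_norm_eq_inner by (subst euclidean_inner) (simp add: power2_eq_square)
    hence "exp (-(norm x)\<^sup>2) = (\<Prod>b\<in>Basis. exp (-(x \<bullet> b)\<^sup>2))"
      by (simp add: exp_sum[symmetric] sum_negf)
    thus "ennreal (exp (-(norm x)\<^sup>2)) = (\<Prod>b\<in>Basis. ennreal (exp (-(x \<bullet> b)\<^sup>2)))"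
      by (simp add: prod_ennreal)
  qed
  also have "\<dots> = (\<Prod>b\<in>(Basis::'a set). \<integral>\<^sup>+x. ennreal (exp (-x\<^sup>2)) \<partial>lborel)"
    by (subst nn_integral_lborel_prod[of "\<lambda>_ x. ennreal (exp (-x\<^sup>2))"]) auto
  also have "\<dots> < \<infinity>"
    using 1 by (simp add: power_less_top_ennreal)
  finally show ?thesis .
qed

lemma nn_integral_lborel_scale:
  fixes f :: "'a::euclidean_space \<Rightarrow> ennreal"
  assumes [measurable]: "f \<in> borel_measurable borel" and "c \<noteq> 0"
  shows "(\<integral>\<^sup>+x. f x \<partial>lborel) = ennreal (\<bar>c\<bar> ^ DIM('a)) * (\<integral>\<^sup>+x. f (t + c *\<^sub>R x) \<partial>lborel)"
proof -
  have "(\<integral>\<^sup>+x. f x \<partial>lborel) = (\<integral>\<^sup>+x. f x \<partial>density (distr lborel borel (\<lambda>x. t + c *\<^sub>R x)) (\<lambda>_. \<bar>c\<bar>^DIM('a)))"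
    using assms by (subst lborel_affine[of c t]) auto
  also have "\<dots> = ennreal (\<bar>c\<bar> ^ DIM('a)) * (\<integral>\<^sup>+x. f (t + c *\<^sub>R x) \<partial>lborel)"
    using assms by (simp add: nn_integral_density nn_integral_distr nn_integral_cmult)
  finally show ?thesis .
qed

lemma nn_integral_lborel_reflect:
  fixes f :: "'a::euclidean_space \<Rightarrow> ennreal"
  assumes [measurable]: "f \<in> borel_measurable borel"
  shows "(\<integral>\<^sup>+x. f (t - x) \<partial>lborel) = (\<integral>\<^sup>+x. f x \<partial>lborel)"
proof -
  show ?thesis using nn_integral_lborel_scale[of f "-1" t] by simp
qed

text \<open>Up to the factor pi^(n/2) this is the heat kernel at time t/4. With this normalisation
  the mass does not depend on t and convolution adds the parameters t.\<close>

definition gauss_kernel :: "real \<Rightarrow> 'a::euclidean_space \<Rightarrow> real" where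
  "gauss_kernel t x = t powr (- real DIM('a) / 2) * exp (-(norm x)\<^sup>2 / t)"

lemma gauss_kernel_nonneg [simp]: "gauss_kernel t x \<ge> 0"
  by (simp add: gauss_kernel_def)

lemma measurable_gauss_kernel [measurable]:
  assumes [measurable]: "f \<in> borel_measurable M" "h \<in> borel_measurable M"
  shows "(\<lambda>x. gauss_kernel (f x) (h x :: 'a::euclidean_space)) \<in> borel_measurable M"
  unfolding gauss_kernel_def by measurable

lemma nn_integral_gauss:
  fixes b :: "'a::euclidean_space"
  assumes "t > 0"
  shows "(\<integral>\<^sup>+x. ennreal (exp (-(norm (x - b))\<^sup>2 / t)) \<partial>lborel) = ennreal (t powr (real DIM('a)/2)) * gauss_const TYPE('a)"
proof -
  have "(\<integral>\<^sup>+x. ennreal (exp (-(norm (x - b))\<^sup>2 / t)) \<partial>lborel)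
    = ennreal (sqrt t ^ DIM('a)) * (\<integral>\<^sup>+(x::'a). ennreal (exp (-(norm (b + sqrt t *\<^sub>R x - b))\<^sup>2 / t)) \<partial>lborel)"
    using assms by (subst nn_integral_lborel_scale[of _ "sqrt t" b]) auto
  also have "\<dots> = ennreal (sqrt t ^ DIM('a)) * gauss_const TYPE('a)"
    using assms unfolding gauss_const_def by (simp add: power_mult_distrib)
  also have "sqrt t ^ DIM('a) = t powr (real DIM('a)/2)"
    using assms by (simp add: powr_half_sqrt[symmetric] powr_realpow[symmetric] powr_powr)
  finally show ?thesis .
qed

lemma nn_integral_gauss_kernel:
  fixes b :: "'a::euclidean_space"
  assumes "t > 0"
  shows "(\<integral>\<^sup>+x. ennreal (gauss_kernel t (x - b)) \<partial>lborel) = gauss_const TYPE('a)"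
proof -
  have "(\<integral>\<^sup>+x. ennreal (gauss_kernel t (x - b)) \<partial>lborel) = ennreal (t powr (- real DIM('a) / 2)) * (\<integral>\<^sup>+x. ennreal (exp (-(norm (x - b))\<^sup>2 / t)) \<partial>lborel)"
    unfolding gauss_kernel_def by (subst nn_integral_cmult[symmetric]) (auto simp: ennreal_mult)
  also have "\<dots> = ennreal (t powr (- real DIM('a) / 2) * t powr (real DIM('a)/2)) * gauss_const TYPE('a)"
    using assms by (subst nn_integral_gauss) (simp_all add: ennreal_mult mult.assoc)
  also have "t powr (- real DIM('a) / 2) * t powr (real DIM('a)/2) = 1"
    using assms by (simp add: powr_add[symmetric])
  finally show ?thesis by simp
qed

lemma complete_square:
  fixes x y :: "'a::euclidean_space"
  assumes "t > 0" "\<tau> > 0"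
  shows "(norm (x - y))\<^sup>2 / t + (norm y)\<^sup>2 / \<tau> = (norm x)\<^sup>2 / (t+\<tau>) + (norm (y - (\<tau>/(t+\<tau>)) *\<^sub>R x))\<^sup>2 / (t*\<tau>/(t+\<tau>))"
proof -
  define c where "c = \<tau>/(t+\<tau>)"
  have n1: "(norm (x - y))\<^sup>2 = (norm x)\<^sup>2 - 2 * (x \<bullet> y) + (norm y)\<^sup>2"
    by (simp add: power2_norm_eq_inner inner_simps inner_commute)
  have n2: "(norm (y - c *\<^sub>R x))\<^sup>2 = (norm y)\<^sup>2 - 2 * c * (x \<bullet> y) + c\<^sup>2 * (norm x)\<^sup>2"
    by (simp add: power2_norm_eq_inner inner_simps inner_commute) (simp add: power2_eq_square algebra_simps)
  have "t + \<tau> \<noteq> 0" using assms by simp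
  show ?thesis unfolding c_def[symmetric] n1 n2 unfolding c_def using assms \<open>t + \<tau> \<noteq> 0\<close>
    by (simp add: divide_simps power2_eq_square) (simp add: algebra_simps)
qed

lemma gauss_kernel_convolution:
  fixes x :: "'a::euclidean_space"
  assumes "t > 0" "\<tau> > 0"
  shows "(\<integral>\<^sup>+y. ennreal (gauss_kernel t (x - y) * gauss_kernel \<tau> y) \<partial>lborel) = gauss_const TYPE('a) * ennreal (gauss_kernel (t+\<tau>) x)"
proof -
  define m where "m = real DIM('a) / 2"
  have e: "gauss_kernel t (x - y) * gauss_kernel \<tau> y = (t powr (-m) * \<tau> powr (-m) * exp (- (norm x)\<^sup>2 / (t+\<tau>)))
      * exp (- (norm (y - (\<tau>/(t+\<tau>)) *\<^sub>R x))\<^sup>2 / (t*\<tau>/(t+\<tau>)))" for y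
  proof -
    have "exp (-(norm (x - y))\<^sup>2 / t) * exp (-(norm y)\<^sup>2 / \<tau>) = exp (-((norm (x - y))\<^sup>2 / t + (norm y)\<^sup>2 / \<tau>))"
      by (simp add: exp_add[symmetric])
    also have "\<dots> = exp (-((norm x)\<^sup>2 / (t+\<tau>))) * exp (-((norm (y - (\<tau>/(t+\<tau>)) *\<^sub>R x))\<^sup>2 / (t*\<tau>/(t+\<tau>))))"
      by (subst complete_square[OF assms]) (simp add: exp_add[symmetric])
    finally show ?thesis by (simp add: gauss_kernel_def m_def mult_ac)
  qed
  have p: "t*\<tau>/(t+\<tau>) > 0" using assms by simp
  have "(\<integral>\<^sup>+y. ennreal (gauss_kernel t (x - y) * gauss_kernel \<tau> y) \<partial>lborel) =
     ennreal (t powr (-m) * \<tau> powr (-m) * exp (- (norm x)\<^sup>2 / (t+\<tau>))) * (ennreal ((t*\<tau>/(t+\<tau>)) powr m) * gauss_const TYPE('a))"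
    unfolding m_def nn_integral_gauss[OF p, of "(\<tau>/(t+\<tau>)) *\<^sub>R x", symmetric] unfolding e m_def
    by (subst nn_integral_cmult[symmetric]) (auto simp: ennreal_mult)
  also have "\<dots> = ennreal (t powr (-m) * \<tau> powr (-m) * exp (- (norm x)\<^sup>2 / (t+\<tau>)) * (t*\<tau>/(t+\<tau>)) powr m) * gauss_const TYPE('a)"
    by (simp add: ennreal_mult mult.assoc)
  also have "t powr (-m) * \<tau> powr (-m) * exp (- (norm x)\<^sup>2 / (t+\<tau>)) * (t*\<tau>/(t+\<tau>)) powr m = gauss_kernel (t+\<tau>) x"
    using assms by (simp add: gauss_kernel_def m_def powr_divide powr_mult powr_minus field_simps)
  finally show ?thesis by (simp add: mult.commute)
qed

section \<open>Fractional kernels as mixtures of Gaussians\<close>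

lemma nn_integral_beta:
  fixes s e \<tau> :: real
  assumes "0 < s" "s < 1" "0 < e" "e < \<tau>"
  shows "(\<integral>\<^sup>+t. ennreal (t powr (-1-s) * (\<tau>-t) powr (s-1)) * indicator {e..\<tau>} t \<partial>lborel)
    = ennreal (e powr (-s) * (\<tau>-e) powr s / (s*\<tau>))"
proof -
  \<comment> \<open>The two exponents add up to -2, which is why an elementary primitive
    exists.\<close>
  define F where "F t = - ((\<tau>-t) powr s * t powr (-s)) / (s*\<tau>)" for t
  have "((\<lambda>t. t powr (-1-s) * (\<tau>-t) powr (s-1)) has_integral (F \<tau> - F e)) {e..\<tau>}"
  \<comment> \<open>The integrand blows up at t = \<tau> since s < 1, so at the endpoints only
    continuity of \<open>F\<close> is available.\<close>
  proof (rule fundamental_theorem_of_calculus_interior)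
    show "continuous_on {e..\<tau>} F"
      unfolding F_def using assms
      by (intro continuous_intros continuous_on_powr') auto
    fix t assume t: "t \<in> {e<..<\<tau>}"
    have "(F has_real_derivative
       - ((s * (\<tau>-t) powr (s-1) * (-1)) * t powr (-s) + (\<tau>-t) powr s * (-s * t powr (-s-1))) / (s*\<tau>)) (at t)"
      unfolding F_def using t assms
      by (auto intro!: derivative_eq_intros simp: field_simps)
    moreover have "(\<tau>-t) powr s = (\<tau>-t) powr (s-1) * (\<tau>-t)" "t powr (-s) = t powr (-1-s) * t" "t powr (-s-1) = t powr (-1-s)"
      using t assms by (simp_all add: powr_mult_base[symmetric] powr_minus powr_diff powr_add field_simps)
    ultimately have "(F has_real_derivative
       - ((s * (\<tau>-t) powr (s-1) * (-1)) * (t powr (-1-s) * t) + (\<tau>-t) powr (s-1) * (\<tau>-t) * (-s * t powr (-1-s))) / (s*\<tau>)) (at t)"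
      by simp
    moreover have "- ((s * (\<tau>-t) powr (s-1) * (-1)) * (t powr (-1-s) * t) + (\<tau>-t) powr (s-1) * (\<tau>-t) * (-s * t powr (-1-s))) / (s*\<tau>)
      = t powr (-1-s) * (\<tau>-t) powr (s-1)"
      using t assms by (simp add: field_simps)
    ultimately show "(F has_vector_derivative t powr (-1-s) * (\<tau>-t) powr (s-1)) (at t)"
      by (simp add: has_real_derivative_iff_has_vector_derivative)
  qed (use assms in auto)
  hence "(\<integral>\<^sup>+t. ennreal (t powr (-1-s) * (\<tau>-t) powr (s-1)) * indicator {e..\<tau>} t \<partial>lborel) = ennreal (F \<tau> - F e)"
    by (intro nn_integral_of_has_integral) auto
  also have "F \<tau> - F e = e powr (-s) * (\<tau>-e) powr s / (s*\<tau>)"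
    using assms by (simp add: F_def mult.commute)
  finally show ?thesis .
qed

text \<open>At \<open>e = 0\<close> this is a multiple of \<open>|z|^(-N-2s)\<close>; the cut at \<open>e > 0\<close> makes it integrable.\<close>

definition ker_cut :: "real \<Rightarrow> real \<Rightarrow> 'a::euclidean_space \<Rightarrow> ennreal" where
  "ker_cut s e z = (\<integral>\<^sup>+t. ennreal (t powr (-1-s) * gauss_kernel t z) * indicator {e<..} t \<partial>lborel)"

text \<open>As a function of \<open>x\<close> this is a multiple of \<open>(R^2 + |x|^2)^(-(N-2s)/2)\<close>.\<close>

definition heat_potential :: "real \<Rightarrow> real \<Rightarrow> 'a::euclidean_space \<Rightarrow> ennreal" where
  "heat_potential s R x = (\<integral>\<^sup>+t. ennreal (t powr (s-1) * exp (-R\<^sup>2/t) * gauss_kernel t x) * indicator {0<..} t \<partial>lborel)"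

lemma measurable_ker_cut [measurable]: "ker_cut s e \<in> borel_measurable borel"
proof -
  have "(\<lambda>z::'a. (\<integral>\<^sup>+t. ennreal (t powr (-1-s) * gauss_kernel t z) * indicator {e<..} t \<partial>lborel)) \<in> borel_measurable borel"
    by measurable
  thus ?thesis by (simp add: ker_cut_def[abs_def])
qed

lemma nn_integral_ker_cut:
  fixes x :: "'a::euclidean_space"
  assumes "0 < s" "e > 0"
  shows "(\<integral>\<^sup>+y. ker_cut s e (x - y) \<partial>lborel) = gauss_const TYPE('a) * ennreal (e powr (-s) / s)"
proof -
  have "(\<integral>\<^sup>+y. ker_cut s e (x - y) \<partial>lborel) = (\<integral>\<^sup>+(z::'a). ker_cut s e z \<partial>lborel)"
    by (rule nn_integral_lborel_reflect) measurable
  also have "\<dots> = (\<integral>\<^sup>+t. (\<integral>\<^sup>+(z::'a). ennreal (t powr (-1-s) * gauss_kernel t z) * indicator {e<..} t \<partial>lborel) \<partial>lborel)"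
    unfolding ker_cut_def by (rule lborel_pair.Fubini') measurable
  also have "\<dots> = (\<integral>\<^sup>+t. gauss_const TYPE('a) * (ennreal (t powr (-s-1)) * indicator {e<..} t) \<partial>lborel)"
  proof (intro nn_integral_cong)
    fix t :: real
    show "(\<integral>\<^sup>+(z::'a). ennreal (t powr (-1-s) * gauss_kernel t z) * indicator {e<..} t \<partial>lborel)
      = gauss_const TYPE('a) * (ennreal (t powr (-s-1)) * indicator {e<..} t)"
    proof (cases "t > e")
      case True
      have "(\<integral>\<^sup>+(z::'a). ennreal (t powr (-1-s) * gauss_kernel t z) \<partial>lborel) = ennreal (t powr (-1-s)) * (\<integral>\<^sup>+(z::'a). ennreal (gauss_kernel t (z - 0)) \<partial>lborel)"
        by (subst nn_integral_cmult[symmetric]) (auto simp: ennreal_mult)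
      also have "\<dots> = ennreal (t powr (-1-s)) * gauss_const TYPE('a)"
        using True assms by (subst nn_integral_gauss_kernel) auto
      finally show ?thesis using True by (simp add: mult.commute minus_diff_commute)
    qed simp
  qed
  also have "\<dots> = gauss_const TYPE('a) * ennreal (e powr (-s) / s)"
    using assms by (subst nn_integral_cmult) (auto simp: nn_integral_powr_tail)
  finally show ?thesis .
qed

text \<open>Both functions are mixtures of Gaussians with time densities \<open>a\<close> and
  \<open>m\<close>. Gaussian convolution adds times, so the convolution in space becomes the
  convolution of \<open>a\<close> and \<open>m\<close> on the half line, and it suffices that this
  is at most e^(-s)/s times \<open>m\<close>.\<close>

lemma ker_cut_heat_potential:
  fixes x :: "'a::euclidean_space"
  assumes s: "0 < s" "s < 1" and e: "e > 0"
  shows "(\<integral>\<^sup>+y. ker_cut s e (x - y) * heat_potential s R y \<partial>lborel)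
     \<le> gauss_const TYPE('a) * ennreal (e powr (-s) / s) * heat_potential s R x"
proof -
  define a where "a t = ennreal (t powr (-1-s)) * indicator {e<..} t" for t
  define m where "m t = ennreal (t powr (s-1) * exp (-R\<^sup>2/t)) * indicator {0<..} t" for t
  let ?c = "gauss_const TYPE('a)"
  have [measurable]: "a \<in> borel_measurable borel" "m \<in> borel_measurable borel"
    unfolding a_def[abs_def] m_def[abs_def] by measurable
  have J: "ker_cut s e z = (\<integral>\<^sup>+t. a t * ennreal (gauss_kernel t z) \<partial>lborel)" for z :: 'a
    unfolding ker_cut_def a_def by (intro nn_integral_cong) (auto simp: ennreal_mult indicator_def)
  have v: "heat_potential s R z = (\<integral>\<^sup>+t. m t * ennreal (gauss_kernel t z) \<partial>lborel)" for z :: 'a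
    unfolding heat_potential_def m_def by (intro nn_integral_cong) (auto simp: ennreal_mult indicator_def)
  have "(\<integral>\<^sup>+y. ker_cut s e (x - y) * heat_potential s R y \<partial>lborel)
    = (\<integral>\<^sup>+y. (\<integral>\<^sup>+t. (\<integral>\<^sup>+\<tau>. (a t * ennreal (gauss_kernel t (x - y))) * (m \<tau> * ennreal (gauss_kernel \<tau> y)) \<partial>lborel) \<partial>lborel) \<partial>lborel)"
    unfolding J v by (simp add: nn_integral_multc nn_integral_cmult)
  also have "\<dots> = (\<integral>\<^sup>+t. (\<integral>\<^sup>+y. (\<integral>\<^sup>+\<tau>. (a t * ennreal (gauss_kernel t (x - y))) * (m \<tau> * ennreal (gauss_kernel \<tau> y)) \<partial>lborel) \<partial>lborel) \<partial>lborel)"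
    by (rule lborel_pair.Fubini') measurable
  also have "\<dots> = (\<integral>\<^sup>+t. (\<integral>\<^sup>+\<tau>. (\<integral>\<^sup>+y. (a t * ennreal (gauss_kernel t (x - y))) * (m \<tau> * ennreal (gauss_kernel \<tau> y)) \<partial>lborel) \<partial>lborel) \<partial>lborel)"
    by (intro nn_integral_cong, rule lborel_pair.Fubini') measurable
  also have "\<dots> = (\<integral>\<^sup>+t. (\<integral>\<^sup>+\<tau>. a t * m \<tau> * (?c * ennreal (gauss_kernel (t+\<tau>) x)) \<partial>lborel) \<partial>lborel)"
  proof (intro nn_integral_cong)
    fix t \<tau> :: real
    show "(\<integral>\<^sup>+y. (a t * ennreal (gauss_kernel t (x - y))) * (m \<tau> * ennreal (gauss_kernel \<tau> y)) \<partial>lborel) = a t * m \<tau> * (?c * ennreal (gauss_kernel (t+\<tau>) x))"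
    proof (cases "t > e \<and> \<tau> > 0")
      case True
      have "(\<integral>\<^sup>+y. (a t * ennreal (gauss_kernel t (x - y))) * (m \<tau> * ennreal (gauss_kernel \<tau> y)) \<partial>lborel) = 
        (\<integral>\<^sup>+y. (a t * m \<tau>) * ennreal (gauss_kernel t (x - y) * gauss_kernel \<tau> y) \<partial>lborel)"
        by (intro nn_integral_cong) (simp add: ennreal_mult mult_ac)
      also have "\<dots> = (a t * m \<tau>) * (?c * ennreal (gauss_kernel (t+\<tau>) x))"
        using True e by (subst nn_integral_cmult) (auto simp: gauss_kernel_convolution)
      finally show ?thesis .
    qed (auto simp: a_def m_def)
  qed
  also have "\<dots> = (\<integral>\<^sup>+t. (\<integral>\<^sup>+\<tau>. a t * m (\<tau> - t) * (?c * ennreal (gauss_kernel \<tau> x)) \<partial>lborel) \<partial>lborel)"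
  proof (rule nn_integral_cong)
    fix t :: real
    show "(\<integral>\<^sup>+\<tau>. a t * m \<tau> * (?c * ennreal (gauss_kernel (t+\<tau>) x)) \<partial>lborel) = (\<integral>\<^sup>+\<tau>. a t * m (\<tau> - t) * (?c * ennreal (gauss_kernel \<tau> x)) \<partial>lborel)"
      by (subst nn_integral_real_affine[where c=1 and t="-t"]) auto
  qed
  also have "\<dots> = (\<integral>\<^sup>+\<tau>. (\<integral>\<^sup>+t. a t * m (\<tau> - t) * (?c * ennreal (gauss_kernel \<tau> x)) \<partial>lborel) \<partial>lborel)"
    by (rule lborel_pair.Fubini') measurable
  also have "\<dots> = (\<integral>\<^sup>+\<tau>. (\<integral>\<^sup>+t. a t * m (\<tau> - t) \<partial>lborel) * (?c * ennreal (gauss_kernel \<tau> x)) \<partial>lborel)"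
    by (intro nn_integral_cong nn_integral_multc) measurable
  \<comment> \<open>The weight exp(-R^2/t) is nondecreasing in t, so it can be pulled out at its
    largest argument \<tau>; the remaining integral is the explicit Beta integral, and (\<tau>-e)^s
    \<le> \<tau>^s reproduces the power \<tau>^(s-1) of \<open>m\<close>.\<close>
  also have "\<dots> \<le> (\<integral>\<^sup>+\<tau>. (ennreal (e powr (-s) / s) * m \<tau>) * (?c * ennreal (gauss_kernel \<tau> x)) \<partial>lborel)"
  proof (intro nn_integral_mono mult_right_mono)
    fix \<tau> :: real
    show "(\<integral>\<^sup>+t. a t * m (\<tau> - t) \<partial>lborel) \<le> ennreal (e powr (-s) / s) * m \<tau>"
    proof (cases "e < \<tau>")
      case False
      have "a t * m (\<tau> - t) = 0" for t using False e by (auto simp: a_def m_def indicator_def)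
      thus ?thesis by (simp del: mult_eq_0_iff)
    next
      case True
      have "(\<integral>\<^sup>+t. a t * m (\<tau> - t) \<partial>lborel) \<le>
        (\<integral>\<^sup>+t. ennreal (exp (-R\<^sup>2/\<tau>)) * (ennreal (t powr (-1-s) * (\<tau>-t) powr (s-1)) * indicator {e..\<tau>} t) \<partial>lborel)"
      proof (intro nn_integral_mono)
        fix t :: real
        show "a t * m (\<tau> - t) \<le> ennreal (exp (-R\<^sup>2/\<tau>)) * (ennreal (t powr (-1-s) * (\<tau>-t) powr (s-1)) * indicator {e..\<tau>} t)"
        proof (cases "e < t \<and> t < \<tau>")
          case True
          have "R\<^sup>2/\<tau> \<le> R\<^sup>2/(\<tau>-t)" using True e by (intro divide_left_mono) auto
          hence "exp (-R\<^sup>2/(\<tau>-t)) \<le> exp (-R\<^sup>2/\<tau>)" by simp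
          hence "t powr (-1-s) * ((\<tau>-t) powr (s-1) * exp (-R\<^sup>2/(\<tau>-t))) \<le> exp (-R\<^sup>2/\<tau>) * (t powr (-1-s) * (\<tau>-t) powr (s-1))"
            by (simp add: mult_left_mono mult.commute mult.left_commute)
          thus ?thesis using True by (simp add: a_def m_def ennreal_mult[symmetric] ennreal_leI)
        qed (auto simp: a_def m_def indicator_def)
      qed
      also have "\<dots> = ennreal (exp (-R\<^sup>2/\<tau>)) * ennreal (e powr (-s) * (\<tau>-e) powr s / (s*\<tau>))"
        using s e True by (subst nn_integral_cmult) (auto simp: nn_integral_beta)
      also have "\<dots> \<le> ennreal (exp (-R\<^sup>2/\<tau>)) * ennreal (e powr (-s) * \<tau> powr s / (s*\<tau>))"
        using s e True by (intro mult_left_mono ennreal_leI divide_right_mono powr_mono2) auto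
      also have "\<dots> = ennreal (e powr (-s) / s) * m \<tau>"
        using s e True by (simp add: m_def ennreal_mult[symmetric] powr_diff field_simps)
      finally show ?thesis .
    qed
  qed auto
  also have "\<dots> = (\<integral>\<^sup>+\<tau>. (?c * ennreal (e powr (-s) / s)) * (m \<tau> * ennreal (gauss_kernel \<tau> x)) \<partial>lborel)"
    by (intro nn_integral_cong) (simp add: mult_ac)
  also have "\<dots> = ?c * ennreal (e powr (-s) / s) * heat_potential s R x"
    unfolding v by (rule nn_integral_cmult) measurable
  finally show ?thesis .
qed

lemma heat_potential_eq:
  fixes x :: "'a::euclidean_space"
  assumes "R > 0"
  shows "heat_potential s R x = ennreal ((R\<^sup>2 + (norm x)\<^sup>2) powr (-((real DIM('a) - 2 * s)/2))) * invgamma_const ((real DIM('a) - 2 * s)/2)"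
proof -
  have "R\<^sup>2 + (norm x)\<^sup>2 > 0" using assms by (simp add: add_pos_nonneg)
  have "heat_potential s R x = (\<integral>\<^sup>+t. ennreal (t powr (-((real DIM('a) - 2 * s)/2)-1) * exp (-(R\<^sup>2 + (norm x)\<^sup>2)/t)) * indicator {0<..} t \<partial>lborel)"
    unfolding heat_potential_def
  proof (intro nn_integral_cong)
    fix t :: real
    have "t powr (s-1) * exp (-R\<^sup>2/t) * gauss_kernel t x = t powr (-((real DIM('a) - 2 * s)/2)-1) * exp (-(R\<^sup>2 + (norm x)\<^sup>2)/t)" if "t > 0"
    proof -
      have "t powr (-((real DIM('a) - 2 * s)/2)-1) = t powr (s-1) * t powr (- real DIM('a) / 2)"
        using that by (simp add: powr_add[symmetric] field_simps)
      moreover have "exp (-(R\<^sup>2 + (norm x)\<^sup>2)/t) = exp (-R\<^sup>2/t) * exp (-(norm x)\<^sup>2 / t)"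
        by (simp add: exp_add[symmetric] diff_divide_distrib)
      ultimately show ?thesis by (simp add: gauss_kernel_def)
    qed
    thus "ennreal (t powr (s-1) * exp (-R\<^sup>2/t) * gauss_kernel t x) * indicator {0<..} t
      = ennreal (t powr (-((real DIM('a) - 2 * s)/2)-1) * exp (-(R\<^sup>2 + (norm x)\<^sup>2)/t)) * indicator {0<..} t"
      by (auto simp: indicator_def)
  qed
  thus ?thesis using invgamma_scaling[OF \<open>R\<^sup>2 + (norm x)\<^sup>2 > 0\<close>] by simp
qed

lemma ker_cut_zero_eq:
  fixes z :: "'a::euclidean_space"
  assumes "z \<noteq> 0"
  shows "ker_cut s 0 z = ennreal (norm z powr (-(real DIM('a) + 2 * s))) * invgamma_const (real DIM('a)/2 + s)"
proof -
  have "ker_cut s 0 z = (\<integral>\<^sup>+t. ennreal (t powr (-(real DIM('a)/2 + s)-1) * exp (-((norm z)\<^sup>2)/t)) * indicator {0<..} t \<partial>lborel)"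
    unfolding ker_cut_def gauss_kernel_def
  proof (intro nn_integral_cong)
    fix t :: real
    have "-(real DIM('a)/2 + s)-1 = (-1-s) + (- real DIM('a) / 2)" by simp
    hence "t powr (-(real DIM('a)/2 + s)-1) = t powr (-1-s) * t powr (- real DIM('a) / 2)" if "t > 0"
      using that by (simp only: powr_add)
    thus "ennreal (t powr (-1-s) * (t powr (- real DIM('a) / 2) * exp (- (norm z)\<^sup>2 / t))) * indicator {0<..} t
      = ennreal (t powr (-(real DIM('a)/2 + s)-1) * exp (-((norm z)\<^sup>2)/t)) * indicator {0<..} t"
      by (auto simp: indicator_def)
  qed
  also have "\<dots> = ennreal (((norm z)\<^sup>2) powr (-(real DIM('a)/2 + s))) * invgamma_const (real DIM('a)/2 + s)"
    using assms by (intro invgamma_scaling) auto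
  also have "((norm z)\<^sup>2) powr (-(real DIM('a)/2 + s)) = norm z powr (-(real DIM('a) + 2 * s))"
  proof -
    have "((norm z)\<^sup>2) powr (-(real DIM('a)/2 + s)) = norm z powr (2 * -(real DIM('a)/2 + s))"
      using assms by (subst powr_powr[symmetric]) simp
    also have "2 * -(real DIM('a)/2 + s) = -(real DIM('a) + 2 * s)" by simp
    finally show ?thesis .
  qed
  finally show ?thesis .
qed

section \<open>The nonlocal form and superharmonic functions\<close>

text \<open>With the singular weight put into the measure, the seminorm is the square L2 norm of the
  increment and the usual integration theory applies to it. On the diagonal the weight is 0, because
  division by 0 gives 0.\<close>

definition KM :: "real \<Rightarrow> ('a::euclidean_space \<times> 'a) measure" where
  "KM s = density (lborel \<Otimes>\<^sub>M lborel) (\<lambda>(x, y). ennreal (1 / norm (x - y) powr (real DIM('a) + 2 * s)))"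

lemma sets_KM [measurable_cong, simp]: "sets (KM s :: ('a::euclidean_space \<times> 'a) measure) = sets (borel \<Otimes>\<^sub>M borel)"
  by (simp add: KM_def)

lemma space_KM [simp]: "space (KM s) = UNIV"
  by (simp add: KM_def space_pair_measure)

lemma measurable_KM_borel_eq: "borel_measurable (KM s :: ('a::euclidean_space \<times> 'a) measure) = borel_measurable (borel \<Otimes>\<^sub>M borel)"
  by (rule measurable_cong_sets) auto

lemma nn_integral_KM:
  assumes [measurable]: "f \<in> borel_measurable (borel \<Otimes>\<^sub>M borel)"
  shows "(\<integral>\<^sup>+z. f z \<partial>(KM s :: ('a::euclidean_space \<times> 'a) measure)) =
    (\<integral>\<^sup>+x. \<integral>\<^sup>+y. ennreal (1 / norm (x - y) powr (real DIM('a) + 2 * s)) * f (x, y) \<partial>lborel \<partial>lborel)"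
proof -
  have "(\<integral>\<^sup>+z. f z \<partial>(KM s :: ('a \<times> 'a) measure)) =
    (\<integral>\<^sup>+z. (case z of (x,y) \<Rightarrow> ennreal (1 / norm (x - y) powr (real DIM('a) + 2 * s))) * f z \<partial>(lborel \<Otimes>\<^sub>M lborel))"
    unfolding KM_def by (subst nn_integral_density) auto
  also have "\<dots> = (\<integral>\<^sup>+x. \<integral>\<^sup>+y. ennreal (1 / norm (x - y) powr (real DIM('a) + 2 * s)) * f (x, y) \<partial>lborel \<partial>lborel)"
    by (subst lborel.nn_integral_fst[symmetric]) auto
  finally show ?thesis .
qed

lemma nn_integral_KM_swap:
  assumes [measurable]: "f \<in> borel_measurable (borel \<Otimes>\<^sub>M borel)"
  shows "(\<integral>\<^sup>+(x,y). f (y,x) \<partial>(KM s :: ('a::euclidean_space \<times> 'a) measure)) = (\<integral>\<^sup>+z. f z \<partial>KM s)"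
proof -
  have "(\<integral>\<^sup>+(x,y). f (y,x) \<partial>(KM s :: ('a::euclidean_space \<times> 'a) measure))
     = (\<integral>\<^sup>+x. \<integral>\<^sup>+y. ennreal (1 / norm (x - y) powr (real DIM('a) + 2 * s)) * f (y, x) \<partial>lborel \<partial>lborel)"
    by (subst nn_integral_KM) auto
  also have "\<dots> = (\<integral>\<^sup>+y. \<integral>\<^sup>+x. ennreal (1 / norm (x - y) powr (real DIM('a) + 2 * s)) * f (y, x) \<partial>lborel \<partial>lborel)"
    by (rule lborel_pair.Fubini') measurable
  also have "\<dots> = (\<integral>\<^sup>+z. f z \<partial>KM s)"
    by (subst nn_integral_KM) (auto simp: norm_minus_commute)
  finally show ?thesis .
qed

lemma AE_KM_both:
  assumes "AE x in lborel. P (x::'a::euclidean_space)"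
  shows "AE z in KM s. P (fst z) \<and> P (snd z)"
proof -
  obtain N where N: "{x. \<not> P x} \<subseteq> N" "N \<in> null_sets lborel"
    using assms by (auto simp: eventually_ae_filter)
  have 1: "AE z in (lborel \<Otimes>\<^sub>M lborel :: ('a \<times> 'a) measure). z \<notin> N \<times> UNIV \<and> z \<notin> UNIV \<times> N"
  proof -
    have "N \<times> UNIV \<in> null_sets (lborel \<Otimes>\<^sub>M lborel :: ('a \<times> 'a) measure)"
      "UNIV \<times> N \<in> null_sets (lborel \<Otimes>\<^sub>M lborel :: ('a \<times> 'a) measure)"
      using N(2) by (auto simp: null_sets_def lborel.emeasure_pair_measure_Times pair_measureI)
    thus ?thesis by (auto simp: AE_not_in eventually_conj_iff)
  qed
  have "AE z in (lborel \<Otimes>\<^sub>M lborel :: ('a \<times> 'a) measure). P (fst z) \<and> P (snd z)"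
    using 1 by eventually_elim (use N in auto)
  thus ?thesis unfolding KM_def by (subst AE_density) (auto elim: eventually_mono simp: split_def)
qed

text \<open>The kernel \<open>ker_cut s e\<close> has total mass \<open>gauss_const * e^(-s)/s\<close>, so the last condition says that
  the truncated fractional Laplacian of \<open>v\<close> is nonnegative for every \<open>e > 0\<close>.\<close>

definition superharm :: "real \<Rightarrow> ('a::euclidean_space \<Rightarrow> real) \<Rightarrow> bool" where
  "superharm s v \<longleftrightarrow> v \<in> borel_measurable borel \<and> (\<forall>x. 0 \<le> v x) \<and> (\<exists>B. \<forall>x. v x \<le> B) \<and>
     (\<forall>e>0. \<forall>x. (\<integral>\<^sup>+y. ker_cut s e (x - y) * ennreal (v y) \<partial>lborel)
        \<le> gauss_const TYPE('a) * ennreal (e powr (-s) / s) * ennreal (v x))"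

lemma superharm_const:
  assumes "0 < s" "c \<ge> 0" shows "superharm s (\<lambda>x::'a::euclidean_space. c)"
  unfolding superharm_def using assms by (auto simp: nn_integral_multc nn_integral_ker_cut)

lemma superharm_add:
  assumes "superharm s (v::'a::euclidean_space \<Rightarrow> real)" "superharm s w" shows "superharm s (\<lambda>x. v x + w x)"
proof -
  obtain B1 B2 where B: "\<And>x. v x \<le> B1" "\<And>x. w x \<le> B2" using assms by (auto simp: superharm_def)
  have [measurable]: "v \<in> borel_measurable borel" "w \<in> borel_measurable borel" using assms by (auto simp: superharm_def)
  have nn: "v x \<ge> 0" "w x \<ge> 0" for x using assms by (auto simp: superharm_def)
  have "(\<integral>\<^sup>+y. ker_cut s e (x - y) * ennreal (v y + w y) \<partial>lborel)
        \<le> gauss_const TYPE('a) * ennreal (e powr (-s) / s) * ennreal (v x + w x)" if "e > 0" for e x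
  proof -
    have "(\<integral>\<^sup>+y. ker_cut s e (x - y) * ennreal (v y + w y) \<partial>lborel)
      = (\<integral>\<^sup>+y. ker_cut s e (x - y) * ennreal (v y) \<partial>lborel) + (\<integral>\<^sup>+y. ker_cut s e (x - y) * ennreal (w y) \<partial>lborel)"
      by (subst nn_integral_add[symmetric]) (auto simp: nn distrib_left)
    also have "\<dots> \<le> gauss_const TYPE('a) * ennreal (e powr (-s) / s) * ennreal (v x) + gauss_const TYPE('a) * ennreal (e powr (-s) / s) * ennreal (w x)"
      using assms that by (intro add_mono) (auto simp: superharm_def)
    also have "\<dots> = gauss_const TYPE('a) * ennreal (e powr (-s) / s) * ennreal (v x + w x)"
      by (simp add: nn distrib_left)
    finally show ?thesis .
  qed
  thus ?thesis using nn B unfolding superharm_def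
    by (auto intro!: exI[of _ "B1+B2"] add_mono)
qed

lemma superharm_cmult:
  assumes "superharm s (v::'a::euclidean_space \<Rightarrow> real)" "c \<ge> 0" shows "superharm s (\<lambda>x. c * v x)"
proof -
  obtain B where B: "\<And>x. v x \<le> B" using assms by (auto simp: superharm_def)
  have [measurable]: "v \<in> borel_measurable borel" using assms by (auto simp: superharm_def)
  have nn: "v x \<ge> 0" for x using assms by (auto simp: superharm_def)
  have "(\<integral>\<^sup>+y. ker_cut s e (x - y) * ennreal (c * v y) \<partial>lborel)
        \<le> gauss_const TYPE('a) * ennreal (e powr (-s) / s) * ennreal (c * v x)" if "e > 0" for e x
  proof -
    have "(\<integral>\<^sup>+y. ker_cut s e (x - y) * ennreal (c * v y) \<partial>lborel)
      = (\<integral>\<^sup>+y. ennreal c * (ker_cut s e (x - y) * ennreal (v y)) \<partial>lborel)"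
      using assms(2) nn by (intro nn_integral_cong) (auto simp: ennreal_mult mult_ac)
    also have "\<dots> = ennreal c * (\<integral>\<^sup>+y. (ker_cut s e (x - y) * ennreal (v y)) \<partial>lborel)"
      by (rule nn_integral_cmult) measurable
    also have "\<dots> \<le> ennreal c * (gauss_const TYPE('a) * ennreal (e powr (-s) / s) * ennreal (v x))"
      using assms that by (intro mult_left_mono) (auto simp: superharm_def)
    also have "\<dots> = gauss_const TYPE('a) * ennreal (e powr (-s) / s) * ennreal (c * v x)"
      using nn assms(2) by (simp add: ennreal_mult mult_ac)
    finally show ?thesis .
  qed
  thus ?thesis using nn B assms unfolding superharm_def
    by (auto intro!: exI[of _ "c*B"] mult_left_mono)
qed

definition bubble :: "real \<Rightarrow> real \<Rightarrow> 'a::euclidean_space \<Rightarrow> real" where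
  "bubble s R x = (R\<^sup>2 + (norm x)\<^sup>2) powr (-((real DIM('a) - 2 * s)/2))"

lemma bubble_pos: "R > 0 \<Longrightarrow> bubble s R x > 0"
  unfolding bubble_def by (simp add: add_pos_nonneg)

text \<open>\<open>heat_potential\<close> is the bubble times a constant \<open>K\<close> that is
  finite and positive exactly when N > 2s allows Gamma((N-2s)/2); dividing the inequality for the
  potential by \<open>K\<close> gives the claim.\<close>

lemma superharm_bubble:
  assumes s: "0 < s" "s < 1" and N: "2 * s < real DIM('a::euclidean_space)" and R: "R > 0"
  shows "superharm s (bubble s R :: 'a \<Rightarrow> real)"
proof -
  let ?b = "bubble s R :: 'a \<Rightarrow> real"
  define K where "K = invgamma_const ((real DIM('a) - 2 * s)/2)"
  have K: "K < \<infinity>" "K > 0" using invgamma_const_finite[of "(real DIM('a) - 2 * s)/2"] invgamma_const_pos N by (auto simp: K_def)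
  have e: "heat_potential s R x = ennreal (?b x) * K" for x :: 'a
    unfolding bubble_def K_def by (rule heat_potential_eq[OF R])
  have [measurable]: "?b \<in> borel_measurable borel" unfolding bubble_def[abs_def] by measurable
  have "?b x \<le> (R\<^sup>2) powr (-((real DIM('a) - 2 * s)/2))" for x
    unfolding bubble_def using R N by (intro powr_mono2') auto
  moreover have "(\<integral>\<^sup>+y. ker_cut s e (x - y) * ennreal (?b y) \<partial>lborel)
        \<le> gauss_const TYPE('a) * ennreal (e powr (-s) / s) * ennreal (?b x)" if "e > 0" for e x
  proof -
    have "(\<integral>\<^sup>+y. ker_cut s e (x - y) * ennreal (?b y) \<partial>lborel) * K
      = (\<integral>\<^sup>+y. ker_cut s e (x - y) * heat_potential s R y \<partial>lborel)"
      unfolding e mult.assoc[symmetric] by (rule nn_integral_multc[symmetric]) measurable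
    also have "\<dots> \<le> gauss_const TYPE('a) * ennreal (e powr (-s) / s) * ennreal (?b x) * K"
      using ker_cut_heat_potential[OF s that, of x R] unfolding e mult.assoc .
    finally have "K * (\<integral>\<^sup>+y. ker_cut s e (x - y) * ennreal (?b y) \<partial>lborel) 
      \<le> K * (gauss_const TYPE('a) * ennreal (e powr (-s) / s) * ennreal (?b x))"
      by (simp add: mult_ac)
    thus ?thesis using K by (subst (asm) ennreal_mult_le_mult_iff) auto
  qed
  ultimately show ?thesis using less_imp_le[OF bubble_pos[OF R]] unfolding superharm_def by auto
qed

lemma ker_cut_mono: "0 \<le> e \<Longrightarrow> ker_cut s e z \<le> ker_cut s 0 z"
  unfolding ker_cut_def by (intro nn_integral_mono mult_left_mono) (auto simp: indicator_def)

lemma ker_cut_tendsto: "(\<lambda>n. ker_cut s (1 / real (Suc n)) z) \<longlonglongrightarrow> ker_cut s 0 z"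
proof -
  define f where "f n t = ennreal (t powr (-1-s) * gauss_kernel t z) * indicator {1 / real (Suc n)<..} t" for n t
  have inc: "incseq f"
  proof (intro incseq_SucI le_funI)
    fix n t
    have "1 / real (Suc (Suc n)) \<le> 1 / real (Suc n)" by (intro divide_left_mono) auto
    thus "f n t \<le> f (Suc n) t" unfolding f_def by (intro mult_left_mono) (auto simp: indicator_def)
  qed
  have lim: "(\<lambda>n. f n t) \<longlonglongrightarrow> ennreal (t powr (-1-s) * gauss_kernel t z) * indicator {0<..} t" for t
  proof (cases "t > 0")
    case True
    then obtain m where m: "1 / real (Suc m) < t" using nat_approx_posE by (metis of_nat_Suc)
    have "f n t = ennreal (t powr (-1-s) * gauss_kernel t z) * indicator {0<..} t" if "n \<ge> m" for n
    proof -
      have "1 / real (Suc n) \<le> 1 / real (Suc m)" using that by (intro divide_left_mono) auto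
      hence "1 / real (Suc n) < t" using m by linarith
      thus ?thesis using True by (simp add: f_def indicator_def)
    qed
    thus ?thesis by (intro tendsto_eventually eventually_sequentiallyI[of m])
  next
    case False
    have "0 < 1 / real (Suc n)" for n by simp
    hence "\<not> 1 / real (Suc n) < t" for n using False by (metis order.strict_trans)
    hence "f n t = 0" for n by (simp add: f_def indicator_def)
    thus ?thesis using False by simp
  qed
  have "(\<lambda>n. \<integral>\<^sup>+t. f n t \<partial>lborel) \<longlonglongrightarrow> (\<integral>\<^sup>+t. ennreal (t powr (-1-s) * gauss_kernel t z) * indicator {0<..} t \<partial>lborel)"
    by (rule nn_integral_LIMSEQ[OF inc _ lim]) (auto simp: f_def)
  thus ?thesis by (simp add: ker_cut_def f_def)
qed

text \<open>For the cut kernel the double integral may be unfolded, and by symmetry it is twice the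
  integral of \<psi> against the truncated fractional Laplacian of v, which is nonnegative. The cut
  kernels increase to a multiple of |z|^(-N-2s), so the assumed integrability of the full form
  dominates the passage to the limit.\<close>

theorem superharm_form_nonneg:
  fixes v \<psi> :: "'a::euclidean_space \<Rightarrow> real"
  assumes s: "0 < s" and v: "superharm s v" and psi: "integrable lborel \<psi>" "\<And>x. \<psi> x \<ge> 0"
    and int: "integrable (KM s) (\<lambda>(x,y). (v x - v y) * (\<psi> x - \<psi> y))"
  shows "0 \<le> (\<integral>(x,y). (v x - v y) * (\<psi> x - \<psi> y) \<partial>KM s)"
proof -
  let ?W = "lborel \<Otimes>\<^sub>M lborel :: ('a \<times> 'a) measure"
  define c where "c = enn2real (invgamma_const (real DIM('a)/2 + s))"
  have cf: "invgamma_const (real DIM('a)/2 + s) < \<infinity>" by (rule invgamma_const_finite) (use s in auto)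
  have ce: "invgamma_const (real DIM('a)/2 + s) = ennreal c" unfolding c_def using cf by simp
  have c0: "c > 0" unfolding c_def using cf invgamma_const_pos by (auto simp: enn2real_positive_iff)
  define J where "J z = 1 / norm z powr (real DIM('a) + 2 * s)" for z :: 'a
  define K where "K n z = enn2real (ker_cut s (1 / real (Suc n)) z)" for n and z :: 'a
  have [measurable]: "v \<in> borel_measurable borel" "\<psi> \<in> borel_measurable borel"
    using v psi by (auto simp: superharm_def)
  have [measurable]: "K n \<in> borel_measurable borel" "J \<in> borel_measurable borel" for n
    unfolding K_def[abs_def] J_def[abs_def] by measurable
  obtain B where B: "\<And>x. v x \<le> B" and v0: "\<And>x. 0 \<le> v x" using v by (auto simp: superharm_def)
  have k0: "ker_cut s 0 z = ennreal (c * J z)" if "z \<noteq> 0" for z :: 'a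
    unfolding ker_cut_zero_eq[OF that] ce J_def powr_minus_divide using c0 by (subst ennreal_mult[symmetric]) (simp_all add: mult.commute)
  have kfin: "ker_cut s (1 / real (Suc n)) z < \<infinity>" if "z \<noteq> 0" for n and z :: 'a
    using ker_cut_mono[of "1 / real (Suc n)" s z] k0[OF that] by (auto simp: le_less_trans)
  have kK: "ker_cut s (1 / real (Suc n)) z = ennreal (K n z)" if "z \<noteq> 0" for n and z :: 'a
    using kfin[OF that] by (simp add: K_def)
  have KJ: "K n z \<le> c * J z" if "z \<noteq> 0" for n z
  proof -
    have "ker_cut s (1 / real (Suc n)) z \<le> ker_cut s 0 z" by (rule ker_cut_mono) simp
    moreover have "c * J z \<ge> 0" using c0 by (simp add: J_def)
    ultimately show ?thesis unfolding k0[OF that] kK[OF that] by (simp add: ennreal_le_iff)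
  qed
  have Kpos: "K n z \<ge> 0" for n z by (simp add: K_def)
  have Klim: "(\<lambda>n. K n z) \<longlonglongrightarrow> c * J z" if "z \<noteq> 0" for z
    using ker_cut_tendsto[of s z] unfolding k0[OF that] kK[OF that]
    using c0 Kpos by (intro tendsto_ennrealD) (auto simp: J_def)
  have neq: "AE z in ?W. fst z - snd z \<noteq> 0"
  proof -
    have "AE x in lborel. AE y in lborel. x - y \<noteq> (0::'a)"
    proof (rule AE_I2)
      fix x :: 'a
      show "AE y in lborel. x - y \<noteq> 0" using AE_lborel_singleton[of x] by eventually_elim auto
    qed
    moreover have "{z \<in> space ?W. fst z - snd z \<noteq> 0} \<in> sets ?W" by measurable
    ultimately show ?thesis by (intro lborel_pair.AE_pair_measure) simp_all
  qed
  define h where "h z = (v (fst z) - v (snd z)) * (\<psi> (fst z) - \<psi> (snd z))" for z :: "'a \<times> 'a"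
  have [measurable]: "h \<in> borel_measurable (borel \<Otimes>\<^sub>M borel)" unfolding h_def by measurable
  have h_eq: "(\<lambda>(x,y). (v x - v y) * (\<psi> x - \<psi> y)) = h" by (auto simp: h_def)
  have KMJ: "KM s = density ?W (\<lambda>z. ennreal (J (fst z - snd z)))" by (simp add: KM_def J_def split_def)
  have hI: "integrable ?W (\<lambda>z. J (fst z - snd z) * h z)"
    using int unfolding h_eq KMJ by (subst (asm) integrable_density) (auto simp: J_def)
  have hE: "(\<integral>(x,y). (v x - v y) * (\<psi> x - \<psi> y) \<partial>KM s) = (\<integral>z. J (fst z - snd z) * h z \<partial>?W)"
    unfolding h_eq KMJ by (subst integral_density) (auto simp: J_def)
  have pos: "0 \<le> (\<integral>z. K n (fst z - snd z) * h z \<partial>?W)" for n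
  proof -
    define e where "e = 1 / real (Suc n)"
    have e: "e > 0" by (simp add: e_def)
    define m where "m = enn2real (gauss_const TYPE('a)) * (e powr (-s) / s)"
    have m0: "m \<ge> 0" using s by (simp add: m_def)
    have me: "gauss_const TYPE('a) * ennreal (e powr (-s) / s) = ennreal m"
      unfolding m_def using gauss_const_finite[where 'a='a] s by (subst ennreal_mult) auto
    have xy: "AE y in lborel. x - y \<noteq> 0" for x :: 'a
      using AE_lborel_singleton[of x] by eventually_elim auto
    have Kint: "(\<integral>\<^sup>+y. ennreal (K n (x - y)) \<partial>lborel) = ennreal m" for x
    proof -
      have "(\<integral>\<^sup>+y. ennreal (K n (x - y)) \<partial>lborel) = (\<integral>\<^sup>+y. ker_cut s e (x - y) \<partial>lborel)"
        using xy[of x] kK[of _ n] unfolding e_def by (intro nn_integral_cong_AE) (auto elim!: eventually_mono)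
      thus ?thesis using nn_integral_ker_cut[OF s e, of x] me by simp
    qed
    have Kv: "(\<integral>\<^sup>+y. ennreal (K n (x - y) * v y) \<partial>lborel) \<le> ennreal (m * v x)" for x
    proof -
      have "(\<integral>\<^sup>+y. ennreal (K n (x - y) * v y) \<partial>lborel) = (\<integral>\<^sup>+y. ker_cut s e (x - y) * ennreal (v y) \<partial>lborel)"
        using xy[of x] kK[of _ n] Kpos v0 unfolding e_def by (intro nn_integral_cong_AE) (auto elim!: eventually_mono simp: ennreal_mult)
      also have "\<dots> \<le> gauss_const TYPE('a) * ennreal (e powr (-s) / s) * ennreal (v x)"
        using v e by (auto simp: superharm_def)
      finally show ?thesis using me m0 v0 by (simp add: ennreal_mult)
    qed
    have iK: "integrable lborel (\<lambda>y. K n (x - y))" for x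
      using Kint[of x] Kpos by (intro integrableI_nonneg) auto
    have iKv: "integrable lborel (\<lambda>y. K n (x - y) * v y)" for x
      using Kv[of x] Kpos v0 by (intro integrableI_nonneg) (auto simp: le_less_trans)
    have inner: "0 \<le> (\<integral>y. K n (x - y) * (v x - v y) \<partial>lborel)" for x
    proof -
      have "(\<integral>y. K n (x - y) * (v x - v y) \<partial>lborel) = (\<integral>y. K n (x - y) \<partial>lborel) * v x - (\<integral>y. K n (x - y) * v y \<partial>lborel)"
        using iK[of x] iKv[of x] by (simp add: right_diff_distrib)
      moreover have "(\<integral>y. K n (x - y) \<partial>lborel) = m"
        using Kint[of x] Kpos m0 by (subst integral_eq_nn_integral) auto
      moreover have "(\<integral>y. K n (x - y) * v y \<partial>lborel) \<le> m * v x"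
        using Kv[of x] Kpos m0 v0 by (subst integral_eq_nn_integral) (auto intro!: enn2real_leI)
      ultimately show ?thesis by simp
    qed
    \<comment> \<open>One half of the symmetrised integrand: only \<psi> at the first point is kept.
      Its absolute integrability uses the finite mass of the cut kernel, which is the reason for
      cutting.\<close>
    define f where "f z = K n (fst z - snd z) * ((v (fst z) - v (snd z)) * \<psi> (fst z))" for z
    have [measurable]: "f \<in> borel_measurable (borel \<Otimes>\<^sub>M borel)" unfolding f_def by measurable
    have fI: "integrable ?W f"
    proof (rule integrableI_bounded)
      have "(\<integral>\<^sup>+z. ennreal (norm (f z)) \<partial>?W) = (\<integral>\<^sup>+x. \<integral>\<^sup>+y. ennreal (norm (f (x,y))) \<partial>lborel \<partial>lborel)"
        by (subst lborel.nn_integral_fst) auto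
      also have "\<dots> \<le> (\<integral>\<^sup>+x. \<integral>\<^sup>+y. ennreal (B * \<psi> x) * ennreal (K n (x - y)) \<partial>lborel \<partial>lborel)"
      proof (intro nn_integral_mono)
        fix x y
        have "\<bar>v x - v y\<bar> \<le> B" using B[of x] B[of y] v0[of x] v0[of y] by linarith
        hence "norm (f (x,y)) \<le> (B * \<psi> x) * K n (x - y)"
          using psi(2)[of x] Kpos[of n "x-y"] mult_right_mono[of "\<bar>v x - v y\<bar>" B "\<psi> x * K n (x - y)"]
          by (simp add: f_def abs_mult mult_ac)
        moreover have "0 \<le> B * \<psi> x" using B[of x] v0[of x] psi(2)[of x] by simp
        ultimately show "ennreal (norm (f (x,y))) \<le> ennreal (B * \<psi> x) * ennreal (K n (x - y))"
          using Kpos by (simp add: ennreal_mult[symmetric] ennreal_leI)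
      qed
      also have "\<dots> = (\<integral>\<^sup>+x. ennreal (B * \<psi> x) * ennreal m \<partial>lborel)"
        by (simp add: nn_integral_cmult Kint)
      also have "\<dots> = ennreal m * (\<integral>\<^sup>+x. ennreal (B * \<psi> x) \<partial>lborel)"
        by (subst nn_integral_cmult[symmetric]) (auto simp: mult.commute)
      also have "\<dots> < \<infinity>"
      proof -
        have "integrable lborel (\<lambda>x. B * \<psi> x)" using psi by simp
        hence "(\<integral>\<^sup>+x. ennreal (norm (B * \<psi> x)) \<partial>lborel) < \<infinity>" unfolding integrable_iff_bounded by blast
        moreover have "(\<integral>\<^sup>+x. ennreal (B * \<psi> x) \<partial>lborel) \<le> (\<integral>\<^sup>+x. ennreal (norm (B * \<psi> x)) \<partial>lborel)"
          by (intro nn_integral_mono ennreal_leI) auto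
        ultimately have "(\<integral>\<^sup>+x. ennreal (B * \<psi> x) \<partial>lborel) < \<infinity>" by (rule le_less_trans[rotated])
        thus ?thesis by (simp add: ennreal_mult_less_top)
      qed
      finally show "(\<integral>\<^sup>+z. ennreal (norm (f z)) \<partial>?W) < \<infinity>" .
    qed simp
    have Ksym: "K n (x - y) = K n (y - x)" for x y
      by (simp add: K_def ker_cut_def gauss_kernel_def norm_minus_commute)
    have "(\<integral>z. K n (fst z - snd z) * h z \<partial>?W) = (\<integral>z. f z + (case z of (x,y) \<Rightarrow> f (y,x)) \<partial>?W)"
      by (intro Bochner_Integration.integral_cong refl) (auto simp: f_def h_def Ksym[of "snd _"] algebra_simps split_def)
    also have "\<dots> = (\<integral>z. f z \<partial>?W) + (\<integral>(x,y). f (y,x) \<partial>?W)"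
      using fI by (intro Bochner_Integration.integral_add lborel_pair.integrable_product_swap) auto
    also have "(\<integral>(x,y). f (y,x) \<partial>?W) = (\<integral>z. f z \<partial>?W)"
      by (rule lborel_pair.integral_product_swap) auto
    also have "(\<integral>z. f z \<partial>?W) = (\<integral>x. (\<integral>y. f (x,y) \<partial>lborel) \<partial>lborel)"
      using fI by (rule lborel_pair.integral_fst'[symmetric])
    also have "(\<lambda>x. \<integral>y. f (x,y) \<partial>lborel) = (\<lambda>x. (\<integral>y. K n (x - y) * (v x - v y) \<partial>lborel) * \<psi> x)"
      by (simp add: f_def fun_eq_iff flip: mult.assoc)
    also have "0 \<le> (\<integral>x. (\<integral>y. K n (x - y) * (v x - v y) \<partial>lborel) * \<psi> x \<partial>lborel) + (\<integral>x. (\<integral>y. K n (x - y) * (v x - v y) \<partial>lborel) * \<psi> x \<partial>lborel)"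
      by (rule add_nonneg_nonneg; rule Bochner_Integration.integral_nonneg; rule mult_nonneg_nonneg[OF inner psi(2)])
    finally show ?thesis .
  qed
  \<comment> \<open>Removal of the cut by dominated convergence; the dominating function is c J |h|,
    integrable by assumption.\<close>
  have "(\<lambda>n. \<integral>z. K n (fst z - snd z) * h z \<partial>?W) \<longlonglongrightarrow> (\<integral>z. c * (J (fst z - snd z) * h z) \<partial>?W)"
  proof (rule integral_dominated_convergence)
    show "integrable ?W (\<lambda>z. norm (c * (J (fst z - snd z) * h z)))" using hI by simp
    show "AE z in ?W. (\<lambda>n. K n (fst z - snd z) * h z) \<longlonglongrightarrow> c * (J (fst z - snd z) * h z)"
      using neq by eventually_elim (auto simp: mult.assoc[symmetric] intro!: tendsto_mult Klim)
    show "AE z in ?W. norm (K n (fst z - snd z) * h z) \<le> norm (c * (J (fst z - snd z) * h z))" for n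
      using neq
    proof eventually_elim
      case (elim z)
      have "\<bar>K n (fst z - snd z)\<bar> \<le> \<bar>c * J (fst z - snd z)\<bar>" using KJ[OF elim, of n] Kpos[of n "fst z - snd z"] by linarith
      thus ?case unfolding mult.assoc[symmetric] norm_mult real_norm_def abs_mult[symmetric]
        by (simp only: abs_mult mult_right_mono abs_ge_zero)
    qed
  qed auto
  hence "0 \<le> (\<integral>z. c * (J (fst z - snd z) * h z) \<partial>?W)"
    by (rule LIMSEQ_le_const) (use pos in auto)
  hence "0 \<le> c * (\<integral>z. (J (fst z - snd z) * h z) \<partial>?W)" by simp
  thus ?thesis using c0 unfolding hE by (simp add: zero_le_mult_iff)
qed

section \<open>Integrability and the fractional Sobolev inequality\<close>

text \<open>Instead of polar coordinates, the kernel is written as a mixture of Gaussians. For each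
  Gaussian the integral of min(1, |z|^2) is at most a constant times min(1, t), and t^(-1-s) min(1,
  t) is integrable on the half line because 0 < s < 1.\<close>

lemma nn_integral_kernel_trunc:
  assumes s: "0 < s" "s < 1"
  shows "(\<integral>\<^sup>+z. ennreal (min 1 ((norm z)\<^sup>2) / norm z powr (real DIM('a) + 2 * s)) \<partial>(lborel :: 'a::euclidean_space measure)) < \<infinity>"
proof -
  let ?c = "gauss_const TYPE('a)"
  define n where "n = real DIM('a)"
  define K where "K = invgamma_const (real DIM('a)/2 + s)"
  have K: "K < \<infinity>" "K > 0" using invgamma_const_finite[of "real DIM('a)/2 + s"] invgamma_const_pos s by (auto simp: K_def)
  have sq: "(\<integral>\<^sup>+(z::'a). ennreal (min 1 ((norm z)\<^sup>2) * gauss_kernel t z) \<partial>lborel) \<le> ennreal (min 1 (2 powr (n/2) * t)) * ?c" if t: "t > 0" for t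
  proof -
    \<comment> \<open>A second moment bound without moments: r exp(-r) \<le> exp(-r/2) trades the
      factor |z|^2 for t and a Gaussian of doubled parameter, whose mass is known.\<close>
    have 1: "(norm z)\<^sup>2 * gauss_kernel t z \<le> 2 powr (n/2) * t * gauss_kernel (2 * t) z" for z :: 'a
    proof -
      define r where "r = (norm z)\<^sup>2 / t"
      have r0: "r \<ge> 0" using t by (simp add: r_def)
      have "r \<le> (1 + r/4)\<^sup>2" using zero_le_power2[of "1 - r/4"] by (simp add: power2_eq_square algebra_simps)
      also have "\<dots> \<le> (exp (r/4))\<^sup>2" using r0 by (intro power_mono exp_ge_add_one_self) auto
      also have "\<dots> = exp (r/2)" by (simp add: power2_eq_square exp_add[symmetric])
      finally have "r * exp (-r) \<le> exp (r/2) * exp (-r)" by (intro mult_right_mono) auto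
      also have "\<dots> = exp (-(r/2))" by (simp add: exp_add[symmetric])
      finally have "t powr (-n/2) * (t * (r * exp (-r))) \<le> t powr (-n/2) * (t * exp (-(r/2)))"
        using t by (intro mult_left_mono) auto
      moreover have "(norm z)\<^sup>2 * gauss_kernel t z = t powr (-n/2) * (t * (r * exp (-r)))"
        using t by (simp add: gauss_kernel_def n_def r_def)
      moreover have "2 powr (n/2) * t * gauss_kernel (2 * t) z = t powr (-n/2) * (t * exp (-(r/2)))"
      proof -
        have "2 powr (n/2) * 2 powr (-n/2) = (1::real)" by (simp add: powr_add[symmetric])
        hence "2 powr (n/2) * ((2 * t) powr (-n/2)) = t powr (-n/2)"
          using t by (simp add: powr_mult mult.assoc[symmetric])
        thus ?thesis using t by (simp add: gauss_kernel_def n_def r_def mult_ac)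
      qed
      ultimately show ?thesis by (simp only:)
    qed
    have "(\<integral>\<^sup>+(z::'a). ennreal (min 1 ((norm z)\<^sup>2) * gauss_kernel t z) \<partial>lborel) \<le> (\<integral>\<^sup>+(z::'a). ennreal (gauss_kernel t (z - 0)) \<partial>lborel)"
      by (intro nn_integral_mono ennreal_leI) (simp add: mult_left_le_one_le)
    also have "\<dots> = ?c" using t by (rule nn_integral_gauss_kernel)
    finally have a: "(\<integral>\<^sup>+(z::'a). ennreal (min 1 ((norm z)\<^sup>2) * gauss_kernel t z) \<partial>lborel) \<le> ?c" .
    have "(\<integral>\<^sup>+(z::'a). ennreal (min 1 ((norm z)\<^sup>2) * gauss_kernel t z) \<partial>lborel) \<le> (\<integral>\<^sup>+(z::'a). ennreal (2 powr (n/2) * t) * ennreal (gauss_kernel (2 * t) (z - 0)) \<partial>lborel)"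
    proof (intro nn_integral_mono)
      fix z :: 'a
      have "min 1 ((norm z)\<^sup>2) * gauss_kernel t z \<le> (norm z)\<^sup>2 * gauss_kernel t z" by (intro mult_right_mono) auto
      also note 1
      finally show "ennreal (min 1 ((norm z)\<^sup>2) * gauss_kernel t z) \<le> ennreal (2 powr (n/2) * t) * ennreal (gauss_kernel (2 * t) (z - 0))"
        using t by (simp add: ennreal_mult[symmetric] ennreal_leI)
    qed
    also have "\<dots> = ennreal (2 powr (n/2) * t) * ?c" using t by (subst nn_integral_cmult) (auto simp: nn_integral_gauss_kernel[of "2 * t" 0, simplified])
    finally show ?thesis using a by (cases "2 powr (n/2) * t \<le> 1") (auto simp: min_def)
  qed
  have "(\<integral>\<^sup>+z. ennreal (min 1 ((norm z)\<^sup>2) / norm z powr (real DIM('a) + 2 * s)) \<partial>(lborel :: 'a measure)) * K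
     = (\<integral>\<^sup>+(z::'a). ennreal (min 1 ((norm z)\<^sup>2)) * ker_cut s 0 z \<partial>lborel)"
  proof (subst nn_integral_multc[symmetric])
    show "(\<integral>\<^sup>+(z::'a). ennreal (min 1 ((norm z)\<^sup>2) / norm z powr (real DIM('a) + 2 * s)) * K \<partial>lborel)
      = (\<integral>\<^sup>+(z::'a). ennreal (min 1 ((norm z)\<^sup>2)) * ker_cut s 0 z \<partial>lborel)"
    proof (intro nn_integral_cong)
      fix z :: 'a
      show "ennreal (min 1 ((norm z)\<^sup>2) / norm z powr (real DIM('a) + 2 * s)) * K = ennreal (min 1 ((norm z)\<^sup>2)) * ker_cut s 0 z"
      proof (cases "z = 0")
        case False
        have "min 1 ((norm z)\<^sup>2) / norm z powr (real DIM('a) + 2 * s) = min 1 ((norm z)\<^sup>2) * norm z powr (-(real DIM('a) + 2 * s))"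
          unfolding powr_minus_divide by simp
        thus ?thesis unfolding ker_cut_zero_eq[OF False] K_def[symmetric]
          by (simp only:) (subst ennreal_mult, auto simp: mult.assoc)
      qed simp
    qed
  qed measurable
  also have "\<dots> = (\<integral>\<^sup>+(z::'a). (\<integral>\<^sup>+t. ennreal (min 1 ((norm z)\<^sup>2)) * (ennreal (t powr (-1-s) * gauss_kernel t z) * indicator {0<..} t) \<partial>lborel) \<partial>lborel)"
    unfolding ker_cut_def by (simp add: nn_integral_cmult)
  also have "\<dots> = (\<integral>\<^sup>+t. (\<integral>\<^sup>+(z::'a). ennreal (min 1 ((norm z)\<^sup>2)) * (ennreal (t powr (-1-s) * gauss_kernel t z) * indicator {0<..} t) \<partial>lborel) \<partial>lborel)"
    by (rule lborel_pair.Fubini') measurable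
  also have "\<dots> \<le> (\<integral>\<^sup>+t. ennreal (t powr (-1-s) * (min 1 (2 powr (n/2) * t))) * indicator {0<..} t * ?c \<partial>lborel)"
  proof (intro nn_integral_mono)
    fix t :: real
    show "(\<integral>\<^sup>+(z::'a). ennreal (min 1 ((norm z)\<^sup>2)) * (ennreal (t powr (-1-s) * gauss_kernel t z) * indicator {0<..} t) \<partial>lborel)
      \<le> ennreal (t powr (-1-s) * (min 1 (2 powr (n/2) * t))) * indicator {0<..} t * ?c"
    proof (cases "t > 0")
      case True
      have "(\<integral>\<^sup>+(z::'a). ennreal (min 1 ((norm z)\<^sup>2)) * (ennreal (t powr (-1-s) * gauss_kernel t z) * indicator {0<..} t) \<partial>lborel)
        = (\<integral>\<^sup>+(z::'a). ennreal (t powr (-1-s)) * ennreal (min 1 ((norm z)\<^sup>2) * gauss_kernel t z) \<partial>lborel)"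
        using True by (intro nn_integral_cong) (simp add: ennreal_mult[symmetric] mult_ac)
      also have "\<dots> = ennreal (t powr (-1-s)) * (\<integral>\<^sup>+(z::'a). ennreal (min 1 ((norm z)\<^sup>2) * gauss_kernel t z) \<partial>lborel)"
        by (rule nn_integral_cmult) measurable
      also have "\<dots> \<le> ennreal (t powr (-1-s)) * (ennreal (min 1 (2 powr (n/2) * t)) * ?c)"
        using sq[OF True] by (intro mult_left_mono) auto
      finally show ?thesis using True by (simp add: ennreal_mult mult.assoc)
    qed simp
  qed
  also have "\<dots> = (\<integral>\<^sup>+t. ennreal (t powr (-1-s) * (min 1 (2 powr (n/2) * t))) * indicator {0<..} t \<partial>lborel) * ?c"
    by (rule nn_integral_multc) measurable
  also have "\<dots> < \<infinity>"
  proof -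
    have "(\<integral>\<^sup>+t. ennreal (t powr (-1-s) * (min 1 (2 powr (n/2) * t))) * indicator {0<..} t \<partial>lborel)
      \<le> (\<integral>\<^sup>+t. ennreal (2 powr (n/2) * t powr (-s)) * indicator {0..1} t + ennreal (t powr (-s-1)) * indicator {1<..} t \<partial>lborel)"
    proof (intro nn_integral_mono)
      fix t :: real
      consider "t \<le> 0" | "0 < t" "t \<le> 1" | "1 < t" by linarith
      thus "ennreal (t powr (-1-s) * (min 1 (2 powr (n/2) * t))) * indicator {0<..} t
        \<le> ennreal (2 powr (n/2) * t powr (-s)) * indicator {0..1} t + ennreal (t powr (-s-1)) * indicator {1<..} t"
      proof cases
        case 2
        have "t powr (-1-s) * min 1 (2 powr (n/2) * t) \<le> t powr (-1-s) * (2 powr (n/2) * t)"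
          by (intro mult_left_mono) auto
        also have "\<dots> = 2 powr (n/2) * (t * t powr (-1-s))" by simp
        also have "t * t powr (-1-s) = t powr (-s)" using 2 by (simp add: powr_mult_base)
        finally show ?thesis using 2 by (simp add: ennreal_leI)
      next
        case 3
        have "t powr (-1-s) * min 1 (2 powr (n/2) * t) \<le> t powr (-1-s) * 1"
          by (intro mult_left_mono) auto
        thus ?thesis using 3 by (simp add: ennreal_leI minus_diff_commute)
      qed (simp add: indicator_def)
    qed
    also have "\<dots> = ennreal (2 powr (n/2) * (1 / (1-s))) + ennreal (1/s)"
    proof -
      have "((\<lambda>t. t powr (-s)) has_integral (1 powr (-s+1) / (-s+1))) {0..1}"
        using s by (intro has_integral_powr_from_0) auto
      hence "((\<lambda>t. 2 powr (n/2) * t powr (-s)) has_integral (2 powr (n/2) * (1 / (1-s)))) {0..1}"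
        by (intro has_integral_mult_right) simp
      hence "(\<integral>\<^sup>+t. ennreal (2 powr (n/2) * t powr (-s)) * indicator {0..1} t \<partial>lborel) = ennreal (2 powr (n/2) * (1 / (1-s)))"
        by (intro nn_integral_of_has_integral) auto
      thus ?thesis using s by (subst nn_integral_add) (auto simp: nn_integral_powr_tail)
    qed
    also have "\<dots> < \<infinity>" by simp
    finally show ?thesis using gauss_const_finite[where 'a='a] by (simp add: ennreal_mult_less_top)
  qed
  finally show ?thesis using K by (auto simp: ennreal_mult_less_top)
qed

text \<open>Again by Gaussian mixtures: integrating in x first leaves t^(-n/2-1) exp(-R^2/t),
  integrable at 0 because R > 0 and at infinity because n > 0.\<close>

lemma integrable_bubble_weight:
  assumes R: "R > 0"
  shows "integrable (lborel :: 'a::euclidean_space measure) (\<lambda>x. (R\<^sup>2 + (norm x)\<^sup>2) powr (-real DIM('a)))"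
proof (rule integrableI_nonneg)
  let ?c = "gauss_const TYPE('a)"
  define n where "n = real DIM('a)"
  have n0: "n > 0" by (simp add: n_def)
  define K where "K = invgamma_const n"
  have K: "K < \<infinity>" "K > 0" using invgamma_const_finite[of n] invgamma_const_pos n0 by (auto simp: K_def)
  have "(\<integral>\<^sup>+x. ennreal ((R\<^sup>2 + (norm x)\<^sup>2) powr (-n)) \<partial>(lborel::'a measure)) * K
    = (\<integral>\<^sup>+x. ennreal ((R\<^sup>2 + (norm x)\<^sup>2) powr (-n)) * K \<partial>(lborel::'a measure))"
    by (rule nn_integral_multc[symmetric]) measurable
  also have "\<dots> = (\<integral>\<^sup>+(x::'a). (\<integral>\<^sup>+t. ennreal (t powr (-n-1) * exp (-(R\<^sup>2 + (norm x)\<^sup>2)/t)) * indicator {0<..} t \<partial>lborel) \<partial>lborel)"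
    unfolding K_def using R by (intro nn_integral_cong invgamma_scaling[symmetric] add_pos_nonneg) auto
  also have "\<dots> = (\<integral>\<^sup>+t. (\<integral>\<^sup>+(x::'a). ennreal (t powr (-n-1) * exp (-(R\<^sup>2 + (norm x)\<^sup>2)/t)) * indicator {0<..} t \<partial>lborel) \<partial>lborel)"
    by (rule lborel_pair.Fubini') measurable
  also have "\<dots> = (\<integral>\<^sup>+t. (ennreal (t powr (-(n/2)-1) * exp (-(R\<^sup>2)/t)) * indicator {0<..} t) * ?c \<partial>lborel)"
  proof (intro nn_integral_cong)
    fix t :: real
    show "(\<integral>\<^sup>+(x::'a). ennreal (t powr (-n-1) * exp (-(R\<^sup>2 + (norm x)\<^sup>2)/t)) * indicator {0<..} t \<partial>lborel)
       = (ennreal (t powr (-(n/2)-1) * exp (-(R\<^sup>2)/t)) * indicator {0<..} t) * ?c"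
    proof (cases "t > 0")
      case True
      have e: "t powr (-n-1) * exp (-(R\<^sup>2 + (norm x)\<^sup>2)/t) = t powr (-(n/2)-1) * exp (-(R\<^sup>2)/t) * gauss_kernel t (x - 0)" for x :: 'a
      proof -
        have "exp (-(R\<^sup>2 + (norm x)\<^sup>2)/t) = exp (-R\<^sup>2/t) * exp (-(norm x)\<^sup>2 / t)"
          by (simp add: exp_add[symmetric] diff_divide_distrib)
        moreover have "t powr (-n-1) = t powr (-(n/2)-1) * t powr (-n/2)"
          using True by (simp add: powr_add[symmetric])
        ultimately show ?thesis by (simp add: gauss_kernel_def n_def)
      qed
      show ?thesis unfolding e using True
        by (simp add: ennreal_mult nn_integral_cmult nn_integral_gauss_kernel[OF True, of 0, simplified])
    qed simp
  qed
  also have "\<dots> = (ennreal ((R\<^sup>2) powr (-(n/2))) * invgamma_const (n/2)) * ?c"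
    using R by (subst nn_integral_multc) (auto simp: invgamma_scaling[of "R\<^sup>2" "n/2", simplified])
  also have "\<dots> < \<infinity>"
    using invgamma_const_finite[of "n/2"] n0 gauss_const_finite[where 'a='a] by (simp add: ennreal_mult_less_top)
  finally show "(\<integral>\<^sup>+x. ennreal ((R\<^sup>2 + (norm x)\<^sup>2) powr (-real DIM('a))) \<partial>(lborel::'a measure)) < \<infinity>"
    using K unfolding n_def by (auto simp: ennreal_mult_less_top)
qed auto

lemma emeasure_superlevel_powr_le:
  fixes w :: "'a::euclidean_space \<Rightarrow> real"
  assumes [measurable]: "w \<in> borel_measurable borel" and w: "\<And>x. w x \<ge> 0"
    and int: "integrable lborel (\<lambda>x. w x powr p)" and c: "c > 0" and p: "p > 0"
  shows "emeasure lborel {y. w y \<ge> c} \<le> ennreal ((\<integral>x. w x powr p \<partial>lborel) / c powr p)"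
proof -
  have "emeasure lborel {y. w y \<ge> c} = (\<integral>\<^sup>+y. indicator {y. w y \<ge> c} y \<partial>lborel)" by simp
  also have "\<dots> \<le> (\<integral>\<^sup>+y. ennreal (w y powr p / c powr p) \<partial>lborel)"
  proof (intro nn_integral_mono)
    fix y
    show "indicator {y. w y \<ge> c} y \<le> ennreal (w y powr p / c powr p)"
      using powr_mono2[of p c "w y"] c p by (auto simp: indicator_def field_simps ennreal_1[symmetric] simp del: ennreal_1 intro!: ennreal_leI)
  qed
  also have "\<dots> = ennreal (\<integral>y. w y powr p / c powr p \<partial>lborel)"
    using int by (intro nn_integral_eq_integral) auto
  finally show ?thesis by simp
qed

text \<open>A pointwise bound gives the inequality directly. Around x take a ball twice as large in
  measure as Chebyshev allows for the set where w is at least w(x)/2. On at least half of the ball w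
  drops below w(x)/2, so the inner integral at x is at least c S^(-2s/n) w(x)^p. Integrating in x
  gives S^(1-2s/n) = S^(2/p).\<close>

theorem fractional_sobolev:
  assumes s: "0 < s" and N: "2 * s < real DIM('a::euclidean_space)"
    and p: "p = 2 * real DIM('a) / (real DIM('a) - 2 * s)"
  obtains C where "C > 0" "\<And>w :: 'a \<Rightarrow> real. w \<in> borel_measurable borel \<Longrightarrow> (\<And>x. w x \<ge> 0) \<Longrightarrow>
    integrable lborel (\<lambda>x. w x powr p) \<Longrightarrow>
    ennreal ((\<integral>x. w x powr p \<partial>lborel) powr (2/p)) \<le> ennreal C * (\<integral>\<^sup>+(x,y). ennreal ((w x - w y)\<^sup>2) \<partial>KM s)"
proof -
  define n where "n = real DIM('a)"
  have n0: "n > 0" "n - 2 * s > 0" using N by (auto simp: n_def)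
  have p': "p = 2 * n / (n - 2 * s)" using p by (simp add: n_def)
  have p2: "p > 2" using n0 s unfolding p' by (simp add: field_simps)
  define \<omega> where "\<omega> = unit_ball_vol n"
  have \<omega>: "\<omega> > 0" using n0 by (simp add: \<omega>_def)
  define b where "b = 1 + 2 * s / n"
  have "p * (2 * s / n) = 4 * s / (n - 2 * s)" "p = 2 + 4 * s / (n - 2 * s)" unfolding p' using n0 by (simp_all add: field_simps)
  hence e1: "2 - p + p * b = p" unfolding b_def by (simp add: distrib_left)
  have e2: "1 - 2 * s / n = 2 / p" unfolding p' using n0 by (simp add: field_simps)
  define c where "c = (1/4) * 2 powr p * (2 powr (p+1) / \<omega>) powr (-b)"
  have c0: "c > 0" using \<omega> by (simp add: c_def)
  show thesis
  proof (rule that[of "1/c"])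
    fix w :: "'a \<Rightarrow> real"
    assume wm[measurable]: "w \<in> borel_measurable borel" and w: "\<And>x. w x \<ge> 0" and int: "integrable lborel (\<lambda>x. w x powr p)"
    define S where "S = (\<integral>x. w x powr p \<partial>lborel)"
    have S0: "S \<ge> 0" unfolding S_def by (intro integral_nonneg_AE) auto
    define J where "J z = 1 / norm z powr (n + 2 * s)" for z :: 'a
    have [measurable]: "J \<in> borel_measurable borel" unfolding J_def[abs_def] by measurable
    show "ennreal ((\<integral>x. w x powr p \<partial>lborel) powr (2/p)) \<le> ennreal (1/c) * (\<integral>\<^sup>+(x,y). ennreal ((w x - w y)\<^sup>2) \<partial>KM s)"
    proof (cases "S = 0")
      case True thus ?thesis by (simp add: S_def)
    next
      case False
      hence S: "S > 0" using S0 by simp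
      have D: "ennreal (c * S powr (- 2 * s / n) * w x powr p) \<le> (\<integral>\<^sup>+y. ennreal (J (x - y)) * ennreal ((w x - w y)\<^sup>2) \<partial>lborel)" for x
      proof (cases "w x = 0")
        case True thus ?thesis using p2 by simp
      next
        case False
        define a where "a = w x"
        have a: "a > 0" using False w[of x] by (simp add: a_def)
        \<comment> \<open>Chebyshev's bound for the measure of the set where w is at least
          a/2.\<close>
        define m where "m = 2 powr p * S / a powr p"
        have m0: "m > 0" using S a by (simp add: m_def)
        \<comment> \<open>Chosen so that the ball of radius r has measure 2 m.\<close>
        define r where "r = (2 * m / \<omega>) powr (1 / n)"
        have r0: "r > 0" using m0 \<omega> by (simp add: r_def)
        have rn: "r ^ DIM('a) = 2 * m / \<omega>"
        proof -
          have "r ^ DIM('a) = r powr n" using r0 by (simp add: n_def powr_realpow)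
          thus ?thesis using m0 \<omega> n0 by (simp add: r_def powr_powr)
        qed
        define T where "T = {y \<in> ball x r. w y < a/2}"
        have [measurable]: "T \<in> sets borel" unfolding T_def by measurable
        have "emeasure lborel (ball x r) = ennreal (2 * m)"
        proof -
          have "emeasure lborel (ball x r) = ennreal (\<omega> * r ^ DIM('a))"
            using r0 by (subst emeasure_ball) (auto simp: \<omega>_def n_def)
          also have "\<omega> * r ^ DIM('a) = 2 * m" using \<omega> by (simp add: rn)
          finally show ?thesis .
        qed
        moreover have "emeasure lborel (ball x r) \<le> emeasure lborel T + emeasure lborel {y. w y \<ge> a/2}"
          by (rule order_trans[OF emeasure_mono emeasure_subadditive]) (auto simp: T_def)
        moreover have "emeasure lborel {y. w y \<ge> a/2} \<le> ennreal m"
        proof -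
          have "emeasure lborel {y. w y \<ge> a/2} \<le> ennreal (S / (a/2) powr p)"
            unfolding S_def using a p2 by (intro emeasure_superlevel_powr_le w int) auto
          also have "S / (a/2) powr p = m" using a by (simp add: m_def powr_divide)
          finally show ?thesis .
        qed
        ultimately have *: "ennreal (2 * m) \<le> emeasure lborel T + ennreal m"
          by (metis (no_types, lifting) add_left_mono dual_order.trans)
        have T: "ennreal m \<le> emeasure lborel T"
        proof (cases "emeasure lborel T")
          case (real t)
          hence "ennreal (2 * m) \<le> ennreal (t + m)" using * m0 by simp
          hence "2 * m \<le> t + m" using real m0 by (subst (asm) ennreal_le_iff) auto
          thus ?thesis using real by (simp add: ennreal_leI)
        qed simp
        define k where "k = (a/2)\<^sup>2 / r powr (n + 2 * s)"
        have k0: "k \<ge> 0" by (simp add: k_def)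
        have "ennreal (k * m) = ennreal k * ennreal m" using k0 m0 by (simp add: ennreal_mult)
        also have "\<dots> \<le> ennreal k * emeasure lborel T" using T by (intro mult_left_mono) auto
        also have "\<dots> = (\<integral>\<^sup>+y. ennreal k * indicator T y \<partial>lborel)" by (simp add: nn_integral_cmult)
        also have "\<dots> \<le> (\<integral>\<^sup>+y. ennreal (J (x - y)) * ennreal ((w x - w y)\<^sup>2) \<partial>lborel)"
        proof (intro nn_integral_mono)
          fix y
          show "ennreal k * indicator T y \<le> ennreal (J (x - y)) * ennreal ((w x - w y)\<^sup>2)"
          proof (cases "y \<in> T")
            case True
            hence y: "norm (x - y) < r" "w y < a/2" by (auto simp: T_def dist_norm)
            hence ne: "norm (x - y) > 0" using a by (auto simp: a_def)
            have "1 / r powr (n + 2 * s) \<le> J (x - y)" unfolding J_def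
              using y ne r0 s n0 by (intro divide_left_mono powr_mono2) auto
            moreover have "(a/2)\<^sup>2 \<le> (w x - w y)\<^sup>2" using y a by (intro power_mono) (auto simp: a_def)
            ultimately have "k \<le> J (x - y) * (w x - w y)\<^sup>2"
              unfolding k_def using mult_mono[of "1 / r powr (n + 2 * s)" "J (x-y)" "(a/2)\<^sup>2" "(w x - w y)\<^sup>2"] by (simp add: J_def)
            moreover have "J (x - y) \<ge> 0" by (simp add: J_def)
            ultimately show ?thesis using True by (simp add: ennreal_mult[symmetric] ennreal_leI)
          qed simp
        qed
        also have "k * m = c * S powr (- 2 * s / n) * w x powr p"
        proof -
          have "r powr (n + 2 * s) = (2 * m / \<omega>) powr b"
            unfolding r_def b_def using n0 m0 \<omega> by (simp add: powr_powr field_simps)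
          also have "2 * m / \<omega> = (2 powr (p+1) / \<omega>) * (S * a powr (-p))"
            using a by (simp add: m_def powr_add powr_minus_divide mult_ac)
          also have "\<dots> powr b = (2 powr (p+1) / \<omega>) powr b * (S powr b * a powr (-p * b))"
            using \<omega> S a by (simp add: powr_mult powr_powr del: times_divide_eq_left times_divide_eq_right)
          finally have kr: "1 / r powr (n + 2 * s) = (2 powr (p+1) / \<omega>) powr (-b) * (S powr (-b) * a powr (p * b))"
            by (simp add: powr_minus_divide)
          have "k = (a/2)\<^sup>2 * (1 / r powr (n + 2 * s))" by (simp add: k_def)
          hence "k * m = c * (S * S powr (-b)) * (a\<^sup>2 * a powr (-p) * a powr (p*b))"
            unfolding kr m_def c_def by (simp add: power2_eq_square powr_minus_divide mult_ac)
          also have "S * S powr (-b) = S powr (- 2 * s / n)"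
            using S by (simp add: powr_mult_base b_def)
          also have "a\<^sup>2 * a powr (-p) * a powr (p*b) = a powr (2 - p + p * b)"
            using a by (simp add: powr_numeral[symmetric] powr_add[symmetric] del: powr_numeral)
          finally show ?thesis unfolding e1 by (simp add: a_def)
        qed
        finally show ?thesis .
      qed
      have "ennreal (S powr (2/p)) = ennreal (S powr (- 2 * s / n) * S)"
        using S by (simp add: e2[symmetric] powr_mult_base mult.commute)
      also have "\<dots> = ennreal (1/c) * ennreal (c * S powr (- 2 * s / n) * S)"
        using c0 S by (simp add: ennreal_mult[symmetric])
      also have "ennreal (c * S powr (- 2 * s / n) * S) = (\<integral>\<^sup>+x. ennreal (c * S powr (- 2 * s / n) * w x powr p) \<partial>lborel)"
        unfolding S_def using int c0 S by (subst nn_integral_eq_integral) (auto simp: S_def)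
      also have "\<dots> \<le> (\<integral>\<^sup>+x. \<integral>\<^sup>+y. ennreal (J (x - y)) * ennreal ((w x - w y)\<^sup>2) \<partial>lborel \<partial>lborel)"
        by (intro nn_integral_mono D)
      also have "\<dots> = (\<integral>\<^sup>+(x,y). ennreal ((w x - w y)\<^sup>2) \<partial>KM s)"
        by (subst nn_integral_KM) (auto simp: J_def n_def)
      finally show ?thesis unfolding S_def by (simp add: mult_left_mono)
    qed
  qed (use c0 in simp)
qed

section \<open>A mountain pass lemma without completeness\<close>

text \<open>Together with the pointwise addition of functions this makes functions into complex
  numbers a real vector space, so that the abstract mountain pass argument can be applied to a
  subspace of them.\<close>

instantiation "fun" :: (type, scaleR) scaleR
begin
definition scaleR_fun :: "real \<Rightarrow> ('a \<Rightarrow> 'b) \<Rightarrow> 'a \<Rightarrow> 'b" where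
  "scaleR_fun c f = (\<lambda>x. c *\<^sub>R f x)"
instance ..
end

lemma scaleR_fun_apply [simp]: "(c *\<^sub>R f) x = c *\<^sub>R f x"
  by (simp add: scaleR_fun_def)

instance "fun" :: (type, real_vector) real_vector
  by standard (auto simp: fun_eq_iff algebra_simps)

text \<open>\<open>nrm\<close> is only a seminorm, since functions equal almost everywhere are
  different elements of E, and \<open>X\<close> need not be complete. Continuous differentiability
  is replaced by a Taylor expansion that is uniform on bounded sets, which is what a discrete
  deformation with a fixed step size needs.\<close>

locale mountain_pass =
  fixes X :: "'v::real_vector set" and nrm :: "'v \<Rightarrow> real" and I :: "'v \<Rightarrow> real" and D :: "'v \<Rightarrow> 'v \<Rightarrow> real"
  assumes X0: "0 \<in> X" and Xadd: "\<And>x y. x \<in> X \<Longrightarrow> y \<in> X \<Longrightarrow> x + y \<in> X" and Xscale: "\<And>c x. x \<in> X \<Longrightarrow> c *\<^sub>R x \<in> X"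
    and nrm_nonneg: "\<And>x. x \<in> X \<Longrightarrow> nrm x \<ge> 0"
    and nrm_scale: "\<And>c x. x \<in> X \<Longrightarrow> nrm (c *\<^sub>R x) = \<bar>c\<bar> * nrm x"
    and nrm_triangle: "\<And>x y. x \<in> X \<Longrightarrow> y \<in> X \<Longrightarrow> nrm (x + y) \<le> nrm x + nrm y"
    and D_add: "\<And>u x y. u \<in> X \<Longrightarrow> x \<in> X \<Longrightarrow> y \<in> X \<Longrightarrow> D u (x + y) = D u x + D u y"
    and D_scale: "\<And>u x c. u \<in> X \<Longrightarrow> x \<in> X \<Longrightarrow> D u (c *\<^sub>R x) = c * D u x"
    and taylor: "\<And>\<rho> \<epsilon>. \<epsilon> > 0 \<Longrightarrow> \<exists>\<delta>>0. \<forall>u\<in>X. \<forall>\<phi>\<in>X. nrm u \<le> \<rho> \<longrightarrow> nrm \<phi> \<le> \<delta> \<longrightarrow> \<bar>I (u + \<phi>) - I u - D u \<phi>\<bar> \<le> \<epsilon> * nrm \<phi>"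
    and D_bounded: "\<And>\<rho>. \<exists>C. \<forall>u\<in>X. nrm u \<le> \<rho> \<longrightarrow> (\<forall>\<phi>\<in>X. \<bar>D u \<phi>\<bar> \<le> C * nrm \<phi>)"
begin

lemma Xdiff: "x \<in> X \<Longrightarrow> y \<in> X \<Longrightarrow> x - y \<in> X"
  using Xadd[of x "(-1) *\<^sub>R y"] Xscale[of y "-1"] by simp

text \<open>Discrete paths replace continuous ones: a chain of steps of length \<open>\<eta>\<close> inside the sublevel set
  \<open>I \<le> b\<close>. In the absence of almost critical points every chain from \<open>0\<close> to \<open>e\<close> can be pushed below
  level \<open>b - \<kappa>\<close> by moving its nodes along descent directions; after finitely many rounds it would
  cross the mountain range below height \<open>\<alpha>\<close>.\<close>

definition low_step :: "real \<Rightarrow> real \<Rightarrow> real \<Rightarrow> 'v \<Rightarrow> 'v \<Rightarrow> bool" where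
  "low_step \<eta> \<rho> b x y \<longleftrightarrow> x \<in> X \<and> y \<in> X \<and> nrm x \<le> \<rho> \<and> nrm y \<le> \<rho> \<and> I x \<le> b \<and> I y \<le> b \<and> nrm (y - x) \<le> \<eta>"

lemma low_step_segment:
  assumes "\<eta> > 0" and p: "p \<in> X" and z: "z \<in> X"
    and seg: "\<And>\<sigma>. 0 \<le> \<sigma> \<Longrightarrow> \<sigma> \<le> 1 \<Longrightarrow> nrm (p + \<sigma> *\<^sub>R z) \<le> \<rho> \<and> I (p + \<sigma> *\<^sub>R z) \<le> b"
  shows "(low_step \<eta> \<rho> b)\<^sup>*\<^sup>* p (p + z)"
proof -
  obtain m where m: "nrm z / \<eta> < real (Suc m)" using reals_Archimedean2 by (metis less_Suc_eq less_trans of_nat_less_iff)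
  let ?q = "\<lambda>j. p + (real j / real (Suc m)) *\<^sub>R z"
  have "(low_step \<eta> \<rho> b)\<^sup>*\<^sup>* p (?q j)" if "j \<le> Suc m" for j
    using that
  proof (induction j)
    case (Suc j)
    have "?q (Suc j) - ?q j = (1 / real (Suc m)) *\<^sub>R z"
      by (simp add: add_divide_distrib scaleR_left_distrib)
    hence "nrm (?q (Suc j) - ?q j) = nrm z / real (Suc m)" using nrm_scale[OF z] by simp
    also have "\<dots> \<le> \<eta>" using m \<open>\<eta> > 0\<close> by (simp add: field_simps)
    finally have "low_step \<eta> \<rho> b (?q j) (?q (Suc j))"
      unfolding low_step_def using seg[of "real j / real (Suc m)"] seg[of "real (Suc j) / real (Suc m)"] Suc.prems p z Xadd Xscale
      by (auto simp: divide_simps)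
    thus ?case using Suc by (meson Suc_leD rtranclp.rtrancl_into_rtrancl)
  qed auto
  from this[of "Suc m"] show ?thesis by simp
qed

text \<open>Steps of length at most r/2 cannot jump over the shell between r/2 and r, and on that
  shell \<open>I\<close> is at least \<alpha>; below level \<alpha> the chain would be trapped in
  the ball of radius r/2.\<close>

lemma low_step_crossing:
  assumes "(low_step \<eta> \<rho> b)\<^sup>*\<^sup>* 0 e" "nrm e > r" "\<eta> \<le> r/2" "r > 0"
    and geo: "\<And>u. u \<in> X \<Longrightarrow> r/2 \<le> nrm u \<Longrightarrow> nrm u \<le> r \<Longrightarrow> I u \<ge> \<alpha>"
  shows "\<alpha> \<le> b"
proof (rule ccontr)
  assume nb: "\<not> \<alpha> \<le> b"
  have z: "nrm 0 = 0" using nrm_scale[OF X0, of 0] by simp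
  from assms(1) have "nrm e < r/2"
  proof (induction rule: rtranclp_induct)
    case base thus ?case using z \<open>r > 0\<close> by simp
  next
    case (step y z)
    hence yz: "y \<in> X" "z \<in> X" "nrm (z - y) \<le> \<eta>" "I z \<le> b" by (auto simp: low_step_def)
    have "nrm z \<le> nrm y + nrm (z - y)" using nrm_triangle[OF yz(1) Xdiff[OF yz(2,1)]] by simp
    hence "nrm z \<le> r" using step.IH yz assms(3) by linarith
    thus ?case using geo[OF yz(2)] yz nb by linarith
  qed
  thus False using assms by linarith
qed

text \<open>Uniform continuity of the derivative comes from the Taylor expansion alone: the value at
  u + z + \<psi> is expanded once around u + z and once around u, and the two expansions are
  compared.\<close>

lemma D_uniform:
  assumes "\<epsilon> > 0"
  shows "\<exists>\<delta>>0. \<forall>u\<in>X. \<forall>z\<in>X. \<forall>\<phi>\<in>X. nrm u \<le> \<rho> \<longrightarrow> nrm z \<le> \<delta> \<longrightarrow> nrm \<phi> \<le> 1 \<longrightarrow> \<bar>D (u + z) \<phi> - D u \<phi>\<bar> \<le> \<epsilon>"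
proof -
  obtain d0 where d0: "d0 > 0" "\<And>u \<phi>. u \<in> X \<Longrightarrow> \<phi> \<in> X \<Longrightarrow> nrm u \<le> \<rho> + 1 \<Longrightarrow> nrm \<phi> \<le> d0 \<Longrightarrow> \<bar>I (u + \<phi>) - I u - D u \<phi>\<bar> \<le> (\<epsilon>/4) * nrm \<phi>"
    using taylor[of "\<epsilon>/4" "\<rho> + 1"] assms by (auto simp del: times_divide_eq_left)
  define d where "d = min d0 1"
  have d: "d > 0" "d \<le> 1" "d \<le> d0" using d0(1) by (auto simp: d_def)
  show ?thesis
  proof (intro exI[of _ "d/2"] conjI ballI impI)
    fix u z \<phi> assume H: "u \<in> X" "z \<in> X" "\<phi> \<in> X" "nrm u \<le> \<rho>" "nrm z \<le> d/2" "nrm \<phi> \<le> 1"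
    define \<psi> where "\<psi> = (d/2) *\<^sub>R \<phi>"
    have psi: "\<psi> \<in> X" "nrm \<psi> \<le> d/2" using H d by (auto simp: \<psi>_def Xscale nrm_scale)
    have uz: "u + z \<in> X" "nrm (u + z) \<le> \<rho> + 1" using H d Xadd nrm_triangle[of u z] by auto
    have zp: "z + \<psi> \<in> X" "nrm (z + \<psi>) \<le> d" using H psi Xadd nrm_triangle[of z \<psi>] by auto
    have A: "\<bar>I (u + z + \<psi>) - I (u + z) - D (u + z) \<psi>\<bar> \<le> (\<epsilon>/4) * (d/2)"
      using d0(2)[OF uz(1) psi(1) uz(2)] psi d mult_left_mono[OF psi(2), of "\<epsilon>/4"] assms by linarith
    have B: "\<bar>I (u + z + \<psi>) - I u - (D u z + D u \<psi>)\<bar> \<le> (\<epsilon>/4) * d"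
      using d0(2)[OF H(1) zp(1)] H(4) zp(2) d mult_left_mono[OF zp(2), of "\<epsilon>/4"] assms
      unfolding D_add[OF H(1,2) psi(1)] add.assoc by linarith
    have C: "\<bar>I (u + z) - I u - D u z\<bar> \<le> (\<epsilon>/4) * (d/2)"
      using d0(2)[OF H(1,2)] H d mult_left_mono[OF H(5), of "\<epsilon>/4"] assms by linarith
    have "\<bar>D (u + z) \<psi> - D u \<psi>\<bar> \<le> (\<epsilon>/4) * (d/2) + (\<epsilon>/4) * d + (\<epsilon>/4) * (d/2)"
      using A B C by linarith
    also have "\<dots> = (d/2) * \<epsilon>" by (simp add: field_simps)
    also have "D (u + z) \<psi> - D u \<psi> = (d/2) * (D (u + z) \<phi> - D u \<phi>)"
      unfolding \<psi>_def D_scale[OF uz(1) H(3)] D_scale[OF H(1,3)] by (simp add: right_diff_distrib)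
    also have "\<bar>\<dots>\<bar> = (d/2) * \<bar>D (u + z) \<phi> - D u \<phi>\<bar>" using d by (simp add: abs_mult)
    finally show "\<bar>D (u + z) \<phi> - D u \<phi>\<bar> \<le> \<epsilon>" by (rule mult_left_le_imp_le) (use d in auto)
  qed (use d in auto)
qed

lemma I_uniform:
  assumes "\<epsilon> > 0"
  shows "\<exists>\<delta>>0. \<forall>u\<in>X. \<forall>z\<in>X. nrm u \<le> \<rho> \<longrightarrow> nrm z \<le> \<delta> \<longrightarrow> \<bar>I (u + z) - I u\<bar> \<le> \<epsilon>"
proof -
  obtain d where d: "d > 0" "\<And>u \<phi>. u \<in> X \<Longrightarrow> \<phi> \<in> X \<Longrightarrow> nrm u \<le> \<rho> \<Longrightarrow> nrm \<phi> \<le> d \<Longrightarrow> \<bar>I (u + \<phi>) - I u - D u \<phi>\<bar> \<le> 1 * nrm \<phi>"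
    using taylor[of "1" "\<rho>"] by auto
  obtain C where C: "\<And>u \<phi>. u \<in> X \<Longrightarrow> nrm u \<le> \<rho> \<Longrightarrow> \<phi> \<in> X \<Longrightarrow> \<bar>D u \<phi>\<bar> \<le> C * nrm \<phi>" using D_bounded by blast
  define K where "K = \<bar>C\<bar> + 1"
  have K: "K > 0" by (simp add: K_def)
  show ?thesis
  proof (intro exI[of _ "min d (\<epsilon>/K)"] conjI ballI impI)
    fix u z assume H: "u \<in> X" "z \<in> X" "nrm u \<le> \<rho>" "nrm z \<le> min d (\<epsilon>/K)"
    have "\<bar>I (u + z) - I u\<bar> \<le> 1 * nrm z + C * nrm z" using d(2)[OF H(1,2,3)] C[OF H(1,3,2)] H by linarith
    also have "\<dots> \<le> K * nrm z" using nrm_nonneg[OF H(2)] by (simp add: K_def distrib_right mult_right_mono)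
    also have "\<dots> \<le> K * (\<epsilon>/K)" using H K by (intro mult_left_mono) auto
    finally show "\<bar>I (u + z) - I u\<bar> \<le> \<epsilon>" using K by simp
  qed (use d K assms in auto)
qed

theorem mountain_pass:
  assumes I0: "I 0 = 0" and r: "r > 0" and \<alpha>: "\<alpha> > 0"
    and geo: "\<And>u. u \<in> X \<Longrightarrow> r/2 \<le> nrm u \<Longrightarrow> nrm u \<le> r \<Longrightarrow> I u \<ge> \<alpha>"
    and e: "e \<in> X" "nrm e > r" "I e \<le> 0" and path: "\<And>t. 0 \<le> t \<Longrightarrow> t \<le> 1 \<Longrightarrow> I (t *\<^sub>R e) \<le> b0"
    and \<delta>: "\<delta> > 0"
  shows "\<exists>u\<in>X. \<alpha>/2 < I u \<and> I u \<le> b0 \<and> (\<forall>\<phi>\<in>X. nrm \<phi> \<le> 1 \<longrightarrow> D u \<phi> > -\<delta>)"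
proof (rule ccontr)
  assume "\<not> ?thesis"
  hence neg: "\<exists>\<phi>\<in>X. nrm \<phi> \<le> 1 \<and> D u \<phi> \<le> -\<delta>" if "u \<in> X" "\<alpha>/2 < I u" "I u \<le> b0" for u
    using that by (meson not_less)
  define desc where "desc x = (SOME \<phi>. \<phi> \<in> X \<and> nrm \<phi> \<le> 1 \<and> D x \<phi> \<le> -\<delta>)" for x
  have desc: "desc u \<in> X" "nrm (desc u) \<le> 1" "D u (desc u) \<le> -\<delta>" if "u \<in> X" "\<alpha>/2 < I u" "I u \<le> b0" for u
    using someI_ex[of "\<lambda>\<phi>. \<phi> \<in> X \<and> nrm \<phi> \<le> 1 \<and> D u \<phi> \<le> -\<delta>"] neg[OF that] unfolding desc_def by blast+
  have b00: "b0 \<ge> 0" using path[of 0] I0 by simp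
  \<comment> \<open>Each round moves the nodes by at most h and lowers the level by \<kappa> = h
    \<delta>/2, so the at most b0/\<kappa> + 1 rounds travel no further than 2 b0/\<delta> + h. All
    uniform constants are taken on this ball in advance.\<close>
  define \<rho>m where "\<rho>m = nrm e + 2 * b0 / \<delta> + 1"
  obtain d1 where d1: "d1 > 0" "\<And>u \<phi>. u \<in> X \<Longrightarrow> \<phi> \<in> X \<Longrightarrow> nrm u \<le> \<rho>m \<Longrightarrow> nrm \<phi> \<le> d1 \<Longrightarrow> \<bar>I (u + \<phi>) - I u - D u \<phi>\<bar> \<le> (\<delta>/8) * nrm \<phi>"
    using taylor[of "\<delta>/8" "\<rho>m"] \<delta> by (auto simp del: times_divide_eq_left)
  obtain d2 where d2: "d2 > 0" "\<And>u z \<phi>. u \<in> X \<Longrightarrow> z \<in> X \<Longrightarrow> \<phi> \<in> X \<Longrightarrow> nrm u \<le> \<rho>m \<Longrightarrow> nrm z \<le> d2 \<Longrightarrow> nrm \<phi> \<le> 1 \<Longrightarrow> \<bar>D (u + z) \<phi> - D u \<phi>\<bar> \<le> \<delta>/8"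
    using D_uniform[of "\<delta>/8" "\<rho>m"] \<delta> by auto
  \<comment> \<open>The last bound gives \<kappa> \<le> \<alpha>/4, so that a node above level b - 2
    \<kappa> with b \<ge> \<alpha> lies above \<alpha>/2, where a descent direction exists.\<close>
  define h where "h = min (min 1 d1) (\<alpha> / (2 * \<delta>))"
  have h: "h > 0" "h \<le> 1" "h \<le> d1" "h \<le> \<alpha> / (2 * \<delta>)" using d1(1) \<alpha> \<delta> by (auto simp: h_def)
  define \<kappa> where "\<kappa> = h * \<delta> / 2"
  have \<kappa>: "\<kappa> > 0" "\<kappa> \<le> \<alpha>/4" using h \<delta> by (auto simp: \<kappa>_def field_simps)
  obtain d3 where d3: "d3 > 0" "\<And>u z. u \<in> X \<Longrightarrow> z \<in> X \<Longrightarrow> nrm u \<le> \<rho>m \<Longrightarrow> nrm z \<le> d3 \<Longrightarrow> \<bar>I (u + z) - I u\<bar> \<le> \<kappa>/2"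
    using I_uniform[of "\<kappa>/2" "\<rho>m"] \<kappa> by auto
  define \<eta> where "\<eta> = min (r/2) (min d2 d3)"
  have \<eta>: "\<eta> > 0" "\<eta> \<le> r/2" "\<eta> \<le> d2" "\<eta> \<le> d3" using r d2 d3 by (auto simp: \<eta>_def)
  have z: "nrm 0 = 0" using nrm_scale[OF X0, of 0] by simp
  have down: "(low_step \<eta> (\<rho> + h) (b - \<kappa>))\<^sup>*\<^sup>* 0 e" if chain: "(low_step \<eta> \<rho> b)\<^sup>*\<^sup>* 0 e" and \<rho>: "\<rho> \<le> \<rho>m" and b: "b \<le> b0" for \<rho> b
  proof -
    have b\<alpha>: "\<alpha> \<le> b" using chain e(2) \<eta>(2) r geo by (rule low_step_crossing)
    \<comment> \<open>Nodes that are already low stay put; in particular the endpoints 0 and e are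
      fixed.\<close>
    define dir where "dir x = (if I x \<le> b - 2 * \<kappa> then 0 else desc x)" for x
    have dir: "dir x \<in> X" "nrm (dir x) \<le> 1" "I x > b - 2 * \<kappa> \<Longrightarrow> D x (dir x) \<le> -\<delta>" if "x \<in> X" "I x \<le> b" for x
      using desc[of x] that b b\<alpha> \<kappa> X0 z by (auto simp: dir_def)
    have "(low_step \<eta> (\<rho> + h) (b - \<kappa>))\<^sup>*\<^sup>* 0 (x + h *\<^sub>R dir x)" if "(low_step \<eta> \<rho> b)\<^sup>*\<^sup>* 0 x" for x
      using that
    proof (induction rule: rtranclp_induct)
      case base
      have "I 0 \<le> b - 2 * \<kappa>" using I0 b\<alpha> \<kappa> \<alpha> by simp
      thus ?case by (simp add: dir_def)
    next
      case (step x y)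
      hence xy: "x \<in> X" "y \<in> X" "nrm x \<le> \<rho>" "nrm y \<le> \<rho>" "I x \<le> b" "I y \<le> b" "nrm (y - x) \<le> \<eta>" by (auto simp: low_step_def)
      define \<phi> \<psi> where "\<phi> = dir x" and "\<psi> = dir y"
      have f: "\<phi> \<in> X" "nrm \<phi> \<le> 1" and p: "\<psi> \<in> X" "nrm \<psi> \<le> 1" using dir xy by (auto simp: \<phi>_def \<psi>_def)
      have yx: "y - x \<in> X" "x - y \<in> X" using xy Xdiff by auto
      have nyx: "nrm (x - y) = nrm (y - x)" using nrm_scale[OF yx(1), of "-1"] by simp
      have osc: "\<bar>I y - I x\<bar> \<le> \<kappa>/2" using d3(2)[OF xy(1) yx(1)] xy \<rho> \<eta> by simp
      have Dc: "\<bar>D y \<phi> - D x \<phi>\<bar> \<le> \<delta>/8" using d2(2)[OF xy(1) yx(1) f(1)] xy \<rho> \<eta> f by simp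
      \<comment> \<open>Neighbouring nodes may have unrelated descent directions, so the chain has
        to be closed up by a segment between them at y. Since the derivative changes by at most
        \<delta>/8 from x to y, every convex combination still descends there: by at least
        7\<kappa>/4 with error \<kappa>/4 if both nodes are high, and otherwise y itself is below b
        - 3\<kappa>/2 already.\<close>
      have low: "nrm (y + h *\<^sub>R \<xi>) \<le> \<rho> + h \<and> I (y + h *\<^sub>R \<xi>) \<le> b - \<kappa>" if xi: "\<xi> = (1-\<sigma>) *\<^sub>R \<phi> + \<sigma> *\<^sub>R \<psi>" "0 \<le> \<sigma>" "\<sigma> \<le> 1" for \<xi> \<sigma>
      proof
        have xX: "\<xi> \<in> X" "h *\<^sub>R \<xi> \<in> X" using xi f p Xadd Xscale by auto
        have "nrm \<xi> \<le> (1-\<sigma>) * nrm \<phi> + \<sigma> * nrm \<psi>"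
          using nrm_triangle[of "(1-\<sigma>) *\<^sub>R \<phi>" "\<sigma> *\<^sub>R \<psi>"] xi f p Xscale by (simp add: nrm_scale)
        also have "\<dots> \<le> (1-\<sigma>) * 1 + \<sigma> * 1" using xi f p by (intro add_mono mult_left_mono) auto
        finally have x1: "nrm \<xi> \<le> 1" by simp
        have hx: "nrm (h *\<^sub>R \<xi>) \<le> h" using nrm_scale[OF xX(1), of h] h x1 by simp
        show "nrm (y + h *\<^sub>R \<xi>) \<le> \<rho> + h" using nrm_triangle[OF xy(2) xX(2)] xy hx by linarith
        have "\<bar>I (y + h *\<^sub>R \<xi>) - I y - D y (h *\<^sub>R \<xi>)\<bar> \<le> (\<delta>/8) * nrm (h *\<^sub>R \<xi>)"
          using d1(2)[OF xy(2) xX(2)] xy \<rho> hx h by linarith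
        also have "\<dots> \<le> (\<delta>/8) * h" using hx \<delta> by (intro mult_left_mono) auto
        finally have T: "I (y + h *\<^sub>R \<xi>) \<le> I y + h * D y \<xi> + (\<delta>/8) * h"
          using D_scale[OF xy(2) xX(1), of h] by linarith
        have Dx: "D y \<xi> = (1-\<sigma>) * D y \<phi> + \<sigma> * D y \<psi>"
          using xi f p xy by (simp add: D_add D_scale Xscale)
        have k4: "(\<delta>/8) * h = \<kappa>/4" by (simp add: \<kappa>_def)
        have zero: "D y \<phi> \<le> 0" "D y \<psi> \<le> 0"
        proof -
          have D0: "D y 0 = 0" using D_scale[OF xy(2) X0, of 0] by simp
          show "D y \<psi> \<le> 0" using dir(3)[OF xy(2,6)] \<delta> D0 unfolding \<psi>_def by (cases "I y \<le> b - 2 * \<kappa>") (auto simp: dir_def)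
          show "D y \<phi> \<le> 0"
          proof (cases "I x \<le> b - 2 * \<kappa>")
            case True thus ?thesis using D0 by (simp add: \<phi>_def dir_def)
          next
            case False
            hence "D x \<phi> \<le> -\<delta>" using dir(3)[OF xy(1,5)] by (simp add: \<phi>_def)
            thus ?thesis using Dc \<delta> by linarith
          qed
        qed
        have neg: "D y \<xi> \<le> 0" unfolding Dx using zero xi by (intro add_nonpos_nonpos mult_nonneg_nonpos) auto
        show "I (y + h *\<^sub>R \<xi>) \<le> b - \<kappa>"
        proof (cases "I x \<le> b - 2 * \<kappa> \<or> I y \<le> b - 2 * \<kappa>")
          case True
          hence "I y \<le> b - 3 * \<kappa> / 2" using osc \<kappa> by linarith
          moreover have "h * D y \<xi> \<le> 0" using h neg by (intro mult_nonneg_nonpos) auto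
          ultimately show ?thesis using T k4 \<kappa> by linarith
        next
          case False
          have "D x \<phi> \<le> -\<delta>" "D y \<psi> \<le> -\<delta>" using dir(3) xy False by (auto simp: \<phi>_def \<psi>_def)
          hence "D y \<phi> \<le> -(7*\<delta>/8)" "D y \<psi> \<le> -(7*\<delta>/8)" using Dc \<delta> by linarith+
          hence "D y \<xi> \<le> (1-\<sigma>) * (-(7*\<delta>/8)) + \<sigma> * (-(7*\<delta>/8))" unfolding Dx using xi by (intro add_mono mult_left_mono) auto
          also have "\<dots> = -(7*\<delta>/8)" by (simp add: algebra_simps)
          finally have "h * D y \<xi> \<le> h * (-(7*\<delta>/8))" using h by (intro mult_left_mono) auto
          also have "\<dots> = - (7 * \<kappa> / 4)" by (simp add: \<kappa>_def)
          finally show ?thesis using T k4 \<kappa> xy by linarith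
        qed
      qed
      have mid: "(low_step \<eta> (\<rho> + h) (b - \<kappa>)) (x + h *\<^sub>R \<phi>) (y + h *\<^sub>R \<phi>)"
      proof -
        \<comment> \<open>The bounds at the moved node x are read off the last step of the chain
          built so far; if that chain is trivial, the moved node is 0.\<close>
        have "nrm (x + h *\<^sub>R \<phi>) \<le> \<rho> + h \<and> I (x + h *\<^sub>R \<phi>) \<le> b - \<kappa>"
        proof (cases "x = 0 \<and> \<phi> = 0")
          case True
          have "\<rho> \<ge> 0" using xy nrm_nonneg by force
          thus ?thesis using True I0 b\<alpha> \<kappa> h z by auto
        next
          case False
          have "(low_step \<eta> (\<rho> + h) (b - \<kappa>))\<^sup>*\<^sup>* 0 (x + h *\<^sub>R \<phi>)" using step.IH by (simp add: \<phi>_def)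
          thus ?thesis
          proof (cases rule: rtranclp.cases)
            case rtrancl_refl
            have "\<rho> \<ge> 0" using xy nrm_nonneg by force
            thus ?thesis using rtrancl_refl I0 b\<alpha> \<kappa> h z by auto
          next
            case (rtrancl_into_rtrancl b)
            thus ?thesis by (auto simp: low_step_def)
          qed
        qed
        thus ?thesis unfolding low_step_def using low[of \<phi> 0] xy f Xadd Xscale by auto
      qed
      have "(low_step \<eta> (\<rho> + h) (b - \<kappa>))\<^sup>*\<^sup>* (y + h *\<^sub>R \<phi>) (y + h *\<^sub>R \<phi> + h *\<^sub>R (\<psi> - \<phi>))"
      proof (rule low_step_segment[OF \<eta>(1)])
        show "y + h *\<^sub>R \<phi> \<in> X" "h *\<^sub>R (\<psi> - \<phi>) \<in> X" using xy f p Xadd Xscale Xdiff by auto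
        fix \<sigma> :: real assume s: "0 \<le> \<sigma>" "\<sigma> \<le> 1"
        have "y + h *\<^sub>R \<phi> + \<sigma> *\<^sub>R (h *\<^sub>R (\<psi> - \<phi>)) = y + h *\<^sub>R ((1-\<sigma>) *\<^sub>R \<phi> + \<sigma> *\<^sub>R \<psi>)"
          by (simp add: algebra_simps)
        thus "nrm (y + h *\<^sub>R \<phi> + \<sigma> *\<^sub>R (h *\<^sub>R (\<psi> - \<phi>))) \<le> \<rho> + h \<and> I (y + h *\<^sub>R \<phi> + \<sigma> *\<^sub>R (h *\<^sub>R (\<psi> - \<phi>))) \<le> b - \<kappa>"
          using low[OF refl s] by (simp only:)
      qed
      moreover have "y + h *\<^sub>R \<phi> + h *\<^sub>R (\<psi> - \<phi>) = y + h *\<^sub>R dir y" by (simp add: algebra_simps \<psi>_def)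
      ultimately show ?case using step.IH mid unfolding \<phi>_def
        by (metis (no_types, lifting) converse_rtranclp_into_rtranclp rtranclp_trans)
    qed
    from this[OF chain] show ?thesis using e(3) b\<alpha> \<kappa> \<alpha> by (simp add: dir_def)
  qed
  \<comment> \<open>Enough rounds to bring the level b0 - J \<kappa> down to 0 or below,
    contradicting that it stays at least \<alpha>.\<close>
  define J where "J = nat \<lceil>b0 / \<kappa>\<rceil>"
  have J: "b0 / \<kappa> \<le> real J" "real J \<le> b0 / \<kappa> + 1" using b00 \<kappa> unfolding J_def by (auto simp: of_nat_ceiling)
  have Jh: "nrm e + real J * h \<le> \<rho>m"
  proof -
    have "real J * h \<le> (b0 / \<kappa> + 1) * h" using J h by (intro mult_right_mono) auto
    also have "\<dots> = 2 * b0 / \<delta> + h" using h \<delta> by (simp add: \<kappa>_def field_simps)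
    finally show ?thesis using h by (simp add: \<rho>m_def)
  qed
  have "(low_step \<eta> (nrm e + real j * h) (b0 - real j * \<kappa>))\<^sup>*\<^sup>* 0 e" if "j \<le> J" for j
    using that
  proof (induction j)
    case 0
    have "(low_step \<eta> (nrm e) b0)\<^sup>*\<^sup>* 0 (0 + e)"
    proof (rule low_step_segment[OF \<eta>(1) X0 e(1)])
      fix \<sigma> :: real assume s: "0 \<le> \<sigma>" "\<sigma> \<le> 1"
      thus "nrm (0 + \<sigma> *\<^sub>R e) \<le> nrm e \<and> I (0 + \<sigma> *\<^sub>R e) \<le> b0"
        using path[OF s] nrm_scale[OF e(1), of \<sigma>] nrm_nonneg[OF e(1)] by (simp add: mult_left_le_one_le)
    qed
    thus ?case by simp
  next
    case (Suc j)
    have "real j * h \<le> real J * h" using Suc.prems h by (intro mult_right_mono) auto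
    hence "(low_step \<eta> (nrm e + real j * h + h) (b0 - real j * \<kappa> - \<kappa>))\<^sup>*\<^sup>* 0 e"
      using Suc Jh \<kappa> by (intro down) auto
    thus ?case by (simp add: algebra_simps)
  qed
  from low_step_crossing[OF this[OF order_refl] e(2) \<eta>(2) r geo] have "\<alpha> \<le> b0 - real J * \<kappa>" by blast
  moreover have "b0 \<le> real J * \<kappa>" using J(1) \<kappa> by (simp add: field_simps)
  ultimately show False using \<alpha> by linarith
qed

end

section \<open>The energy space\<close>

lemma powr_add_le:
  fixes a b p :: real assumes "a \<ge> 0" "b \<ge> 0" "p \<ge> 0"
  shows "(a + b) powr p \<le> 2 powr p * (a powr p + b powr p)"
proof -
  have "(a + b) powr p \<le> (2 * max a b) powr p" using assms by (intro powr_mono2) auto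
  also have "\<dots> = 2 powr p * (max a b) powr p" using assms by (simp add: powr_mult)
  also have "\<dots> \<le> 2 powr p * (a powr p + b powr p)" by (intro mult_left_mono) (auto simp: max_def)
  finally show ?thesis .
qed

lemma borel_measurable_cnj [measurable (raw)]:
  "f \<in> borel_measurable M \<Longrightarrow> (\<lambda>x. cnj (f x)) \<in> borel_measurable M"
  by (rule borel_measurable_continuous_on[of cnj]) (auto intro: continuous_intros)

lemma integrable_mult_cnj:
  fixes f g :: "'a \<Rightarrow> complex"
  assumes [measurable]: "f \<in> borel_measurable M" "g \<in> borel_measurable M"
    and i: "integrable M (\<lambda>x. (cmod (f x))\<^sup>2)" "integrable M (\<lambda>x. (cmod (g x))\<^sup>2)"
  shows "integrable M (\<lambda>x. f x * cnj (g x))"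
proof (rule Bochner_Integration.integrable_bound)
  show "integrable M (\<lambda>x. (cmod (f x))\<^sup>2 + (cmod (g x))\<^sup>2)" using i by simp
  show "AE x in M. norm (f x * cnj (g x)) \<le> norm ((cmod (f x))\<^sup>2 + (cmod (g x))\<^sup>2)"
  proof (rule AE_I2)
    fix x
    have "0 \<le> (cmod (f x) - cmod (g x))\<^sup>2" by simp
    hence "2 * (cmod (f x) * cmod (g x)) \<le> (cmod (f x))\<^sup>2 + (cmod (g x))\<^sup>2" by (simp add: power2_eq_square algebra_simps)
    moreover have "0 \<le> cmod (f x) * cmod (g x)" by simp
    ultimately have "cmod (f x) * cmod (g x) \<le> (cmod (f x))\<^sup>2 + (cmod (g x))\<^sup>2" by linarith
    thus "norm (f x * cnj (g x)) \<le> norm ((cmod (f x))\<^sup>2 + (cmod (g x))\<^sup>2)" by (simp add: norm_mult)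
  qed
qed measurable

lemma cmod_add_sq_le: "(cmod (a + b))\<^sup>2 \<le> 2 * (cmod a)\<^sup>2 + 2 * (cmod b)\<^sup>2"
proof -
  have "(cmod (a + b))\<^sup>2 \<le> (cmod a + cmod b)\<^sup>2" by (intro power_mono norm_triangle_ineq) auto
  also have "\<dots> \<le> 2 * (cmod a)\<^sup>2 + 2 * (cmod b)\<^sup>2"
    using zero_le_power2[of "cmod a - cmod b"] by (simp add: power2_eq_square algebra_simps)
  finally show ?thesis .
qed

lemma integrable_cmod_add_sq:
  fixes f g :: "'a \<Rightarrow> complex"
  assumes [measurable]: "f \<in> borel_measurable M" "g \<in> borel_measurable M"
    and i: "integrable M (\<lambda>x. (cmod (f x))\<^sup>2)" "integrable M (\<lambda>x. (cmod (g x))\<^sup>2)"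
  shows "integrable M (\<lambda>x. (cmod (f x + g x))\<^sup>2)"
proof (rule Bochner_Integration.integrable_bound)
  show "integrable M (\<lambda>x. 2 * (cmod (f x))\<^sup>2 + 2 * (cmod (g x))\<^sup>2)" using i by simp
  show "AE x in M. norm ((cmod (f x + g x))\<^sup>2) \<le> norm (2 * (cmod (f x))\<^sup>2 + 2 * (cmod (g x))\<^sup>2)"
    using cmod_add_sq_le by (intro AE_I2) simp
qed measurable

lemma Re_mult_cnj_inner: "Re (a * cnj b) = a \<bullet> b"
  by (simp add: inner_complex_def)

definition magd :: "(real^'n \<Rightarrow> real^'n) \<Rightarrow> (real^'n \<Rightarrow> complex) \<Rightarrow> ((real^'n) \<times> (real^'n)) \<Rightarrow> complex" where
  "magd A u z = mag_diff A u (fst z) (snd z)"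

lemma measurable_magd [measurable]:
  assumes "continuous_on UNIV A" and [measurable]: "u \<in> borel_measurable borel"
  shows "magd A u \<in> borel_measurable (borel \<Otimes>\<^sub>M borel)"
proof -
  have "continuous_on UNIV (\<lambda>z. A ((1/2) *\<^sub>R (fst z + snd z)) \<bullet> (fst z - snd z) :: real)"
    by (intro continuous_intros continuous_on_compose2[OF assms(1), where f="\<lambda>z. (1/2) *\<^sub>R (fst z + snd z)"]) auto
  hence "continuous_on UNIV (\<lambda>z. cis (A ((1/2) *\<^sub>R (fst z + snd z)) \<bullet> (fst z - snd z)))"
    by (rule continuous_on_cis)
  hence [measurable]: "(\<lambda>z. cis (A ((1/2) *\<^sub>R (fst z + snd z)) \<bullet> (fst z - snd z))) \<in> borel_measurable (borel \<Otimes>\<^sub>M borel)"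
    unfolding borel_prod by (rule borel_measurable_continuous_onI)
  show ?thesis unfolding magd_def[abs_def] mag_diff_def by measurable
qed

lemma magd_add: "magd A (u + v) z = magd A u z + magd A v z"
  by (simp add: magd_def mag_diff_def algebra_simps)

lemma magd_scale: "magd A (c *\<^sub>R u) z = c *\<^sub>R magd A u z"
  by (simp add: magd_def mag_diff_def algebra_simps)

text \<open>The phase has modulus one, so this is the reverse triangle inequality; it lets the
  scalar Sobolev inequality act on |u|.\<close>

lemma magd_diamagnetic: "(cmod (u (fst z)) - cmod (u (snd z)))\<^sup>2 \<le> (cmod (magd A u z))\<^sup>2"
proof -
  have "\<bar>cmod (u (fst z)) - cmod (u (snd z))\<bar> \<le> cmod (magd A u z)"
    unfolding magd_def mag_diff_def using norm_triangle_ineq3[of "u (fst z)" "u (snd z) * cis (A ((1/2) *\<^sub>R (fst z + snd z)) \<bullet> (fst z - snd z))"]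
    by (simp add: norm_mult)
  from power_mono[OF this, of 2] show ?thesis by simp
qed

text \<open>Selected once as a function of the dimension and s, so that the bounds derived from it
  are the same for all potentials V and can be fixed before V is given.\<close>

definition sob_const :: "'a::euclidean_space itself \<Rightarrow> real \<Rightarrow> real" where
  "sob_const _ s = (SOME C. C > 0 \<and> (\<forall>w :: 'a \<Rightarrow> real. w \<in> borel_measurable borel \<longrightarrow> (\<forall>x. w x \<ge> 0) \<longrightarrow>
    integrable lborel (\<lambda>x. w x powr (sobolev_crit DIM('a) s)) \<longrightarrow>
    ennreal ((\<integral>x. w x powr (sobolev_crit DIM('a) s) \<partial>lborel) powr (2/sobolev_crit DIM('a) s)) \<le> ennreal C * (\<integral>\<^sup>+(x,y). ennreal ((w x - w y)\<^sup>2) \<partial>KM s)))"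

lemma sob_const:
  assumes s: "0 < s" and N: "2 * s < real DIM('a::euclidean_space)"
  shows "sob_const TYPE('a) s > 0"
    and "\<And>w :: 'a \<Rightarrow> real. w \<in> borel_measurable borel \<Longrightarrow> (\<And>x. w x \<ge> 0) \<Longrightarrow>
    integrable lborel (\<lambda>x. w x powr (sobolev_crit DIM('a) s)) \<Longrightarrow>
    ennreal ((\<integral>x. w x powr (sobolev_crit DIM('a) s) \<partial>lborel) powr (2/sobolev_crit DIM('a) s)) \<le> ennreal (sob_const TYPE('a) s) * (\<integral>\<^sup>+(x,y). ennreal ((w x - w y)\<^sup>2) \<partial>KM s)"
proof -
  have "\<exists>C. C > 0 \<and> (\<forall>w :: 'a \<Rightarrow> real. w \<in> borel_measurable borel \<longrightarrow> (\<forall>x. w x \<ge> 0) \<longrightarrow>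
    integrable lborel (\<lambda>x. w x powr (sobolev_crit DIM('a) s)) \<longrightarrow>
    ennreal ((\<integral>x. w x powr (sobolev_crit DIM('a) s) \<partial>lborel) powr (2/sobolev_crit DIM('a) s)) \<le> ennreal C * (\<integral>\<^sup>+(x,y). ennreal ((w x - w y)\<^sup>2) \<partial>KM s))"
    by (rule fractional_sobolev[OF s N sobolev_crit_def[of "DIM('a)" s]]) blast
  from someI_ex[OF this] show "sob_const TYPE('a) s > 0"
    and "\<And>w :: 'a \<Rightarrow> real. w \<in> borel_measurable borel \<Longrightarrow> (\<And>x. w x \<ge> 0) \<Longrightarrow>
    integrable lborel (\<lambda>x. w x powr (sobolev_crit DIM('a) s)) \<Longrightarrow>
    ennreal ((\<integral>x. w x powr (sobolev_crit DIM('a) s) \<partial>lborel) powr (2/sobolev_crit DIM('a) s)) \<le> ennreal (sob_const TYPE('a) s) * (\<integral>\<^sup>+(x,y). ennreal ((w x - w y)\<^sup>2) \<partial>KM s)"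
    unfolding sob_const_def by blast+
qed

locale mag_space =
  fixes s ps Cs :: real and A :: "real^'n \<Rightarrow> real^'n" and V :: "real^'n \<Rightarrow> real"
  assumes s: "0 < s" "s < 1" and N: "2 * s < real CARD('n)"
    and A: "continuous_on UNIV A" and V: "continuous_on UNIV V" and V0: "\<And>x. V x \<ge> 0"
    and ps_def: "ps = sobolev_crit CARD('n) s" and Cs_def: "Cs = sob_const TYPE(real^'n) s"
begin

abbreviation E where "E \<equiv> energy_space s A V"

lemma ps_gt_2: "ps > 2"
  using s N by (simp add: ps_def sobolev_crit_def field_simps)

lemma measurable_V [measurable]: "V \<in> borel_measurable borel"
  using V by (rule borel_measurable_continuous_onI)

lemmas measurable_magd' [measurable] = measurable_magd[OF A]

lemma seminorm_sq_eq: 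
  assumes [measurable]: "u \<in> borel_measurable borel"
  shows "mag_seminorm_sq s A u = (\<integral>\<^sup>+z. ennreal ((cmod (magd A u z))\<^sup>2) \<partial>KM s)"
proof -
  have "(\<integral>\<^sup>+z. ennreal ((cmod (magd A u z))\<^sup>2) \<partial>KM s) = (\<integral>\<^sup>+z. (case z of (x,y) \<Rightarrow> ennreal (1 / norm (x - y) powr (real CARD('n) + 2 * s))) * ennreal ((cmod (magd A u z))\<^sup>2) \<partial>(lborel \<Otimes>\<^sub>M lborel))"
    unfolding KM_def by (subst nn_integral_density) auto
  also have "\<dots> = mag_seminorm_sq s A u"
    unfolding mag_seminorm_sq_def by (intro nn_integral_cong) (auto simp: magd_def ennreal_mult[symmetric] split: prod.split)
  finally show ?thesis ..
qed

lemma E_iff: "u \<in> E \<longleftrightarrow> u \<in> borel_measurable borel \<and> integrable lborel (\<lambda>x. cmod (u x) powr ps)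
   \<and> integrable (KM s) (\<lambda>z. (cmod (magd A u z))\<^sup>2) \<and> integrable lborel (\<lambda>x. V x * (cmod (u x))\<^sup>2)"
proof -
  have "integrable (KM s) (\<lambda>z. (cmod (magd A u z))\<^sup>2) \<longleftrightarrow> mag_seminorm_sq s A u < \<infinity>" if [measurable]: "u \<in> borel_measurable borel"
    unfolding seminorm_sq_eq[OF that] by (subst integrable_iff_bounded) auto
  thus ?thesis by (auto simp: energy_space_def mag_sobolev_space_def ps_def)
qed

lemma E_D [dest]:
  assumes "u \<in> E"
  shows E_measurable: "u \<in> borel_measurable borel" and E_powr: "integrable lborel (\<lambda>x. cmod (u x) powr ps)"
    and E_magd: "integrable (KM s) (\<lambda>z. (cmod (magd A u z))\<^sup>2)" and E_V: "integrable lborel (\<lambda>x. V x * (cmod (u x))\<^sup>2)"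
  using assms by (auto simp: E_iff)

lemma E_sqrtV:
  assumes "u \<in> E" shows "integrable lborel (\<lambda>x. (cmod (of_real (sqrt (V x)) * u x))\<^sup>2)"
  using E_V[OF assms] V0 by (simp add: norm_mult power_mult_distrib)

lemma E_zero: "0 \<in> E"
  by (auto simp: E_iff magd_def mag_diff_def zero_fun_def)

lemma E_scale: "u \<in> E \<Longrightarrow> c *\<^sub>R u \<in> E"
  unfolding E_iff magd_scale by (auto simp: power_mult_distrib powr_mult mult.left_commute[of "V _"])
    (auto simp: scaleR_fun_def)

lemma E_add:
  assumes "u \<in> E" "v \<in> E" shows "u + v \<in> E"
proof -
  note [measurable] = E_measurable[OF assms(1)] E_measurable[OF assms(2)]
  have 1: "(\<lambda>x. u x + v x) \<in> borel_measurable borel" by measurable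
  have 2: "integrable lborel (\<lambda>x. cmod (u x + v x) powr ps)"
  proof (rule Bochner_Integration.integrable_bound)
    show "integrable lborel (\<lambda>x. 2 powr ps * (cmod (u x) powr ps + cmod (v x) powr ps))" using assms by auto
    show "AE x in lborel. norm (cmod (u x + v x) powr ps) \<le> norm (2 powr ps * (cmod (u x) powr ps + cmod (v x) powr ps))"
    proof (rule AE_I2)
      fix x
      have "cmod (u x + v x) powr ps \<le> (cmod (u x) + cmod (v x)) powr ps"
        using ps_gt_2 by (intro powr_mono2 norm_triangle_ineq) auto
      also have "\<dots> \<le> 2 powr ps * (cmod (u x) powr ps + cmod (v x) powr ps)"
        using ps_gt_2 by (intro powr_add_le) auto
      finally show "norm (cmod (u x + v x) powr ps) \<le> norm (2 powr ps * (cmod (u x) powr ps + cmod (v x) powr ps))" by simp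
    qed
  qed measurable
  have 3: "integrable (KM s) (\<lambda>z. (cmod (magd A (u + v) z))\<^sup>2)"
    unfolding magd_add using assms by (intro integrable_cmod_add_sq) (auto simp: measurable_KM_borel_eq)
  have "integrable lborel (\<lambda>x. (cmod (of_real (sqrt (V x)) * u x + of_real (sqrt (V x)) * v x))\<^sup>2)"
    using E_sqrtV assms by (intro integrable_cmod_add_sq) auto
  hence 4: "integrable lborel (\<lambda>x. V x * (cmod (u x + v x))\<^sup>2)"
    using V0 by (simp add: norm_mult power_mult_distrib distrib_left[symmetric])
  show ?thesis using 1 2 3 4 by (simp add: E_iff plus_fun_def)
qed

lemma E_diff: "u \<in> E \<Longrightarrow> v \<in> E \<Longrightarrow> u - v \<in> E"
  using E_add[of u "(-1) *\<^sub>R v"] E_scale[of v "-1"] by simp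

text \<open>The weak formulation takes real parts, so E is used as a real space: the inner product
  of the complex plane as a real plane stands for Re(a cnj b), and \<open>ip_eq\<close> connects
  this with \<open>mag_form\<close>.\<close>

definition ip :: "(real^'n \<Rightarrow> complex) \<Rightarrow> (real^'n \<Rightarrow> complex) \<Rightarrow> real" where
  "ip u v = (\<integral>z. magd A u z \<bullet> magd A v z \<partial>KM s) + (\<integral>x. V x * (u x \<bullet> v x) \<partial>lborel)"

lemma magd_integrable:
  assumes "u \<in> E" "v \<in> E" shows "integrable (KM s) (\<lambda>z. magd A u z * cnj (magd A v z))"
  using assms by (intro integrable_mult_cnj) (auto simp: measurable_KM_borel_eq)

lemma magd_integrable_inner:
  assumes "u \<in> E" "v \<in> E" shows "integrable (KM s) (\<lambda>z. magd A u z \<bullet> magd A v z)"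
  using integrable_Re[OF magd_integrable[OF assms]] by (simp only: Re_mult_cnj_inner)

lemma V_integrable:
  assumes "u \<in> E" "v \<in> E" shows "integrable lborel (\<lambda>x. of_real (V x) * u x * cnj (v x))"
proof -
  note [measurable] = E_measurable[OF assms(1)] E_measurable[OF assms(2)]
  have "integrable lborel (\<lambda>x. (of_real (sqrt (V x)) * u x) * cnj (of_real (sqrt (V x)) * v x))"
    using E_sqrtV assms by (intro integrable_mult_cnj) auto
  moreover have "(of_real (sqrt (V x)) * u x) * cnj (of_real (sqrt (V x)) * v x) = of_real (V x) * u x * cnj (v x)" for x
  proof -
    have "complex_of_real (sqrt (V x)) * complex_of_real (sqrt (V x)) = of_real (V x)"
      using V0 by (simp flip: of_real_mult)
    moreover have "(of_real (sqrt (V x)) * u x) * cnj (of_real (sqrt (V x)) * v x)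
      = (complex_of_real (sqrt (V x)) * complex_of_real (sqrt (V x))) * u x * cnj (v x)" by simp
    ultimately show ?thesis by (simp only:)
  qed
  ultimately show ?thesis by (simp only:)
qed

lemma Re_V: "Re (of_real (V x) * u x * cnj (v x)) = V x * (u x \<bullet> v x)"
  by (simp add: inner_complex_def algebra_simps)

lemma V_integrable_inner:
  assumes "u \<in> E" "v \<in> E" shows "integrable lborel (\<lambda>x. V x * (u x \<bullet> v x))"
  using integrable_Re[OF V_integrable[OF assms]] by (simp only: Re_V)

lemma ip_eq:
  assumes "u \<in> E" "v \<in> E"
  shows "ip u v = Re (mag_form s A u v) + Re (\<integral>x. of_real (V x) * u x * cnj (v x) \<partial>lborel)"
proof -
  note [measurable] = E_measurable[OF assms(1)] E_measurable[OF assms(2)]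
  have "mag_form s A u v = (\<integral>z. magd A u z * cnj (magd A v z) \<partial>KM s)"
  proof -
    have "(KM s :: ((real^'n) \<times> (real^'n)) measure) = density (lborel \<Otimes>\<^sub>M lborel) (\<lambda>z. ennreal (1 / norm (fst z - snd z) powr (real CARD('n) + 2 * s)))"
      by (simp add: KM_def split_def)
    hence "(\<integral>z. magd A u z * cnj (magd A v z) \<partial>KM s) = (\<integral>z. (1 / norm (fst z - snd z) powr (real CARD('n) + 2 * s)) *\<^sub>R (magd A u z * cnj (magd A v z)) \<partial>(lborel \<Otimes>\<^sub>M lborel))"
      by (simp only:) (subst integral_density, auto)
    also have "\<dots> = mag_form s A u v"
      unfolding mag_form_def by (intro Bochner_Integration.integral_cong refl) (auto simp: magd_def scaleR_conv_of_real split: prod.split)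
    finally show ?thesis ..
  qed
  moreover have "Re (\<integral>z. magd A u z * cnj (magd A v z) \<partial>KM s) = (\<integral>z. magd A u z \<bullet> magd A v z \<partial>KM s)"
    using magd_integrable[OF assms] by (simp only: integral_Re[symmetric] Re_mult_cnj_inner)
  moreover have "Re (\<integral>x. of_real (V x) * u x * cnj (v x) \<partial>lborel) = (\<integral>x. V x * (u x \<bullet> v x) \<partial>lborel)"
    using V_integrable[OF assms] by (simp only: integral_Re[symmetric] Re_V)
  ultimately show ?thesis by (simp add: ip_def)
qed

lemma ip_sym: "ip u v = ip v u"
  unfolding ip_def by (simp add: inner_commute)

lemma ip_add: assumes "u \<in> E" "v \<in> E" "w \<in> E" shows "ip u (v + w) = ip u v + ip u w"
  unfolding ip_def magd_add plus_fun_apply inner_add_right distrib_left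
  using assms by (simp add: magd_integrable_inner V_integrable_inner)

lemma ip_scale: "ip u (c *\<^sub>R v) = c * ip u v"
  unfolding ip_def magd_scale scaleR_fun_apply inner_scaleR_right
  by (simp add: mult.left_commute[of "V _"] distrib_left)

lemma ip_self: "ip u u = (\<integral>z. (cmod (magd A u z))\<^sup>2 \<partial>KM s) + (\<integral>x. V x * (cmod (u x))\<^sup>2 \<partial>lborel)"
  unfolding ip_def power2_norm_eq_inner ..

lemma ip_self_nonneg: "ip u u \<ge> 0"
  unfolding ip_self using V0 by (intro add_nonneg_nonneg integral_nonneg_AE AE_I2) auto

definition nrm where "nrm u = sqrt (ip u u)"

lemma nrm_nonneg [simp]: "nrm u \<ge> 0" by (simp add: nrm_def ip_self_nonneg)

lemma nrm_sq: "(nrm u)\<^sup>2 = ip u u" by (simp add: nrm_def ip_self_nonneg)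

lemma nrm_scale: "nrm (c *\<^sub>R u) = \<bar>c\<bar> * nrm u"
proof -
  have "ip (c *\<^sub>R u) (c *\<^sub>R u) = c\<^sup>2 * ip u u" by (simp add: ip_scale ip_sym[of "c *\<^sub>R u"] power2_eq_square)
  thus ?thesis by (simp add: nrm_def real_sqrt_mult)
qed

lemma ip_expand: assumes "u \<in> E" "v \<in> E" shows "ip (u + v) (u + v) = ip u u + 2 * ip u v + ip v v"
  using ip_add[OF E_add[OF assms] assms] ip_add[OF assms(1) assms] ip_add[OF assms(2) assms]
    ip_sym[of "u + v" u] ip_sym[of "u + v" v] ip_sym[of v u] by linarith

lemma ip_CS: assumes "u \<in> E" "v \<in> E" shows "\<bar>ip u v\<bar> \<le> nrm u * nrm v"
proof -
  have q: "0 \<le> ip u u + 2 * t * ip u v + t\<^sup>2 * ip v v" for t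
  proof -
    have "0 \<le> ip (u + t *\<^sub>R v) (u + t *\<^sub>R v)" by (rule ip_self_nonneg)
    thus ?thesis using ip_expand[OF assms(1) E_scale[OF assms(2)], of t]
      by (simp add: ip_scale ip_sym[of "t *\<^sub>R v"] power2_eq_square)
  qed
  have "(ip u v)\<^sup>2 \<le> ip u u * ip v v"
  proof (cases "ip v v = 0")
    case True
    have "ip u v = 0"
    proof (rule ccontr)
      assume n: "ip u v \<noteq> 0"
      \<comment> \<open>A degenerate direction v: the quadratic in t is then affine, and this t
        gives it the value -1.\<close>
      have "0 \<le> ip u u + 2 * (- (ip u u + 1) / (2 * ip u v)) * ip u v" using q[of "- (ip u u + 1) / (2 * ip u v)"] True by simp
      also have "\<dots> = -1" using n by (simp add: field_simps)
      finally show False by simp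
    qed
    thus ?thesis using True by simp
  next
    case False
    hence p: "ip v v > 0" using ip_self_nonneg[of v] by simp
    have "0 \<le> ip u u + 2 * (- ip u v / ip v v) * ip u v + (- ip u v / ip v v)\<^sup>2 * ip v v" by (rule q)
    also have "\<dots> = ip u u - (ip u v)\<^sup>2 / ip v v" using p by (simp add: power2_eq_square)
    finally show ?thesis using p by (simp add: pos_divide_le_eq)
  qed
  from real_sqrt_le_mono[OF this] show ?thesis by (simp add: nrm_def real_sqrt_mult)
qed

lemma nrm_triangle: assumes "u \<in> E" "v \<in> E" shows "nrm (u + v) \<le> nrm u + nrm v"
proof -
  have "(nrm (u + v))\<^sup>2 \<le> (nrm u + nrm v)\<^sup>2"
  proof -
    have "(nrm (u + v))\<^sup>2 = ip u u + 2 * ip u v + ip v v" using ip_expand[OF assms] by (simp add: nrm_sq)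
    moreover have "(nrm u + nrm v)\<^sup>2 = ip u u + ip v v + 2 * (nrm u * nrm v)" by (simp add: power2_sum nrm_sq)
    ultimately show ?thesis using ip_CS[OF assms] by linarith
  qed
  thus ?thesis by (rule power2_le_imp_le) simp
qed

lemma Cs_pos: "Cs > 0" unfolding Cs_def by (rule sob_const) (use s N in auto)

lemma sobolev_real:
  fixes w :: "real^'n \<Rightarrow> real"
  assumes [measurable]: "w \<in> borel_measurable borel" and "\<And>x. w x \<ge> 0" "integrable lborel (\<lambda>x. w x powr ps)"
    and i: "integrable (KM s) (\<lambda>z. (w (fst z) - w (snd z))\<^sup>2)"
  shows "(\<integral>x. w x powr ps \<partial>lborel) \<le> (Cs * (\<integral>z. (w (fst z) - w (snd z))\<^sup>2 \<partial>KM s)) powr (ps/2)"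
proof -
  let ?S = "\<integral>x. w x powr ps \<partial>lborel"
  have S0: "?S \<ge> 0" by (intro integral_nonneg_AE) auto
  have "ennreal (?S powr (2/ps)) \<le> ennreal Cs * (\<integral>\<^sup>+(x,y). ennreal ((w x - w y)\<^sup>2) \<partial>KM s)"
    using sob_const(2)[of s w] assms s N by (simp add: ps_def Cs_def)
  also have "(\<integral>\<^sup>+(x,y). ennreal ((w x - w y)\<^sup>2) \<partial>KM s) = ennreal (\<integral>z. (w (fst z) - w (snd z))\<^sup>2 \<partial>KM s)"
    using i by (subst nn_integral_eq_integral[symmetric]) (auto simp: split_def)
  also have "ennreal Cs * \<dots> = ennreal (Cs * (\<integral>z. (w (fst z) - w (snd z))\<^sup>2 \<partial>KM s))"
    using Cs_pos by (simp add: ennreal_mult)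
  finally have "?S powr (2/ps) \<le> Cs * (\<integral>z. (w (fst z) - w (snd z))\<^sup>2 \<partial>KM s)"
    using Cs_pos by (subst (asm) ennreal_le_iff) (auto intro!: mult_nonneg_nonneg integral_nonneg_AE)
  hence "(?S powr (2/ps)) powr (ps/2) \<le> (Cs * (\<integral>z. (w (fst z) - w (snd z))\<^sup>2 \<partial>KM s)) powr (ps/2)"
    using ps_gt_2 by (intro powr_mono2) auto
  thus ?thesis using S0 ps_gt_2 by (simp add: powr_powr)
qed

lemma diamagnetic_integrable:
  assumes "u \<in> E"
  shows "integrable (KM s) (\<lambda>z. (cmod (u (fst z)) - cmod (u (snd z)))\<^sup>2)"
    and "(\<integral>z. (cmod (u (fst z)) - cmod (u (snd z)))\<^sup>2 \<partial>KM s) \<le> (nrm u)\<^sup>2"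
proof -
  note [measurable] = E_measurable[OF assms(1)]
  show 1: "integrable (KM s) (\<lambda>z. (cmod (u (fst z)) - cmod (u (snd z)))\<^sup>2)"
    by (rule Bochner_Integration.integrable_bound[OF E_magd[OF assms]]) (auto simp: measurable_KM_borel_eq magd_diamagnetic)
  have "(\<integral>z. (cmod (u (fst z)) - cmod (u (snd z)))\<^sup>2 \<partial>KM s) \<le> (\<integral>z. (cmod (magd A u z))\<^sup>2 \<partial>KM s)"
    by (rule integral_mono[OF 1 E_magd[OF assms] magd_diamagnetic])
  also have "\<dots> \<le> (nrm u)\<^sup>2" unfolding nrm_sq ip_self using V0 by (simp add: integral_nonneg_AE)
  finally show "(\<integral>z. (cmod (u (fst z)) - cmod (u (snd z)))\<^sup>2 \<partial>KM s) \<le> (nrm u)\<^sup>2" .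
qed

lemma sobolev_nrm:
  assumes "u \<in> E"
  shows "(\<integral>x. cmod (u x) powr ps \<partial>lborel) \<le> (Cs * (nrm u)\<^sup>2) powr (ps/2)"
proof -
  note [measurable] = E_measurable[OF assms(1)]
  have "(\<integral>x. cmod (u x) powr ps \<partial>lborel) \<le> (Cs * (\<integral>z. (cmod (u (fst z)) - cmod (u (snd z)))\<^sup>2 \<partial>KM s)) powr (ps/2)"
    using assms diamagnetic_integrable by (intro sobolev_real) auto
  also have "\<dots> \<le> (Cs * (nrm u)\<^sup>2) powr (ps/2)"
    using assms diamagnetic_integrable(2) Cs_pos ps_gt_2 by (intro powr_mono2 mult_left_mono mult_nonneg_nonneg integral_nonneg_AE) auto
  finally show ?thesis .
qed

end

section \<open>Weak limits and local compactness\<close>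

text \<open>The device behind the Brezis-Lieb lemma: the positive part of a_n - \<delta> e_n is
  dominated by \<Psi> and tends to 0 in mean, while \<delta> e_n contributes at most \<delta> C. It
  serves as a substitute for uniform integrability.\<close>

lemma integral_tendsto_zero_uniform:
  fixes a e :: "nat \<Rightarrow> 'a \<Rightarrow> real"
  assumes [measurable]: "\<And>n. a n \<in> borel_measurable M" and a0: "\<And>n x. a n x \<ge> 0" and e0: "\<And>n x. e n x \<ge> 0"
    and ei: "\<And>n. integrable M (e n)" and eC: "\<And>n. (\<integral>x. e n x \<partial>M) \<le> C"
    and lim: "AE x in M. (\<lambda>n. a n x) \<longlonglongrightarrow> 0"
    and bound: "\<And>\<delta>. \<delta> > 0 \<Longrightarrow> \<exists>\<Psi>. integrable M \<Psi> \<and> (\<forall>n x. a n x \<le> \<delta> * e n x + \<Psi> x)"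
  shows "integrable M (a n)" "(\<lambda>n. \<integral>x. a n x \<partial>M) \<longlonglongrightarrow> 0"
proof -
  have [measurable]: "e n \<in> borel_measurable M" for n using ei by auto
  show ai: "integrable M (a n)" for n
  proof -
    obtain \<Psi> where P: "integrable M \<Psi>" "\<forall>n x. a n x \<le> 1 * e n x + \<Psi> x" using bound[of 1] by auto
    show ?thesis
    proof (rule Bochner_Integration.integrable_bound)
      show "integrable M (\<lambda>x. e n x + \<Psi> x)" using P(1) ei by simp
      show "AE x in M. norm (a n x) \<le> norm (e n x + \<Psi> x)"
      proof (rule AE_I2)
        fix x
        have "a n x \<le> 1 * e n x + \<Psi> x" using P(2) by blast
        thus "norm (a n x) \<le> norm (e n x + \<Psi> x)" using a0[of n x] by simp
      qed
    qed simp
  qed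
  have C0: "C \<ge> 0" by (rule order_trans[OF Bochner_Integration.integral_nonneg[OF e0] eC[of 0]])
  show "(\<lambda>n. \<integral>x. a n x \<partial>M) \<longlonglongrightarrow> 0"
  proof (rule LIMSEQ_I)
    fix \<epsilon> :: real assume \<epsilon>: "\<epsilon> > 0"
    define \<delta> where "\<delta> = \<epsilon> / (2 * (C + 1))"
    have \<delta>: "\<delta> > 0" "\<delta> * C \<le> \<epsilon>/2" using \<epsilon> C0 by (auto simp: \<delta>_def field_simps)
    obtain \<Psi> where P: "integrable M \<Psi>" "\<And>n x. a n x \<le> \<delta> * e n x + \<Psi> x" using bound[OF \<delta>(1)] by auto
    have [measurable]: "\<Psi> \<in> borel_measurable M" using P by auto
    define g where "g n x = max 0 (a n x - \<delta> * e n x)" for n x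
    have [measurable]: "g n \<in> borel_measurable M" for n unfolding g_def[abs_def] by measurable
    have gi: "(\<lambda>n. \<integral>x. g n x \<partial>M) \<longlonglongrightarrow> (\<integral>x. 0 \<partial>M)"
    proof (rule integral_dominated_convergence)
      show "integrable M (\<lambda>x. \<bar>\<Psi> x\<bar>)" using P by simp
      show "AE x in M. (\<lambda>n. g n x) \<longlonglongrightarrow> 0" using lim
      proof eventually_elim
        case (elim x)
        show ?case
        proof (rule tendsto_sandwich[OF _ _ tendsto_const elim])
          have "0 \<le> g n x \<and> g n x \<le> a n x" for n using a0[of n x] e0[of n x] \<delta> by (simp add: g_def)
          thus "\<forall>\<^sub>F n in sequentially. 0 \<le> g n x" "\<forall>\<^sub>F n in sequentially. g n x \<le> a n x" by (auto intro!: always_eventually)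
        qed
      qed
      show "AE x in M. norm (g n x) \<le> \<bar>\<Psi> x\<bar>" for n
      proof (rule AE_I2)
        fix x
        have "g n x \<le> \<bar>\<Psi> x\<bar>" "g n x \<ge> 0" using P(2)[of n x] by (auto simp: g_def)
        thus "norm (g n x) \<le> \<bar>\<Psi> x\<bar>" by simp
      qed
    qed measurable
    have g_int: "integrable M (g n)" for n
    proof (rule Bochner_Integration.integrable_bound[OF ai[of n]])
      have "0 \<le> g n x \<and> g n x \<le> a n x" for x using a0[of n x] e0[of n x] \<delta> by (simp add: g_def)
      thus "AE x in M. norm (g n x) \<le> norm (a n x)" using a0 by (intro AE_I2) simp
    qed measurable
    obtain n0 where n0: "\<And>n. n \<ge> n0 \<Longrightarrow> norm ((\<integral>x. g n x \<partial>M) - 0) < \<epsilon>/2"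
      using LIMSEQ_D[OF gi, of "\<epsilon>/2"] \<epsilon> by auto
    have "norm ((\<integral>x. a n x \<partial>M) - 0) < \<epsilon>" if "n \<ge> n0" for n
    proof -
      have "(\<integral>x. a n x \<partial>M) \<le> (\<integral>x. g n x + \<delta> * e n x \<partial>M)"
        using g_int ei ai by (intro integral_mono) (auto simp: g_def)
      also have "\<dots> = (\<integral>x. g n x \<partial>M) + \<delta> * (\<integral>x. e n x \<partial>M)" using g_int ei by simp
      also have "\<dots> \<le> (\<integral>x. g n x \<partial>M) + \<delta> * C" using eC \<delta> by (intro add_left_mono mult_left_mono) auto
      also have "\<dots> < \<epsilon>" using n0[OF that] \<delta> by (simp add: abs_less_iff)
      finally show ?thesis using a0 by (simp add: integral_nonneg_AE)
    qed
    thus "\<exists>no. \<forall>n\<ge>no. norm ((\<integral>x. a n x \<partial>M) - 0) < \<epsilon>" by blast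
  qed
qed

lemma fatou_integrable:
  fixes f :: "nat \<Rightarrow> 'a \<Rightarrow> real"
  assumes fi: "\<And>n. integrable M (f n)" and f0: "\<And>n x. f n x \<ge> 0" and C: "\<And>n. (\<integral>x. f n x \<partial>M) \<le> C"
    and lim: "AE x in M. (\<lambda>n. f n x) \<longlonglongrightarrow> g x" and [measurable]: "g \<in> borel_measurable M" and g0: "\<And>x. g x \<ge> 0"
  shows "integrable M g" "(\<integral>x. g x \<partial>M) \<le> C"
proof -
  have C0: "C \<ge> 0" by (rule order_trans[OF Bochner_Integration.integral_nonneg[OF f0] C[of 0]])
  have [measurable]: "f n \<in> borel_measurable M" for n using fi by auto
  have "(\<integral>\<^sup>+x. ennreal (g x) \<partial>M) = (\<integral>\<^sup>+x. liminf (\<lambda>n. ennreal (f n x)) \<partial>M)"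
    using lim
  proof (intro nn_integral_cong_AE, eventually_elim)
    case (elim x)
    have "(\<lambda>n. ennreal (f n x)) \<longlonglongrightarrow> ennreal (g x)" using elim(2) by (rule tendsto_ennrealI)
    from lim_imp_Liminf[OF sequentially_bot this] show ?case by simp
  qed
  also have "\<dots> \<le> liminf (\<lambda>n. \<integral>\<^sup>+x. ennreal (f n x) \<partial>M)" by (rule nn_integral_liminf) measurable
  also have "\<dots> \<le> ennreal C"
  proof -
    have "(\<integral>\<^sup>+x. ennreal (f n x) \<partial>M) \<le> ennreal C" for n
      using fi f0 C by (subst nn_integral_eq_integral) (auto intro!: ennreal_leI)
    hence "liminf (\<lambda>n. \<integral>\<^sup>+x. ennreal (f n x) \<partial>M) \<le> liminf (\<lambda>n::nat. ennreal C)"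
      by (intro Liminf_mono always_eventually allI)
    thus ?thesis by (simp add: Liminf_const)
  qed
  finally have *: "(\<integral>\<^sup>+x. ennreal (g x) \<partial>M) \<le> ennreal C" .
  show gi: "integrable M g" using * g0 by (intro integrableI_nonneg) (auto simp: le_less_trans)
  show "(\<integral>x. g x \<partial>M) \<le> C"
    using * g0 C0 by (subst (asm) nn_integral_eq_integral[OF gi]) (auto simp: ennreal_le_iff)
qed

text \<open>A bounded sequence in L2 that converges a.e. converges weakly. The pairing of f_n - g
  with \<phi> is split by ab \<le> \<delta> a^2 + b^2/\<delta>, which is the domination required by
  \<open>integral_tendsto_zero_uniform\<close>; no weak compactness enters.\<close>

lemma L2_weak_limit:
  fixes f :: "nat \<Rightarrow> 'a \<Rightarrow> 'b::{euclidean_space}"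
  assumes [measurable]: "\<And>n. f n \<in> borel_measurable M" "g \<in> borel_measurable M" "\<phi> \<in> borel_measurable M"
    and fi: "\<And>n. integrable M (\<lambda>x. (norm (f n x))\<^sup>2)" and C: "\<And>n. (\<integral>x. (norm (f n x))\<^sup>2 \<partial>M) \<le> C"
    and lim: "AE x in M. (\<lambda>n. f n x) \<longlonglongrightarrow> g x" and \<phi>: "integrable M (\<lambda>x. (norm (\<phi> x))\<^sup>2)"
  shows "integrable M (\<lambda>x. (norm (g x))\<^sup>2)" "(\<integral>x. (norm (g x))\<^sup>2 \<partial>M) \<le> C"
    and "(\<lambda>n. \<integral>x. f n x \<bullet> \<phi> x \<partial>M) \<longlonglongrightarrow> (\<integral>x. g x \<bullet> \<phi> x \<partial>M)"
proof -
  have lim2: "AE x in M. (\<lambda>n. (norm (f n x))\<^sup>2) \<longlonglongrightarrow> (norm (g x))\<^sup>2"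
    using lim by eventually_elim (intro tendsto_intros)
  show gi: "integrable M (\<lambda>x. (norm (g x))\<^sup>2)" and gC: "(\<integral>x. (norm (g x))\<^sup>2 \<partial>M) \<le> C"
    by (rule fatou_integrable[OF fi _ C lim2]; simp)+
  have sq: "(norm (a - b))\<^sup>2 \<le> 2 * (norm a)\<^sup>2 + 2 * (norm b)\<^sup>2" for a b :: 'b
  proof -
    have "(norm (a - b))\<^sup>2 \<le> (norm a + norm b)\<^sup>2" by (intro power_mono norm_triangle_ineq4) auto
    also have "\<dots> \<le> 2 * (norm a)\<^sup>2 + 2 * (norm b)\<^sup>2"
      using zero_le_power2[of "norm a - norm b"] by (simp add: power2_eq_square algebra_simps)
    finally show ?thesis .
  qed
  have ii: "integrable M (\<lambda>x. (norm (f n x - g x))\<^sup>2)" for n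
    by (rule Bochner_Integration.integrable_bound[of M "\<lambda>x. 2 * (norm (f n x))\<^sup>2 + 2 * (norm (g x))\<^sup>2"])
       (use fi gi sq in \<open>auto intro!: AE_I2\<close>)
  have iC: "(\<integral>x. (norm (f n x - g x))\<^sup>2 \<partial>M) \<le> 4 * C" for n
  proof -
    have "(\<integral>x. (norm (f n x - g x))\<^sup>2 \<partial>M) \<le> (\<integral>x. 2 * (norm (f n x))\<^sup>2 + 2 * (norm (g x))\<^sup>2 \<partial>M)"
      using ii fi gi sq by (intro integral_mono) auto
    also have "\<dots> \<le> 4 * C" using fi gi C[of n] gC by simp
    finally show ?thesis .
  qed
  have yng: "a * b \<le> \<delta> * a\<^sup>2 + b\<^sup>2 / \<delta>" if "\<delta> > 0" "a \<ge> 0" "b \<ge> 0" for \<delta> a b :: real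
  proof (cases "b \<le> \<delta> * a")
    case True
    hence "a * b \<le> a * (\<delta> * a)" using that by (intro mult_left_mono) auto
    thus ?thesis using that by (simp add: power2_eq_square mult_ac add_increasing2)
  next
    case False
    hence "a \<le> b / \<delta>" using that by (simp add: field_simps)
    hence "a * b \<le> b / \<delta> * b" using that by (intro mult_right_mono) auto
    moreover have "\<delta> * a\<^sup>2 \<ge> 0" using that by simp
    ultimately show ?thesis by (simp add: power2_eq_square)
  qed
  have T: "(\<lambda>n. \<integral>x. norm (f n x - g x) * norm (\<phi> x) \<partial>M) \<longlonglongrightarrow> 0"
    and Ti: "integrable M (\<lambda>x. norm (f n x - g x) * norm (\<phi> x))" for n
  proof -
    have lim3: "AE x in M. (\<lambda>n. norm (f n x - g x) * norm (\<phi> x)) \<longlonglongrightarrow> 0"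
      using lim
    proof eventually_elim
      case (elim x)
      have "(\<lambda>n. norm (f n x - g x) * norm (\<phi> x)) \<longlonglongrightarrow> norm (g x - g x) * norm (\<phi> x)"
        using elim by (intro tendsto_intros)
      thus ?case by simp
    qed
    have bd: "\<exists>\<Psi>. integrable M \<Psi> \<and> (\<forall>n x. norm (f n x - g x) * norm (\<phi> x) \<le> \<delta> * (norm (f n x - g x))\<^sup>2 + \<Psi> x)" if "\<delta> > 0" for \<delta>
      using \<phi> that yng by (intro exI[of _ "\<lambda>x. (norm (\<phi> x))\<^sup>2 / \<delta>"]) auto
    show "(\<lambda>n. \<integral>x. norm (f n x - g x) * norm (\<phi> x) \<partial>M) \<longlonglongrightarrow> 0"
      "integrable M (\<lambda>x. norm (f n x - g x) * norm (\<phi> x))" for n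
      by (rule integral_tendsto_zero_uniform[OF _ _ _ ii iC lim3 bd]; auto)+
  qed
  have inner_int: "integrable M (\<lambda>x. h x \<bullet> \<phi> x)" if [measurable]: "h \<in> borel_measurable M" and h: "integrable M (\<lambda>x. (norm (h x))\<^sup>2)" for h
  proof (rule Bochner_Integration.integrable_bound[of M "\<lambda>x. (norm (h x))\<^sup>2 + (norm (\<phi> x))\<^sup>2"])
    show "AE x in M. norm (h x \<bullet> \<phi> x) \<le> norm ((norm (h x))\<^sup>2 + (norm (\<phi> x))\<^sup>2)"
    proof (rule AE_I2)
      fix x
      have "\<bar>h x \<bullet> \<phi> x\<bar> \<le> norm (h x) * norm (\<phi> x)" by (rule Cauchy_Schwarz_ineq2)
      also have "\<dots> \<le> (norm (h x))\<^sup>2 + (norm (\<phi> x))\<^sup>2" using yng[of 1 "norm (h x)" "norm (\<phi> x)"] by simp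
      finally show "norm (h x \<bullet> \<phi> x) \<le> norm ((norm (h x))\<^sup>2 + (norm (\<phi> x))\<^sup>2)" by simp
    qed
  qed (use h \<phi> in auto)
  show "(\<lambda>n. \<integral>x. f n x \<bullet> \<phi> x \<partial>M) \<longlonglongrightarrow> (\<integral>x. g x \<bullet> \<phi> x \<partial>M)"
  proof (rule LIM_zero_cancel, rule Lim_null_comparison[OF always_eventually T], rule allI)
    fix n
    have "(\<integral>x. f n x \<bullet> \<phi> x \<partial>M) - (\<integral>x. g x \<bullet> \<phi> x \<partial>M) = (\<integral>x. (f n x - g x) \<bullet> \<phi> x \<partial>M)"
      using inner_int[OF _ fi] inner_int[OF _ gi] by (simp add: inner_diff_left)
    also have "norm \<dots> \<le> (\<integral>x. norm (f n x - g x) * norm (\<phi> x) \<partial>M)"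
    proof (rule order_trans[OF integral_norm_bound], rule integral_mono)
      have "integrable M (\<lambda>x. (f n x - g x) \<bullet> \<phi> x)" by (rule inner_int[OF _ ii]) measurable
      thus "integrable M (\<lambda>x. norm ((f n x - g x) \<bullet> \<phi> x))" by simp
    qed (use Ti[of n] in \<open>auto simp: Cauchy_Schwarz_ineq2\<close>)
    finally show "norm ((\<integral>x. f n x \<bullet> \<phi> x \<partial>M) - (\<integral>x. g x \<bullet> \<phi> x \<partial>M)) \<le> (\<integral>x. norm (f n x - g x) * norm (\<phi> x) \<partial>M)" .
  qed
qed

text \<open>Young's inequality with a small weight on the second factor, by comparing a with
  \<epsilon> b^(p-1): either the product is at most \<epsilon> b^p, or b is controlled by a power of
  a/\<epsilon>.\<close>

lemma young_small:
  fixes p \<epsilon> :: real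
  assumes p: "p > 1" and \<epsilon>: "\<epsilon> > 0"
  shows "\<exists>K\<ge>0. \<forall>a\<ge>0. \<forall>b\<ge>0. a * b \<le> K * a powr (p/(p-1)) + \<epsilon> * b powr p"
proof (intro exI[of _ "(1/\<epsilon>) powr (1/(p-1))"] conjI allI impI)
  fix a b :: real assume a: "a \<ge> 0" and b: "b \<ge> 0"
  show "a * b \<le> (1/\<epsilon>) powr (1/(p-1)) * a powr (p/(p-1)) + \<epsilon> * b powr p"
  proof (cases "a \<le> \<epsilon> * b powr (p-1)")
    case True
    hence "a * b \<le> \<epsilon> * b powr (p-1) * b" using b by (intro mult_right_mono) auto
    also have "\<dots> = \<epsilon> * b powr p" using b powr_mult_base[of b "p-1"] by (simp add: mult_ac)
    finally show ?thesis by (simp add: add_increasing)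
  next
    case False
    have "b powr (p-1) \<le> a / \<epsilon>" using False \<epsilon> by (simp add: field_simps)
    hence "(b powr (p-1)) powr (1/(p-1)) \<le> (a/\<epsilon>) powr (1/(p-1))" using p by (intro powr_mono2) auto
    hence "b \<le> (a/\<epsilon>) powr (1/(p-1))" using p b by (simp add: powr_powr)
    hence "a * b \<le> a * (a/\<epsilon>) powr (1/(p-1))" using a by (intro mult_left_mono)
    also have "\<dots> = (1/\<epsilon>) powr (1/(p-1)) * (a * a powr (1/(p-1)))" using a \<epsilon> by (simp add: powr_divide)
    also have "a * a powr (1/(p-1)) = a powr (p/(p-1))"
    proof -
      have "1 + 1/(p-1) = p/(p-1)" using p by (simp add: field_simps)
      thus ?thesis using a powr_mult_base[of a "1/(p-1)"] by simp
    qed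
    finally show ?thesis using \<epsilon> by (simp add: add_increasing2)
  qed
qed simp

section \<open>Partition of space into cubes of side h\<close>

definition cell :: "real \<Rightarrow> real^'n \<Rightarrow> 'n \<Rightarrow> int" where
  "cell h x = (\<lambda>i. \<lfloor>x $ i / h\<rfloor>)"

lemma cell_vimage_eq:
  fixes c :: "'n::finite \<Rightarrow> int"
  assumes "h > 0"
  shows "{y :: real^'n. cell h y = c} = (\<Inter>i. {y. of_int (c i) * h \<le> y $ i \<and> y $ i < of_int (c i) * h + h})"
  using assms by (auto simp: cell_def fun_eq_iff floor_eq_iff field_simps)

lemma sets_cell [measurable]:
  assumes "h > 0" shows "{y :: real^'n. cell h y = c} \<in> sets borel"
proof -
  have "{y :: real^'n. of_int (c i) * h \<le> y $ i \<and> y $ i < of_int (c i) * h + h} \<in> sets borel" for i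
    by measurable
  thus ?thesis unfolding cell_vimage_eq[OF assms] by (intro sets.countable_INT'') auto
qed

lemma emeasure_cell:
  assumes "h > 0" shows "emeasure lborel {y :: real^'n. cell h y = c} = ennreal (h ^ CARD('n))"
proof -
  define a b :: "real^'n" where "a = (\<chi> i. of_int (c i) * h)" and "b = (\<chi> i. of_int (c i) * h + h)"
  have "(\<Prod>i\<in>Basis. (b - a) \<bullet> i) = (\<Prod>i\<in>(Basis::(real^'n) set). h)"
    by (intro prod.cong) (auto simp: Basis_vec_def inner_axis a_def b_def)
  hence p: "(\<Prod>i\<in>Basis. (b - a) \<bullet> i) = h ^ CARD('n)" by simp
  have le: "\<And>i. i \<in> Basis \<Longrightarrow> a \<bullet> i \<le> b \<bullet> i" using assms by (auto simp: Basis_vec_def inner_axis a_def b_def)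
  have "box a b \<subseteq> {y. cell h y = c}" "{y. cell h y = c} \<subseteq> cbox a b"
    unfolding cell_vimage_eq[OF assms] by (auto simp: box_def Basis_vec_def inner_axis a_def b_def cbox_def less_imp_le)
  hence "emeasure lborel (box a b) \<le> emeasure lborel {y. cell h y = c}" "emeasure lborel {y. cell h y = c} \<le> emeasure lborel (cbox a b)"
    using assms by (auto intro!: emeasure_mono)
  thus ?thesis using le p by simp
qed

lemma cell_norm_diff:
  assumes "h > 0" "cell h x = cell h (y :: real^'n)" shows "norm (x - y) \<le> real CARD('n) * h"
proof -
  have "norm (x - y) \<le> (\<Sum>i\<in>UNIV. \<bar>(x - y) $ i\<bar>)" by (rule norm_le_l1_cart)
  also have "\<dots> \<le> (\<Sum>i\<in>(UNIV::'n set). h)"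
  proof (intro sum_mono)
    fix i
    have "x \<in> {y. cell h y = cell h y}" "\<lfloor>x $ i / h\<rfloor> = \<lfloor>y $ i / h\<rfloor>" using assms(2) by (auto simp: cell_def fun_eq_iff)
    hence "\<bar>x $ i / h - y $ i / h\<bar> \<le> 1" by linarith
    hence "\<bar>(x $ i - y $ i) / h\<bar> \<le> 1" by (simp add: diff_divide_distrib)
    thus "\<bar>(x - y) $ i\<bar> \<le> h" using assms by (simp add: abs_divide)
  qed
  finally show ?thesis by simp
qed

lemma finite_cells:
  assumes "h > 0" shows "finite (cell h ` (cball 0 l :: (real^'n) set))"
proof -
  have "cell h ` (cball 0 l :: (real^'n) set) \<subseteq> {f. \<forall>i. f i \<in> {\<lfloor>-l/h\<rfloor> .. \<lfloor>l/h\<rfloor>}}"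
  proof safe
    fix x :: "real^'n" and i assume "x \<in> cball 0 l"
    hence "\<bar>x $ i\<bar> \<le> l" using component_le_norm_cart[of x i] by (auto simp: dist_norm)
    thus "cell h x i \<in> {\<lfloor>-l/h\<rfloor> .. \<lfloor>l/h\<rfloor>}" using assms
      by (auto simp: cell_def intro!: floor_mono divide_right_mono simp flip: minus_divide_left) (use assms in \<open>simp add: field_simps\<close>)
  qed
  moreover have "finite {f :: 'n \<Rightarrow> int. \<forall>i. f i \<in> {\<lfloor>-l/h\<rfloor> .. \<lfloor>l/h\<rfloor>}}"
    using finite_PiE[of "UNIV::'n set" "\<lambda>_. {\<lfloor>-l/h\<rfloor> .. \<lfloor>l/h\<rfloor>}"] by (simp add: PiE_UNIV_domain Pi_def)
  ultimately show ?thesis by (rule finite_subset)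
qed

lemma borel_measurable_vec_component [measurable (raw)]:
  fixes f :: "'a \<Rightarrow> real^'n"
  shows "f \<in> borel_measurable M \<Longrightarrow> (\<lambda>x. f x $ i) \<in> borel_measurable M"
  by (rule borel_measurable_continuous_on[of "\<lambda>x. x $ i"]) (auto intro: continuous_intros)

lemma pred_cell_eq [measurable (raw)]:
  fixes f g :: "'a \<Rightarrow> real^'n"
  assumes [measurable]: "f \<in> borel_measurable M" "g \<in> borel_measurable M"
  shows "Measurable.pred M (\<lambda>x. cell h (f x) = cell h (g x))"
  unfolding cell_def fun_eq_iff by measurable

lemma norm_cis_diff_le: "cmod (1 - cis a) \<le> \<bar>a\<bar>"
proof -
  have "cmod (1 - cis a) = 2 * \<bar>sin (a/2)\<bar>"
    using dist_exp_i_1[of a] by (simp add: cis_conv_exp norm_minus_commute)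
  also have "\<bar>sin (a/2)\<bar> \<le> \<bar>a/2\<bar>" by (rule abs_sin_x_le_abs_x)
  finally show ?thesis by simp
qed

lemma le_one_plus_powr:
  fixes t p :: real assumes "t \<ge> 0" "p \<ge> 1" shows "t \<le> 1 + t powr p"
proof (cases "t \<le> 1")
  case False
  hence "t powr 1 \<le> t powr p" using assms by (intro powr_mono) auto
  thus ?thesis using False by simp
qed (simp add: add_increasing2)

context mag_space
begin

text \<open>The integral over the cube, not the mean: the division by h^N happens where the averages
  are compared with the function.\<close>

definition cavg :: "real \<Rightarrow> (real^'n \<Rightarrow> complex) \<Rightarrow> ('n \<Rightarrow> int) \<Rightarrow> complex" where
  "cavg h u c = (\<integral>y. indicator {y. cell h y = c} y *\<^sub>R u y \<partial>lborel)"

lemma cavg_integrable: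
  assumes "u \<in> E" "h > 0"
  shows "integrable lborel (\<lambda>y. indicator {y. cell h y = c} y *\<^sub>R u y)"
    and "norm (cavg h u c) \<le> h ^ CARD('n) + (\<integral>y. cmod (u y) powr ps \<partial>lborel)"
proof -
  note [measurable] = E_measurable[OF assms(1)] sets_cell[OF assms(2)]
  have i1: "integrable lborel (\<lambda>y. indicator {y. cell h y = c} y :: real)"
    by (rule integrable_real_indicator) (auto simp: emeasure_cell[OF assms(2)])
  have i2: "integrable lborel (\<lambda>y. indicator {y. cell h y = c} y + cmod (u y) powr ps)"
    using i1 assms(1) by auto
  have b: "norm (indicator {y. cell h y = c} y *\<^sub>R u y) \<le> indicator {y. cell h y = c} y + cmod (u y) powr ps" for y
    using le_one_plus_powr[of "cmod (u y)" ps] ps_gt_2 by (auto simp: indicator_def)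
  show i3: "integrable lborel (\<lambda>y. indicator {y. cell h y = c} y *\<^sub>R u y)"
    by (rule Bochner_Integration.integrable_bound[OF i2]) (use b in \<open>auto intro!: AE_I2 order_trans[OF _ abs_ge_self]\<close>)
  have "norm (cavg h u c) \<le> (\<integral>y. norm (indicator {y. cell h y = c} y *\<^sub>R u y) \<partial>lborel)"
    unfolding cavg_def by (rule integral_norm_bound)
  also have "\<dots> \<le> (\<integral>y. indicator {y. cell h y = c} y + cmod (u y) powr ps \<partial>lborel)"
    using i3 i2 b by (intro integral_mono integrable_norm) auto
  also have "\<dots> = measure lborel {y. cell h y = c} + (\<integral>y. cmod (u y) powr ps \<partial>lborel)"
    using i1 assms(1) by (subst Bochner_Integration.integral_add) auto
  also have "measure lborel {y::real^'n. cell h y = c} = h ^ CARD('n)"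
    using emeasure_cell[OF assms(2), of c] assms(2) by (simp add: measure_def)
  finally show "norm (cavg h u c) \<le> h ^ CARD('n) + (\<integral>y. cmod (u y) powr ps \<partial>lborel)" .
qed

lemma cavg_diff:
  assumes "u \<in> E" "v \<in> E" "h > 0" shows "cavg h (u - v) c = cavg h u c - cavg h v c"
  unfolding cavg_def using cavg_integrable(1)[OF assms(1,3)] cavg_integrable(1)[OF assms(2,3)]
  by (simp add: scaleR_diff_right)

text \<open>Replacing \<open>w\<close> by its averages over the cubes of side \<open>h\<close>: the error splits into the points where the
  increment exceeds \<open>\<eta>\<close>, the other ones, and the magnetic phase.\<close>

lemma cell_approx:
  assumes h: "0 < h" "h \<le> 1" and B: "\<And>z. z \<in> cball 0 (l + real CARD('n)) \<Longrightarrow> norm (A z) \<le> B" and w: "w \<in> E" and \<eta>: "\<eta> > 0" and l: "l \<ge> 0"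
  defines "L \<equiv> cball 0 l :: (real^'n) set" and "L' \<equiv> cball 0 (l + real CARD('n)) :: (real^'n) set"
  shows "(\<integral>\<^sup>+x. ennreal (cmod (w x)) * indicator L x \<partial>lborel) \<le>
    (\<integral>\<^sup>+x. ennreal (cmod (cavg h w (cell h x)) / h ^ CARD('n)) * indicator L x \<partial>lborel)
    + ennreal \<eta> * emeasure lborel L
    + ennreal ((real CARD('n) * h) powr (real CARD('n) + 2 * s) / h ^ CARD('n) / \<eta> * (nrm w)\<^sup>2)
    + ennreal (B * (real CARD('n) * h)) * (emeasure lborel L' + ennreal (\<integral>x. cmod (w x) powr ps \<partial>lborel))"
proof -
  let ?n = "real CARD('n)"
  define H where "H = h ^ CARD('n)"
  have H: "H > 0" using h by (simp add: H_def)
  define d where "d = ?n * h"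
  have d: "d > 0" "d \<le> ?n" using h by (auto simp: d_def)
  note [measurable] = E_measurable[OF w] sets_cell[OF h(1)]
  define Q where "Q x y = (if cell h x = cell h y then 1 else 0 :: ennreal)" for x y :: "real^'n"
  have [measurable]: "(\<lambda>z. Q (fst z) (snd z)) \<in> borel_measurable (borel \<Otimes>\<^sub>M borel)"
    unfolding Q_def by measurable
  have [measurable (raw)]: "f \<in> borel_measurable M \<Longrightarrow> g \<in> borel_measurable M \<Longrightarrow> (\<lambda>z. Q (f z) (g z)) \<in> borel_measurable M"
    for f g :: "(real^'n) \<times> (real^'n) \<Rightarrow> real^'n" and M unfolding Q_def by measurable
  have Qx[measurable]: "Q x \<in> borel_measurable borel" for x
    unfolding Q_def[abs_def] by measurable
  have Q1: "(\<integral>\<^sup>+y. Q x y \<partial>lborel) = ennreal H" for x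
  proof -
    have "(\<integral>\<^sup>+y. Q x y \<partial>lborel) = (\<integral>\<^sup>+y. indicator {y. cell h y = cell h x} y \<partial>lborel)"
      by (intro nn_integral_cong) (auto simp: Q_def indicator_def)
    thus ?thesis by (simp add: emeasure_cell[OF h(1)] H_def)
  qed
  have Qsym: "Q x y = Q y x" for x y by (auto simp: Q_def indicator_def)
  have B0: "B \<ge> 0" using B[of 0] l by (auto intro: order_trans[OF norm_ge_zero])
  \<comment> \<open>Within one cube the phase differs from 1 by at most B d, so the plain increment
    is the magnetic one plus a multiple of h |w|. The midpoint of x and y stays in the enlarged
    ball, where A is bounded by B.\<close>
  have pt: "cmod (w x - w y) \<le> cmod (magd A w (x,y)) + B * d * cmod (w y)" if "x \<in> L" "cell h x = cell h y" for x y
  proof -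
    have nd: "norm (x - y) \<le> d" using cell_norm_diff[OF h(1) that(2)] by (simp add: d_def)
    define m where "m = (1/2) *\<^sub>R (x + y)"
    have "m = x - (1/2) *\<^sub>R (x - y)" by (simp add: m_def vec_eq_iff field_simps)
    hence "norm m \<le> norm x + (1/2) * norm (x - y)" using norm_triangle_ineq4[of x "(1/2) *\<^sub>R (x - y)"] by simp
    also have "\<dots> \<le> l + ?n" using that(1) nd d by (auto simp: L_def dist_norm)
    finally have "norm (A m) \<le> B" by (intro B) (simp add: dist_norm)
    hence "\<bar>A m \<bullet> (x - y)\<bar> \<le> B * d" using Cauchy_Schwarz_ineq2[of "A m" "x - y"] mult_mono[OF \<open>norm (A m) \<le> B\<close> nd] B0 by simp
    with norm_cis_diff_le have c: "cmod (1 - cis (A m \<bullet> (x - y))) \<le> B * d" by (rule order_trans)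
    have "w x - w y = magd A w (x,y) - w y * (1 - cis (A m \<bullet> (x - y)))"
      by (simp add: magd_def mag_diff_def m_def algebra_simps)
    hence "cmod (w x - w y) \<le> cmod (magd A w (x,y)) + cmod (w y) * cmod (1 - cis (A m \<bullet> (x - y)))"
      using norm_triangle_ineq4[of "magd A w (x,y)" "w y * (1 - cis (A m \<bullet> (x - y)))"] by (simp add: norm_mult)
    also have "\<dots> \<le> cmod (magd A w (x,y)) + cmod (w y) * (B * d)" using c by (intro add_left_mono mult_left_mono) auto
    finally show ?thesis by (simp add: mult_ac)
  qed
  have young: "t \<le> \<eta> + t\<^sup>2 / \<eta>" if "t \<ge> 0" for t
  proof (cases "t \<le> \<eta>")
    case False
    hence "t * \<eta> \<le> t\<^sup>2" using that by (simp add: power2_eq_square mult_left_mono)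
    thus ?thesis using \<eta> by (simp add: field_simps add_increasing)
  qed (use \<eta> in \<open>simp add: add_increasing2\<close>)
  define P where "P x y = (cmod (magd A w (x,y)))\<^sup>2" for x y
  have [measurable]: "(\<lambda>z. P (fst z) (snd z)) \<in> borel_measurable (borel \<Otimes>\<^sub>M borel)" unfolding P_def by simp
  have [measurable]: "P x \<in> borel_measurable borel" for x
  proof -
    have "(\<lambda>y. magd A w (x, y)) \<in> borel_measurable borel"
      by (rule measurable_compose[OF _ measurable_magd'[OF E_measurable[OF w]]]) measurable
    thus ?thesis unfolding P_def[abs_def] by measurable
  qed
  have main: "ennreal (cmod (w x)) \<le> ennreal (cmod (cavg h w (cell h x)) / H) + 
     (ennreal \<eta> + ennreal (1 / (H * \<eta>)) * (\<integral>\<^sup>+y. Q x y * ennreal (P x y) \<partial>lborel) + ennreal (B * d / H) * (\<integral>\<^sup>+y. Q x y * (indicator L' y * ennreal (cmod (w y))) \<partial>lborel))"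
    if x: "x \<in> L" for x
  proof -
    let ?c = "{y. cell h y = cell h x}"
    have i1: "integrable lborel (\<lambda>y. indicator ?c y *\<^sub>R w x)"
      by (intro integrable_scaleR_left integrable_real_indicator) (auto simp: emeasure_cell[OF h(1)])
    note i2 = cavg_integrable(1)[OF w h(1), of "cell h x"]
    have "(\<integral>y. indicator ?c y *\<^sub>R w x \<partial>lborel) = H *\<^sub>R w x"
    proof -
      have "measure lborel ?c = H" using emeasure_cell[OF h(1), of "cell h x"] H by (simp add: measure_def H_def)
      thus ?thesis using emeasure_cell[OF h(1), of "cell h x"] by simp
    qed
    hence "H *\<^sub>R w x - cavg h w (cell h x) = (\<integral>y. indicator ?c y *\<^sub>R (w x - w y) \<partial>lborel)"
      using i1 i2 by (simp add: cavg_def scaleR_diff_right)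
    hence "cmod (H *\<^sub>R w x) \<le> cmod (cavg h w (cell h x)) + cmod (\<integral>y. indicator ?c y *\<^sub>R (w x - w y) \<partial>lborel)"
      by (metis norm_triangle_sub)
    hence "H * cmod (w x) \<le> cmod (cavg h w (cell h x)) + cmod (\<integral>y. indicator ?c y *\<^sub>R (w x - w y) \<partial>lborel)"
      using H by simp
    hence "ennreal (H * cmod (w x)) \<le> ennreal (cmod (cavg h w (cell h x))) + ennreal (cmod (\<integral>y. indicator ?c y *\<^sub>R (w x - w y) \<partial>lborel))"
      by (simp add: ennreal_leI flip: ennreal_plus)
    also have "ennreal (cmod (\<integral>y. indicator ?c y *\<^sub>R (w x - w y) \<partial>lborel)) \<le> (\<integral>\<^sup>+y. ennreal (norm (indicator ?c y *\<^sub>R (w x - w y))) \<partial>lborel)"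
      using i1 i2 by (intro integral_norm_bound_ennreal) (simp add: scaleR_diff_right)
    also have "\<dots> \<le> (\<integral>\<^sup>+y. ennreal \<eta> * Q x y + ennreal (1/\<eta>) * (Q x y * ennreal (P x y)) + ennreal (B * d) * (Q x y * (indicator L' y * ennreal (cmod (w y)))) \<partial>lborel)"
    proof (intro nn_integral_mono)
      fix y
      show "ennreal (norm (indicator ?c y *\<^sub>R (w x - w y))) \<le> ennreal \<eta> * Q x y + ennreal (1/\<eta>) * (Q x y * ennreal (P x y)) + ennreal (B * d) * (Q x y * (indicator L' y * ennreal (cmod (w y))))"
      proof (cases "cell h x = cell h y")
        case True
        have "norm y \<le> norm x + norm (x - y)" by (metis norm_minus_commute norm_triangle_sub)
        also have "\<dots> \<le> l + ?n"
        proof -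
          have "norm x \<le> l" using x by (simp add: L_def dist_norm)
          moreover have "norm (x - y) \<le> d" using cell_norm_diff[OF h(1) True] by (simp add: d_def)
          ultimately show ?thesis using d by linarith
        qed
        finally have "y \<in> L'" by (simp add: L'_def dist_norm)
        have "cmod (w x - w y) \<le> \<eta> + (1/\<eta>) * P x y + B * d * cmod (w y)"
          using pt[OF x True] young[of "cmod (magd A w (x,y))"] by (simp add: P_def)
        hence "ennreal (cmod (w x - w y)) \<le> ennreal (\<eta> + (1/\<eta>) * P x y + B * d * cmod (w y))" by (rule ennreal_leI)
        also have "\<dots> = ennreal \<eta> + ennreal (1/\<eta>) * ennreal (P x y) + ennreal (B * d) * ennreal (cmod (w y))"
          using \<eta> B0 d by (simp add: P_def ennreal_mult[symmetric])
        finally show ?thesis using True \<open>y \<in> L'\<close> by (simp add: Q_def)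
      qed (auto simp: indicator_def)
    qed
    also have "\<dots> = ennreal \<eta> * ennreal H + ennreal (1/\<eta>) * (\<integral>\<^sup>+y. Q x y * ennreal (P x y) \<partial>lborel) + ennreal (B * d) * (\<integral>\<^sup>+y. Q x y * (indicator L' y * ennreal (cmod (w y))) \<partial>lborel)"
    proof -
      have [measurable]: "L' \<in> sets borel" unfolding L'_def by simp
      show ?thesis by (simp add: nn_integral_add nn_integral_cmult Q1)
    qed
    finally have "ennreal (1/H) * ennreal (H * cmod (w x)) \<le> ennreal (1/H) * (ennreal (cmod (cavg h w (cell h x))) + (ennreal \<eta> * ennreal H + ennreal (1/\<eta>) * (\<integral>\<^sup>+y. Q x y * ennreal (P x y) \<partial>lborel) + ennreal (B * d) * (\<integral>\<^sup>+y. Q x y * (indicator L' y * ennreal (cmod (w y))) \<partial>lborel)))"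
      by (intro mult_left_mono) auto
    moreover have "ennreal (1/H) * ennreal (H * cmod (w x)) = ennreal (cmod (w x))"
      using H by (simp add: ennreal_mult[symmetric])
    moreover have "ennreal (1/H) * (ennreal a + (ennreal \<eta> * ennreal H + ennreal (1/\<eta>) * X + ennreal (B * d) * Y))
       = ennreal (a / H) + (ennreal \<eta> + ennreal (1 / (H * \<eta>)) * X + ennreal (B * d / H) * Y)" if "a \<ge> 0" for a X Y
      using H \<eta> B0 d that by (simp add: distrib_left mult.assoc[symmetric] ennreal_mult[symmetric])
    ultimately show ?thesis by simp
  qed
  have Lm[measurable]: "L \<in> sets borel" "L' \<in> sets borel" unfolding L_def L'_def by simp_all
  have [measurable]: "(\<lambda>x. ennreal (cmod (cavg h w (cell h x)) / H)) \<in> borel_measurable borel"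
  proof -
    have "(\<lambda>x. \<integral>y. (if cell h y = cell h x then 1 else 0) *\<^sub>R w y \<partial>lborel) \<in> borel_measurable borel"
      by (rule lborel.borel_measurable_lebesgue_integral) measurable
    moreover have "(\<integral>y. (if cell h y = cell h x then 1 else 0) *\<^sub>R w y \<partial>lborel) = cavg h w (cell h x)" for x
      unfolding cavg_def by (intro Bochner_Integration.integral_cong) (auto simp: indicator_def)
    ultimately have [measurable]: "(\<lambda>x. cavg h w (cell h x)) \<in> borel_measurable borel" by simp
    show ?thesis by measurable
  qed
  have "(\<integral>\<^sup>+x. ennreal (cmod (w x)) * indicator L x \<partial>lborel) \<le>
    (\<integral>\<^sup>+x. ennreal (cmod (cavg h w (cell h x)) / H) * indicator L x + 
     (ennreal \<eta> * indicator L x + ennreal (1 / (H * \<eta>)) * (\<integral>\<^sup>+y. Q x y * ennreal (P x y) \<partial>lborel) + ennreal (B * d / H) * (\<integral>\<^sup>+y. Q x y * (indicator L' y * ennreal (cmod (w y))) \<partial>lborel)) \<partial>lborel)"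
    using main by (intro nn_integral_mono) (auto simp: indicator_def)
  also have "\<dots> = (\<integral>\<^sup>+x. ennreal (cmod (cavg h w (cell h x)) / H) * indicator L x \<partial>lborel) + 
     (ennreal \<eta> * emeasure lborel L + ennreal (1 / (H * \<eta>)) * (\<integral>\<^sup>+x. \<integral>\<^sup>+y. Q x y * ennreal (P x y) \<partial>lborel \<partial>lborel) + ennreal (B * d / H) * (\<integral>\<^sup>+x. \<integral>\<^sup>+y. Q x y * (indicator L' y * ennreal (cmod (w y))) \<partial>lborel \<partial>lborel))"
  proof -
    have [measurable]: "(\<lambda>x. \<integral>\<^sup>+y. Q x y * ennreal (P x y) \<partial>lborel) \<in> borel_measurable borel"
      "(\<lambda>x. \<integral>\<^sup>+y. Q x y * (indicator L' y * ennreal (cmod (w y))) \<partial>lborel) \<in> borel_measurable borel"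
      by measurable
    show ?thesis by (simp add: nn_integral_add nn_integral_cmult)
  qed
  \<comment> \<open>Two points of one cube are at distance at most d, so the cube indicator is at
    most d^(N+2s) times the singular kernel. After division by h^N this leaves an error of order
    h^(2s).\<close>
  also have "(\<integral>\<^sup>+x. \<integral>\<^sup>+y. Q x y * ennreal (P x y) \<partial>lborel \<partial>lborel) \<le> ennreal (d powr (?n + 2 * s)) * ennreal ((nrm w)\<^sup>2)"
  proof -
    have "(\<integral>\<^sup>+x. \<integral>\<^sup>+y. Q x y * ennreal (P x y) \<partial>lborel \<partial>lborel) \<le> (\<integral>\<^sup>+x. \<integral>\<^sup>+y. ennreal (d powr (?n + 2 * s)) * (ennreal (1 / norm (x - y) powr (?n + 2 * s)) * ennreal (P x y)) \<partial>lborel \<partial>lborel)"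
    proof (intro nn_integral_mono)
      fix x y
      show "Q x y * ennreal (P x y) \<le> ennreal (d powr (?n + 2 * s)) * (ennreal (1 / norm (x - y) powr (?n + 2 * s)) * ennreal (P x y))"
      proof (cases "cell h x = cell h y \<and> x \<noteq> y")
        case True
        hence "norm (x - y) \<le> d" "norm (x - y) > 0" using cell_norm_diff[OF h(1)] by (auto simp: d_def)
        hence "norm (x - y) powr (?n + 2 * s) \<le> d powr (?n + 2 * s)" using s by (intro powr_mono2) auto
        hence "1 \<le> d powr (?n + 2 * s) * (1 / norm (x - y) powr (?n + 2 * s))" using \<open>norm (x - y) > 0\<close> by (simp add: field_simps)
        hence "1 * P x y \<le> d powr (?n + 2 * s) * (1 / norm (x - y) powr (?n + 2 * s)) * P x y" by (intro mult_right_mono) (auto simp: P_def)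
        moreover have "P x y \<ge> 0" by (simp add: P_def)
        ultimately show ?thesis using True by (simp add: Q_def ennreal_mult[symmetric] ennreal_leI mult.assoc)
      next
        case False
        thus ?thesis by (cases "x = y") (auto simp: Q_def P_def magd_def mag_diff_def)
      qed
    qed
    also have "\<dots> = ennreal (d powr (?n + 2 * s)) * (\<integral>\<^sup>+z. ennreal (P (fst z) (snd z)) \<partial>KM s)"
    proof -
      have "(\<integral>\<^sup>+z. ennreal (P (fst z) (snd z)) \<partial>KM s) = (\<integral>\<^sup>+x. \<integral>\<^sup>+y. ennreal (1 / norm (x - y) powr (?n + 2 * s)) * ennreal (P x y) \<partial>lborel \<partial>lborel)"
        by (subst nn_integral_KM) auto
      moreover have [measurable]: "(\<lambda>x. \<integral>\<^sup>+y. ennreal (1 / norm (x - y) powr (?n + 2 * s)) * ennreal (P x y) \<partial>lborel) \<in> borel_measurable borel"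
        by measurable
      ultimately show ?thesis by (simp add: nn_integral_cmult)
    qed
    also have "(\<integral>\<^sup>+z. ennreal (P (fst z) (snd z)) \<partial>KM s) = ennreal (\<integral>z. P (fst z) (snd z) \<partial>KM s)"
      using E_magd[OF w] unfolding P_def by (intro nn_integral_eq_integral) auto
    also have "\<dots> \<le> ennreal ((nrm w)\<^sup>2)"
      using V0 unfolding nrm_sq ip_self P_def by (intro ennreal_leI) (simp add: integral_nonneg_AE)
    finally show ?thesis by (simp add: mult_left_mono)
  qed
  also have "(\<integral>\<^sup>+x. \<integral>\<^sup>+y. Q x y * (indicator L' y * ennreal (cmod (w y))) \<partial>lborel \<partial>lborel) \<le> ennreal H * (emeasure lborel L' + ennreal (\<integral>x. cmod (w x) powr ps \<partial>lborel))"
  proof -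
    have "(\<integral>\<^sup>+x. \<integral>\<^sup>+y. Q x y * (indicator L' y * ennreal (cmod (w y))) \<partial>lborel \<partial>lborel) = (\<integral>\<^sup>+y. \<integral>\<^sup>+x. Q x y * (indicator L' y * ennreal (cmod (w y))) \<partial>lborel \<partial>lborel)"
      by (rule lborel_pair.Fubini') measurable
    also have "\<dots> = (\<integral>\<^sup>+y. ennreal H * (indicator L' y * ennreal (cmod (w y))) \<partial>lborel)"
    proof (rule nn_integral_cong)
      fix y
      have "(\<lambda>x. Q x y) = Q y" using Qsym by auto
      hence "(\<integral>\<^sup>+x. Q x y * (indicator L' y * ennreal (cmod (w y))) \<partial>lborel) = (\<integral>\<^sup>+x. Q y x * (indicator L' y * ennreal (cmod (w y))) \<partial>lborel)"
        by (metis (no_types, lifting))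
      also have "\<dots> = ennreal H * (indicator L' y * ennreal (cmod (w y)))"
        by (subst nn_integral_multc) (auto simp: Q1)
      finally show "(\<integral>\<^sup>+x. Q x y * (indicator L' y * ennreal (cmod (w y))) \<partial>lborel) = ennreal H * (indicator L' y * ennreal (cmod (w y)))" .
    qed
    also have "\<dots> \<le> (\<integral>\<^sup>+y. ennreal H * (indicator L' y + ennreal (cmod (w y) powr ps)) \<partial>lborel)"
    proof (intro nn_integral_mono mult_left_mono)
      fix y
      have "ennreal (cmod (w y)) \<le> 1 + ennreal (cmod (w y) powr ps)"
        using le_one_plus_powr[of "cmod (w y)" ps] ps_gt_2
        by (simp add: ennreal_leI flip: ennreal_plus ennreal_1)
      thus "indicator L' y * ennreal (cmod (w y)) \<le> indicator L' y + ennreal (cmod (w y) powr ps)" by (auto simp: indicator_def)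
    qed auto
    also have "\<dots> = ennreal H * (emeasure lborel L' + ennreal (\<integral>x. cmod (w x) powr ps \<partial>lborel))"
      using E_powr[OF w] by (simp add: nn_integral_cmult nn_integral_add nn_integral_eq_integral)
    finally show ?thesis .
  qed
  finally have fin: "(\<integral>\<^sup>+x. ennreal (cmod (w x)) * indicator L x \<partial>lborel) \<le>
    (\<integral>\<^sup>+x. ennreal (cmod (cavg h w (cell h x)) / H) * indicator L x \<partial>lborel) +
    (ennreal \<eta> * emeasure lborel L + ennreal (1 / (H * \<eta>)) * (ennreal (d powr (?n + 2 * s)) * ennreal ((nrm w)\<^sup>2)) +
     ennreal (B * d / H) * (ennreal H * (emeasure lborel L' + ennreal (\<integral>x. cmod (w x) powr ps \<partial>lborel))))"
    by (simp add: add_left_mono add_mono mult_left_mono)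
  have e1: "ennreal (1 / (H * \<eta>)) * (ennreal (d powr (?n + 2 * s)) * ennreal ((nrm w)\<^sup>2)) = ennreal (d powr (?n + 2 * s) / H / \<eta> * (nrm w)\<^sup>2)"
    using H \<eta> by (simp add: ennreal_mult[symmetric])
  have e2: "ennreal (B * d / H) * (ennreal H * X) = ennreal (B * d) * X" for X
    using H B0 d by (simp add: ennreal_mult[symmetric] mult.assoc[symmetric])
  show ?thesis using fin unfolding e1 e2 unfolding H_def d_def by (simp add: add.assoc)
qed

end

lemma sets_borel_cball [measurable]: "cball (a::'a::metric_space) r \<in> sets borel"
  by simp

text \<open>The usual proof that L1 convergence yields an a.e. convergent subsequence, with the
  exhaustion by balls built in: the j-th increment is at most 2^(-j) on the ball of radius j, so no
  further diagonal argument over balls is needed.\<close>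

lemma AE_convergent_of_L1_local_Cauchy:
  fixes f :: "nat \<Rightarrow> 'a::euclidean_space \<Rightarrow> 'b::{banach, second_countable_topology}"
  assumes [measurable]: "\<And>n. f n \<in> borel_measurable borel"
    and C: "\<And>(l::nat) \<epsilon>. \<epsilon> > 0 \<Longrightarrow> \<exists>n0. \<forall>n\<ge>n0. \<forall>m\<ge>n0. (\<integral>\<^sup>+x. ennreal (norm (f n x - f m x)) * indicator (cball 0 (real l)) x \<partial>lborel) \<le> ennreal \<epsilon>"
  obtains r g where "strict_mono (r::nat\<Rightarrow>nat)" "g \<in> borel_measurable borel" "AE x in lborel. (\<lambda>n. f (r n) x) \<longlonglongrightarrow> g x"
proof -
  obtain n0 where n0: "\<And>l n m. n \<ge> n0 l \<Longrightarrow> m \<ge> n0 l \<Longrightarrow> (\<integral>\<^sup>+x. ennreal (norm (f n x - f m x)) * indicator (cball 0 (real l)) x \<partial>lborel) \<le> ennreal ((1/2)^l)"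
  proof -
    have "\<forall>l. \<exists>n0. \<forall>n\<ge>n0. \<forall>m\<ge>n0. (\<integral>\<^sup>+x. ennreal (norm (f n x - f m x)) * indicator (cball 0 (real l)) x \<partial>lborel) \<le> ennreal ((1/2)^l)"
      using C by simp
    thus ?thesis using that by metis
  qed
  \<comment> \<open>The maximum with the successor keeps the subsequence strictly increasing, while
    n0 supplies the Cauchy bound on the ball of radius j.\<close>
  define r where "r = rec_nat (n0 0) (\<lambda>j rj. max (Suc rj) (n0 (Suc j)))"
  have r0: "r 0 = n0 0" and rS: "r (Suc j) = max (Suc (r j)) (n0 (Suc j))" for j by (auto simp: r_def)
  have mono: "strict_mono r" by (rule strict_monoI_Suc) (simp add: rS less_max_iff_disj)
  have rn: "r j \<ge> n0 j" for j by (cases j) (auto simp: r0 rS)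
  have rn': "r (Suc j) \<ge> n0 j" for j using rn[of j] by (simp add: rS)
  define a where "a j x = ennreal (norm (f (r (Suc j)) x - f (r j) x)) * indicator (cball 0 (real j)) x" for j x
  have [measurable]: "a j \<in> borel_measurable borel" for j unfolding a_def[abs_def] by measurable
  have "(\<integral>\<^sup>+x. (\<Sum>j. a j x) \<partial>lborel) = (\<Sum>j. \<integral>\<^sup>+x. a j x \<partial>lborel)"
    by (rule nn_integral_suminf) measurable
  also have "\<dots> \<le> (\<Sum>j. ennreal ((1/2)^j))"
    unfolding a_def by (intro suminf_le n0 rn rn') auto
  also have "\<dots> = ennreal (\<Sum>j. (1/2)^j)" by (intro suminf_ennreal2 summable_geometric) auto
  finally have "(\<integral>\<^sup>+x. (\<Sum>j. a j x) \<partial>lborel) \<noteq> \<infinity>" by (auto simp: top_unique)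
  hence "AE x in lborel. (\<Sum>j. a j x) \<noteq> \<infinity>" by (intro nn_integral_noteq_infinite) auto
  hence conv: "AE x in lborel. convergent (\<lambda>n. f (r n) x)"
  proof eventually_elim
    case (elim x)
    obtain m :: nat where m: "norm x \<le> real m" using real_arch_simple by blast
    define d where "d j = f (r (Suc j)) x - f (r j) x" for j
    have "summable (\<lambda>j. norm (d j) * indicator (cball 0 (real j)) x)"
    proof (rule summable_suminf_not_top)
      have "ennreal (norm (d j) * indicator (cball 0 (real j)) x) = a j x" for j
        by (auto simp: a_def d_def indicator_def)
      thus "(\<Sum>j. ennreal (norm (d j) * indicator (cball 0 (real j)) x)) \<noteq> top" using elim by simp
    qed auto
    hence "summable (\<lambda>j. norm (d (j + m)) * indicator (cball 0 (real (j + m))) x)" by (subst summable_iff_shift)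
    moreover have "norm (d (j + m)) * indicator (cball 0 (real (j + m))) x = norm (d (j + m))" for j
    proof -
      have "x \<in> cball 0 (real (j + m))" using m by (simp add: dist_norm)
      thus ?thesis by simp
    qed
    ultimately have "summable (\<lambda>j. norm (d (j + m)))" by (simp only:)
    hence "summable (\<lambda>j. d (j + m))" by (rule summable_norm_cancel)
    hence "summable d" by (simp add: summable_iff_shift)
    hence "convergent (\<lambda>n. \<Sum>j<n. d j)" by (simp add: summable_iff_convergent)
    hence "convergent (\<lambda>n. f (r 0) x + (\<Sum>j<n. d j))" by (intro convergent_add convergent_const)
    moreover have "f (r 0) x + (\<Sum>j<n. d j) = f (r n) x" for n
      unfolding d_def by (subst sum_lessThan_telescope) simp
    ultimately show ?case by simp
  qed
  show thesis
  proof (rule that[OF mono, of "\<lambda>x. lim (\<lambda>n. f (r n) x)"])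
    show "(\<lambda>x. lim (\<lambda>n. f (r n) x)) \<in> borel_measurable borel" by measurable
    show "AE x in lborel. (\<lambda>n. f (r n) x) \<longlonglongrightarrow> lim (\<lambda>n. f (r n) x)"
      using conv by eventually_elim (simp add: convergent_LIMSEQ_iff)
  qed
qed

context mag_space
begin

lemma nrm_diff: assumes "u \<in> E" "v \<in> E" shows "nrm (u - v) \<le> nrm u + nrm v"
  using nrm_triangle[OF assms(1) E_scale[OF assms(2), of "-1"]] nrm_scale[of "-1" v] by simp

lemma powr_bound_of_nrm:
  assumes "u \<in> E" "nrm u \<le> \<rho>"
  shows "(\<integral>x. cmod (u x) powr ps \<partial>lborel) \<le> (Cs * \<rho>\<^sup>2) powr (ps/2)"
proof -
  have "(Cs * (nrm u)\<^sup>2) powr (ps/2) \<le> (Cs * \<rho>\<^sup>2) powr (ps/2)"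
    using assms(2) Cs_pos ps_gt_2 by (intro powr_mono2 mult_left_mono power_mono) auto
  thus ?thesis using sobolev_nrm[OF assms(1)] by linarith
qed

text \<open>The cube integrals at all scales are countably many bounded sequences, so one
  subsequence makes all of them converge. Since a function is close to its cube averages in L1 on
  balls, uniformly over norm-bounded sets, that subsequence is locally Cauchy in L1.\<close>

theorem rellich:
  assumes uE: "\<And>n. u n \<in> E" and \<rho>: "\<And>n. nrm (u n) \<le> \<rho>"
  obtains k U where "strict_mono (k::nat\<Rightarrow>nat)" "U \<in> borel_measurable borel" "AE x in lborel. (\<lambda>n. u (k n) x) \<longlonglongrightarrow> U x"
proof -
  let ?n = "real CARD('n)"
  define S where "S = (Cs * \<rho>\<^sup>2) powr (ps/2)"
  \<comment> \<open>Scale and cube form a single countable index, so that one diagonal argument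
    treats all cube integrals at once.\<close>
  define \<Phi> where "\<Phi> n jc = cavg (1 / real (Suc (fst jc))) (u n) (snd jc)" for n and jc :: "nat \<times> ('n \<Rightarrow> int)"
  have bd: "norm (\<Phi> n jc) \<le> 1 + S" for n jc
  proof -
    have "norm (\<Phi> n jc) \<le> (1 / real (Suc (fst jc))) ^ CARD('n) + (\<integral>y. cmod (u n y) powr ps \<partial>lborel)"
      unfolding \<Phi>_def by (rule cavg_integrable(2)[OF uE]) simp
    moreover have "(1 / real (Suc (fst jc))) ^ CARD('n) \<le> 1" by (intro power_le_one) auto
    moreover have "(\<integral>y. cmod (u n y) powr ps \<partial>lborel) \<le> S" unfolding S_def by (rule powr_bound_of_nrm[OF uE \<rho>])
    ultimately show ?thesis by linarith
  qed
  obtain k where k: "strict_mono (k::nat\<Rightarrow>nat)" "\<And>jc. \<exists>l. (\<lambda>n. \<Phi> (k n) jc) \<longlonglongrightarrow> l"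
    using function_convergent_subsequence[of UNIV \<Phi> "1 + S"] bd by auto
  have C: "\<exists>n0. \<forall>n\<ge>n0. \<forall>m\<ge>n0. (\<integral>\<^sup>+x. ennreal (norm (u (k n) x - u (k m) x)) * indicator (cball 0 (real l)) x \<partial>lborel) \<le> ennreal \<epsilon>"
    if \<epsilon>: "\<epsilon> > 0" for l :: nat and \<epsilon>
  proof -
    let ?L = "cball 0 (real l) :: (real^'n) set" and ?L' = "cball 0 (real l + ?n) :: (real^'n) set"
    define mL mL' where "mL = measure lborel ?L" and "mL' = measure lborel ?L'"
    have eL: "emeasure lborel ?L = ennreal mL" "emeasure lborel ?L' = ennreal mL'" and m0: "mL \<ge> 0" "mL' \<ge> 0"
      unfolding mL_def mL'_def using emeasure_lborel_cball_finite[of "0::real^'n" "real l"] emeasure_lborel_cball_finite[of "0::real^'n" "real l + ?n"]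
      by (auto intro!: emeasure_eq_ennreal_measure simp: top_unique)
    have "bounded (A ` ?L')" by (intro compact_imp_bounded compact_continuous_image continuous_on_subset[OF A]) auto
    then obtain B0 where B0: "\<And>z. z \<in> ?L' \<Longrightarrow> norm (A z) \<le> B0" unfolding bounded_iff by blast
    define B where "B = \<bar>B0\<bar>"
    have B: "\<And>z. z \<in> ?L' \<Longrightarrow> norm (A z) \<le> B" "B \<ge> 0" using B0 unfolding B_def by (auto intro: order_trans[OF _ abs_ge_self])
    define S2 where "S2 = (Cs * (2 * \<rho>)\<^sup>2) powr (ps/2)"
    have S2: "S2 \<ge> 0" by (simp add: S2_def)
    \<comment> \<open>The order of choices matters: \<eta> first, as the error c1 carries 1/\<eta>;
      then the side h; then the tolerance \<epsilon>' for the cube integrals, as they are divided by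
      h^N; and last n0, a maximum over the finitely many cubes meeting the ball.\<close>
    define \<eta> where "\<eta> = \<epsilon> / (4 * (mL + 1))"
    have \<eta>: "\<eta> > 0" "\<eta> * mL \<le> \<epsilon>/4" using \<epsilon> m0 by (auto simp: \<eta>_def field_simps)
    define c1 where "c1 h = (?n * h) powr (?n + 2 * s) / h ^ CARD('n) / \<eta> * (2 * \<rho>)\<^sup>2" for h
    define c2 where "c2 h = B * (?n * h) * (mL' + S2)" for h
    have h0: "(\<lambda>j. 1 / real (Suc j)) \<longlonglongrightarrow> 0" using LIMSEQ_Suc[OF lim_1_over_n[where 'a=real]] by simp
    have "(\<lambda>j. c2 (1 / real (Suc j))) \<longlonglongrightarrow> B * (?n * 0) * (mL' + S2)" unfolding c2_def by (intro tendsto_intros h0)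
    hence l2: "(\<lambda>j. c2 (1 / real (Suc j))) \<longlonglongrightarrow> 0" by simp
    have l1: "(\<lambda>j. c1 (1 / real (Suc j))) \<longlonglongrightarrow> 0"
    proof -
      have "c1 h = ?n powr (?n + 2 * s) / \<eta> * (2 * \<rho>)\<^sup>2 * h powr (2 * s)" if "h > 0" for h
        using that by (simp add: c1_def powr_mult powr_add powr_realpow)
      moreover have "(\<lambda>j. ?n powr (?n + 2 * s) / \<eta> * (2 * \<rho>)\<^sup>2 * (1 / real (Suc j)) powr (2 * s)) \<longlonglongrightarrow> ?n powr (?n + 2 * s) / \<eta> * (2 * \<rho>)\<^sup>2 * 0"
      proof (intro tendsto_mult tendsto_const)
        have "(\<lambda>j. real (Suc j) powr (- (2 * s))) \<longlonglongrightarrow> 0"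
        proof (rule tendsto_neg_powr)
          show "filterlim (\<lambda>j. real (Suc j)) at_top sequentially"
            by (rule filterlim_compose[OF filterlim_real_sequentially filterlim_Suc])
        qed (use s in simp)
        thus "(\<lambda>j. (1 / real (Suc j)) powr (2 * s)) \<longlonglongrightarrow> 0" by (simp add: powr_divide powr_minus_divide)
      qed
      ultimately show ?thesis by simp
    qed
    have "\<forall>\<^sub>F j in sequentially. c1 (1 / real (Suc j)) < \<epsilon>/4 \<and> c2 (1 / real (Suc j)) < \<epsilon>/4"
      using order_tendstoD(2)[OF l1, of "\<epsilon>/4"] order_tendstoD(2)[OF l2, of "\<epsilon>/4"] \<epsilon> by (auto simp: eventually_conj_iff)
    then obtain j where j: "c1 (1 / real (Suc j)) < \<epsilon>/4" "c2 (1 / real (Suc j)) < \<epsilon>/4" by (auto simp: eventually_sequentially)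
    define h where "h = 1 / real (Suc j)"
    have h: "0 < h" "h \<le> 1" "c1 h < \<epsilon>/4" "c2 h < \<epsilon>/4" using j by (auto simp: h_def)
    define H where "H = h ^ CARD('n)"
    have H: "H > 0" using h by (simp add: H_def)
    define \<epsilon>' where "\<epsilon>' = \<eta> * H"
    have e': "\<epsilon>' > 0" "\<epsilon>' / H * mL \<le> \<epsilon>/4" using \<eta> H by (auto simp: \<epsilon>'_def)
    have "\<exists>n0. \<forall>n\<ge>n0. \<forall>m\<ge>n0. norm (\<Phi> (k n) (j, c) - \<Phi> (k m) (j, c)) < \<epsilon>'" for c
    proof -
      have "Cauchy (\<lambda>n. \<Phi> (k n) (j, c))" using k(2)[of "(j, c)"] LIMSEQ_imp_Cauchy by blast
      from CauchyD[OF this e'(1)] show ?thesis by blast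
    qed
    then obtain n1 where n1: "\<And>c n m. n \<ge> n1 c \<Longrightarrow> m \<ge> n1 c \<Longrightarrow> norm (\<Phi> (k n) (j, c) - \<Phi> (k m) (j, c)) < \<epsilon>'" by metis
    define n0 where "n0 = Max (n1 ` (cell h ` ?L))"
    have fin: "finite (cell h ` ?L)" by (rule finite_cells[OF h(1)])
    show ?thesis
    proof (intro exI[of _ n0] allI impI)
      fix n m assume nm: "n \<ge> n0" "m \<ge> n0"
      define w where "w = u (k n) - u (k m)"
      have w: "w \<in> E" unfolding w_def by (intro E_diff uE)
      have nw: "nrm w \<le> 2 * \<rho>" using nrm_diff[OF uE uE, of "k n" "k m"] \<rho>[of "k n"] \<rho>[of "k m"] by (simp add: w_def)
      have Sw: "(\<integral>x. cmod (w x) powr ps \<partial>lborel) \<le> S2" unfolding S2_def by (rule powr_bound_of_nrm[OF w nw])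
      have S0: "(\<integral>x. cmod (w x) powr ps \<partial>lborel) \<ge> 0" by (simp add: integral_nonneg_AE)
      have cav: "cmod (cavg h w (cell h x)) \<le> \<epsilon>'" if "x \<in> ?L" for x
      proof -
        have "n1 (cell h x) \<le> n0" unfolding n0_def using fin that by (intro Max_ge) auto
        hence "norm (\<Phi> (k n) (j, cell h x) - \<Phi> (k m) (j, cell h x)) < \<epsilon>'" using nm by (intro n1) auto
        moreover have "cavg h w (cell h x) = \<Phi> (k n) (j, cell h x) - \<Phi> (k m) (j, cell h x)"
          unfolding w_def by (subst cavg_diff[OF uE uE h(1)]) (simp add: \<Phi>_def h_def)
        ultimately show ?thesis by simp
      qed
      have "(\<integral>\<^sup>+x. ennreal (norm (u (k n) x - u (k m) x)) * indicator ?L x \<partial>lborel) = (\<integral>\<^sup>+x. ennreal (cmod (w x)) * indicator ?L x \<partial>lborel)"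
        by (simp add: w_def)
      also have "\<dots> \<le> (\<integral>\<^sup>+x. ennreal (cmod (cavg h w (cell h x)) / h ^ CARD('n)) * indicator ?L x \<partial>lborel)
        + ennreal \<eta> * emeasure lborel ?L
        + ennreal ((?n * h) powr (?n + 2 * s) / h ^ CARD('n) / \<eta> * (nrm w)\<^sup>2)
        + ennreal (B * (?n * h)) * (emeasure lborel ?L' + ennreal (\<integral>x. cmod (w x) powr ps \<partial>lborel))"
        using cell_approx[OF h(1,2) B(1) w \<eta>(1), of "real l"] by simp
      also have "\<dots> \<le> ennreal (\<epsilon>/4) + ennreal (\<epsilon>/4) + ennreal (\<epsilon>/4) + ennreal (\<epsilon>/4)"
      proof (intro add_mono)
        have "(\<integral>\<^sup>+x. ennreal (cmod (cavg h w (cell h x)) / h ^ CARD('n)) * indicator ?L x \<partial>lborel) \<le> (\<integral>\<^sup>+x. ennreal (\<epsilon>' / H) * indicator ?L x \<partial>lborel)"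
          using cav H unfolding H_def[symmetric] by (intro nn_integral_mono) (auto simp: indicator_def intro!: ennreal_leI divide_right_mono)
        also have "\<dots> = ennreal (\<epsilon>' / H * mL)" using e' H m0 by (subst ennreal_mult) (simp_all add: nn_integral_cmult eL)
        also have "\<dots> \<le> ennreal (\<epsilon>/4)" using e' by (intro ennreal_leI)
        finally show "(\<integral>\<^sup>+x. ennreal (cmod (cavg h w (cell h x)) / h ^ CARD('n)) * indicator ?L x \<partial>lborel) \<le> ennreal (\<epsilon>/4)" .
        show "ennreal \<eta> * emeasure lborel ?L \<le> ennreal (\<epsilon>/4)"
          unfolding eL using \<eta> m0 by (simp add: ennreal_mult[symmetric] ennreal_leI)
        have "(?n * h) powr (?n + 2 * s) / h ^ CARD('n) / \<eta> * (nrm w)\<^sup>2 \<le> c1 h"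
          unfolding c1_def using h \<eta> nw by (intro mult_left_mono power_mono) auto
        thus "ennreal ((?n * h) powr (?n + 2 * s) / h ^ CARD('n) / \<eta> * (nrm w)\<^sup>2) \<le> ennreal (\<epsilon>/4)"
          using h by (intro ennreal_leI) linarith
        have "B * (?n * h) * (mL' + (\<integral>x. cmod (w x) powr ps \<partial>lborel)) \<le> c2 h"
          unfolding c2_def using B h Sw by (intro mult_left_mono) auto
        thus "ennreal (B * (?n * h)) * (emeasure lborel ?L' + ennreal (\<integral>x. cmod (w x) powr ps \<partial>lborel)) \<le> ennreal (\<epsilon>/4)"
          unfolding eL using h B m0 S0 by (simp add: ennreal_mult[symmetric] ennreal_leI flip: ennreal_plus)
      qed
      also have "\<dots> = ennreal \<epsilon>" using \<epsilon> by (simp flip: ennreal_plus)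
      finally show "(\<integral>\<^sup>+x. ennreal (norm (u (k n) x - u (k m) x)) * indicator ?L x \<partial>lborel) \<le> ennreal \<epsilon>" .
    qed
  qed
  obtain r g where r: "strict_mono r" "g \<in> borel_measurable borel" "AE x in lborel. (\<lambda>n. u (k (r n)) x) \<longlonglongrightarrow> g x"
    by (rule AE_convergent_of_L1_local_Cauchy[of "\<lambda>n. u (k n)", OF E_measurable[OF uE] C])
  show thesis
    by (rule that[of "k \<circ> r" g]) (use r k(1) in \<open>auto simp: strict_mono_o\<close>)
qed

end

section \<open>The functional and its critical points\<close>

lemma powr_pred_mult_le:
  fixes a b p :: real assumes "a \<ge> 0" "b \<ge> 0" "p > 1"
  shows "a powr (p-1) * b \<le> a powr p + b powr p"
proof (cases "a \<le> b")
  case True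
  hence "a powr (p-1) * b \<le> b powr (p-1) * b" using assms by (intro mult_right_mono powr_mono2) auto
  also have "\<dots> = b powr p" using assms powr_mult_base[of b "p-1"] by (simp add: mult.commute)
  finally show ?thesis by (simp add: add_increasing)
next
  case False
  hence "a powr (p-1) * b \<le> a powr (p-1) * a" using assms by (intro mult_left_mono) auto
  also have "\<dots> = a powr p" using assms powr_mult_base[of a "p-1"] by (simp add: mult.commute)
  finally show ?thesis by (simp add: add_increasing2)
qed

lemma power2_powr_half:
  fixes t m :: real assumes "t \<ge> 0" shows "(t\<^sup>2) powr (m/2) = t powr m"
proof (cases "t = 0")
  case False
  have "(t\<^sup>2) powr (m/2) = (t powr 2) powr (m/2)" using False assms by simp
  also have "\<dots> = t powr m" by (subst powr_powr) simp
  finally show ?thesis .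
qed simp

text \<open>The nonlinearity is \<open>f x (|u|^2) u\<close>. The critical growth bound makes the
  functional well defined; \<open>f_compact\<close> is the compactness hypothesis: in the dual
  exponent ps/(ps-1) the nonlinearity is an arbitrarily small multiple of t^ps plus a fixed
  integrable function. Subcritical growth gives this on balls, an integrable coefficient near
  infinity.\<close>

locale mag_nl = mag_space s ps Cs A V for s ps Cs :: real and A :: "real^'n \<Rightarrow> real^'n" and V :: "real^'n \<Rightarrow> real" +
  fixes f :: "real^'n \<Rightarrow> real \<Rightarrow> real" and C1 :: real
  assumes f_meas: "(\<lambda>z. f (fst z) (snd z)) \<in> borel_measurable (borel \<Otimes>\<^sub>M borel)"
    and f_cont: "\<And>x. continuous_on {0..} (f x)"
    and f_nonneg: "\<And>x t. t \<ge> 0 \<Longrightarrow> 0 \<le> f x t"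
    and f_crit: "\<And>x t. t \<ge> 0 \<Longrightarrow> f x t \<le> C1 * t powr ((ps - 2)/2)"
    and f_compact: "\<And>\<delta>. \<delta> > 0 \<Longrightarrow> \<exists>\<Psi>. integrable lborel \<Psi> \<and> (\<forall>x t. t \<ge> 0 \<longrightarrow> (f x (t\<^sup>2) * t) powr (ps/(ps-1)) \<le> \<delta> * t powr ps + \<Psi> x)"
begin

lemma C1_nonneg: "C1 \<ge> 0"
  using f_nonneg[of 1 undefined] f_crit[of 1 undefined] by simp

lemma f_measurable [measurable (raw)]:
  assumes [measurable]: "g \<in> borel_measurable M" "h \<in> borel_measurable M"
  shows "(\<lambda>x. f (g x) (h x)) \<in> borel_measurable M"
proof -
  have "(\<lambda>x. (g x, h x)) \<in> measurable M (borel \<Otimes>\<^sub>M borel)" by measurable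
  from measurable_compose[OF this f_meas] show ?thesis by simp
qed

text \<open>The primitive of \<open>f x\<close> from 0, written as an integral over the whole line
  so that joint measurability in x and t follows from that of parametrised integrals.\<close>

definition Ff :: "real^'n \<Rightarrow> real \<Rightarrow> real" where
  "Ff x t = (\<integral>\<tau>. (if 0 \<le> \<tau> \<and> \<tau> \<le> t then f x \<tau> else 0) \<partial>lborel)"

lemma Ff_measurable [measurable (raw)]:
  assumes [measurable]: "g \<in> borel_measurable M" "h \<in> borel_measurable M"
  shows "(\<lambda>x. Ff (g x) (h x)) \<in> borel_measurable M"
  unfolding Ff_def by measurable

lemma Ff_eq_integral: assumes "t \<ge> 0" shows "Ff x t = integral {0..t} (f x)"
proof -
  have "set_integrable lborel {0..t} (f x)"
    by (rule borel_integrable_atLeastAtMost') (rule continuous_on_subset[OF f_cont], auto)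
  hence "(LINT \<tau>:{0..t}|lborel. f x \<tau>) = integral {0..t} (f x)" by (rule set_borel_integral_eq_integral)
  moreover have "(LINT \<tau>:{0..t}|lborel. f x \<tau>) = Ff x t"
    unfolding Ff_def set_lebesgue_integral_def by (intro Bochner_Integration.integral_cong) (auto simp: indicator_def)
  ultimately show ?thesis by simp
qed

lemma Ff_nonneg: "Ff x t \<ge> 0"
  unfolding Ff_def by (rule Bochner_Integration.integral_nonneg) (auto simp: f_nonneg)

lemma Ff_le: assumes t: "t \<ge> 0" shows "Ff x t \<le> C1 * t powr (ps/2)"
proof -
  have "integral {0..t} (f x) \<le> integral {0..t} (\<lambda>_. C1 * t powr ((ps-2)/2))"
  proof (rule integral_le)
    show "f x integrable_on {0..t}" by (intro integrable_continuous_real continuous_on_subset[OF f_cont]) auto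
    fix y assume y: "y \<in> {0..t}"
    have "f x y \<le> C1 * y powr ((ps - 2)/2)" using f_crit y by simp
    also have "\<dots> \<le> C1 * t powr ((ps - 2)/2)" using y ps_gt_2 C1_nonneg by (intro mult_left_mono powr_mono2) auto
    finally show "f x y \<le> C1 * t powr ((ps - 2)/2)" .
  qed auto
  also have "\<dots> = C1 * (t * t powr ((ps-2)/2))" using t by (simp add: mult_ac)
  also have "t * t powr ((ps-2)/2) = t powr (ps/2)"
  proof -
    have "1 + (ps-2)/2 = ps/2" by (simp add: field_simps)
    thus ?thesis using powr_mult_base[OF t, of "(ps-2)/2"] by (simp only:)
  qed
  finally show ?thesis by (simp add: Ff_eq_integral t)
qed

lemma Ff_0: "Ff x 0 = 0"
  using Ff_le[of 0 x] Ff_nonneg[of x 0] ps_gt_2 by simp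

definition Nn :: "real^'n \<Rightarrow> complex \<Rightarrow> complex" where
  "Nn x z = f x ((cmod z)\<^sup>2) *\<^sub>R z"

lemma Nn_measurable [measurable (raw)]:
  assumes [measurable]: "g \<in> borel_measurable M" "h \<in> borel_measurable M"
  shows "(\<lambda>x. Nn (g x) (h x)) \<in> borel_measurable M"
  unfolding Nn_def by measurable

lemma norm_Nn: "cmod (Nn x z) = f x ((cmod z)\<^sup>2) * cmod z"
  using f_nonneg[of "(cmod z)\<^sup>2" x] by (simp add: Nn_def)

lemma norm_Nn_le: "cmod (Nn x z) \<le> C1 * cmod z powr (ps-1)"
proof -
  have "cmod (Nn x z) \<le> C1 * (cmod z)\<^sup>2 powr ((ps-2)/2) * cmod z"
    unfolding norm_Nn by (intro mult_right_mono f_crit) auto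
  also have "\<dots> = C1 * (cmod z * cmod z powr (ps-2))" by (simp add: power2_powr_half mult_ac)
  also have "cmod z * cmod z powr (ps-2) = cmod z powr (ps-1)" using powr_mult_base[of "cmod z" "ps-2"] by simp
  finally show ?thesis .
qed

lemma Nn_continuous: "isCont (Nn x) z"
proof -
  have "continuous_on UNIV (\<lambda>z. f x ((cmod z)\<^sup>2) *\<^sub>R z)"
    by (intro continuous_intros continuous_on_compose2[OF f_cont[of x], where f="\<lambda>z. (cmod z)\<^sup>2"]) auto
  thus ?thesis unfolding Nn_def[abs_def] by (simp add: continuous_on_eq_continuous_at)
qed

text \<open>Along the segment from z to z + b the function \<open>Ff x (|.|^2) / 2\<close> has
  derivative \<open>Nn x (.)\<close> paired with b. Only the first derivative is used, since
  \<open>f x\<close> is merely continuous.\<close>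

lemma Ff_mean_value:
  "\<exists>\<sigma>\<in>{0..1}. Ff x ((cmod (z + b))\<^sup>2) / 2 - Ff x ((cmod z)\<^sup>2) / 2 = Nn x (z + \<sigma> *\<^sub>R b) \<bullet> b"
proof -
  define q where "q \<sigma> = (cmod (z + \<sigma> *\<^sub>R b))\<^sup>2" for \<sigma> :: real
  define Q where "Q = (cmod z + cmod b)\<^sup>2"
  have qQ: "q ` {0..1} \<subseteq> {0..Q}"
  proof safe
    fix \<sigma> :: real assume s: "\<sigma> \<in> {0..1}"
    have "cmod (z + \<sigma> *\<^sub>R b) \<le> cmod z + \<sigma> * cmod b" using norm_triangle_ineq[of z "\<sigma> *\<^sub>R b"] s by simp
    also have "\<dots> \<le> cmod z + cmod b" using s by (simp add: mult_left_le_one_le)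
    finally show "q \<sigma> \<in> {0..Q}" by (auto simp: q_def Q_def intro!: power_mono)
  qed
  have der: "((\<lambda>\<sigma>. Ff x (q \<sigma>) / 2) has_derivative (\<lambda>h. h * (Nn x (z + \<sigma> *\<^sub>R b) \<bullet> b))) (at \<sigma> within {0..1})" if s: "\<sigma> \<in> {0..1}" for \<sigma>
  proof -
    have qs: "q \<sigma> \<in> {0..Q}" using qQ s by blast
    have "((\<lambda>t. integral {0..t} (f x)) has_real_derivative f x (q \<sigma>)) (at (q \<sigma>) within {0..Q})"
      using qs by (intro integral_has_real_derivative continuous_on_subset[OF f_cont]) auto
    hence "(Ff x has_real_derivative f x (q \<sigma>)) (at (q \<sigma>) within {0..Q})"
      by (rule has_field_derivative_transform_within[where d=1]) (use qs in \<open>auto simp: Ff_eq_integral\<close>)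
    hence 1: "(Ff x has_real_derivative f x (q \<sigma>)) (at (q \<sigma>) within q ` {0..1})" using qQ by (rule has_field_derivative_subset)
    have q': "q = (\<lambda>\<sigma>. z \<bullet> z + 2 * \<sigma> * (z \<bullet> b) + \<sigma> * \<sigma> * (b \<bullet> b))"
      by (auto simp: q_def power2_norm_eq_inner inner_simps inner_commute algebra_simps)
    have "(q has_real_derivative (2 * (z \<bullet> b) + 2 * \<sigma> * (b \<bullet> b))) (at \<sigma> within {0..1})"
      unfolding q' by (auto intro!: derivative_eq_intros)
    from DERIV_image_chain[OF 1 this]
    have "((\<lambda>\<sigma>. Ff x (q \<sigma>)) has_real_derivative f x (q \<sigma>) * (2 * (z \<bullet> b) + 2 * \<sigma> * (b \<bullet> b))) (at \<sigma> within {0..1})" by (simp add: o_def)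
    hence "((\<lambda>\<sigma>. Ff x (q \<sigma>) / 2) has_real_derivative f x (q \<sigma>) * (2 * (z \<bullet> b) + 2 * \<sigma> * (b \<bullet> b)) / 2) (at \<sigma> within {0..1})"
      by (rule DERIV_cdivide)
    moreover have "f x (q \<sigma>) * (2 * (z \<bullet> b) + 2 * \<sigma> * (b \<bullet> b)) / 2 = Nn x (z + \<sigma> *\<^sub>R b) \<bullet> b"
      by (simp add: Nn_def q_def inner_simps algebra_simps)
    ultimately show ?thesis by (simp add: has_field_derivative_def mult_commute_abs)
  qed
  obtain \<sigma> where "\<sigma> \<in> {0..1}" "Ff x (q 1) / 2 - Ff x (q 0) / 2 = (1 - 0) * (Nn x (z + \<sigma> *\<^sub>R b) \<bullet> b)"
    using mvt_very_simple[of 0 1 "\<lambda>\<sigma>. Ff x (q \<sigma>) / 2" "\<lambda>\<sigma> h. h * (Nn x (z + \<sigma> *\<^sub>R b) \<bullet> b)"] der by auto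
  thus ?thesis by (intro bexI[of _ \<sigma>]) (auto simp: q_def)
qed

definition I :: "(real^'n \<Rightarrow> complex) \<Rightarrow> real" where
  "I u = (nrm u)\<^sup>2 / 2 - (\<integral>x. Ff x ((cmod (u x))\<^sup>2) \<partial>lborel) / 2"

definition D :: "(real^'n \<Rightarrow> complex) \<Rightarrow> (real^'n \<Rightarrow> complex) \<Rightarrow> real" where
  "D u v = ip u v - (\<integral>x. Nn x (u x) \<bullet> v x \<partial>lborel)"

lemma Ff_integrable: assumes "u \<in> E" shows "integrable lborel (\<lambda>x. Ff x ((cmod (u x))\<^sup>2))"
proof (rule Bochner_Integration.integrable_bound)
  note [measurable] = E_measurable[OF assms]
  show "integrable lborel (\<lambda>x. C1 * cmod (u x) powr ps)" using assms by auto
  show "AE x in lborel. norm (Ff x ((cmod (u x))\<^sup>2)) \<le> norm (C1 * cmod (u x) powr ps)"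
    using Ff_le[of "(cmod (u _))\<^sup>2"] C1_nonneg Ff_nonneg by (intro AE_I2) (simp add: power2_powr_half)
  show "(\<lambda>x. Ff x ((cmod (u x))\<^sup>2)) \<in> borel_measurable lborel" by measurable
qed

lemma Ff_integral_le: assumes "u \<in> E" shows "(\<integral>x. Ff x ((cmod (u x))\<^sup>2) \<partial>lborel) \<le> C1 * (\<integral>x. cmod (u x) powr ps \<partial>lborel)"
proof -
  have "(\<integral>x. Ff x ((cmod (u x))\<^sup>2) \<partial>lborel) \<le> (\<integral>x. C1 * cmod (u x) powr ps \<partial>lborel)"
    using Ff_integrable[OF assms] assms Ff_le[of "(cmod (u _))\<^sup>2"] by (intro integral_mono) (auto simp: power2_powr_half)
  thus ?thesis by simp
qed

lemma Nn_pair_le: "\<bar>Nn x z \<bullet> w\<bar> \<le> C1 * (cmod z powr ps + cmod w powr ps)"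
proof -
  have "\<bar>Nn x z \<bullet> w\<bar> \<le> cmod (Nn x z) * cmod w" by (rule Cauchy_Schwarz_ineq2)
  also have "\<dots> \<le> C1 * cmod z powr (ps-1) * cmod w" by (intro mult_right_mono norm_Nn_le) auto
  also have "\<dots> \<le> C1 * (cmod z powr ps + cmod w powr ps)"
    using powr_pred_mult_le[of "cmod z" "cmod w" ps] ps_gt_2 C1_nonneg by (simp add: mult.assoc mult_left_mono)
  finally show ?thesis .
qed

lemma Nn_integrable: assumes "u \<in> E" "v \<in> E" shows "integrable lborel (\<lambda>x. Nn x (u x) \<bullet> v x)"
proof (rule Bochner_Integration.integrable_bound)
  note [measurable] = E_measurable[OF assms(1)] E_measurable[OF assms(2)]
  show "integrable lborel (\<lambda>x. C1 * (cmod (u x) powr ps + cmod (v x) powr ps))" using assms by auto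
  show "AE x in lborel. norm (Nn x (u x) \<bullet> v x) \<le> norm (C1 * (cmod (u x) powr ps + cmod (v x) powr ps))"
    using Nn_pair_le C1_nonneg by (intro AE_I2) simp
  show "(\<lambda>x. Nn x (u x) \<bullet> v x) \<in> borel_measurable lborel" by measurable
qed

lemma D_add: assumes "u \<in> E" "v \<in> E" "w \<in> E" shows "D u (v + w) = D u v + D u w"
  using assms by (simp add: D_def ip_add inner_add_right Nn_integrable)

lemma D_scale: assumes "u \<in> E" "v \<in> E" shows "D u (c *\<^sub>R v) = c * D u v"
  using assms by (simp add: D_def ip_scale right_diff_distrib)

lemma zero_nrm_AE:
  assumes "v \<in> E" "nrm v = 0" shows "AE x in lborel. v x = 0"
proof -
  note [measurable] = E_measurable[OF assms(1)]
  have "(\<integral>x. cmod (v x) powr ps \<partial>lborel) \<le> 0" using sobolev_nrm[OF assms(1)] assms(2) by simp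
  moreover have "(\<integral>x. cmod (v x) powr ps \<partial>lborel) \<ge> 0" by (simp add: integral_nonneg_AE)
  ultimately have "(\<integral>x. cmod (v x) powr ps \<partial>lborel) = 0" by simp
  hence "AE x in lborel. cmod (v x) powr ps = 0"
    using assms(1) by (subst (asm) integral_nonneg_eq_0_iff_AE) auto
  thus ?thesis by eventually_elim auto
qed

lemma scaled_powr_bound:
  assumes "v \<in> E" "nrm v > 0"
  shows "integrable lborel (\<lambda>x. (cmod (v x) / nrm v) powr ps)" "(\<integral>x. (cmod (v x) / nrm v) powr ps \<partial>lborel) \<le> Cs powr (ps/2)"
proof -
  have w: "(1 / nrm v) *\<^sub>R v \<in> E" "nrm ((1 / nrm v) *\<^sub>R v) \<le> 1" using assms by (auto simp: nrm_scale intro: E_scale)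
  have e: "cmod (((1 / nrm v) *\<^sub>R v) x) = cmod (v x) / nrm v" for x using assms by simp
  show "integrable lborel (\<lambda>x. (cmod (v x) / nrm v) powr ps)" using E_powr[OF w(1)] unfolding e .
  show "(\<integral>x. (cmod (v x) / nrm v) powr ps \<partial>lborel) \<le> Cs powr (ps/2)" using powr_bound_of_nrm[OF w] unfolding e by simp
qed

text \<open>\<open>Nn_pair_le\<close> is not homogeneous in \<phi>, so it is applied to \<phi>
  scaled to norm one. If the seminorm of \<phi> is 0, the Sobolev inequality forces \<phi> = 0 a.e.
  and the nonlinear term vanishes.\<close>

lemma D_bounded: "\<exists>C. \<forall>u\<in>E. nrm u \<le> \<rho> \<longrightarrow> (\<forall>\<phi>\<in>E. \<bar>D u \<phi>\<bar> \<le> C * nrm \<phi>)"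
proof (intro exI[of _ "\<rho> + C1 * ((Cs * \<rho>\<^sup>2) powr (ps/2) + Cs powr (ps/2))"] ballI impI)
  fix u \<phi> assume u: "u \<in> E" "nrm u \<le> \<rho>" and p: "\<phi> \<in> E"
  note [measurable] = E_measurable[OF u(1)] E_measurable[OF p]
  let ?K = "C1 * ((Cs * \<rho>\<^sup>2) powr (ps/2) + Cs powr (ps/2))"
  have "\<bar>ip u \<phi>\<bar> \<le> \<rho> * nrm \<phi>" using ip_CS[OF u(1) p] mult_right_mono[OF u(2), of "nrm \<phi>"] by simp
  moreover have "\<bar>\<integral>x. Nn x (u x) \<bullet> \<phi> x \<partial>lborel\<bar> \<le> ?K * nrm \<phi>"
  proof (cases "nrm \<phi> = 0")
    case True
    have "(\<integral>x. Nn x (u x) \<bullet> \<phi> x \<partial>lborel) = 0"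
      by (rule integral_eq_zero_AE) (rule eventually_mono[OF zero_nrm_AE[OF p True]], simp)
    thus ?thesis using True by simp
  next
    case False
    hence b: "nrm \<phi> > 0" using nrm_nonneg[of \<phi>] by linarith
    have i: "integrable lborel (\<lambda>x. Nn x (u x) \<bullet> ((1 / nrm \<phi>) *\<^sub>R \<phi>) x)" using Nn_integrable[OF u(1) E_scale[OF p]] .
    have "\<bar>\<integral>x. Nn x (u x) \<bullet> ((1 / nrm \<phi>) *\<^sub>R \<phi>) x \<partial>lborel\<bar> \<le> (\<integral>x. \<bar>Nn x (u x) \<bullet> ((1 / nrm \<phi>) *\<^sub>R \<phi>) x\<bar> \<partial>lborel)"
      by (rule integral_abs_bound)
    also have "\<dots> \<le> (\<integral>x. C1 * (cmod (u x) powr ps + (cmod (\<phi> x) / nrm \<phi>) powr ps) \<partial>lborel)"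
    proof (rule integral_mono)
      show "integrable lborel (\<lambda>x. \<bar>Nn x (u x) \<bullet> ((1 / nrm \<phi>) *\<^sub>R \<phi>) x\<bar>)" using i by (rule integrable_abs)
      show "integrable lborel (\<lambda>x. C1 * (cmod (u x) powr ps + (cmod (\<phi> x) / nrm \<phi>) powr ps))"
        using E_powr[OF u(1)] scaled_powr_bound(1)[OF p b] by simp
      show "\<bar>Nn x (u x) \<bullet> ((1 / nrm \<phi>) *\<^sub>R \<phi>) x\<bar> \<le> C1 * (cmod (u x) powr ps + (cmod (\<phi> x) / nrm \<phi>) powr ps)" for x
        using Nn_pair_le[of x "u x" "((1 / nrm \<phi>) *\<^sub>R \<phi>) x"] b by simp
    qed
    also have "\<dots> = C1 * ((\<integral>x. cmod (u x) powr ps \<partial>lborel) + (\<integral>x. (cmod (\<phi> x) / nrm \<phi>) powr ps \<partial>lborel))"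
      using E_powr[OF u(1)] scaled_powr_bound(1)[OF p b] by simp
    also have "\<dots> \<le> ?K"
      using powr_bound_of_nrm[OF u] scaled_powr_bound(2)[OF p b] C1_nonneg by (intro mult_left_mono add_mono)
    finally have "\<bar>(\<integral>x. Nn x (u x) \<bullet> \<phi> x \<partial>lborel) / nrm \<phi>\<bar> \<le> ?K" by simp
    thus ?thesis using b by (simp add: field_simps)
  qed
  ultimately show "\<bar>D u \<phi>\<bar> \<le> (\<rho> + ?K) * nrm \<phi>" unfolding D_def distrib_right by linarith
qed

text \<open>The common compactness step for Taylor remainders and for weak limits: whatever tends to
  0 a.e. and is bounded by the nonlinearity at points of size at most y_n tends to 0 in the dual
  Lebesgue space. \<open>f_compact\<close> provides the domination for
  \<open>integral_tendsto_zero_uniform\<close>.\<close>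

lemma vanish:
  fixes \<Delta> y :: "nat \<Rightarrow> real^'n \<Rightarrow> real"
  assumes [measurable]: "\<And>n. \<Delta> n \<in> borel_measurable borel" and \<Delta>0: "\<And>n x. \<Delta> n x \<ge> 0"
    and yi: "\<And>n. integrable lborel (\<lambda>x. y n x powr ps)" and yC: "\<And>n. (\<integral>x. y n x powr ps \<partial>lborel) \<le> C"
    and lim: "AE x in lborel. (\<lambda>n. \<Delta> n x) \<longlonglongrightarrow> 0"
    and bd: "\<And>n x. \<exists>z z'. cmod z \<le> y n x \<and> cmod z' \<le> y n x \<and> \<Delta> n x \<le> cmod (Nn x z) + cmod (Nn x z')"
  shows "integrable lborel (\<lambda>x. \<Delta> n x powr (ps/(ps-1)))" "(\<lambda>n. \<integral>x. \<Delta> n x powr (ps/(ps-1)) \<partial>lborel) \<longlonglongrightarrow> 0"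
proof -
  let ?r = "ps/(ps-1)"
  have r0: "?r > 0" using ps_gt_2 by simp
  have lim': "AE x in lborel. (\<lambda>n. \<Delta> n x powr ?r) \<longlonglongrightarrow> 0"
    using lim
  proof eventually_elim
    case (elim x)
    have "(\<lambda>n. \<Delta> n x powr ?r) \<longlonglongrightarrow> 0 powr ?r"
      using elim r0 \<Delta>0 by (intro tendsto_powr') (auto intro!: always_eventually)
    thus ?case by simp
  qed
  have bound: "\<exists>\<Psi>. integrable lborel \<Psi> \<and> (\<forall>n x. \<Delta> n x powr ?r \<le> \<delta> * y n x powr ps + \<Psi> x)" if \<delta>: "\<delta> > 0" for \<delta>
  proof -
    define \<delta>' where "\<delta>' = \<delta> / (2 * 2 powr ?r)"
    have d': "\<delta>' > 0" "2 powr ?r * (2 * \<delta>') = \<delta>" using \<delta> by (auto simp: \<delta>'_def)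
    obtain \<Psi> where P: "integrable lborel \<Psi>" "\<And>x t. t \<ge> 0 \<Longrightarrow> (f x (t\<^sup>2) * t) powr ?r \<le> \<delta>' * t powr ps + \<Psi> x"
      using f_compact[OF d'(1)] by auto
    show ?thesis
    proof (intro exI[of _ "\<lambda>x. 2 powr ?r * (2 * \<Psi> x)"] conjI allI)
      fix n x
      obtain z z' where z: "cmod z \<le> y n x" "cmod z' \<le> y n x" "\<Delta> n x \<le> cmod (Nn x z) + cmod (Nn x z')" using bd by blast
      have b: "cmod (Nn x w) powr ?r \<le> \<delta>' * y n x powr ps + \<Psi> x" if "cmod w \<le> y n x" for w
      proof -
        have "cmod (Nn x w) powr ?r \<le> \<delta>' * cmod w powr ps + \<Psi> x" unfolding norm_Nn by (rule P(2)) simp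
        also have "\<dots> \<le> \<delta>' * y n x powr ps + \<Psi> x" using that d' ps_gt_2 by (intro add_right_mono mult_left_mono powr_mono2) auto
        finally show ?thesis .
      qed
      have "\<Delta> n x powr ?r \<le> (cmod (Nn x z) + cmod (Nn x z')) powr ?r" using z \<Delta>0 r0 by (intro powr_mono2) auto
      also have "\<dots> \<le> 2 powr ?r * (cmod (Nn x z) powr ?r + cmod (Nn x z') powr ?r)" using r0 by (intro powr_add_le) auto
      also have "\<dots> \<le> 2 powr ?r * ((\<delta>' * y n x powr ps + \<Psi> x) + (\<delta>' * y n x powr ps + \<Psi> x))"
        using b z by (intro mult_left_mono add_mono) auto
      also have "\<dots> = (2 powr ?r * (2 * \<delta>')) * y n x powr ps + 2 powr ?r * (2 * \<Psi> x)" by (simp add: algebra_simps)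
      finally show "\<Delta> n x powr ?r \<le> \<delta> * y n x powr ps + 2 powr ?r * (2 * \<Psi> x)" unfolding d'(2) .
    qed (use P in simp)
  qed
  show "integrable lborel (\<lambda>x. \<Delta> n x powr ?r)" "(\<lambda>n. \<integral>x. \<Delta> n x powr ?r \<partial>lborel) \<longlonglongrightarrow> 0"
    by (rule integral_tendsto_zero_uniform[OF _ _ _ yi yC lim' bound]; simp)+
qed

end

section \<open>Differentiability, weak limits and nontrivial critical points\<close>

context mag_nl
begin

lemma Nn_tendsto_diff:
  assumes "a \<longlonglongrightarrow> U" "b \<longlonglongrightarrow> U" shows "(\<lambda>n. cmod (Nn x (a n) - Nn x (b n))) \<longlonglongrightarrow> 0"
proof -
  have "(\<lambda>n. Nn x (a n) - Nn x (b n)) \<longlonglongrightarrow> Nn x U - Nn x U"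
    by (intro tendsto_diff isCont_tendsto_compose[OF Nn_continuous] assms)
  thus ?thesis by (simp add: tendsto_norm_zero)
qed

lemma integral_sum_powr_le:
  assumes a: "integrable lborel (\<lambda>x. a x powr ps)" "\<And>x. a x \<ge> (0::real)" "(\<integral>x. a x powr ps \<partial>lborel) \<le> S1"
    and b: "integrable lborel (\<lambda>x. b x powr ps)" "\<And>x. b x \<ge> 0" "(\<integral>x. b x powr ps \<partial>lborel) \<le> S2"
    and [measurable]: "a \<in> borel_measurable borel" "b \<in> borel_measurable borel"
  shows "integrable lborel (\<lambda>x. (a x + b x) powr ps)" "(\<integral>x. (a x + b x) powr ps \<partial>(lborel::(real^'n) measure)) \<le> 2 powr ps * (S1 + S2)"
proof -
  have le: "(a x + b x) powr ps \<le> 2 powr ps * (a x powr ps + b x powr ps)" for x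
    using a(2)[of x] b(2)[of x] ps_gt_2 by (intro powr_add_le) auto
  have i: "integrable lborel (\<lambda>x. 2 powr ps * (a x powr ps + b x powr ps))" using a b by simp
  show I: "integrable lborel (\<lambda>x. (a x + b x) powr ps)"
    by (rule Bochner_Integration.integrable_bound[OF i]) (use le in \<open>auto intro!: AE_I2\<close>)
  have "(\<integral>x. (a x + b x) powr ps \<partial>lborel) \<le> (\<integral>x. 2 powr ps * (a x powr ps + b x powr ps) \<partial>lborel)"
    by (rule integral_mono[OF I i le])
  also have "\<dots> = 2 powr ps * ((\<integral>x. a x powr ps \<partial>lborel) + (\<integral>x. b x powr ps \<partial>lborel))" using a b by simp
  also have "\<dots> \<le> 2 powr ps * (S1 + S2)" using a b by (intro mult_left_mono add_mono) auto
  finally show "(\<integral>x. (a x + b x) powr ps \<partial>lborel) \<le> 2 powr ps * (S1 + S2)" .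
qed

definition remainder :: "(real^'n \<Rightarrow> complex) \<Rightarrow> (real^'n \<Rightarrow> complex) \<Rightarrow> real^'n \<Rightarrow> real" where
  "remainder u v x = Ff x ((cmod (u x + v x))\<^sup>2) / 2 - Ff x ((cmod (u x))\<^sup>2) / 2 - Nn x (u x) \<bullet> v x"

lemma remainder_integrable: assumes "u \<in> E" "v \<in> E" shows "integrable lborel (remainder u v)"
  using Ff_integrable[OF E_add[OF assms]] Ff_integrable[OF assms(1)] Nn_integrable[OF assms]
  unfolding remainder_def[abs_def] by simp

lemma remainder_integral: assumes "u \<in> E" "v \<in> E"
  shows "I (u + v) - I u - D u v = (nrm v)\<^sup>2 / 2 - (\<integral>x. remainder u v x \<partial>lborel)"
  using Ff_integrable[OF E_add[OF assms]] Ff_integrable[OF assms(1)] Nn_integrable[OF assms] ip_expand[OF assms]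
  unfolding remainder_def I_def D_def nrm_sq by (simp add: field_simps)

lemma remainder_bound: "\<exists>\<sigma>\<in>{0..1}. \<bar>remainder u v x\<bar> \<le> cmod (Nn x (u x + \<sigma> *\<^sub>R v x) - Nn x (u x)) * cmod (v x)"
proof -
  obtain \<sigma> where s: "\<sigma> \<in> {0..1}" "Ff x ((cmod (u x + v x))\<^sup>2) / 2 - Ff x ((cmod (u x))\<^sup>2) / 2 = Nn x (u x + \<sigma> *\<^sub>R v x) \<bullet> v x"
    using Ff_mean_value by blast
  hence "remainder u v x = (Nn x (u x + \<sigma> *\<^sub>R v x) - Nn x (u x)) \<bullet> v x" by (simp add: remainder_def inner_diff_left)
  thus ?thesis using s(1) by (auto intro!: bexI[of _ \<sigma>] Cauchy_Schwarz_ineq2)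
qed

text \<open>By contradiction and compactness, which avoids a quantitative modulus of continuity for
  the nonlinearity: along a bad sequence Rellich gives a.e. convergence of u_n, the Sobolev
  inequality gives \<phi>_n to 0 a.e., and the remainder divided by |\<phi>_n| vanishes in the dual
  Lebesgue space.\<close>

lemma taylor:
  assumes \<epsilon>: "\<epsilon> > 0"
  shows "\<exists>\<delta>>0. \<forall>u\<in>E. \<forall>\<phi>\<in>E. nrm u \<le> \<rho> \<longrightarrow> nrm \<phi> \<le> \<delta> \<longrightarrow> \<bar>I (u + \<phi>) - I u - D u \<phi>\<bar> \<le> \<epsilon> * nrm \<phi>"
proof (rule ccontr)
  let ?r = "ps/(ps-1)"
  assume neg: "\<not> ?thesis"
  \<comment> \<open>The bound by \<epsilon> lets the quadratic term (nrm \<phi>)^2/2 absorb at most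
    half of \<epsilon> nrm \<phi>, so the other half must come from the integral remainder.\<close>
  have "\<exists>u \<phi>. u \<in> E \<and> \<phi> \<in> E \<and> nrm u \<le> \<rho> \<and> nrm \<phi> \<le> min \<epsilon> (1 / real (Suc n)) \<and> \<bar>I (u + \<phi>) - I u - D u \<phi>\<bar> > \<epsilon> * nrm \<phi>" for n
  proof -
    have "min \<epsilon> (1 / real (Suc n)) > 0" using \<epsilon> by simp
    thus ?thesis using neg by (meson not_le)
  qed
  then obtain u \<phi> where H: "\<And>n. u n \<in> E" "\<And>n. \<phi> n \<in> E" "\<And>n. nrm (u n) \<le> \<rho>" "\<And>n. nrm (\<phi> n) \<le> min \<epsilon> (1 / real (Suc n))"
      "\<And>n. \<bar>I (u n + \<phi> n) - I (u n) - D (u n) (\<phi> n)\<bar> > \<epsilon> * nrm (\<phi> n)" by metis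
  have big: "(\<epsilon>/2) * nrm (\<phi> n) < \<bar>\<integral>x. remainder (u n) (\<phi> n) x \<partial>lborel\<bar>" for n
  proof -
    have "nrm (\<phi> n) * nrm (\<phi> n) \<le> \<epsilon> * nrm (\<phi> n)" using H(4)[of n] by (intro mult_right_mono) auto
    hence "(nrm (\<phi> n))\<^sup>2 / 2 \<le> (\<epsilon>/2) * nrm (\<phi> n)" by (simp add: power2_eq_square)
    moreover have "(nrm (\<phi> n))\<^sup>2 / 2 \<ge> 0" by simp
    ultimately show ?thesis using H(5)[of n] unfolding remainder_integral[OF H(1,2)] by linarith
  qed
  have pos: "nrm (\<phi> n) > 0" for n
  proof (rule ccontr)
    assume "\<not> nrm (\<phi> n) > 0"
    hence z: "nrm (\<phi> n) = 0" using nrm_nonneg[of "\<phi> n"] by linarith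
    have "(\<integral>x. remainder (u n) (\<phi> n) x \<partial>lborel) = 0"
      by (rule integral_eq_zero_AE) (rule eventually_mono[OF zero_nrm_AE[OF H(2) z]], simp add: remainder_def)
    thus False using big[of n] z by simp
  qed
  obtain k U where k: "strict_mono (k::nat\<Rightarrow>nat)" "AE x in lborel. (\<lambda>n. u (k n) x) \<longlonglongrightarrow> U x"
    by (rule rellich[OF H(1,3)])
  note [measurable] = E_measurable[OF H(1)] E_measurable[OF H(2)]
  have lim0: "(\<lambda>n. \<integral>x. norm (cmod (\<phi> (k n) x) powr ps) \<partial>lborel) \<longlonglongrightarrow> 0"
  proof (rule tendsto_sandwich[OF _ _ tendsto_const])
    show "\<forall>\<^sub>F n in sequentially. (\<integral>x. norm (cmod (\<phi> (k n) x) powr ps) \<partial>lborel) \<le> (Cs * (1 / real (Suc (k n)))\<^sup>2) powr (ps/2)"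
      using H(4) by (intro always_eventually allI) (auto intro!: powr_bound_of_nrm[OF H(2), simplified])
    have "(\<lambda>n. (1 / real (Suc (k n)))) \<longlonglongrightarrow> 0"
      using LIMSEQ_subseq_LIMSEQ[OF LIMSEQ_Suc[OF lim_1_over_n[where 'a=real]] k(1)] by (simp add: o_def)
    hence "(\<lambda>n. Cs * (1 / real (Suc (k n)))\<^sup>2) \<longlonglongrightarrow> Cs * 0\<^sup>2" by (intro tendsto_intros)
    hence "(\<lambda>n. (Cs * (1 / real (Suc (k n)))\<^sup>2) powr (ps/2)) \<longlonglongrightarrow> (Cs * 0\<^sup>2) powr (ps/2)"
      using ps_gt_2 Cs_pos by (intro tendsto_powr') (auto intro!: always_eventually)
    thus "(\<lambda>n. (Cs * (1 / real (Suc (k n)))\<^sup>2) powr (ps/2)) \<longlonglongrightarrow> 0" by simp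
  qed (auto intro!: always_eventually integral_nonneg_AE)
  obtain r where r: "strict_mono (r::nat\<Rightarrow>nat)" "AE x in lborel. (\<lambda>n. cmod (\<phi> (k (r n)) x) powr ps) \<longlonglongrightarrow> 0"
    using tendsto_L1_AE_subseq[of lborel "\<lambda>n x. cmod (\<phi> (k n) x) powr ps", OF E_powr[OF H(2)] lim0] by blast
  define u' \<phi>' where "u' n = u (k (r n))" and "\<phi>' n = \<phi> (k (r n))" for n
  have H': "u' n \<in> E" "\<phi>' n \<in> E" "nrm (u' n) \<le> \<rho>" "nrm (\<phi>' n) \<le> 1" "nrm (\<phi>' n) > 0" for n
  proof -
    have "min \<epsilon> (1 / real (Suc (k (r n)))) \<le> 1 / real (Suc (k (r n)))" by simp
    also have "\<dots> \<le> 1" by simp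
    finally show "nrm (\<phi>' n) \<le> 1" using H(4)[of "k (r n)"] unfolding \<phi>'_def by linarith
  qed (use H pos in \<open>auto simp: u'_def \<phi>'_def\<close>)
  note [measurable] = E_measurable[OF H'(1)] E_measurable[OF H'(2)]
  have limu: "AE x in lborel. (\<lambda>n. u' n x) \<longlonglongrightarrow> U x \<and> (\<lambda>n. \<phi>' n x) \<longlonglongrightarrow> 0"
    using k(2) r(2)
  proof eventually_elim
    case (elim x)
    have "(\<lambda>n. (cmod (\<phi>' n x) powr ps) powr (1/ps)) \<longlonglongrightarrow> 0 powr (1/ps)"
      using elim(2) ps_gt_2 unfolding \<phi>'_def by (intro tendsto_powr') (auto intro!: always_eventually)
    hence "(\<lambda>n. \<phi>' n x) \<longlonglongrightarrow> 0" using ps_gt_2 by (simp add: powr_powr tendsto_norm_zero_iff)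
    thus ?case using LIMSEQ_subseq_LIMSEQ[OF elim(1) r(1)] by (simp add: u'_def o_def)
  qed
  \<comment> \<open>The intermediate points \<sigma> come from the mean value theorem separately for
    each x, without any measurability in x; this quotient is measurable and is dominated by the same
    difference. Where \<phi>' vanishes it is 0, as division by 0 gives 0.\<close>
  define \<Delta> where "\<Delta> n x = \<bar>remainder (u' n) (\<phi>' n) x\<bar> / cmod (\<phi>' n x)" for n x
  have [measurable]: "remainder (u' n) (\<phi>' n) \<in> borel_measurable borel" for n using remainder_integrable[OF H'(1,2)] by auto
  have [measurable]: "\<Delta> n \<in> borel_measurable borel" for n unfolding \<Delta>_def[abs_def] by measurable
  have "\<exists>\<sigma>\<in>{0..1}. \<bar>remainder (u' n) (\<phi>' n) x\<bar> \<le> cmod (Nn x (u' n x + \<sigma> *\<^sub>R \<phi>' n x) - Nn x (u' n x)) * cmod (\<phi>' n x)" for n x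
    by (rule remainder_bound)
  then obtain \<sigma> where s: "\<And>n x. \<sigma> n x \<in> {0..1}" "\<And>n x. \<bar>remainder (u' n) (\<phi>' n) x\<bar> \<le> cmod (Nn x (u' n x + \<sigma> n x *\<^sub>R \<phi>' n x) - Nn x (u' n x)) * cmod (\<phi>' n x)"
    by metis
  have \<Delta>le: "\<Delta> n x \<le> cmod (Nn x (u' n x + \<sigma> n x *\<^sub>R \<phi>' n x) - Nn x (u' n x))" for n x
    using s(2)[of n x] by (cases "\<phi>' n x = 0") (auto simp: \<Delta>_def field_simps)
  have \<Delta>0: "\<Delta> n x \<ge> 0" for n x by (simp add: \<Delta>_def)
  have lim\<Delta>: "AE x in lborel. (\<lambda>n. \<Delta> n x) \<longlonglongrightarrow> 0"
    using limu
  proof eventually_elim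
    case (elim x)
    have "(\<lambda>n. \<sigma> n x *\<^sub>R \<phi>' n x) \<longlonglongrightarrow> 0"
    proof (rule Lim_null_comparison[OF always_eventually tendsto_norm_zero[OF conjunct2[OF elim]]], rule allI)
      show "norm (\<sigma> n x *\<^sub>R \<phi>' n x) \<le> norm (\<phi>' n x)" for n using s(1)[of n x] by (simp add: mult_left_le_one_le)
    qed
    hence "(\<lambda>n. u' n x + \<sigma> n x *\<^sub>R \<phi>' n x) \<longlonglongrightarrow> U x + 0" using elim by (intro tendsto_add) auto
    hence "(\<lambda>n. cmod (Nn x (u' n x + \<sigma> n x *\<^sub>R \<phi>' n x) - Nn x (u' n x))) \<longlonglongrightarrow> 0" using elim by (intro Nn_tendsto_diff) auto
    thus ?case by (rule tendsto_sandwich[OF _ _ tendsto_const, rotated 2]) (auto intro!: always_eventually \<Delta>0 \<Delta>le)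
  qed
  define y where "y n x = cmod (u' n x) + cmod (\<phi>' n x)" for n x
  note Su = powr_bound_of_nrm[OF H'(1,3)] and Sp = powr_bound_of_nrm[OF H'(2,4)]
  have yi: "integrable lborel (\<lambda>x. y n x powr ps)" and yC: "(\<integral>x. y n x powr ps \<partial>lborel) \<le> 2 powr ps * ((Cs * \<rho>\<^sup>2) powr (ps/2) + (Cs * 1\<^sup>2) powr (ps/2))" for n
    unfolding y_def using integral_sum_powr_le[OF E_powr[OF H'(1)] _ Su E_powr[OF H'(2)] _ Sp] by auto
  have bd: "\<exists>z z'. cmod z \<le> y n x \<and> cmod z' \<le> y n x \<and> \<Delta> n x \<le> cmod (Nn x z) + cmod (Nn x z')" for n x
  proof (intro exI conjI)
    have "cmod (u' n x + \<sigma> n x *\<^sub>R \<phi>' n x) \<le> cmod (u' n x) + \<sigma> n x * cmod (\<phi>' n x)"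
      using norm_triangle_ineq[of "u' n x" "\<sigma> n x *\<^sub>R \<phi>' n x"] s(1)[of n x] by simp
    also have "\<dots> \<le> y n x" unfolding y_def using s(1)[of n x] by (simp add: mult_left_le_one_le)
    finally show "cmod (u' n x + \<sigma> n x *\<^sub>R \<phi>' n x) \<le> y n x" .
    show "cmod (u' n x) \<le> y n x" by (simp add: y_def)
    show "\<Delta> n x \<le> cmod (Nn x (u' n x + \<sigma> n x *\<^sub>R \<phi>' n x)) + cmod (Nn x (u' n x))"
      using \<Delta>le[of n x] norm_triangle_ineq4 by (rule order_trans)
  qed
  note van = vanish[OF _ \<Delta>0 yi yC lim\<Delta> bd, simplified]
  define C where "C = Cs powr (ps/2)"
  have C0: "C \<ge> 0" by (simp add: C_def)
  define \<epsilon>2 where "\<epsilon>2 = \<epsilon> / (4 * (C + 1))"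
  have e2: "\<epsilon>2 > 0" "\<epsilon>2 * C \<le> \<epsilon>/4" using \<epsilon> C0 by (auto simp: \<epsilon>2_def field_simps)
  obtain K where K: "K \<ge> 0" "\<And>a b. a \<ge> 0 \<Longrightarrow> b \<ge> 0 \<Longrightarrow> a * b \<le> K * a powr ?r + \<epsilon>2 * b powr ps"
    using young_small[of ps \<epsilon>2] ps_gt_2 e2 by auto
  have "(\<lambda>n. K * (\<integral>x. \<Delta> n x powr ?r \<partial>lborel)) \<longlonglongrightarrow> K * 0" by (intro tendsto_mult tendsto_const van(2))
  hence "\<forall>\<^sub>F n in sequentially. K * (\<integral>x. \<Delta> n x powr ?r \<partial>lborel) < \<epsilon>/4" using \<epsilon> by (intro order_tendstoD) auto
  then obtain n where n: "K * (\<integral>x. \<Delta> n x powr ?r \<partial>lborel) < \<epsilon>/4" by (auto simp: eventually_sequentially)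
  let ?b = "nrm (\<phi>' n)"
  have eq: "\<bar>remainder (u' n) (\<phi>' n) x\<bar> = ?b * (\<Delta> n x * (cmod (\<phi>' n x) / ?b))" for x
  proof (cases "\<phi>' n x = 0")
    case True
    thus ?thesis using s(2)[of n x] by simp
  next
    case False
    thus ?thesis using H'(5)[of n] by (simp add: \<Delta>_def)
  qed
  have "\<bar>\<integral>x. remainder (u' n) (\<phi>' n) x \<partial>lborel\<bar> \<le> (\<integral>x. \<bar>remainder (u' n) (\<phi>' n) x\<bar> \<partial>lborel)"
    by (rule integral_abs_bound)
  also have "\<dots> \<le> (\<integral>x. ?b * (K * \<Delta> n x powr ?r + \<epsilon>2 * (cmod (\<phi>' n x) / ?b) powr ps) \<partial>lborel)"
  proof (rule integral_mono)
    show "integrable lborel (\<lambda>x. \<bar>remainder (u' n) (\<phi>' n) x\<bar>)" using remainder_integrable[OF H'(1,2)] by simp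
    show "integrable lborel (\<lambda>x. ?b * (K * \<Delta> n x powr ?r + \<epsilon>2 * (cmod (\<phi>' n x) / ?b) powr ps))"
      using van(1) scaled_powr_bound(1)[OF H'(2,5)] by simp
    show "\<bar>remainder (u' n) (\<phi>' n) x\<bar> \<le> ?b * (K * \<Delta> n x powr ?r + \<epsilon>2 * (cmod (\<phi>' n x) / ?b) powr ps)" for x
      unfolding eq by (intro mult_left_mono K(2) \<Delta>0) auto
  qed
  also have "\<dots> = ?b * (K * (\<integral>x. \<Delta> n x powr ?r \<partial>lborel) + \<epsilon>2 * (\<integral>x. (cmod (\<phi>' n x) / ?b) powr ps \<partial>lborel))"
    using van(1) scaled_powr_bound(1)[OF H'(2,5)] by simp
  also have "\<dots> \<le> ?b * (\<epsilon>/4 + \<epsilon>2 * C)"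
    using n scaled_powr_bound(2)[OF H'(2,5), of n] e2 unfolding C_def by (intro mult_left_mono add_mono) auto
  also have "\<dots> \<le> ?b * (\<epsilon>/4 + \<epsilon>/4)" using e2 by (intro mult_left_mono add_left_mono) auto
  also have "\<dots> = (\<epsilon>/2) * nrm (\<phi>' n)" by simp
  finally show False using big[of "k (r n)"] unfolding u'_def \<phi>'_def by linarith
qed

lemma mountain_pass_axioms: "mountain_pass E nrm I D"
proof
qed (use E_zero E_add E_scale nrm_scale nrm_triangle D_add D_scale taylor D_bounded in auto)

text \<open>The quadratic part is treated as two L2 pairings, of magnetic increments under
  \<open>KM s\<close> and of sqrt(V) u under Lebesgue measure; the nonlinear part converges strongly
  in the dual Lebesgue space by \<open>vanish\<close>.\<close>

lemma weak_limit:
  assumes uE: "\<And>n. u n \<in> E" and \<rho>: "\<And>n. nrm (u n) \<le> \<rho>" and [measurable]: "U \<in> borel_measurable borel"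
    and lim: "AE x in lborel. (\<lambda>n. u n x) \<longlonglongrightarrow> U x"
  shows "U \<in> E" "(\<integral>x. cmod (U x) powr ps \<partial>lborel) \<le> (Cs * \<rho>\<^sup>2) powr (ps/2)"
    "(\<lambda>n. \<integral>x. cmod (Nn x (u n x) - Nn x (U x)) powr (ps/(ps-1)) \<partial>lborel) \<longlonglongrightarrow> 0"
    "integrable lborel (\<lambda>x. cmod (Nn x (u n x) - Nn x (U x)) powr (ps/(ps-1)))"
    "\<And>\<phi>. \<phi> \<in> E \<Longrightarrow> (\<lambda>n. D (u n) \<phi>) \<longlonglongrightarrow> D U \<phi>"
proof -
  let ?r = "ps/(ps-1)"
  note [measurable] = E_measurable[OF uE]
  have limp: "AE x in lborel. (\<lambda>n. cmod (u n x) powr ps) \<longlonglongrightarrow> cmod (U x) powr ps"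
    using lim by eventually_elim (use ps_gt_2 in \<open>intro tendsto_powr' tendsto_norm tendsto_const, auto\<close>)
  note SU = powr_bound_of_nrm[OF uE \<rho>]
  show "(\<integral>x. cmod (U x) powr ps \<partial>lborel) \<le> (Cs * \<rho>\<^sup>2) powr (ps/2)"
    by (rule fatou_integrable[OF E_powr[OF uE] _ SU limp]; simp)
  have UC: "(\<integral>x. cmod (U x) powr ps \<partial>lborel) \<le> (Cs * \<rho>\<^sup>2) powr (ps/2)" and Ui: "integrable lborel (\<lambda>x. cmod (U x) powr ps)"
    by (rule fatou_integrable[OF E_powr[OF uE] _ SU limp]; simp)+
  have bnd: "(\<integral>z. (cmod (magd A (u n) z))\<^sup>2 \<partial>KM s) \<le> \<rho>\<^sup>2" "(\<integral>x. (cmod (of_real (sqrt (V x)) * u n x))\<^sup>2 \<partial>lborel) \<le> \<rho>\<^sup>2" for n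
  proof -
    have "(nrm (u n))\<^sup>2 \<le> \<rho>\<^sup>2" by (intro power_mono \<rho>) simp
    hence "(\<integral>z. (cmod (magd A (u n) z))\<^sup>2 \<partial>KM s) + (\<integral>x. V x * (cmod (u n x))\<^sup>2 \<partial>lborel) \<le> \<rho>\<^sup>2" by (simp add: nrm_sq ip_self)
    moreover have "(\<integral>z. (cmod (magd A (u n) z))\<^sup>2 \<partial>KM s) \<ge> 0" "(\<integral>x. V x * (cmod (u n x))\<^sup>2 \<partial>lborel) \<ge> 0"
      using V0 by (auto intro!: integral_nonneg_AE)
    moreover have eq: "(cmod (of_real (sqrt (V x)) * u n x))\<^sup>2 = V x * (cmod (u n x))\<^sup>2" for x
      using V0 by (simp add: norm_mult power_mult_distrib)
    ultimately show "(\<integral>z. (cmod (magd A (u n) z))\<^sup>2 \<partial>KM s) \<le> \<rho>\<^sup>2" "(\<integral>x. (cmod (of_real (sqrt (V x)) * u n x))\<^sup>2 \<partial>lborel) \<le> \<rho>\<^sup>2" unfolding eq by linarith+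
  qed
  have lim1: "AE z in KM s. (\<lambda>n. magd A (u n) z) \<longlonglongrightarrow> magd A U z"
    using AE_KM_both[OF lim] unfolding magd_def mag_diff_def
    by eventually_elim (auto intro!: tendsto_intros)
  have lim2: "AE x in lborel. (\<lambda>n. complex_of_real (sqrt (V x)) * u n x) \<longlonglongrightarrow> complex_of_real (sqrt (V x)) * U x"
    using lim by eventually_elim (auto intro!: tendsto_intros)
  have mm: "magd A v \<in> borel_measurable (KM s)" if "v \<in> borel_measurable borel" for v
    using measurable_magd'[OF that] by (simp add: measurable_KM_borel_eq)
  have mV: "(\<lambda>x. complex_of_real (sqrt (V x)) * v x) \<in> borel_measurable lborel" if [measurable]: "v \<in> borel_measurable borel" for v
    by measurable
  have UE: "U \<in> E"
  proof -
    have "integrable (KM s) (\<lambda>z. (cmod (magd A U z))\<^sup>2)"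
      by (rule L2_weak_limit(1)[OF mm mm mm E_magd[OF uE] bnd(1) lim1 E_magd[OF uE[of 0]]]) measurable
    moreover have "integrable lborel (\<lambda>x. (cmod (of_real (sqrt (V x)) * U x))\<^sup>2)"
      by (rule L2_weak_limit(1)[OF mV mV mV E_sqrtV[OF uE] bnd(2) lim2 E_sqrtV[OF uE[of 0]]]) measurable
    ultimately show ?thesis using Ui V0 by (simp add: E_iff norm_mult power_mult_distrib)
  qed
  thus "U \<in> E" .
  define \<Delta> where "\<Delta> n x = cmod (Nn x (u n x) - Nn x (U x))" for n x
  have [measurable]: "\<Delta> n \<in> borel_measurable borel" for n unfolding \<Delta>_def[abs_def] by measurable
  have \<Delta>0: "\<Delta> n x \<ge> 0" for n x by (simp add: \<Delta>_def)
  have lim\<Delta>: "AE x in lborel. (\<lambda>n. \<Delta> n x) \<longlonglongrightarrow> 0"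
    using lim unfolding \<Delta>_def by eventually_elim (auto intro!: Nn_tendsto_diff)
  have yi: "integrable lborel (\<lambda>x. (cmod (u n x) + cmod (U x)) powr ps)"
    and yC: "(\<integral>x. (cmod (u n x) + cmod (U x)) powr ps \<partial>lborel) \<le> 2 powr ps * ((Cs * \<rho>\<^sup>2) powr (ps/2) + (Cs * \<rho>\<^sup>2) powr (ps/2))" for n
    using integral_sum_powr_le[OF E_powr[OF uE] _ SU Ui _ UC] by auto
  have bd: "\<exists>z z'. cmod z \<le> cmod (u n x) + cmod (U x) \<and> cmod z' \<le> cmod (u n x) + cmod (U x) \<and> \<Delta> n x \<le> cmod (Nn x z) + cmod (Nn x z')" for n x
    unfolding \<Delta>_def by (rule exI[of _ "u n x"], rule exI[of _ "U x"]) (auto intro: norm_triangle_ineq4)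
  note van = vanish[OF _ \<Delta>0 yi yC lim\<Delta> bd, simplified]
  show "(\<lambda>n. \<integral>x. cmod (Nn x (u n x) - Nn x (U x)) powr ?r \<partial>lborel) \<longlonglongrightarrow> 0"
    "integrable lborel (\<lambda>x. cmod (Nn x (u n x) - Nn x (U x)) powr ?r)"
    using van by (auto simp: \<Delta>_def)
  fix \<phi> assume p: "\<phi> \<in> E"
  note [measurable] = E_measurable[OF p]
  have l1: "(\<lambda>n. \<integral>z. magd A (u n) z \<bullet> magd A \<phi> z \<partial>KM s) \<longlonglongrightarrow> (\<integral>z. magd A U z \<bullet> magd A \<phi> z \<partial>KM s)"
    by (rule L2_weak_limit(3)[OF mm mm mm E_magd[OF uE] bnd(1) lim1 E_magd[OF p]]) measurable
  have "(\<lambda>n. \<integral>x. (complex_of_real (sqrt (V x)) * u n x) \<bullet> (complex_of_real (sqrt (V x)) * \<phi> x) \<partial>lborel) \<longlonglongrightarrow> (\<integral>x. (complex_of_real (sqrt (V x)) * U x) \<bullet> (complex_of_real (sqrt (V x)) * \<phi> x) \<partial>lborel)"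
    by (rule L2_weak_limit(3)[OF mV mV mV E_sqrtV[OF uE] bnd(2) lim2 E_sqrtV[OF p]]) measurable
  moreover have "(complex_of_real (sqrt (V x)) * a) \<bullet> (complex_of_real (sqrt (V x)) * b) = V x * (a \<bullet> b)" for a b x
  proof -
    have "(complex_of_real (sqrt (V x)) * a) \<bullet> (complex_of_real (sqrt (V x)) * b) = (sqrt (V x) * sqrt (V x)) * (a \<bullet> b)"
      by (simp add: scaleR_conv_of_real[symmetric])
    thus ?thesis using V0 by simp
  qed
  ultimately have l2: "(\<lambda>n. \<integral>x. V x * (u n x \<bullet> \<phi> x) \<partial>lborel) \<longlonglongrightarrow> (\<integral>x. V x * (U x \<bullet> \<phi> x) \<partial>lborel)" by (simp only:)
  have l3: "(\<lambda>n. \<integral>x. Nn x (u n x) \<bullet> \<phi> x \<partial>lborel) \<longlonglongrightarrow> (\<integral>x. Nn x (U x) \<bullet> \<phi> x \<partial>lborel)"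
  proof (rule LIMSEQ_I)
    fix \<epsilon> :: real assume \<epsilon>: "\<epsilon> > 0"
    define C where "C = (\<integral>x. cmod (\<phi> x) powr ps \<partial>lborel)"
    have C0: "C \<ge> 0" by (simp add: C_def integral_nonneg_AE)
    define \<epsilon>2 where "\<epsilon>2 = \<epsilon> / (2 * (C + 1))"
    have e2: "\<epsilon>2 > 0" "\<epsilon>2 * C \<le> \<epsilon>/2" using \<epsilon> C0 by (auto simp: \<epsilon>2_def field_simps)
    obtain K where K: "K \<ge> 0" "\<And>a b. a \<ge> 0 \<Longrightarrow> b \<ge> 0 \<Longrightarrow> a * b \<le> K * a powr ?r + \<epsilon>2 * b powr ps"
      using young_small[of ps \<epsilon>2] ps_gt_2 e2 by auto
    have "(\<lambda>n. K * (\<integral>x. \<Delta> n x powr ?r \<partial>lborel)) \<longlonglongrightarrow> K * 0" by (intro tendsto_mult tendsto_const van(2))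
    hence "\<forall>\<^sub>F n in sequentially. K * (\<integral>x. \<Delta> n x powr ?r \<partial>lborel) < \<epsilon>/2" using \<epsilon> by (intro order_tendstoD) auto
    then obtain n0 where n0: "\<And>n. n \<ge> n0 \<Longrightarrow> K * (\<integral>x. \<Delta> n x powr ?r \<partial>lborel) < \<epsilon>/2" by (auto simp: eventually_sequentially)
    have "norm ((\<integral>x. Nn x (u n x) \<bullet> \<phi> x \<partial>lborel) - (\<integral>x. Nn x (U x) \<bullet> \<phi> x \<partial>lborel)) < \<epsilon>" if "n \<ge> n0" for n
    proof -
      have i: "integrable lborel (\<lambda>x. (Nn x (u n x) - Nn x (U x)) \<bullet> \<phi> x)"
        using Nn_integrable[OF uE p] Nn_integrable[OF UE p] by (simp add: inner_diff_left)
      have "(\<integral>x. Nn x (u n x) \<bullet> \<phi> x \<partial>lborel) - (\<integral>x. Nn x (U x) \<bullet> \<phi> x \<partial>lborel) = (\<integral>x. (Nn x (u n x) - Nn x (U x)) \<bullet> \<phi> x \<partial>lborel)"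
        using Nn_integrable[OF uE p] Nn_integrable[OF UE p] by (simp add: inner_diff_left)
      also have "norm \<dots> \<le> (\<integral>x. norm ((Nn x (u n x) - Nn x (U x)) \<bullet> \<phi> x) \<partial>lborel)" by (rule integral_norm_bound)
      also have "\<dots> \<le> (\<integral>x. K * \<Delta> n x powr ?r + \<epsilon>2 * cmod (\<phi> x) powr ps \<partial>lborel)"
      proof (rule integral_mono)
        show "integrable lborel (\<lambda>x. norm ((Nn x (u n x) - Nn x (U x)) \<bullet> \<phi> x))" using i by (rule integrable_norm)
        show "integrable lborel (\<lambda>x. K * \<Delta> n x powr ?r + \<epsilon>2 * cmod (\<phi> x) powr ps)" using van(1) E_powr[OF p] by simp
        fix x
        have "norm ((Nn x (u n x) - Nn x (U x)) \<bullet> \<phi> x) \<le> \<Delta> n x * cmod (\<phi> x)"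
          unfolding \<Delta>_def real_norm_def by (rule Cauchy_Schwarz_ineq2)
        also have "\<dots> \<le> K * \<Delta> n x powr ?r + \<epsilon>2 * cmod (\<phi> x) powr ps" by (intro K(2) \<Delta>0) simp
        finally show "norm ((Nn x (u n x) - Nn x (U x)) \<bullet> \<phi> x) \<le> K * \<Delta> n x powr ?r + \<epsilon>2 * cmod (\<phi> x) powr ps" .
      qed
      also have "\<dots> = K * (\<integral>x. \<Delta> n x powr ?r \<partial>lborel) + \<epsilon>2 * C" using van(1) E_powr[OF p] by (simp add: C_def)
      also have "\<dots> < \<epsilon>" using n0[OF that] e2 by linarith
      finally show ?thesis .
    qed
    thus "\<exists>no. \<forall>n\<ge>no. norm ((\<integral>x. Nn x (u n x) \<bullet> \<phi> x \<partial>lborel) - (\<integral>x. Nn x (U x) \<bullet> \<phi> x \<partial>lborel)) < \<epsilon>" by blast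
  qed
  show "(\<lambda>n. D (u n) \<phi>) \<longlonglongrightarrow> D U \<phi>"
    unfolding D_def ip_def by (intro tendsto_diff tendsto_add l1 l2 l3)
qed

text \<open>Almost critical points are bounded by the coercivity assumption, and an a.e. limit of
  them is critical by \<open>weak_limit\<close>. It is nontrivial because otherwise the nonlinear
  pairing, hence also the norm, would tend to 0 along the sequence, while the energy stays above
  \<alpha>/2.\<close>

theorem mountain_pass_solution:
  assumes r: "r > 0" and \<alpha>: "\<alpha> > 0"
    and geo: "\<And>u. u \<in> E \<Longrightarrow> r/2 \<le> nrm u \<Longrightarrow> nrm u \<le> r \<Longrightarrow> I u \<ge> \<alpha>"
    and e: "e \<in> E" "nrm e > r" "I e \<le> 0" and path: "\<And>t. 0 \<le> t \<Longrightarrow> t \<le> 1 \<Longrightarrow> I (t *\<^sub>R e) \<le> b0"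
    and c: "c > 0" and \<theta>: "\<theta> \<ge> 1" and AR: "\<And>u. u \<in> E \<Longrightarrow> c * (nrm u)\<^sup>2 \<le> I u - D u u / \<theta>"
  obtains U where "U \<in> E" "\<And>\<phi>. \<phi> \<in> E \<Longrightarrow> D U \<phi> = 0" "\<not> (AE x in lborel. U x = 0)"
    "(\<integral>x. cmod (U x) powr ps \<partial>lborel) \<le> (Cs * ((b0 + 1) / c + 1)\<^sup>2) powr (ps/2)"
proof -
  let ?r = "ps/(ps-1)"
  interpret mp: mountain_pass E nrm I D by (rule mountain_pass_axioms)
  have I0: "I 0 = 0" by (simp add: I_def nrm_sq ip_self magd_def mag_diff_def Ff_0)
  have b00: "b0 \<ge> 0" using path[of 0] I0 by simp
  \<comment> \<open>For t = nrm u > 1 coercivity reads c t^2 \<le> b0 + t \<le> (b0 + 1) t.\<close>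
  define \<rho> where "\<rho> = (b0 + 1) / c + 1"
  have \<rho>: "\<rho> \<ge> 1" using b00 c by (simp add: \<rho>_def)
  have "\<exists>u\<in>E. \<alpha>/2 < I u \<and> I u \<le> b0 \<and> (\<forall>\<phi>\<in>E. nrm \<phi> \<le> 1 \<longrightarrow> D u \<phi> > - (1 / real (Suc n)))" for n
    by (rule mp.mountain_pass[OF I0 r \<alpha> geo e path]) auto
  then obtain u where u: "\<And>n. u n \<in> E" "\<And>n. \<alpha>/2 < I (u n)" "\<And>n. I (u n) \<le> b0"
    "\<And>n \<phi>. \<phi> \<in> E \<Longrightarrow> nrm \<phi> \<le> 1 \<Longrightarrow> D (u n) \<phi> > - (1 / real (Suc n))" by metis
  have D1: "\<bar>D (u n) \<phi>\<bar> \<le> 1 / real (Suc n)" if "\<phi> \<in> E" "nrm \<phi> \<le> 1" for n \<phi>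
  proof -
    have "nrm ((-1) *\<^sub>R \<phi>) \<le> 1" unfolding nrm_scale using that by simp
    from u(4)[OF E_scale[OF that(1)] this, of n] have "- (1 / real (Suc n)) < - D (u n) \<phi>"
      unfolding D_scale[OF u(1) that(1)] by simp
    thus ?thesis using u(4)[OF that, of n] by linarith
  qed
  have D2: "\<bar>D (u n) \<phi>\<bar> \<le> (nrm \<phi> + 1) / real (Suc n)" if "\<phi> \<in> E" for n \<phi>
  proof -
    have p: "nrm \<phi> + 1 > 0" using nrm_nonneg[of \<phi>] by linarith
    have "\<bar>D (u n) ((1 / (nrm \<phi> + 1)) *\<^sub>R \<phi>)\<bar> \<le> 1 / real (Suc n)"
      using p by (intro D1 E_scale that) (simp add: nrm_scale)
    hence "\<bar>D (u n) \<phi> / (nrm \<phi> + 1)\<bar> \<le> 1 / real (Suc n)" using D_scale[OF u(1) that] by simp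
    thus ?thesis using p by (simp add: field_simps abs_divide)
  qed
  have bound: "nrm (u n) \<le> \<rho>" for n
  proof (rule ccontr)
    assume "\<not> ?thesis"
    hence g: "nrm (u n) > \<rho>" by simp
    let ?t = "nrm (u n)"
    have t: "?t > 1" using g \<rho> by simp
    have "\<bar>D (u n) (u n)\<bar> \<le> ?t"
    proof -
      have "\<bar>D (u n) ((1/?t) *\<^sub>R u n)\<bar> \<le> 1 / real (Suc n)" using t by (intro D1 E_scale u) (simp add: nrm_scale)
      also have "\<dots> \<le> 1" by simp
      finally have "\<bar>D (u n) (u n) / ?t\<bar> \<le> 1" using D_scale[OF u(1) u(1)] by simp
      thus ?thesis using t by (simp add: abs_divide)
    qed
    moreover have "\<bar>D (u n) (u n) / \<theta>\<bar> \<le> \<bar>D (u n) (u n)\<bar>" using \<theta> divide_left_mono[of 1 \<theta> "\<bar>D (u n) (u n)\<bar>"] by (simp add: abs_divide)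
    ultimately have "c * ?t\<^sup>2 \<le> b0 + ?t" using AR[OF u(1), of n] u(3)[of n] by linarith
    also have "\<dots> \<le> b0 * ?t + ?t" using b00 t mult_left_mono[of 1 ?t b0] by simp
    finally have "(c * ?t) * ?t \<le> (b0 + 1) * ?t" by (simp add: power2_eq_square algebra_simps)
    hence "c * ?t \<le> b0 + 1" using t by simp
    hence "?t \<le> (b0 + 1) / c" using c by (simp add: field_simps)
    thus False using g by (simp add: \<rho>_def)
  qed
  obtain k U where k: "strict_mono (k::nat\<Rightarrow>nat)" "U \<in> borel_measurable borel" "AE x in lborel. (\<lambda>n. u (k n) x) \<longlonglongrightarrow> U x"
    by (rule rellich[OF u(1) bound])
  note wl = weak_limit[of "\<lambda>n. u (k n)", OF u(1) bound k(2,3)]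
  have inv: "(\<lambda>n. 1 / real (Suc (k n))) \<longlonglongrightarrow> 0"
    using LIMSEQ_subseq_LIMSEQ[OF LIMSEQ_Suc[OF lim_1_over_n[where 'a=real]] k(1)] by (simp add: o_def)
  show thesis
  proof (rule that[OF wl(1)])
    show "(\<integral>x. cmod (U x) powr ps \<partial>lborel) \<le> (Cs * ((b0 + 1) / c + 1)\<^sup>2) powr (ps/2)" using wl(2) by (simp add: \<rho>_def)
    fix \<phi> assume p: "\<phi> \<in> E"
    have "(\<lambda>n. D (u (k n)) \<phi>) \<longlonglongrightarrow> 0"
    proof (rule Lim_null_comparison[OF always_eventually], rule allI)
      show "norm (D (u (k n)) \<phi>) \<le> (nrm \<phi> + 1) * (1 / real (Suc (k n)))" for n using D2[OF p, of "k n"] by simp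
      show "(\<lambda>n. (nrm \<phi> + 1) * (1 / real (Suc (k n)))) \<longlonglongrightarrow> 0" using tendsto_mult_right_zero[OF inv] .
    qed
    with wl(5)[OF p] show "D U \<phi> = 0" by (rule LIMSEQ_unique)
  next
    show "\<not> (AE x in lborel. U x = 0)"
    proof
      assume U0: "AE x in lborel. U x = 0"
      have nz: "Nn x 0 = 0" for x by (simp add: Nn_def)
      have e1: "(\<integral>x. cmod (Nn x (u (k n) x) - Nn x (U x)) powr ?r \<partial>lborel) = (\<integral>x. cmod (Nn x (u (k n) x)) powr ?r \<partial>lborel)" for n
      proof (rule integral_cong_AE)
        note [measurable] = E_measurable[OF u(1)] k(2)
        show "(\<lambda>x. cmod (Nn x (u (k n) x) - Nn x (U x)) powr ?r) \<in> borel_measurable lborel" by measurable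
        show "(\<lambda>x. cmod (Nn x (u (k n) x)) powr ?r) \<in> borel_measurable lborel" by measurable
        show "AE x in lborel. cmod (Nn x (u (k n) x) - Nn x (U x)) powr ?r = cmod (Nn x (u (k n) x)) powr ?r"
          using U0 by eventually_elim (simp add: nz)
      qed
      have e2: "integrable lborel (\<lambda>x. cmod (Nn x (u (k n) x)) powr ?r)" for n
      proof (rule integrable_cong_AE_imp[OF wl(4)[of n]])
        note [measurable] = E_measurable[OF u(1)]
        show "(\<lambda>x. cmod (Nn x (u (k n) x)) powr ?r) \<in> borel_measurable lborel" by measurable
        show "AE x in lborel. cmod (Nn x (u (k n) x) - Nn x (U x)) powr ?r = cmod (Nn x (u (k n) x)) powr ?r"
          using U0 by eventually_elim (simp add: nz)
      qed
      define S where "S = (Cs * \<rho>\<^sup>2) powr (ps/2)"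
      have S0: "S \<ge> 0" by (simp add: S_def)
      define \<epsilon>2 where "\<epsilon>2 = \<alpha> / (2 * (S + 1))"
      have ee: "\<epsilon>2 > 0" "\<epsilon>2 * S \<le> \<alpha>/2" using \<alpha> S0 by (auto simp: \<epsilon>2_def field_simps)
      obtain K where K: "K \<ge> 0" "\<And>a b. a \<ge> 0 \<Longrightarrow> b \<ge> 0 \<Longrightarrow> a * b \<le> K * a powr ?r + \<epsilon>2 * b powr ps"
        using young_small[of ps \<epsilon>2] ps_gt_2 ee by auto
      have "(\<lambda>n. K * (\<integral>x. cmod (Nn x (u (k n) x)) powr ?r \<partial>lborel)) \<longlonglongrightarrow> K * 0" by (intro tendsto_mult tendsto_const wl(3)[unfolded e1])
      moreover have "(\<lambda>n. (\<rho> + 1) * (1 / real (Suc (k n)))) \<longlonglongrightarrow> (\<rho> + 1) * 0" by (intro tendsto_mult tendsto_const inv)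
      ultimately have "(\<lambda>n. K * (\<integral>x. cmod (Nn x (u (k n) x)) powr ?r \<partial>lborel) + (\<rho> + 1) * (1 / real (Suc (k n)))) \<longlonglongrightarrow> K * 0 + (\<rho> + 1) * 0" by (rule tendsto_add)
      hence "\<forall>\<^sub>F n in sequentially. K * (\<integral>x. cmod (Nn x (u (k n) x)) powr ?r \<partial>lborel) + (\<rho> + 1) * (1 / real (Suc (k n))) < \<alpha>/2" using \<alpha> by (intro order_tendstoD) auto
      then obtain n where n: "K * (\<integral>x. cmod (Nn x (u (k n) x)) powr ?r \<partial>lborel) + (\<rho> + 1) * (1 / real (Suc (k n))) < \<alpha>/2" by (auto simp: eventually_sequentially)
      let ?v = "u (k n)"
      have "(\<integral>x. Nn x (?v x) \<bullet> ?v x \<partial>lborel) \<le> (\<integral>x. K * cmod (Nn x (?v x)) powr ?r + \<epsilon>2 * cmod (?v x) powr ps \<partial>lborel)"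
      proof (rule integral_mono)
        show "integrable lborel (\<lambda>x. Nn x (?v x) \<bullet> ?v x)" by (rule Nn_integrable[OF u(1) u(1)])
        show "integrable lborel (\<lambda>x. K * cmod (Nn x (?v x)) powr ?r + \<epsilon>2 * cmod (?v x) powr ps)" using e2 E_powr[OF u(1)] by simp
        show "Nn x (?v x) \<bullet> ?v x \<le> K * cmod (Nn x (?v x)) powr ?r + \<epsilon>2 * cmod (?v x) powr ps" for x
          using norm_cauchy_schwarz K(2)[of "cmod (Nn x (?v x))" "cmod (?v x)"] by (meson norm_ge_zero order_trans)
      qed
      also have "\<dots> = K * (\<integral>x. cmod (Nn x (?v x)) powr ?r \<partial>lborel) + \<epsilon>2 * (\<integral>x. cmod (?v x) powr ps \<partial>lborel)"
        using e2 E_powr[OF u(1)] by simp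
      also have "\<dots> \<le> K * (\<integral>x. cmod (Nn x (?v x)) powr ?r \<partial>lborel) + \<epsilon>2 * S"
        using powr_bound_of_nrm[OF u(1) bound, of "k n"] ee unfolding S_def by (intro add_left_mono mult_left_mono) auto
      finally have NN: "(\<integral>x. Nn x (?v x) \<bullet> ?v x \<partial>lborel) \<le> K * (\<integral>x. cmod (Nn x (?v x)) powr ?r \<partial>lborel) + \<alpha>/2" using ee by linarith
      have "D ?v ?v \<le> (\<rho> + 1) * (1 / real (Suc (k n)))"
      proof -
        have "D ?v ?v \<le> (nrm ?v + 1) / real (Suc (k n))" using D2[OF u(1), of "k n" "k n"] by linarith
        also have "\<dots> \<le> (\<rho> + 1) / real (Suc (k n))" using bound by (intro divide_right_mono) auto
        finally show ?thesis by simp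
      qed
      \<comment> \<open>D v v and the nonlinear pairing are both small, and their sum is the squared
        norm; the energy is at most half of it because the primitive is nonnegative.\<close>
      hence "(nrm ?v)\<^sup>2 < \<alpha>" using NN n unfolding nrm_sq D_def by linarith
      moreover have "I ?v \<le> (nrm ?v)\<^sup>2 / 2" unfolding I_def by (simp add: integral_nonneg_AE Ff_nonneg)
      ultimately show False using u(2)[of "k n"] by linarith
    qed
  qed
qed

end

section \<open>Sup bound and decay of critical points\<close>

definition shrink :: "real \<Rightarrow> complex \<Rightarrow> complex" where
  "shrink v a = (if a = 0 then 0 else (max 0 (cmod a - v) / cmod a) *\<^sub>R a)"

lemma norm_shrink: assumes "v \<ge> 0" shows "cmod (shrink v a) = max 0 (cmod a - v)"
  using assms by (auto simp: shrink_def)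

text \<open>Equivariance under phases turns the magnetic increment of the thresholded function into
  an ordinary difference of two thresholded values.\<close>

lemma shrink_rotate: assumes "cmod c = 1" shows "shrink v a * c = shrink v (a * c)"
  using assms by (auto simp: shrink_def norm_mult)

text \<open>Above the threshold shrink v a = a - v a/|a|, and v/|a| < 1 bounds the change of the
  unit vector term by 2 |a-b|; hence the constant 3. Moving the threshold costs at most its
  displacement. The bound shows that the test function has finite magnetic energy.\<close>

lemma shrink_lipschitz:
  assumes v: "v1 \<ge> 0" "v2 \<ge> 0"
  shows "cmod (shrink v1 a - shrink v2 b) \<le> 3 * cmod (a - b) + \<bar>v1 - v2\<bar>"
proof -
  have 1: "cmod (shrink v a - shrink v b) \<le> 3 * cmod (a - b)" if v0: "v \<ge> 0" for v a b
  proof -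
    have ab: "\<bar>cmod a - cmod b\<bar> \<le> cmod (a - b)" by (rule norm_triangle_ineq3)
    consider "cmod b \<le> v" | "cmod a \<le> v" | "cmod a > v" "cmod b > v" by linarith
    thus ?thesis
    proof cases
      case 1
      hence "cmod (shrink v b) = 0" using norm_shrink[OF v0, of b] by simp
      hence "shrink v b = 0" by simp
      hence "cmod (shrink v a - shrink v b) = max 0 (cmod a - v)" using norm_shrink[OF v0, of a] by simp
      also have "\<dots> \<le> 3 * cmod (a - b)" using 1 ab by auto
      finally show ?thesis .
    next
      case 2
      hence "cmod (shrink v a) = 0" using norm_shrink[OF v0, of a] by simp
      hence "shrink v a = 0" by simp
      hence "cmod (shrink v a - shrink v b) = max 0 (cmod b - v)" using norm_shrink[OF v0, of b] by simp
      also have "\<dots> \<le> 3 * cmod (a - b)" using 2 ab by auto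
      finally show ?thesis .
    next
      case 3
      hence n: "cmod a > 0" "cmod b > 0" using v0 by auto
      have "shrink v a - shrink v b = (a - b) - v *\<^sub>R ((1 / cmod a) *\<^sub>R (a - b) + (1 / cmod a - 1 / cmod b) *\<^sub>R b)"
      proof -
        have "shrink v a = a - (v / cmod a) *\<^sub>R a" using 3 n by (auto simp: shrink_def diff_divide_distrib scaleR_left_diff_distrib)
        moreover have "shrink v b = b - (v / cmod b) *\<^sub>R b" using 3 n by (auto simp: shrink_def diff_divide_distrib scaleR_left_diff_distrib)
        ultimately show ?thesis by (simp add: scaleR_diff_left scaleR_diff_right scaleR_add_right)
      qed
      hence "cmod (shrink v a - shrink v b) \<le> cmod (a - b) + v * cmod ((1 / cmod a) *\<^sub>R (a - b) + (1 / cmod a - 1 / cmod b) *\<^sub>R b)"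
        using norm_triangle_ineq4[of "a - b" "v *\<^sub>R ((1 / cmod a) *\<^sub>R (a - b) + (1 / cmod a - 1 / cmod b) *\<^sub>R b)"] v0 by simp
      also have "cmod ((1 / cmod a) *\<^sub>R (a - b) + (1 / cmod a - 1 / cmod b) *\<^sub>R b) \<le> cmod (a - b) / cmod a + cmod (a - b) / cmod a"
      proof (rule norm_triangle_le, rule add_mono)
        show "norm ((1 / cmod a) *\<^sub>R (a - b)) \<le> cmod (a - b) / cmod a" by simp
        have "1 / cmod a - 1 / cmod b = (cmod b - cmod a) / (cmod a * cmod b)" using n by (simp add: field_simps)
        hence "norm ((1 / cmod a - 1 / cmod b) *\<^sub>R b) = \<bar>cmod b - cmod a\<bar> / cmod a" using n by (simp add: abs_mult)
        also have "\<dots> \<le> cmod (a - b) / cmod a" using ab n by (intro divide_right_mono) auto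
        finally show "norm ((1 / cmod a - 1 / cmod b) *\<^sub>R b) \<le> cmod (a - b) / cmod a" .
      qed
      also have "v * (cmod (a - b) / cmod a + cmod (a - b) / cmod a) = (v / cmod a) * (2 * cmod (a - b))" by simp
      also have "\<dots> \<le> 1 * (2 * cmod (a - b))" using 3 n v0 by (intro mult_right_mono) auto
      finally show ?thesis using v0 by (simp add: mult_left_mono)
    qed
  qed
  have 2: "cmod (shrink v1 b - shrink v2 b) \<le> \<bar>v1 - v2\<bar>"
  proof (cases "b = 0")
    case False
    have "shrink v1 b - shrink v2 b = ((max 0 (cmod b - v1) - max 0 (cmod b - v2)) / cmod b) *\<^sub>R b"
      using False by (simp add: shrink_def diff_divide_distrib scaleR_left_diff_distrib)
    hence "cmod (shrink v1 b - shrink v2 b) = \<bar>max 0 (cmod b - v1) - max 0 (cmod b - v2)\<bar>" using False by simp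
    also have "\<dots> \<le> \<bar>v1 - v2\<bar>" by auto
    finally show ?thesis .
  qed (simp add: shrink_def)
  have "cmod (shrink v1 a - shrink v2 b) \<le> cmod (shrink v1 a - shrink v1 b) + cmod (shrink v1 b - shrink v2 b)"
    using norm_triangle_ineq[of "shrink v1 a - shrink v1 b" "shrink v1 b - shrink v2 b"] by simp
  thus ?thesis using 1[OF v(1), of a b] 2 by linarith
qed

text \<open>Only the cross term depends on the phases, and it enters with the nonpositive
  coefficient -(x+y); Cauchy-Schwarz replaces it by the product of moduli.\<close>

lemma diamagnetic_product:
  fixes a b :: complex
  assumes "x \<ge> 0" "y \<ge> 0"
  shows "(cmod a - cmod b) * (x * cmod a - y * cmod b) \<le> (a - b) \<bullet> (x *\<^sub>R a - y *\<^sub>R b)"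
proof -
  have "(x + y) * (a \<bullet> b) \<le> (x + y) * (cmod a * cmod b)" using assms by (intro mult_left_mono norm_cauchy_schwarz) auto
  moreover have "(a - b) \<bullet> (x *\<^sub>R a - y *\<^sub>R b) = x * (cmod a)\<^sup>2 + y * (cmod b)\<^sup>2 - (x + y) * (a \<bullet> b)"
    by (simp add: inner_simps inner_commute power2_norm_eq_inner algebra_simps)
  ultimately show ?thesis by (simp add: power2_eq_square algebra_simps)
qed

text \<open>With p = a - v and q = b - w this is the monotonicity inequality (p^+ - q^+)^2 \<le> (p
  - q)(p^+ - q^+), rearranged so that the increment of the comparison function appears as a separate
  term.\<close>

lemma positive_part_product:
  fixes a b v w :: real
  shows "(max 0 (a - v) - max 0 (b - w))\<^sup>2 + (v - w) * (max 0 (a - v) - max 0 (b - w)) \<le> (a - b) * (max 0 (a - v) - max 0 (b - w))"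
proof -
  have 1: "(max 0 p - max 0 q)\<^sup>2 \<le> (p - q) * (max 0 p - max 0 q)" for p q :: real
  proof -
    consider "p \<ge> 0" "q \<ge> 0" | "p \<ge> 0" "q < 0" | "p < 0" "q \<ge> 0" | "p < 0" "q < 0" by linarith
    thus ?thesis
    proof cases
      case 2
      hence "p * q \<le> 0" by (simp add: mult_nonneg_nonpos)
      thus ?thesis using 2 by (simp add: power2_eq_square algebra_simps)
    next
      case 3
      hence "p * q \<le> 0" by (simp add: mult_nonpos_nonneg)
      thus ?thesis using 3 by (simp add: power2_eq_square algebra_simps)
    qed (simp_all add: power2_eq_square)
  qed
  from 1[of "a - v" "b - w"] show ?thesis by (simp add: algebra_simps)
qed

text \<open>A bounded Lipschitz function has squared increments at most C min(1, |x-y|^2), so they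
  are integrable over all pairs that meet a set of finite measure.\<close>

lemma KM_trunc_integrable:
  fixes S :: "(real^'n) set"
  assumes s: "0 < s" "s < 1" and [measurable]: "S \<in> sets borel" and fin: "emeasure lborel S < \<infinity>"
  shows "integrable (KM s) (\<lambda>z. min 1 ((norm (fst z - snd z))\<^sup>2) * (indicator S (fst z) + indicator S (snd z)))"
proof -
  define k where "k = (\<integral>\<^sup>+z. ennreal (min 1 ((norm z)\<^sup>2) / norm z powr (real DIM(real^'n) + 2 * s)) \<partial>(lborel :: (real^'n) measure))"
  have k: "k < \<infinity>" unfolding k_def by (rule nn_integral_kernel_trunc[OF s])
  have 1: "(\<integral>\<^sup>+z. ennreal (min 1 ((norm (fst z - snd z))\<^sup>2) * indicator S (fst z)) \<partial>KM s) < \<infinity>"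
  proof -
    have "(\<integral>\<^sup>+z. ennreal (min 1 ((norm (fst z - snd z))\<^sup>2) * indicator S (fst z)) \<partial>KM s)
      = (\<integral>\<^sup>+x. \<integral>\<^sup>+y. ennreal (1 / norm (x - y) powr (real DIM(real^'n) + 2 * s)) * ennreal (min 1 ((norm (x - y))\<^sup>2) * indicator S x) \<partial>lborel \<partial>lborel)"
      by (subst nn_integral_KM) auto
    also have "\<dots> = (\<integral>\<^sup>+x. indicator S x * k \<partial>lborel)"
    proof (intro nn_integral_cong)
      fix x :: "real^'n"
      have "(\<integral>\<^sup>+y. ennreal (1 / norm (x - y) powr (real DIM(real^'n) + 2 * s)) * ennreal (min 1 ((norm (x - y))\<^sup>2) * indicator S x) \<partial>lborel)
        = (\<integral>\<^sup>+y. indicator S x * ennreal (min 1 ((norm (x - y))\<^sup>2) / norm (x - y) powr (real DIM(real^'n) + 2 * s)) \<partial>lborel)"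
        by (intro nn_integral_cong) (auto simp: indicator_def ennreal_mult[symmetric])
      also have "\<dots> = indicator S x * (\<integral>\<^sup>+y. ennreal (min 1 ((norm (x - y))\<^sup>2) / norm (x - y) powr (real DIM(real^'n) + 2 * s)) \<partial>lborel)"
        by (rule nn_integral_cmult) measurable
      also have "(\<integral>\<^sup>+y. ennreal (min 1 ((norm (x - y))\<^sup>2) / norm (x - y) powr (real DIM(real^'n) + 2 * s)) \<partial>lborel) = k"
        unfolding k_def by (rule nn_integral_lborel_reflect) measurable
      finally show "(\<integral>\<^sup>+y. ennreal (1 / norm (x - y) powr (real DIM(real^'n) + 2 * s)) * ennreal (min 1 ((norm (x - y))\<^sup>2) * indicator S x) \<partial>lborel) = indicator S x * k" .
    qed
    also have "\<dots> = emeasure lborel S * k" by (subst nn_integral_multc) auto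
    also have "\<dots> < \<infinity>" using fin k by (simp add: ennreal_mult_less_top)
    finally show ?thesis .
  qed
  have "(\<integral>\<^sup>+z. ennreal (min 1 ((norm (fst z - snd z))\<^sup>2) * indicator S (snd z)) \<partial>KM s)
    = (\<integral>\<^sup>+z. ennreal (min 1 ((norm (fst z - snd z))\<^sup>2) * indicator S (fst z)) \<partial>KM s)"
    using nn_integral_KM_swap[of "\<lambda>z. ennreal (min 1 ((norm (fst z - snd z))\<^sup>2) * indicator S (fst z))" s]
    by (simp add: split_def norm_minus_commute)
  hence 2: "(\<integral>\<^sup>+z. ennreal (min 1 ((norm (fst z - snd z))\<^sup>2) * indicator S (snd z)) \<partial>KM s) < \<infinity>" using 1 by simp
  have "integrable (KM s) (\<lambda>z. min 1 ((norm (fst z - snd z))\<^sup>2) * indicator S (fst z))"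
    by (rule integrableI_nonneg) (use 1 in \<open>auto simp: measurable_KM_borel_eq\<close>)
  moreover have "integrable (KM s) (\<lambda>z. min 1 ((norm (fst z - snd z))\<^sup>2) * indicator S (snd z))"
    by (rule integrableI_nonneg) (use 2 in \<open>auto simp: measurable_KM_borel_eq\<close>)
  ultimately show ?thesis by (simp add: distrib_left)
qed

context mag_nl
begin

definition excess :: "(real^'n \<Rightarrow> complex) \<Rightarrow> (real^'n \<Rightarrow> real) \<Rightarrow> real^'n \<Rightarrow> real" where
  "excess U v x = max 0 (cmod (U x) - v x)"

text \<open>Testing the equation with \<open>(|U| - v)^+ U/|U|\<close>; the diamagnetic inequality removes the phase and the
  superharmonicity of \<open>v\<close> the mixed term.\<close>

theorem test_ineq:
  assumes U: "U \<in> E" and sol: "\<And>\<phi>. \<phi> \<in> E \<Longrightarrow> D U \<phi> = 0"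
    and v: "superharm s v" and lip: "\<And>x y. \<bar>v x - v y\<bar> \<le> L * norm (x - y)" and \<epsilon>: "\<epsilon> > 0" "\<And>x. v x \<ge> \<epsilon>"
  shows "integrable lborel (\<lambda>x. excess U v x powr ps)"
    "integrable (KM s) (\<lambda>z. (excess U v (fst z) - excess U v (snd z))\<^sup>2)"
    "integrable lborel (\<lambda>x. f x ((cmod (U x))\<^sup>2) * (cmod (U x) * excess U v x))"
    "integrable lborel (\<lambda>x. V x * (cmod (U x) * excess U v x))"
    "(\<integral>z. (excess U v (fst z) - excess U v (snd z))\<^sup>2 \<partial>KM s) \<le> (\<integral>x. f x ((cmod (U x))\<^sup>2) * (cmod (U x) * excess U v x) \<partial>lborel) - (\<integral>x. V x * (cmod (U x) * excess U v x) \<partial>lborel)"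
proof -
  note [measurable] = E_measurable[OF U]
  have vm[measurable]: "v \<in> borel_measurable borel" and v0: "\<And>x. v x \<ge> 0" using v by (auto simp: superharm_def)
  obtain B where B: "\<And>x. v x \<le> B" using v by (auto simp: superharm_def)
  define \<psi> where "\<psi> = excess U v"
  have psi: "\<psi> x = max 0 (cmod (U x) - v x)" for x by (simp add: \<psi>_def excess_def)
  have [measurable]: "\<psi> \<in> borel_measurable borel" unfolding \<psi>_def excess_def[abs_def] by measurable
  have psi0: "\<psi> x \<ge> 0" "\<psi> x \<le> cmod (U x)" for x using v0[of x] by (auto simp: psi)
  define \<phi> where "\<phi> x = shrink (v x) (U x)" for x
  have [measurable]: "\<phi> \<in> borel_measurable borel" unfolding \<phi>_def[abs_def] shrink_def by measurable
  have nphi: "cmod (\<phi> x) = \<psi> x" for x using norm_shrink[OF v0] by (simp add: \<phi>_def psi)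
  \<comment> \<open>The lower bound v \<ge> \<epsilon> gives the support of the test function finite
    measure; this controls the increments of v, which need not be square integrable over all
    pairs.\<close>
  define S where "S = {x. \<psi> x > 0}"
  have [measurable]: "S \<in> sets borel" unfolding S_def by measurable
  have S: "emeasure lborel S < \<infinity>"
  proof -
    have "emeasure lborel S \<le> emeasure lborel {x. cmod (U x) \<ge> \<epsilon>}"
      using \<epsilon>(2) by (intro emeasure_mono) (auto simp: S_def psi less_max_iff_disj intro: order_trans less_imp_le)
    also have "\<dots> \<le> ennreal ((\<integral>x. cmod (U x) powr ps \<partial>lborel) / \<epsilon> powr ps)"
      using U \<epsilon> ps_gt_2 by (intro emeasure_superlevel_powr_le) auto
    also have "\<dots> < \<infinity>" by simp
    finally show ?thesis .
  qed
  define g where "g z = \<bar>v (fst z) - v (snd z)\<bar>\<^sup>2 * (indicator S (fst z) + indicator S (snd z))" for z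
  have gi: "integrable (KM s) g"
  proof (rule Bochner_Integration.integrable_bound)
    define C where "C = L\<^sup>2 + B\<^sup>2"
    show "integrable (KM s) (\<lambda>z. C * (min 1 ((norm (fst z - snd z))\<^sup>2) * (indicator S (fst z) + indicator S (snd z))))"
      by (intro integrable_mult_right KM_trunc_integrable[OF s(1,2) _ S]) measurable
    show "g \<in> borel_measurable (KM s)" unfolding g_def[abs_def] measurable_KM_borel_eq by measurable
    show "AE z in KM s. norm (g z) \<le> norm (C * (min 1 ((norm (fst z - snd z))\<^sup>2) * (indicator S (fst z) + indicator S (snd z))))"
    proof (rule AE_I2)
      fix z
      have "\<bar>v (fst z) - v (snd z)\<bar>\<^sup>2 \<le> C * min 1 ((norm (fst z - snd z))\<^sup>2)"
      proof -
        have "\<bar>v (fst z) - v (snd z)\<bar> \<le> \<bar>B\<bar>" using B[of "fst z"] B[of "snd z"] v0[of "fst z"] v0[of "snd z"] by linarith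
        hence "\<bar>v (fst z) - v (snd z)\<bar>\<^sup>2 \<le> B\<^sup>2" by (metis abs_ge_zero power2_abs power_mono)
        hence 1: "\<bar>v (fst z) - v (snd z)\<bar>\<^sup>2 \<le> C * 1" by (simp add: C_def add_increasing)
        have "\<bar>v (fst z) - v (snd z)\<bar>\<^sup>2 \<le> (L * norm (fst z - snd z))\<^sup>2" using lip by (intro power_mono) auto
        also have "\<dots> \<le> C * (norm (fst z - snd z))\<^sup>2" by (simp add: C_def power_mult_distrib mult_right_mono)
        finally show ?thesis using 1 by (simp add: min_def)
      qed
      from mult_right_mono[OF this, of "indicator S (fst z) + indicator S (snd z)"]
      have "0 \<le> g z \<and> g z \<le> C * (min 1 ((norm (fst z - snd z))\<^sup>2) * (indicator S (fst z) + indicator S (snd z)))" by (simp add: g_def mult.assoc)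
      thus "norm (g z) \<le> norm (C * (min 1 ((norm (fst z - snd z))\<^sup>2) * (indicator S (fst z) + indicator S (snd z))))" by simp
    qed
  qed
  have zero: "\<phi> x = 0" "\<psi> x = 0" if "x \<notin> S" for x
  proof -
    show "\<psi> x = 0" using that psi0[of x] by (simp add: S_def)
    thus "\<phi> x = 0" using nphi[of x] by simp
  qed
  let ?c = "\<lambda>z. cis (A ((1/2) *\<^sub>R (fst z + snd z)) \<bullet> (fst z - snd z))"
  have md\<phi>: "magd A \<phi> z = shrink (v (fst z)) (U (fst z)) - shrink (v (snd z)) (U (snd z) * ?c z)" for z
    unfolding magd_def mag_diff_def \<phi>_def by (simp add: shrink_rotate)
  have mdU: "magd A U z = U (fst z) - U (snd z) * ?c z" for z by (simp add: magd_def mag_diff_def)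
  have md_le: "(cmod (magd A \<phi> z))\<^sup>2 \<le> 18 * (cmod (magd A U z))\<^sup>2 + 2 * g z" for z
  proof (cases "fst z \<in> S \<or> snd z \<in> S")
    case True
    have "cmod (magd A \<phi> z) \<le> 3 * cmod (magd A U z) + \<bar>v (fst z) - v (snd z)\<bar>"
      unfolding md\<phi> mdU by (rule shrink_lipschitz) (auto simp: v0)
    hence "(cmod (magd A \<phi> z))\<^sup>2 \<le> (3 * cmod (magd A U z) + \<bar>v (fst z) - v (snd z)\<bar>)\<^sup>2" by (intro power_mono) auto
    also have "\<dots> \<le> 18 * (cmod (magd A U z))\<^sup>2 + 2 * \<bar>v (fst z) - v (snd z)\<bar>\<^sup>2"
      using zero_le_power2[of "3 * cmod (magd A U z) - \<bar>v (fst z) - v (snd z)\<bar>"] by (simp add: power2_eq_square algebra_simps)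
    also have "\<bar>v (fst z) - v (snd z)\<bar>\<^sup>2 \<le> g z" using True by (auto simp: g_def indicator_def)
    finally show ?thesis by simp
  next
    case False
    thus ?thesis using zero by (simp add: magd_def mag_diff_def g_def)
  qed
  have \<phi>E: "\<phi> \<in> E"
  proof -
    have "integrable lborel (\<lambda>x. cmod (\<phi> x) powr ps)"
      by (rule Bochner_Integration.integrable_bound[OF E_powr[OF U]]) (use psi0 ps_gt_2 in \<open>auto simp: nphi intro!: AE_I2 powr_mono2\<close>)
    moreover have "integrable (KM s) (\<lambda>z. (cmod (magd A \<phi> z))\<^sup>2)"
    proof (rule Bochner_Integration.integrable_bound)
      show "integrable (KM s) (\<lambda>z. 18 * (cmod (magd A U z))\<^sup>2 + 2 * g z)" using gi U by auto
      show "(\<lambda>z. (cmod (magd A \<phi> z))\<^sup>2) \<in> borel_measurable (KM s)" unfolding measurable_KM_borel_eq by measurable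
    qed (use md_le in \<open>auto intro!: AE_I2 order_trans[OF _ abs_ge_self]\<close>)
    moreover have "integrable lborel (\<lambda>x. V x * (cmod (\<phi> x))\<^sup>2)"
      by (rule Bochner_Integration.integrable_bound[OF E_V[OF U]]) (use psi0 V0 in \<open>auto simp: nphi abs_mult intro!: AE_I2 mult_left_mono power_mono\<close>)
    ultimately show ?thesis by (simp add: E_iff)
  qed
  show "integrable lborel (\<lambda>x. excess U v x powr ps)" using E_powr[OF \<phi>E] by (simp add: nphi \<psi>_def)
  have ii: "integrable (KM s) (\<lambda>z. (\<psi> (fst z) - \<psi> (snd z))\<^sup>2)"
    using diamagnetic_integrable(1)[OF \<phi>E] by (simp add: nphi)
  thus "integrable (KM s) (\<lambda>z. (excess U v (fst z) - excess U v (snd z))\<^sup>2)" by (simp add: \<psi>_def)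
  have inner: "a \<bullet> shrink r a = cmod a * max 0 (cmod a - r)" for a r
    by (auto simp: shrink_def power2_norm_eq_inner[symmetric] power2_eq_square)
  have NnI: "Nn x (U x) \<bullet> \<phi> x = f x ((cmod (U x))\<^sup>2) * (cmod (U x) * \<psi> x)" for x
    by (simp add: Nn_def \<phi>_def inner psi)
  have VI: "U x \<bullet> \<phi> x = cmod (U x) * \<psi> x" for x by (simp add: \<phi>_def inner psi)
  show "integrable lborel (\<lambda>x. f x ((cmod (U x))\<^sup>2) * (cmod (U x) * excess U v x))" using Nn_integrable[OF U \<phi>E] unfolding NnI \<psi>_def .
  show "integrable lborel (\<lambda>x. V x * (cmod (U x) * excess U v x))" using V_integrable_inner[OF U \<phi>E] unfolding VI \<psi>_def .
  \<comment> \<open>Increments of \<psi> vanish unless the pair meets S, and there the increment of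
    v is counted by g, so the mixed term is integrable by ab \<le> a^2 + b^2.\<close>
  have vpsi: "integrable (KM s) (\<lambda>(x,y). (v x - v y) * (\<psi> x - \<psi> y))"
  proof (rule Bochner_Integration.integrable_bound)
    show "integrable (KM s) (\<lambda>z. g z + (\<psi> (fst z) - \<psi> (snd z))\<^sup>2)" using gi ii by simp
    show "(\<lambda>(x,y). (v x - v y) * (\<psi> x - \<psi> y)) \<in> borel_measurable (KM s)" unfolding measurable_KM_borel_eq by measurable
    show "AE z in KM s. norm ((\<lambda>(x,y). (v x - v y) * (\<psi> x - \<psi> y)) z) \<le> norm (g z + (\<psi> (fst z) - \<psi> (snd z))\<^sup>2)"
    proof (rule AE_I2)
      fix z :: "(real^'n) \<times> (real^'n)"
      let ?a = "v (fst z) - v (snd z)" and ?b = "\<psi> (fst z) - \<psi> (snd z)"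
      have g0: "g z \<ge> 0" by (simp add: g_def)
      have "\<bar>?a * ?b\<bar> \<le> g z + ?b\<^sup>2"
      proof (cases "fst z \<in> S \<or> snd z \<in> S")
        case True
        have "2 * (\<bar>?a\<bar> * \<bar>?b\<bar>) \<le> \<bar>?a\<bar>\<^sup>2 + \<bar>?b\<bar>\<^sup>2" using sum_squares_bound[of "\<bar>?a\<bar>" "\<bar>?b\<bar>"] by simp
        moreover have "\<bar>?a\<bar>\<^sup>2 \<le> g z" using True by (auto simp: g_def indicator_def)
        moreover have "\<bar>?a\<bar> * \<bar>?b\<bar> \<ge> 0" by simp
        ultimately show ?thesis unfolding abs_mult power2_abs by linarith
      next
        case False thus ?thesis using zero g0 by simp
      qed
      thus "norm ((\<lambda>(x,y). (v x - v y) * (\<psi> x - \<psi> y)) z) \<le> norm (g z + (\<psi> (fst z) - \<psi> (snd z))\<^sup>2)"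
        using g0 by (simp add: split_def)
    qed
  qed
  have psi1: "integrable lborel \<psi>"
  proof (rule Bochner_Integration.integrable_bound)
    show "integrable lborel (\<lambda>x. indicator S x + cmod (U x) powr ps)" using S U by auto
    show "AE x in lborel. norm (\<psi> x) \<le> norm (indicator S x + cmod (U x) powr ps)"
    proof (rule AE_I2)
      fix x
      show "norm (\<psi> x) \<le> norm (indicator S x + cmod (U x) powr ps)"
        using psi0[of x] le_one_plus_powr[of "cmod (U x)" ps] ps_gt_2 zero(2)[of x] by (cases "x \<in> S") auto
    qed
  qed measurable
  have sup: "0 \<le> (\<integral>(x,y). (v x - v y) * (\<psi> x - \<psi> y) \<partial>KM s)"
    by (rule superharm_form_nonneg[OF s(1) v psi1 psi0(1) vpsi])
  have "(\<integral>z. (\<psi> (fst z) - \<psi> (snd z))\<^sup>2 \<partial>KM s) + (\<integral>(x,y). (v x - v y) * (\<psi> x - \<psi> y) \<partial>KM s)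
    = (\<integral>z. (\<psi> (fst z) - \<psi> (snd z))\<^sup>2 + (\<lambda>(x,y). (v x - v y) * (\<psi> x - \<psi> y)) z \<partial>KM s)"
    by (rule Bochner_Integration.integral_add[OF ii vpsi, symmetric])
  also have "\<dots> \<le> (\<integral>z. magd A U z \<bullet> magd A \<phi> z \<partial>KM s)"
  proof (rule integral_mono)
    show "integrable (KM s) (\<lambda>z. (\<psi> (fst z) - \<psi> (snd z))\<^sup>2 + (\<lambda>(x,y). (v x - v y) * (\<psi> x - \<psi> y)) z)"
      by (rule Bochner_Integration.integrable_add[OF ii vpsi])
    show "integrable (KM s) (\<lambda>z. magd A U z \<bullet> magd A \<phi> z)" by (rule magd_integrable_inner[OF U \<phi>E])
    fix z :: "(real^'n) \<times> (real^'n)"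
    define a b where "a = U (fst z)" and "b = U (snd z) * ?c z"
    \<comment> \<open>The test function is a nonnegative real multiple of U at each point; p and q
      are these multiples after the phase has been moved into b, which is the form of
      \<open>diamagnetic_product\<close>.\<close>
    define p q where "p = (if a = 0 then 0 else \<psi> (fst z) / cmod a)" and "q = (if b = 0 then 0 else \<psi> (snd z) / cmod b)"
    have pq: "p \<ge> 0" "q \<ge> 0" using psi0 by (auto simp: p_def q_def)
    have nb: "cmod b = cmod (U (snd z))" by (simp add: b_def norm_mult)
    have b0: "b = 0 \<longleftrightarrow> U (snd z) = 0" using nb by (metis norm_eq_zero)
    have pa: "p * cmod a = \<psi> (fst z)" using psi0[of "fst z"] by (auto simp: p_def a_def)
    have qb: "q * cmod b = \<psi> (snd z)" using psi0[of "snd z"] b0 nb by (auto simp: q_def)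
    have "magd A \<phi> z = p *\<^sub>R a - q *\<^sub>R b"
      unfolding md\<phi> a_def[symmetric] b_def[symmetric] shrink_def p_def q_def psi a_def[symmetric] nb[symmetric] by simp
    moreover have "magd A U z = a - b" by (simp add: mdU a_def b_def)
    ultimately have "(cmod a - cmod b) * (\<psi> (fst z) - \<psi> (snd z)) \<le> magd A U z \<bullet> magd A \<phi> z"
      using diamagnetic_product[OF pq, of a b] pa qb by simp
    moreover have "(\<psi> (fst z) - \<psi> (snd z))\<^sup>2 + (v (fst z) - v (snd z)) * (\<psi> (fst z) - \<psi> (snd z)) \<le> (cmod a - cmod b) * (\<psi> (fst z) - \<psi> (snd z))"
      unfolding psi nb a_def by (rule positive_part_product)
    ultimately show "(\<psi> (fst z) - \<psi> (snd z))\<^sup>2 + (\<lambda>(x,y). (v x - v y) * (\<psi> x - \<psi> y)) z \<le> magd A U z \<bullet> magd A \<phi> z"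
      by (simp add: split_def)
  qed
  also have "\<dots> = (\<integral>x. Nn x (U x) \<bullet> \<phi> x \<partial>lborel) - (\<integral>x. V x * (U x \<bullet> \<phi> x) \<partial>lborel)"
    using sol[OF \<phi>E] by (simp add: D_def ip_def)
  finally show "(\<integral>z. (excess U v (fst z) - excess U v (snd z))\<^sup>2 \<partial>KM s) \<le> (\<integral>x. f x ((cmod (U x))\<^sup>2) * (cmod (U x) * excess U v x) \<partial>lborel) - (\<integral>x. V x * (cmod (U x) * excess U v x) \<partial>lborel)"
    using sup unfolding NnI VI \<psi>_def by linarith
qed

end

text \<open>The bubble is |(R, x)|^(-\<beta>) with the norm taken in the product space; that norm is
  at least R and 1-Lipschitz in x, so a one-variable derivative bound suffices.\<close>

lemma bubble_lipschitz:
  fixes x y :: "'a::euclidean_space"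
  assumes R: "R > 0" and N: "2 * s < real DIM('a)"
  shows "\<bar>bubble s R x - bubble s R y\<bar> \<le> (real DIM('a) - 2 * s) * R powr (-(real DIM('a) - 2 * s) - 1) * norm (x - y)"
proof -
  define \<beta> where "\<beta> = real DIM('a) - 2 * s"
  have \<beta>: "\<beta> > 0" using N by (simp add: \<beta>_def)
  define g where "g x = norm (R, x)" for x :: 'a
  have gR: "g x \<ge> R" for x using R by (simp add: g_def norm_Pair real_le_rsqrt)
  have b: "bubble s R x = g x powr (-\<beta>)" for x :: 'a
  proof -
    have "R\<^sup>2 + (norm x)\<^sup>2 = (g x)\<^sup>2" by (simp add: g_def norm_Pair)
    moreover have "(g x)\<^sup>2 = g x powr 2" using gR[of x] R by simp
    ultimately have "bubble s R x = (g x powr 2) powr (-(\<beta>/2))" by (simp add: bubble_def \<beta>_def)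
    thus ?thesis by (subst (asm) powr_powr) simp
  qed
  have "norm (g x powr (-\<beta>) - g y powr (-\<beta>)) \<le> (\<beta> * R powr (-\<beta>-1)) * norm (g x - g y)"
  proof (rule field_differentiable_bound[of "{R..}" "\<lambda>t. t powr (-\<beta>)" "\<lambda>t. -\<beta> * t powr (-\<beta>-1)"])
    fix t assume t: "t \<in> {R..}"
    show "((\<lambda>t. t powr (-\<beta>)) has_field_derivative -\<beta> * t powr (-\<beta>-1)) (at t within {R..})"
      using t R by (auto intro!: derivative_eq_intros)
    have "t powr (-\<beta>-1) \<le> R powr (-\<beta>-1)" using t R \<beta> by (intro powr_mono2') auto
    thus "norm (-\<beta> * t powr (-\<beta>-1)) \<le> \<beta> * R powr (-\<beta>-1)" using \<beta> by (simp add: abs_mult)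
  qed (use gR in auto)
  also have "norm (g x - g y) \<le> norm (x - y)"
    using norm_triangle_ineq3[of "(R, x)" "(R, y)"] by (simp add: g_def norm_Pair)
  finally show ?thesis using \<beta> unfolding b \<beta>_def[symmetric] by (simp add: mult_left_mono)
qed

text \<open>The ratio q is the solution of (2^p q)^\<gamma> = q, so the geometric bound S q^j
  reproduces itself: the growing factor 2^(jp) is absorbed by the exponent \<gamma> > 1, and the
  smallness assumption is the case j = 0.\<close>

lemma De_Giorgi_iteration:
  fixes U :: "nat \<Rightarrow> real"
  assumes \<gamma>: "\<gamma> > 1" and S: "S > 0" and a: "a \<ge> 0" and p: "p > 0"
    and q: "q = 2 powr (-(p * \<gamma> / (\<gamma> - 1)))" and small: "(a * 4 powr p * S) powr \<gamma> \<le> S * q"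
    and U0: "0 \<le> U 0" "U 0 \<le> S" and step: "\<And>j. 0 \<le> U j \<Longrightarrow> 0 \<le> U (Suc j) \<and> U (Suc j) \<le> (a * 2 powr ((real j + 2) * p) * U j) powr \<gamma>"
  shows "U \<longlonglongrightarrow> 0"
proof -
  have q0: "0 < q" "q < 1" using \<gamma> p by (auto simp: q powr_less_one)
  have qq: "(2 powr p * q) powr \<gamma> = q"
  proof -
    have "(2 powr p * q) powr \<gamma> = 2 powr ((p - p * \<gamma> / (\<gamma> - 1)) * \<gamma>)" unfolding q by (simp add: powr_add[symmetric] powr_powr)
    also have "(p - p * \<gamma> / (\<gamma> - 1)) * \<gamma> = -(p * \<gamma> / (\<gamma> - 1))" using \<gamma> by (simp add: field_simps)
    finally show ?thesis by (simp add: q)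
  qed
  have main: "0 \<le> U j \<and> U j \<le> S * q ^ j" for j
  proof (induction j)
    case (Suc j)
    have "U (Suc j) \<le> (a * 2 powr ((real j + 2) * p) * U j) powr \<gamma>" using step Suc by blast
    also have "\<dots> \<le> (a * 2 powr ((real j + 2) * p) * (S * q ^ j)) powr \<gamma>"
      using Suc a \<gamma> by (intro powr_mono2 mult_left_mono mult_nonneg_nonneg) auto
    also have "a * 2 powr ((real j + 2) * p) * (S * q ^ j) = (a * 4 powr p * S) * (2 powr p * q) ^ j"
    proof -
      have "2 powr ((real j + 2) * p) = (2 powr p) ^ j * 4 powr p"
      proof -
        have "(4::real) powr p = (2 powr 2) powr p" by simp
        also have "\<dots> = 2 powr (2 * p)" by (subst powr_powr) simp
        finally have "4 powr p = 2 powr (2 * p)" .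
        moreover have "(2 powr p) ^ j = 2 powr (real j * p)" by (simp add: powr_realpow[symmetric] powr_powr mult.commute)
        ultimately show ?thesis by (simp add: powr_add[symmetric] distrib_right)
      qed
      thus ?thesis by (simp add: power_mult_distrib mult_ac)
    qed
    also have "\<dots> powr \<gamma> = (a * 4 powr p * S) powr \<gamma> * ((2 powr p * q) powr \<gamma>) ^ j"
    proof -
      have "((2 powr p * q) ^ j) powr \<gamma> = ((2 powr p * q) powr \<gamma>) ^ j"
        using q0 by (simp add: powr_realpow[symmetric] powr_powr mult.commute)
      thus ?thesis using a S q0 by (subst powr_mult) auto
    qed
    also have "\<dots> \<le> S * q * q ^ j" unfolding qq using small q0 by (intro mult_right_mono) auto
    finally show ?case using step Suc by simp
  qed (use U0 in simp)
  show ?thesis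
  proof (rule tendsto_sandwich[OF _ _ tendsto_const])
    show "(\<lambda>j. S * q ^ j) \<longlonglongrightarrow> 0" using q0 by (intro tendsto_mult_right_zero LIMSEQ_realpow_zero) auto
  qed (use main in auto)
qed

context mag_nl
begin

lemma test_ineq_const:
  assumes U: "U \<in> E" and sol: "\<And>\<phi>. \<phi> \<in> E \<Longrightarrow> D U \<phi> = 0" and k: "k > 0"
  shows "integrable lborel (\<lambda>x. excess U (\<lambda>_. k) x powr ps)"
    "integrable (KM s) (\<lambda>z. (excess U (\<lambda>_. k) (fst z) - excess U (\<lambda>_. k) (snd z))\<^sup>2)"
    "integrable lborel (\<lambda>x. f x ((cmod (U x))\<^sup>2) * (cmod (U x) * excess U (\<lambda>_. k) x))"
    "integrable lborel (\<lambda>x. V x * (cmod (U x) * excess U (\<lambda>_. k) x))"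
    "(\<integral>z. (excess U (\<lambda>_. k) (fst z) - excess U (\<lambda>_. k) (snd z))\<^sup>2 \<partial>KM s) \<le> (\<integral>x. f x ((cmod (U x))\<^sup>2) * (cmod (U x) * excess U (\<lambda>_. k) x) \<partial>lborel) - (\<integral>x. V x * (cmod (U x) * excess U (\<lambda>_. k) x) \<partial>lborel)"
  by (rule test_ineq[OF U sol superharm_const[OF s(1) less_imp_le[OF k]], where L=0 and \<epsilon>=k]; use k in simp)+

text \<open>Subcritical growth supplies the factor K^(p-ps), which is small for large K while S
  stays fixed. This is why a bound on the critical integral, without smallness, is enough to start
  the iteration.\<close>

theorem sup_bound:
  assumes U: "U \<in> E" and sol: "\<And>\<phi>. \<phi> \<in> E \<Longrightarrow> D U \<phi> = 0"
    and p: "2 < p" "p < ps" and C2: "C2 \<ge> 0" "\<And>x t. t \<ge> 0 \<Longrightarrow> f x t \<le> C2 * t powr ((p-2)/2)"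
    and S: "S > 0" "(\<integral>x. cmod (U x) powr ps \<partial>lborel) \<le> S" and K: "K > 0"
    and small: "(Cs * C2 * K powr (p - ps) * 4 powr ps * S) powr (ps/2) \<le> S * 2 powr (-(ps * (ps/2) / (ps/2 - 1)))"
  shows "AE x in lborel. cmod (U x) \<le> 2 * K"
proof -
  note [measurable] = E_measurable[OF U]
  \<comment> \<open>Levels increase from K to 2 K with gaps K 2^(-j-1).\<close>
  define k where "k j = K * (2 - (1/2)^j)" for j :: nat
  have kK: "K \<le> k j" "k j \<le> 2 * K" for j
  proof -
    have "(1/2::real)^j \<le> 1" by (rule power_le_one) auto
    thus "K \<le> k j" using K mult_left_mono[of 1 "2 - (1/2)^j" K] by (simp add: k_def)
    show "k j \<le> 2 * K" using K by (simp add: k_def)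
  qed
  have k0: "k j > 0" for j using kK(1)[of j] K by linarith
  define \<psi> where "\<psi> j = excess U (\<lambda>_. k j)" for j
  have psi: "\<psi> j x = max 0 (cmod (U x) - k j)" for j x by (simp add: \<psi>_def excess_def)
  define W where "W j = (\<integral>x. \<psi> j x powr ps \<partial>lborel)" for j
  note T = test_ineq_const[OF U sol k0]
  have [measurable]: "\<psi> j \<in> borel_measurable borel" for j unfolding \<psi>_def excess_def[abs_def] by measurable
  have psi_i: "integrable lborel (\<lambda>x. \<psi> j x powr ps)" for j using T(1)[of j] by (simp add: \<psi>_def)
  have W0: "W j \<ge> 0" for j by (simp add: W_def integral_nonneg_AE)
  have step: "W (Suc j) \<le> (Cs * C2 * K powr (p - ps) * 2 powr ((real j + 2) * ps) * W j) powr (ps/2)" for j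
  proof -
    let ?j = "Suc j"
    have pt: "f x ((cmod (U x))\<^sup>2) * (cmod (U x) * \<psi> ?j x) \<le> C2 * K powr (p - ps) * 2 powr ((real j + 2) * ps) * \<psi> j x powr ps" for x
    proof (cases "cmod (U x) > k ?j")
      case False
      hence "\<psi> ?j x = 0" by (simp add: psi)
      thus ?thesis using C2 by simp
    next
      case True
      let ?w = "cmod (U x)"
      have w0: "?w > 0" using True k0[of ?j] by linarith
      have wK: "?w \<ge> K" using True kK(1)[of ?j] by linarith
      have kd: "k ?j - k j = K * (1/2)^(Suc j)" by (simp add: k_def algebra_simps)
      \<comment> \<open>Above level k (j+1) the modulus exceeds k j by a definite fraction, so it is
        comparable with the excess over k j; the price is the factor 2^(j+2) that the iteration
        tolerates.\<close>
      have "?w \<le> 2 ^ (j+2) * \<psi> j x"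
      proof -
        have "?w * (k ?j - k j) \<le> (?w - k j) * k ?j"
        proof -
          have "k j * k ?j \<le> k j * ?w" using True k0[of j] by (intro mult_left_mono) auto
          thus ?thesis by (simp add: algebra_simps)
        qed
        also have "\<dots> \<le> \<psi> j x * (2 * K)" using kK[of ?j] k0[of ?j] K by (intro mult_mono) (auto simp: psi)
        finally have "K * (?w * (1/2)^(Suc j)) \<le> K * (\<psi> j x * 2)" unfolding kd by (simp add: mult_ac)
        hence "?w * (1/2)^(Suc j) \<le> \<psi> j x * 2" using K by (simp add: mult_le_cancel_left_pos)
        hence "2^(Suc j) * (?w * (1/2)^(Suc j)) \<le> 2^(Suc j) * (\<psi> j x * 2)" by (intro mult_left_mono) auto
        moreover have "2^(Suc j) * (?w * (1/2)^(Suc j)) = ?w" by (simp add: power_one_over)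
        ultimately have "?w \<le> 2^(Suc j) * (\<psi> j x * 2)" by (simp only:)
        thus ?thesis by (simp add: mult_ac)
      qed
      hence "?w powr ps \<le> (2 ^ (j+2) * \<psi> j x) powr ps" using ps_gt_2 by (intro powr_mono2) auto
      also have "\<dots> = 2 powr ((real j + 2) * ps) * \<psi> j x powr ps"
      proof -
        have "(2::real) ^ (j+2) = 2 powr (real j + 2)" by (subst powr_realpow[symmetric]) (auto simp: add.commute)
        thus ?thesis by (simp add: powr_mult powr_powr psi)
      qed
      finally have wp: "?w powr ps \<le> 2 powr ((real j + 2) * ps) * \<psi> j x powr ps" .
      have wpp: "(?w\<^sup>2) powr ((p-2)/2) * (?w * ?w) = ?w powr p"
      proof -
        have "?w * ?w = ?w powr 2" using w0 by (simp add: power2_eq_square)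
        hence "(?w\<^sup>2) powr ((p-2)/2) * (?w * ?w) = ?w powr (p-2) * ?w powr 2" unfolding power2_powr_half[OF norm_ge_zero] by (simp only:)
        also have "\<dots> = ?w powr p" by (subst powr_add[symmetric]) simp
        finally show ?thesis .
      qed
      have "f x (?w\<^sup>2) * (?w * \<psi> ?j x) \<le> (C2 * (?w\<^sup>2) powr ((p-2)/2)) * (?w * ?w)"
        using C2 f_nonneg k0[of ?j] by (intro mult_mono) (auto simp: psi)
      hence "f x (?w\<^sup>2) * (?w * \<psi> ?j x) \<le> C2 * ?w powr p" unfolding mult.assoc wpp .
      also have "?w powr p = ?w powr (p - ps) * ?w powr ps" using w0 by (simp add: powr_add[symmetric])
      \<comment> \<open>Here w \<ge> K and p < ps, so the missing powers of w become a gain in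
        K.\<close>
      also have "\<dots> \<le> K powr (p - ps) * (2 powr ((real j + 2) * ps) * \<psi> j x powr ps)"
        using wp wK K p by (intro mult_mono powr_mono2') auto
      finally show ?thesis using C2 by (simp add: mult_left_mono mult.assoc)
    qed
    have "(\<integral>z. (\<psi> ?j (fst z) - \<psi> ?j (snd z))\<^sup>2 \<partial>KM s) \<le> (\<integral>x. f x ((cmod (U x))\<^sup>2) * (cmod (U x) * \<psi> ?j x) \<partial>lborel) - (\<integral>x. V x * (cmod (U x) * \<psi> ?j x) \<partial>lborel)"
      using T(5)[of ?j] unfolding \<psi>_def .
    also have "\<dots> \<le> (\<integral>x. f x ((cmod (U x))\<^sup>2) * (cmod (U x) * \<psi> ?j x) \<partial>lborel)"
    proof -
      have "0 \<le> (\<integral>x. V x * (cmod (U x) * \<psi> ?j x) \<partial>lborel)"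
        by (rule Bochner_Integration.integral_nonneg) (auto simp: V0 psi)
      thus ?thesis by linarith
    qed
    also have "\<dots> \<le> (\<integral>x. C2 * K powr (p - ps) * 2 powr ((real j + 2) * ps) * \<psi> j x powr ps \<partial>lborel)"
      using T(3)[of ?j] psi_i[of j] pt unfolding \<psi>_def by (intro integral_mono) auto
    also have "\<dots> = C2 * K powr (p - ps) * 2 powr ((real j + 2) * ps) * W j" by (simp add: W_def)
    finally have e: "(\<integral>z. (\<psi> ?j (fst z) - \<psi> ?j (snd z))\<^sup>2 \<partial>KM s) \<le> C2 * K powr (p - ps) * 2 powr ((real j + 2) * ps) * W j" .
    have "W ?j \<le> (Cs * (\<integral>z. (\<psi> ?j (fst z) - \<psi> ?j (snd z))\<^sup>2 \<partial>KM s)) powr (ps/2)"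
      unfolding W_def using T(1,2)[of ?j] by (intro sobolev_real) (auto simp: \<psi>_def excess_def)
    also have "\<dots> \<le> (Cs * (C2 * K powr (p - ps) * 2 powr ((real j + 2) * ps) * W j)) powr (ps/2)"
      using e Cs_pos ps_gt_2 by (intro powr_mono2 mult_left_mono mult_nonneg_nonneg Bochner_Integration.integral_nonneg) auto
    finally show ?thesis by (simp add: mult.assoc)
  qed
  have "W \<longlonglongrightarrow> 0"
  proof (rule De_Giorgi_iteration[of "ps/2" S "Cs * C2 * K powr (p - ps)" ps])
    have "W 0 \<le> (\<integral>x. cmod (U x) powr ps \<partial>lborel)"
      unfolding W_def using psi_i U k0[of 0] ps_gt_2 by (intro integral_mono powr_mono2) (auto simp: psi)
    thus "W 0 \<le> S" using S by linarith
  qed (use small S Cs_pos C2 ps_gt_2 W0 step in auto)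
  moreover have "(\<integral>x. excess U (\<lambda>_. 2 * K) x powr ps \<partial>lborel) \<le> W j" for j
    unfolding W_def
  proof (rule integral_mono)
    show "integrable lborel (\<lambda>x. excess U (\<lambda>_. 2 * K) x powr ps)"
      using test_ineq_const(1)[OF U sol, of "2 * K"] K by simp
    show "excess U (\<lambda>_. 2 * K) x powr ps \<le> \<psi> j x powr ps" for x
      using kK(2)[of j] ps_gt_2 by (intro powr_mono2) (auto simp: excess_def psi)
  qed (rule psi_i)
  ultimately have "(\<integral>x. excess U (\<lambda>_. 2 * K) x powr ps \<partial>lborel) \<le> 0" by (intro LIMSEQ_le_const) auto
  moreover have "(\<integral>x. excess U (\<lambda>_. 2 * K) x powr ps \<partial>lborel) \<ge> 0" by (simp add: integral_nonneg_AE)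
  ultimately have "(\<integral>x. excess U (\<lambda>_. 2 * K) x powr ps \<partial>lborel) = 0" by linarith
  moreover have "integrable lborel (\<lambda>x. excess U (\<lambda>_. 2 * K) x powr ps)"
    using test_ineq_const(1)[OF U sol, of "2 * K"] K by simp
  ultimately have "AE x in lborel. excess U (\<lambda>_. 2 * K) x powr ps = 0" by (subst (asm) integral_nonneg_eq_0_iff_AE) auto
  thus ?thesis by eventually_elim (auto simp: excess_def max_def split: if_splits)
qed

text \<open>Inside the ball the comparison function lies above M, hence above |U|, and the test
  function vanishes; outside, the reaction is dominated by V. So the energy of the excess is at most
  0, and the Sobolev inequality makes the excess zero a.e.\<close>

theorem decay:
  assumes U: "U \<in> E" and sol: "\<And>\<phi>. \<phi> \<in> E \<Longrightarrow> D U \<phi> = 0"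
    and M: "M \<ge> 0" "AE x in lborel. cmod (U x) \<le> M" and R: "R > 0"
    and fV: "\<And>x t. t \<ge> 0 \<Longrightarrow> norm x > R \<Longrightarrow> f x t \<le> V x"
  shows "AE x in lborel. cmod (U x) \<le> M * (2 * R\<^sup>2) powr ((real CARD('n) - 2 * s)/2) * bubble s R x"
proof -
  note [measurable] = E_measurable[OF U]
  define \<beta> where "\<beta> = real CARD('n) - 2 * s"
  have \<beta>: "\<beta> > 0" using N by (simp add: \<beta>_def)
  \<comment> \<open>On |x| \<le> R the bubble is at least (2 R^2)^(-\<beta>/2), so this is the
    factor that lifts it to M there.\<close>
  define c where "c = M * (2 * R\<^sup>2) powr (\<beta>/2)"
  have c0: "c \<ge> 0" using M by (simp add: c_def)
  have bub: "bubble s R x > 0" for x :: "real^'n" by (rule bubble_pos[OF R])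
  have inside: "M \<le> c * bubble s R x" if "norm x \<le> R" for x :: "real^'n"
  proof -
    have "(norm x)\<^sup>2 \<le> R\<^sup>2" using that by (intro power_mono) auto
    hence "(2 * R\<^sup>2) powr (-(\<beta>/2)) \<le> bubble s R x" unfolding bubble_def using R \<beta> by (simp add: \<beta>_def) (intro powr_mono2', auto simp: add_pos_nonneg)
    hence "c * (2 * R\<^sup>2) powr (-(\<beta>/2)) \<le> c * bubble s R x" using c0 by (intro mult_left_mono)
    moreover have "c * (2 * R\<^sup>2) powr (-(\<beta>/2)) = M" using R by (simp add: c_def powr_minus)
    ultimately show ?thesis by simp
  qed
  have each: "AE x in lborel. cmod (U x) \<le> c * bubble s R x + \<epsilon>" if \<epsilon>: "\<epsilon> > 0" for \<epsilon>
  proof -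
    \<comment> \<open>The bubble tends to 0 at infinity, whereas testing needs a positive lower
      bound; the constant \<epsilon> supplies it and is sent to 0 along a countable sequence at the
      end.\<close>
    define v where "v x = c * bubble s R x + \<epsilon>" for x :: "real^'n"
    have sv: "superharm s v" unfolding v_def
      using s N R c0 \<epsilon> by (intro superharm_add superharm_cmult superharm_bubble superharm_const) auto
    have lip: "\<bar>v x - v y\<bar> \<le> (c * (\<beta> * R powr (-\<beta>-1))) * norm (x - y)" for x y
    proof -
      have "\<bar>v x - v y\<bar> = c * \<bar>bubble s R x - bubble s R y\<bar>" using c0 by (simp add: v_def abs_mult right_diff_distrib[symmetric])
      also have "\<dots> \<le> c * ((\<beta> * R powr (-\<beta>-1)) * norm (x - y))"
        using bubble_lipschitz[OF R, of s x y] N c0 by (intro mult_left_mono) (simp_all add: \<beta>_def)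
      finally show ?thesis by (simp add: mult.assoc)
    qed
    have ve: "v x \<ge> \<epsilon>" for x using c0 less_imp_le[OF bub[of x]] by (simp add: v_def)
    note T = test_ineq[OF U sol sv lip \<epsilon> ve]
    have "(\<integral>x. f x ((cmod (U x))\<^sup>2) * (cmod (U x) * excess U v x) \<partial>lborel) \<le> (\<integral>x. V x * (cmod (U x) * excess U v x) \<partial>lborel)"
    proof (rule integral_mono_AE[OF T(3,4)])
      show "AE x in lborel. f x ((cmod (U x))\<^sup>2) * (cmod (U x) * excess U v x) \<le> V x * (cmod (U x) * excess U v x)"
        using M(2)
      proof eventually_elim
        case (elim x)
        show ?case
        proof (cases "norm x > R")
          case True
          thus ?thesis using fV[of "(cmod (U x))\<^sup>2" x] by (intro mult_right_mono) (auto simp: excess_def)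
        next
          case False
          hence "cmod (U x) \<le> v x" using inside[of x] elim \<epsilon> by (simp add: v_def)
          thus ?thesis by (simp add: excess_def)
        qed
      qed
    qed
    hence z: "(\<integral>z. (excess U v (fst z) - excess U v (snd z))\<^sup>2 \<partial>KM s) \<le> 0" using T(5) by linarith
    have "(\<integral>z. (excess U v (fst z) - excess U v (snd z))\<^sup>2 \<partial>KM s) \<ge> 0" by (rule Bochner_Integration.integral_nonneg) auto
    hence z: "(\<integral>z. (excess U v (fst z) - excess U v (snd z))\<^sup>2 \<partial>KM s) = 0" using z by linarith
    have [measurable]: "v \<in> borel_measurable borel" using sv by (simp add: superharm_def)
    have "(\<integral>x. excess U v x powr ps \<partial>lborel) \<le> (Cs * (\<integral>z. (excess U v (fst z) - excess U v (snd z))\<^sup>2 \<partial>KM s)) powr (ps/2)"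
      using T(1,2) by (intro sobolev_real) (auto simp: excess_def[abs_def])
    hence "(\<integral>x. excess U v x powr ps \<partial>lborel) \<le> 0" using z by simp
    moreover have "(\<integral>x. excess U v x powr ps \<partial>lborel) \<ge> 0" by (simp add: integral_nonneg_AE)
    ultimately have "(\<integral>x. excess U v x powr ps \<partial>lborel) = 0" by linarith
    hence "AE x in lborel. excess U v x powr ps = 0" using T(1) by (subst (asm) integral_nonneg_eq_0_iff_AE) auto
    thus ?thesis by eventually_elim (auto simp: excess_def max_def v_def split: if_splits)
  qed
  have "AE x in lborel. \<forall>n. cmod (U x) \<le> c * bubble s R x + 1 / real (Suc n)"
    by (subst AE_all_countable) (use each in auto)
  thus ?thesis
  proof eventually_elim
    case (elim x)
    show ?case
    proof (rule field_le_epsilon)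
      fix e :: real assume "e > 0"
      then obtain n where "1 / real (Suc n) < e" using nat_approx_posE by (metis of_nat_Suc)
      thus "cmod (U x) \<le> M * (2 * R\<^sup>2) powr ((real CARD('n) - 2 * s)/2) * bubble s R x + e"
        using elim[rule_format, of n] by (simp add: c_def \<beta>_def)
    qed
  qed
qed

end

section \<open>The penalized nonlinearity\<close>

text \<open>Near 0 the limsup gives the larger power b, at infinity the smaller power a, and
  compactness covers the middle. As a < b, the power t^a dominates on [0,1] and t^b beyond 1, so
  both bounds hold for all t.\<close>

lemma growth_bound:
  fixes g :: "real \<Rightarrow> real"
  assumes ab: "0 < a" "a < b" and g: "continuous_on {0..} g"
    and g1: "Limsup (at_right 0) (\<lambda>t. ereal (g t / t powr b)) < \<infinity>"
    and g2: "Limsup at_top (\<lambda>t. ereal (g t / t powr a)) < \<infinity>"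
  obtains C where "C > 0" "\<And>t. t \<ge> 0 \<Longrightarrow> g t \<le> C * t powr b" "\<And>t. t \<ge> 0 \<Longrightarrow> g t \<le> C * t powr a"
proof -
  obtain n1 :: nat where "Limsup (at_right 0) (\<lambda>t. ereal (g t / t powr b)) < ereal (real n1)"
    using g1 less_PInf_Ex_of_nat by auto
  hence "\<forall>\<^sub>F t in at_right 0. ereal (g t / t powr b) < ereal (real n1)" by (rule Limsup_lessD)
  then obtain \<epsilon>' where e': "\<epsilon>' > 0" "\<And>t. 0 < t \<Longrightarrow> t < \<epsilon>' \<Longrightarrow> g t / t powr b < real n1"
    by (auto simp: eventually_at_right_field)
  obtain n2 :: nat where "Limsup at_top (\<lambda>t. ereal (g t / t powr a)) < ereal (real n2)"
    using g2 less_PInf_Ex_of_nat by auto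
  hence "\<forall>\<^sub>F t in at_top. ereal (g t / t powr a) < ereal (real n2)" by (rule Limsup_lessD)
  then obtain T' where T': "\<And>t. t \<ge> T' \<Longrightarrow> g t / t powr a < real n2" by (auto simp: eventually_at_top_linorder)
  define \<epsilon> T where "\<epsilon> = min (\<epsilon>'/2) 1" and "T = max T' 1"
  have eT: "0 < \<epsilon>" "\<epsilon> \<le> 1" "\<epsilon> < \<epsilon>'" "T \<ge> 1" "T \<ge> T'" using e'(1) by (auto simp: \<epsilon>_def T_def)
  have "compact (g ` {\<epsilon>..T})" using eT by (intro compact_continuous_image continuous_on_subset[OF g]) auto
  then obtain B where B: "\<And>t. t \<in> {\<epsilon>..T} \<Longrightarrow> \<bar>g t\<bar> \<le> B" using compact_imp_bounded bounded_iff by (metis imageI real_norm_def)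
  have B0: "B \<ge> 0" using B[of 1] eT by auto
  define C where "C = real n1 + real n2 + B / \<epsilon> powr b + B + 1"
  have C: "C > 0" "real n1 \<le> C" "real n2 \<le> C" "B / \<epsilon> powr b \<le> C" "B \<le> C" using B0 eT by (auto simp: C_def add_increasing add_increasing2 add_nonneg_pos)
  have small: "g t \<le> C * t powr b" if t: "0 < t" "t \<le> 1" for t
  proof (cases "t \<le> \<epsilon>")
    case True
    hence "g t / t powr b < real n1" using e'(2) t eT by auto
    hence "g t \<le> real n1 * t powr b" using t by (simp add: pos_divide_less_eq)
    also have "\<dots> \<le> C * t powr b" using C by (intro mult_right_mono) auto
    finally show ?thesis .
  next
    case False
    hence "g t \<le> B" using B[of t] t eT by auto
    also have "\<dots> = B / \<epsilon> powr b * \<epsilon> powr b" using eT by simp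
    also have "\<dots> \<le> C * t powr b" using C False eT ab B0 by (intro mult_mono powr_mono2) auto
    finally show ?thesis .
  qed
  have big: "g t \<le> C * t powr a" if t: "t \<ge> 1" for t
  proof (cases "t \<ge> T")
    case True
    hence "g t / t powr a < real n2" using T' eT by auto
    hence "g t \<le> real n2 * t powr a" using t by (simp add: pos_divide_less_eq)
    also have "\<dots> \<le> C * t powr a" using C by (intro mult_right_mono) auto
    finally show ?thesis .
  next
    case False
    hence "g t \<le> B" using B[of t] t eT by auto
    also have "\<dots> \<le> C * 1" using C by simp
    also have "\<dots> \<le> C * t powr a" using C t ab by (intro mult_left_mono) (auto simp: ge_one_powr_ge_zero)
    finally show ?thesis .
  qed
  \<comment> \<open>At t = 0 both powers are 0, so the claim there is a sign condition, obtained by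
    continuity from the bound for t > 0.\<close>
  have g0: "g 0 \<le> 0"
  proof (rule tendsto_le[of "at_right (0::real)"])
    have "(g \<longlongrightarrow> g 0) (at 0 within {0..})" using g by (auto simp: continuous_on_def)
    thus "(g \<longlongrightarrow> g 0) (at_right 0)" by (rule tendsto_within_subset) auto
    have "((\<lambda>t. t) \<longlongrightarrow> 0) (at_right (0::real))" by (rule tendsto_ident_at)
    hence "((\<lambda>t. C * t powr b) \<longlongrightarrow> C * 0 powr b) (at_right 0)"
      using ab by (intro tendsto_mult tendsto_const tendsto_powr') (auto simp: eventually_at_right_field intro: exI[of _ 1])
    thus "((\<lambda>t. C * t powr b) \<longlongrightarrow> 0) (at_right 0)" by simp
    show "\<forall>\<^sub>F t in at_right 0. g t \<le> C * t powr b" using small by (auto simp: eventually_at_right_field intro!: exI[of _ 1])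
  qed auto
  show thesis
  proof (rule that[OF C(1)])
    fix t :: real assume t: "t \<ge> 0"
    consider "t = 0" | "0 < t" "t \<le> 1" | "t \<ge> 1" using t by linarith
    hence "g t \<le> C * t powr b \<and> g t \<le> C * t powr a"
    proof cases
      case 1 thus ?thesis using g0 by simp
    next
      case 2
      hence "t powr b \<le> t powr a" using ab by (intro powr_mono') auto
      hence "C * t powr b \<le> C * t powr a" using C by (intro mult_left_mono) auto
      thus ?thesis using small[OF 2] by linarith
    next
      case 3
      hence "t powr a \<le> t powr b" using ab by (intro powr_mono) auto
      hence "C * t powr a \<le> C * t powr b" using C by (intro mult_left_mono) auto
      thus ?thesis using big[OF 3] by linarith
    qed
    thus "g t \<le> C * t powr b" "g t \<le> C * t powr a" by auto
  qed
qed

text \<open>By (g3) the quotient G(t)/t^(\<theta>/2) has nonnegative derivative, hence is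
  nondecreasing from t = 1 on.\<close>

lemma primitive_lower_bound:
  fixes g G :: "real \<Rightarrow> real"
  assumes g: "continuous_on {0..} g" and G: "\<And>t. t \<ge> 0 \<Longrightarrow> G t = integral {0..t} g"
    and AR: "\<And>t. t > 0 \<Longrightarrow> \<theta>/2 * G t \<le> t * g t" and t: "t \<ge> 1"
  shows "G 1 * t powr (\<theta>/2) \<le> G t"
proof -
  have der: "(G has_real_derivative g x) (at x)" if x: "x > 0" for x
  proof -
    have "((\<lambda>t. integral {0..t} g) has_real_derivative g x) (at x within {0..x+1})"
      using x by (intro integral_has_real_derivative continuous_on_subset[OF g]) auto
    hence "((\<lambda>t. integral {0..t} g) has_real_derivative g x) (at x)"
      using x by (simp add: at_within_interior[of x "{0..x+1}"])
    thus ?thesis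
      by (rule has_field_derivative_transform_within_open[of _ _ _ "{0<..}"]) (use x G in auto)
  qed
  have "G 1 * 1 powr (-(\<theta>/2)) \<le> G t * t powr (-(\<theta>/2))"
  proof (rule DERIV_nonneg_imp_nondecreasing[OF t])
    fix x :: real assume x: "1 \<le> x" "x \<le> t"
    have "((\<lambda>x. G x * x powr (-(\<theta>/2))) has_real_derivative (g x * x powr (-(\<theta>/2)) + (-(\<theta>/2) * x powr (-(\<theta>/2) - 1)) * G x)) (at x)"
      using x by (auto intro!: derivative_eq_intros der)
    moreover have "x powr (-(\<theta>/2)) = x * x powr (-(\<theta>/2) - 1)" using x by (simp add: powr_mult_base)
    hence "g x * x powr (-(\<theta>/2)) + (-(\<theta>/2) * x powr (-(\<theta>/2) - 1)) * G x = x powr (-(\<theta>/2) - 1) * (x * g x - \<theta>/2 * G x)"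
      by (simp add: algebra_simps)
    moreover have "x powr (-(\<theta>/2) - 1) * (x * g x - \<theta>/2 * G x) \<ge> 0" using AR[of x] x by (intro mult_nonneg_nonneg) auto
    ultimately show "\<exists>y. ((\<lambda>x. G x * x powr (-(\<theta>/2))) has_real_derivative y) (at x) \<and> 0 \<le> y" by auto
  qed
  hence "G 1 \<le> G t * t powr (-(\<theta>/2))" by simp
  hence "G 1 * t powr (\<theta>/2) \<le> G t * t powr (-(\<theta>/2)) * t powr (\<theta>/2)" by (intro mult_right_mono) auto
  also have "\<dots> = G t" using t by (simp add: powr_minus)
  finally show ?thesis .
qed

text \<open>The variable t stands for |u|^2, so the cut sits at M^2. Beyond it the factor freezes at
  M^(q-p) and the growth is that of the exponent p, which is subcritical.\<close>

definition trunc_pow :: "real \<Rightarrow> real \<Rightarrow> real \<Rightarrow> real \<Rightarrow> real" where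
  "trunc_pow p q M t = t powr ((p-2)/2) * (min t (M\<^sup>2)) powr ((q-p)/2)"

lemma trunc_pow_nonneg: "trunc_pow p q M t \<ge> 0"
  by (simp add: trunc_pow_def)

lemma trunc_pow_continuous:
  assumes "2 < p" "p < q" shows "continuous_on {0..} (trunc_pow p q M)"
  unfolding trunc_pow_def[abs_def] using assms by (intro continuous_intros continuous_on_powr') auto

lemma trunc_pow_eq:
  assumes "0 \<le> t" "t \<le> M\<^sup>2" shows "trunc_pow p q M t = t powr ((q-2)/2)"
proof -
  have e: "(p-2)/2 + (q-p)/2 = (q-2)/2" by (simp add: field_simps)
  have "trunc_pow p q M t = t powr ((p-2)/2) * t powr ((q-p)/2)" using assms by (simp add: trunc_pow_def)
  also have "\<dots> = t powr ((q-2)/2)" unfolding powr_add[symmetric] e ..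
  finally show ?thesis .
qed

lemma trunc_pow_le:
  assumes p: "2 < p" "p < m" "m \<le> q" and M: "M \<ge> 1" and lam: "0 \<le> lam" "lam \<le> M powr (-(q-p))" and t: "t \<ge> 0"
  shows "lam * trunc_pow p q M t \<le> t powr ((p-2)/2)" "lam * trunc_pow p q M t \<le> t powr ((m-2)/2)"
proof -
  have lM: "lam * (min t (M\<^sup>2)) powr ((q-p)/2) \<le> 1"
  proof -
    have "lam * (min t (M\<^sup>2)) powr ((q-p)/2) \<le> M powr (-(q-p)) * (M\<^sup>2) powr ((q-p)/2)"
      using lam t p by (intro mult_mono powr_mono2) auto
    also have "(M\<^sup>2) powr ((q-p)/2) = M powr (q-p)"
    proof -
      have 1: "(M\<^sup>2) powr ((q-p)/2) = (M powr 2) powr ((q-p)/2)" using M by simp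
      have 2: "2 * ((q-p)/2) = q-p" by simp
      show ?thesis unfolding 1 powr_powr 2 ..
    qed
    also have "M powr (-(q-p)) * M powr (q-p) = 1" using M by (simp add: powr_add[symmetric])
    finally show ?thesis .
  qed
  have e: "lam * trunc_pow p q M t = (lam * (min t (M\<^sup>2)) powr ((q-p)/2)) * t powr ((p-2)/2)" by (simp add: trunc_pow_def)
  show 1: "lam * trunc_pow p q M t \<le> t powr ((p-2)/2)"
    unfolding e using lM by (intro mult_left_le_one_le) (auto simp: lam)
  show "lam * trunc_pow p q M t \<le> t powr ((m-2)/2)"
  proof (cases "t \<le> 1")
    case True
    have "lam \<le> 1" using lam M p powr_mono[of "-(q-p)" 0 M] by simp
    hence "lam * trunc_pow p q M t \<le> 1 * trunc_pow p q M t" using trunc_pow_nonneg by (intro mult_right_mono) auto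
    also have "\<dots> = t powr ((q-2)/2)" using True M t by (simp add: trunc_pow_eq order_trans[OF True one_le_power])
    also have "\<dots> \<le> t powr ((m-2)/2)" using True t p by (intro powr_mono') auto
    finally show ?thesis .
  next
    case False
    hence "t powr ((p-2)/2) \<le> t powr ((m-2)/2)" using p by (intro powr_mono) auto
    thus ?thesis using 1 by linarith
  qed
qed

text \<open>The truncated factor is nondecreasing, so on [0,t] it may be replaced by its value at t,
  and what remains is the exact integral of a power with exponent (p-2)/2. Since \<theta> \<le> p,
  the truncation keeps condition (g3).\<close>

lemma trunc_pow_AR:
  assumes p: "2 < p" "p < q" and t: "t \<ge> 0"
  shows "p/2 * integral {0..t} (trunc_pow p q M) \<le> t * trunc_pow p q M t"
proof -
  have "integral {0..t} (trunc_pow p q M) \<le> integral {0..t} (\<lambda>\<tau>. \<tau> powr ((p-2)/2) * (min t (M\<^sup>2)) powr ((q-p)/2))"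
  proof (rule integral_le)
    show "trunc_pow p q M integrable_on {0..t}"
      by (intro integrable_continuous_real continuous_on_subset[OF trunc_pow_continuous[OF p]]) auto
    show "(\<lambda>\<tau>. \<tau> powr ((p-2)/2) * (min t (M\<^sup>2)) powr ((q-p)/2)) integrable_on {0..t}"
      using p by (intro integrable_continuous_real continuous_intros continuous_on_powr') auto
  qed (use p in \<open>auto simp: trunc_pow_def intro!: mult_left_mono powr_mono2\<close>)
  also have "\<dots> = t powr (p/2) / (p/2) * (min t (M\<^sup>2)) powr ((q-p)/2)"
  proof -
    have "((\<lambda>\<tau>. \<tau> powr ((p-2)/2)) has_integral (t powr ((p-2)/2+1) / ((p-2)/2+1))) {0..t}"
      using p t by (intro has_integral_powr_from_0) auto
    moreover have "(p-2)/2+1 = p/2" by (simp add: field_simps)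
    ultimately have "((\<lambda>\<tau>. \<tau> powr ((p-2)/2)) has_integral (t powr (p/2) / (p/2))) {0..t}" by (simp only:)
    hence "((\<lambda>\<tau>. \<tau> powr ((p-2)/2) * (min t (M\<^sup>2)) powr ((q-p)/2)) has_integral (t powr (p/2) / (p/2) * (min t (M\<^sup>2)) powr ((q-p)/2))) {0..t}"
      by (rule has_integral_mult_left)
    thus ?thesis by (rule integral_unique)
  qed
  finally have "p/2 * integral {0..t} (trunc_pow p q M) \<le> p/2 * (t powr (p/2) / (p/2) * (min t (M\<^sup>2)) powr ((q-p)/2))"
    using p by (intro mult_left_mono) auto
  also have "\<dots> = t powr (p/2) * (min t (M\<^sup>2)) powr ((q-p)/2)" using p by simp
  also have "t powr (p/2) = t * t powr ((p-2)/2)"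
  proof -
    have "1 + (p-2)/2 = p/2" by (simp add: field_simps)
    thus ?thesis using powr_mult_base[OF t, of "(p-2)/2"] by (simp only:)
  qed
  finally show ?thesis by (simp add: trunc_pow_def[of _ _ _ t] mult.assoc)
qed

text \<open>The assumptions on g concern t \<ge> 0 only; max 0 t extends the nonlinearity
  continuously, hence measurably, to the whole line.\<close>

definition truncated_nl :: "(real \<Rightarrow> real) \<Rightarrow> real \<Rightarrow> real \<Rightarrow> real \<Rightarrow> real \<Rightarrow> real \<Rightarrow> real" where
  "truncated_nl g lam p q M t = g (max 0 t) + lam * trunc_pow p q M (max 0 t)"

definition penalize :: "(real \<Rightarrow> real) \<Rightarrow> real \<Rightarrow> ('a::real_normed_vector \<Rightarrow> real) \<Rightarrow> 'a \<Rightarrow> real \<Rightarrow> real" where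
  "penalize k R P x t = (if norm x \<le> R then k t else min (k t) (P x))"

lemma powr_sublinear_bound:
  fixes c m l \<delta> :: real
  assumes "c \<ge> 0" "0 < m" "m < l" "\<delta> > 0"
  shows "\<exists>C\<ge>0. \<forall>t\<ge>0. c * t powr m \<le> \<delta> * t powr l + C"
proof -
  define T where "T = (c/\<delta>) powr (1/(l-m))"
  have T0: "T \<ge> 0" by (simp add: T_def)
  have "c * t powr m \<le> \<delta> * t powr l + c * T powr m" if t: "t \<ge> 0" for t
  proof (cases "t \<le> T")
    case True
    hence "c * t powr m \<le> c * T powr m" using assms t by (intro mult_left_mono powr_mono2) auto
    thus ?thesis using assms by (simp add: add_increasing)
  next
    case False
    have "T powr (l-m) \<le> t powr (l-m)" using False assms T0 by (intro powr_mono2) auto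
    moreover have "T powr (l-m) = c/\<delta>" using assms by (simp add: T_def powr_powr)
    ultimately have "c \<le> \<delta> * t powr (l-m)" using assms by (simp add: field_simps)
    hence "c * t powr m \<le> \<delta> * t powr (l-m) * t powr m" by (intro mult_right_mono) auto
    also have "\<dots> = \<delta> * t powr l" by (simp add: powr_add[symmetric] mult.assoc)
    finally show ?thesis using assms T0 by (simp add: add_increasing2)
  qed
  thus ?thesis using assms by (intro exI[of _ "c * T powr m"]) auto
qed

text \<open>A Lipschitz function supported in the unit ball, where V is bounded by Vinf and the
  penalization is inactive; a multiple of it is the mountain pass endpoint.\<close>

definition tent :: "real^'n \<Rightarrow> complex" where "tent x = of_real (max 0 (1 - norm x))"

lemma tent_measurable [measurable]: "tent \<in> borel_measurable borel"
  unfolding tent_def[abs_def] by measurable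

lemma cmod_tent: "cmod (tent x) = max 0 (1 - norm x)" unfolding tent_def norm_of_real by simp

text \<open>The increment is split into that of the tent, which is Lipschitz, and a phase error
  bounded by B |x-y|; together they are controlled by min(1, |x-y|^2) over pairs meeting the unit
  ball.\<close>

lemma tent_magd_integrable:
  fixes A :: "real^'n \<Rightarrow> real^'n"
  assumes s: "0 < s" "s < 1" and A: "continuous_on UNIV A"
  shows "integrable (KM s) (\<lambda>z. (cmod (magd A tent z))\<^sup>2)"
proof -
  have "compact (A ` cball 0 2)" by (intro compact_continuous_image continuous_on_subset[OF A]) auto
  then obtain B where B: "\<And>x. x \<in> cball 0 2 \<Longrightarrow> norm (A x) \<le> B" using compact_imp_bounded bounded_iff by (metis imageI)
  have B0: "B \<ge> 0" using B[of 0] norm_ge_zero[of "A 0"] by (simp del: norm_ge_zero) 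
  define C where "C = (1 + B)\<^sup>2 + 4"
  let ?S = "cball (0::real^'n) 1"
  have bound: "(cmod (magd A tent (x, y)))\<^sup>2 \<le> C * (min 1 ((norm (x - y))\<^sup>2) * (indicator ?S x + indicator ?S y))" for x y
  proof (cases "x \<in> ?S \<or> y \<in> ?S")
    case False
    hence "tent x = 0" "tent y = 0" by (auto simp: tent_def max_def)
    thus ?thesis using False by (simp add: magd_def mag_diff_def)
  next
    case True
    define a where "a = A ((1/2) *\<^sub>R (x + y)) \<bullet> (x - y)"
    have e1: "cmod (tent x) \<le> 1" for x :: "real^'n" by (simp add: cmod_tent)
    have m: "magd A tent (x, y) = (tent x - tent y) + tent y * (1 - cis a)"
      by (simp add: magd_def mag_diff_def a_def algebra_simps)
    have "(cmod (magd A tent (x, y)))\<^sup>2 \<le> C * min 1 ((norm (x - y))\<^sup>2)"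
    proof (cases "norm (x - y) \<le> 1")
      case near: True
      \<comment> \<open>Keeps the midpoint of a near pair in the ball of radius 2, where A is
        bounded.\<close>
      have "norm (x + y) \<le> 4"
      proof -
        have "norm x \<le> norm y + norm (x - y)" "norm y \<le> norm x + norm (x - y)"
          using norm_triangle_sub[of x y] norm_triangle_sub[of y x] by (auto simp: norm_minus_commute)
        hence "norm x + norm y \<le> 4" using True near by auto
        thus ?thesis using norm_triangle_ineq[of x y] by linarith
      qed
      hence "norm (A ((1/2) *\<^sub>R (x + y))) \<le> B" by (intro B) simp
      hence "\<bar>a\<bar> \<le> B * norm (x - y)"
        unfolding a_def by (rule order_trans[OF Cauchy_Schwarz_ineq2 mult_right_mono]) simp
      hence "cmod (1 - cis a) \<le> B * norm (x - y)" by (rule order_trans[OF norm_cis_diff_le])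
      hence "cmod (tent y * (1 - cis a)) \<le> 1 * (B * norm (x - y))" unfolding norm_mult using e1 by (intro mult_mono) auto
      moreover have "cmod (tent x - tent y) \<le> norm (x - y)"
      proof -
        have "cmod (tent x - tent y) = \<bar>max 0 (1 - norm x) - max 0 (1 - norm y)\<bar>"
          unfolding tent_def of_real_diff[symmetric] norm_of_real ..
        also have "\<dots> \<le> \<bar>norm x - norm y\<bar>" by linarith
        also have "\<dots> \<le> norm (x - y)" by (rule norm_triangle_ineq3)
        finally show ?thesis .
      qed
      ultimately have "cmod (magd A tent (x, y)) \<le> (1 + B) * norm (x - y)"
        unfolding m using norm_triangle_ineq[of "tent x - tent y" "tent y * (1 - cis a)"] by (simp add: algebra_simps)
      hence "(cmod (magd A tent (x, y)))\<^sup>2 \<le> ((1 + B) * norm (x - y))\<^sup>2" by (intro power_mono) auto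
      also have "\<dots> = (1 + B)\<^sup>2 * (norm (x - y))\<^sup>2" by (rule power_mult_distrib)
      also have "\<dots> \<le> C * (norm (x - y))\<^sup>2" by (intro mult_right_mono) (auto simp: C_def)
      also have "(norm (x - y))\<^sup>2 = min 1 ((norm (x - y))\<^sup>2)" using near by (simp add: power_le_one)
      finally show ?thesis .
    next
      case False
      have "cmod (magd A tent (x, y)) \<le> cmod (tent x) + cmod (tent y)"
        unfolding magd_def mag_diff_def by (rule order_trans[OF norm_triangle_ineq4]) (simp add: norm_mult)
      also have "\<dots> \<le> 2" using e1[of x] e1[of y] by linarith
      finally have "(cmod (magd A tent (x, y)))\<^sup>2 \<le> 2\<^sup>2" by (intro power_mono) auto
      also have "\<dots> \<le> C" by (simp add: C_def)
      also have "C = C * min 1 ((norm (x - y))\<^sup>2)" using False by (simp add: one_le_power)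
      finally show ?thesis .
    qed
    also have "\<dots> \<le> C * min 1 ((norm (x - y))\<^sup>2) * (indicator ?S x + indicator ?S y)"
    proof -
      have "C * min 1 ((norm (x - y))\<^sup>2) \<ge> 0" by (simp add: C_def)
      moreover have "1 \<le> indicator ?S x + (indicator ?S y :: real)" using True by (auto simp: indicator_def)
      ultimately show ?thesis using mult_left_mono[of 1 "indicator ?S x + indicator ?S y" "C * min 1 ((norm (x - y))\<^sup>2)"] by simp
    qed
    finally show ?thesis by (simp only: mult.assoc)
  qed
  show ?thesis
  proof (rule Bochner_Integration.integrable_bound)
    show "integrable (KM s) (\<lambda>z. C * (min 1 ((norm (fst z - snd z))\<^sup>2) * (indicator ?S (fst z) + indicator ?S (snd z))))"
      by (intro integrable_mult_right KM_trunc_integrable[OF s]) (use emeasure_lborel_cball_finite[of "0::real^'n" 1] in auto)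
    show "(\<lambda>z. (cmod (magd A tent z))\<^sup>2) \<in> borel_measurable (KM s)"
      using measurable_magd[OF A tent_measurable] by measurable
    show "AE z in KM s. norm ((cmod (magd A tent z))\<^sup>2) \<le> norm (C * (min 1 ((norm (fst z - snd z))\<^sup>2) * (indicator ?S (fst z) + indicator ?S (snd z))))"
    proof (rule AE_I2)
      fix z
      show "norm ((cmod (magd A tent z))\<^sup>2) \<le> norm (C * (min 1 ((norm (fst z - snd z))\<^sup>2) * (indicator ?S (fst z) + indicator ?S (snd z))))"
        using order_trans[OF bound[of "fst z" "snd z"] abs_ge_self] by simp
    qed
  qed
qed

lemma tent_powr_integrable: assumes "m > 0" shows "integrable lborel (\<lambda>x. cmod (tent (x::real^'n)) powr m)"
proof (rule Bochner_Integration.integrable_bound)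
  show "integrable lborel (indicator (cball (0::real^'n) 1) :: _ \<Rightarrow> real)" using emeasure_lborel_cball_finite[of "0::real^'n" 1] by (intro integrable_real_indicator) auto
  show "AE x in lborel. norm (cmod (tent (x::real^'n)) powr m) \<le> norm (indicator (cball 0 1) x :: real)"
    using assms by (intro AE_I2) (auto simp: indicator_def cmod_tent max_def intro!: powr_le1)
qed measurable

context mag_space
begin

lemma tent_energy:
  assumes V1: "\<And>x. x \<in> ball 0 1 \<Longrightarrow> V x \<le> Vinf"
  shows tent_E: "tent \<in> E"
    and tent_nrm: "(nrm tent)\<^sup>2 \<le> (\<integral>z. (cmod (magd A tent z))\<^sup>2 \<partial>KM s) + Vinf * (\<integral>(x::real^'n). (cmod (tent x))\<^sup>2 \<partial>lborel)"
proof -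
  have le: "V x * (cmod (tent x))\<^sup>2 \<le> Vinf * (cmod (tent x))\<^sup>2" for x
  proof (cases "x \<in> ball 0 1")
    case True thus ?thesis using V1 by (intro mult_right_mono) auto
  qed (auto simp: cmod_tent)
  have int2: "integrable lborel (\<lambda>(x::real^'n). Vinf * (cmod (tent x))\<^sup>2)"
    using tent_powr_integrable[of 2, where 'n='n] by simp
  have int: "integrable lborel (\<lambda>x. V x * (cmod (tent x))\<^sup>2)"
  proof (rule Bochner_Integration.integrable_bound[OF int2])
    show "AE x in lborel. norm (V x * (cmod (tent x))\<^sup>2) \<le> norm (Vinf * (cmod (tent x))\<^sup>2)"
      using le V0 by (intro AE_I2) (auto intro!: order_trans[OF _ abs_ge_self])
  qed measurable
  show E: "tent \<in> E" unfolding E_iff using tent_powr_integrable[of ps] ps_gt_2 tent_magd_integrable[OF s A] int by auto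
  have "(\<integral>x. V x * (cmod (tent x))\<^sup>2 \<partial>lborel) \<le> (\<integral>(x::real^'n). Vinf * (cmod (tent x))\<^sup>2 \<partial>lborel)"
    by (rule Bochner_Integration.integral_mono[OF int int2 le])
  thus "(nrm tent)\<^sup>2 \<le> (\<integral>z. (cmod (magd A tent z))\<^sup>2 \<partial>KM s) + Vinf * (\<integral>(x::real^'n). (cmod (tent x))\<^sup>2 \<partial>lborel)"
    by (simp add: nrm_sq ip_self)
qed

end

context mag_nl
begin

text \<open>The Sobolev inequality bounds the integral of the primitive by C1 Cs^(ps/2) (nrm u)^ps,
  which for nrm u \<le> r is at most half of (nrm u)^2; so a quarter of the squared norm
  survives.\<close>

lemma I_lower:
  assumes u: "u \<in> E" "nrm u \<le> r" and r: "C1 * Cs powr (ps/2) * r powr (ps - 2) \<le> 1/2"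
  shows "I u \<ge> (nrm u)\<^sup>2 / 4"
proof -
  have "(\<integral>x. Ff x ((cmod (u x))\<^sup>2) \<partial>lborel) \<le> C1 * (\<integral>x. cmod (u x) powr ps \<partial>lborel)" by (rule Ff_integral_le[OF u(1)])
  also have "\<dots> \<le> C1 * (Cs * (nrm u)\<^sup>2) powr (ps/2)" by (intro mult_left_mono sobolev_nrm u C1_nonneg)
  also have "(Cs * (nrm u)\<^sup>2) powr (ps/2) = Cs powr (ps/2) * ((nrm u)\<^sup>2 powr (ps/2))" using Cs_pos by (simp add: powr_mult)
  also have "(nrm u)\<^sup>2 powr (ps/2) = (nrm u)\<^sup>2 * nrm u powr (ps-2)"
  proof (cases "nrm u = 0")
    case False
    hence n0: "nrm u > 0" using nrm_nonneg[of u] by linarith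
    have "(nrm u)\<^sup>2 powr (ps/2) = (nrm u powr 2) powr (ps/2)" using n0 by simp
    also have "\<dots> = nrm u powr (2 + (ps - 2))" unfolding powr_powr by simp
    also have "\<dots> = nrm u powr 2 * nrm u powr (ps-2)" by (rule powr_add)
    finally show ?thesis using n0 by simp
  qed simp
  also have "C1 * (Cs powr (ps/2) * ((nrm u)\<^sup>2 * nrm u powr (ps-2))) = (C1 * Cs powr (ps/2) * nrm u powr (ps-2)) * (nrm u)\<^sup>2" by (simp only: mult_ac)
  also have "\<dots> \<le> (C1 * Cs powr (ps/2) * r powr (ps-2)) * (nrm u)\<^sup>2"
    using u C1_nonneg ps_gt_2 by (intro mult_right_mono mult_left_mono powr_mono2) auto
  also have "\<dots> \<le> 1/2 * (nrm u)\<^sup>2" by (intro mult_right_mono r) auto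
  finally show ?thesis unfolding I_def by linarith
qed

lemma I_scale_le: "I (t *\<^sub>R u) \<le> t\<^sup>2 * (nrm u)\<^sup>2 / 2"
proof -
  have "(\<integral>x. Ff x ((cmod ((t *\<^sub>R u) x))\<^sup>2) \<partial>lborel) \<ge> 0" by (intro Bochner_Integration.integral_nonneg Ff_nonneg)
  moreover have "(nrm (t *\<^sub>R u))\<^sup>2 = t\<^sup>2 * (nrm u)\<^sup>2" unfolding nrm_scale by (simp add: power_mult_distrib)
  ultimately show ?thesis unfolding I_def by linarith
qed

end

text \<open>The factor \<open>2\<theta>/(\<theta>-2)\<close> in the last assumption is what the coercivity estimate needs; the remaining
  constant makes the cap dominate \<open>(C0+1)|U|^(2*_s-2)\<close> for \<open>|U| \<le> M (2R^2)^((N-2s)/2) |x|^(-(N-2s))\<close>.\<close>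

locale penalized = mag_space s ps Cs A V for s ps Cs :: real and A :: "real^'n \<Rightarrow> real^'n" and V :: "real^'n \<Rightarrow> real" +
  fixes g G :: "real \<Rightarrow> real" and \<theta> p q C0 lam M R :: real
  assumes exponents: "2 < \<theta>" "\<theta> \<le> p" "p < ps" "ps \<le> q"
    and g: "continuous_on {0..} g" and G: "\<And>t. t \<ge> 0 \<Longrightarrow> G t = integral {0..t} g"
    and g_AR: "\<And>t. t > 0 \<Longrightarrow> 0 < \<theta> / 2 * G t \<and> \<theta> / 2 * G t \<le> t * g t"
    and C0: "C0 > 0" and g_le: "\<And>t. t \<ge> 0 \<Longrightarrow> g t \<le> C0 * t powr ((ps-2)/2)" "\<And>t. t \<ge> 0 \<Longrightarrow> g t \<le> C0 * t powr ((p-2)/2)"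
    and M: "M \<ge> 1" and lam: "0 \<le> lam" "lam \<le> M powr (-(q-p))" and R: "R \<ge> 1"
    and V_large: "\<And>x. norm x > R \<Longrightarrow> 2 * \<theta> / (\<theta> - 2) * ((C0 + 1) * M powr (ps-2) * 2 powr (2 * s)) * (R / norm x) powr (4 * s) \<le> V x"
begin

definition P where "P x = (C0 + 1) * M powr (ps-2) * 2 powr (2 * s) * (R / norm (x::real^'n)) powr (4 * s)"
definition k where "k = truncated_nl g lam p q M"
definition f where "f = penalize k R P"

lemma p_gt_2: "2 < p" and p_lt_q: "p < q" using exponents by auto

lemma g_pos: assumes "t > 0" shows "g t > 0"
proof -
  have "t * g t > 0" using g_AR[OF assms] by linarith
  thus ?thesis using assms by (simp add: zero_less_mult_iff)
qed

lemma g_nonneg: assumes "t \<ge> 0" shows "g t \<ge> 0"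
proof (cases "t = 0")
  case True
  have "(g \<longlongrightarrow> g 0) (at 0 within {0..})" using g by (auto simp: continuous_on_def)
  hence "(g \<longlongrightarrow> g 0) (at_right 0)" by (rule tendsto_within_subset) auto
  moreover have "\<forall>\<^sub>F t in at_right 0. 0 \<le> g t" using g_pos less_imp_le by (auto simp: eventually_at_right_field intro!: exI[of _ 1])
  ultimately show ?thesis unfolding True by (intro tendsto_lowerbound) auto
next
  case False thus ?thesis using g_pos[of t] assms by simp
qed

lemma g_max_continuous: "continuous_on UNIV (\<lambda>t. g (max 0 t))"
  by (rule continuous_on_compose2[OF g]) (auto intro!: continuous_intros)

lemma k_continuous: "continuous_on UNIV k"
  unfolding k_def truncated_nl_def[abs_def]
  by (intro continuous_on_add continuous_on_mult_left g_max_continuous continuous_on_compose2[OF trunc_pow_continuous[OF p_gt_2 p_lt_q]] continuous_intros) auto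

lemma k_measurable [measurable]: "k \<in> borel_measurable borel"
  by (rule borel_measurable_continuous_onI[OF k_continuous])

lemma k_eq: "t \<ge> 0 \<Longrightarrow> k t = g t + lam * trunc_pow p q M t" by (simp add: k_def truncated_nl_def max_def)

lemma k_nonneg: "t \<ge> 0 \<Longrightarrow> k t \<ge> 0" using g_nonneg lam by (simp add: k_eq trunc_pow_nonneg)

lemma k_le:
  assumes "t \<ge> 0" shows k_le_crit: "k t \<le> (C0 + 1) * t powr ((ps-2)/2)" and k_le_sub: "k t \<le> (C0 + 1) * t powr ((p-2)/2)"
  using g_le[OF assms] trunc_pow_le[OF p_gt_2 exponents(3,4) M lam assms] by (simp_all add: k_eq assms algebra_simps)

lemma P_nonneg: "P x \<ge> 0" using C0 by (simp add: P_def)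

lemma V_ge_P: "norm x > R \<Longrightarrow> 2 * \<theta> / (\<theta> - 2) * P x \<le> V x"
  using V_large[of x] by (simp add: P_def mult_ac)

lemma f_le_P: "norm x > R \<Longrightarrow> f x t \<le> P x" by (simp add: f_def penalize_def)

lemma f_le_k: "f x t \<le> k t" by (simp add: f_def penalize_def)

lemma f_inside: "norm x \<le> R \<Longrightarrow> f x = k" by (auto simp: f_def penalize_def)

lemma penalized_nonneg: "t \<ge> 0 \<Longrightarrow> f x t \<ge> 0" using k_nonneg P_nonneg by (simp add: f_def penalize_def)

text \<open>The exponent ps/(ps-2) equals N/(2s), so this power of P is a multiple of |x|^(-2N),
  compared outside the ball with (R^2 + |x|^2)^(-N).\<close>

lemma P_integrable: "integrable lborel (\<lambda>x. P x powr (ps/(ps-2)) * indicator (- cball 0 R) x)"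
proof (rule Bochner_Integration.integrable_bound)
  define n where "n = real CARD('n)"
  define B where "B = (C0 + 1) * M powr (ps-2) * 2 powr (2 * s)"
  have B: "B > 0" using C0 M by (simp add: B_def)
  define c where "c = B powr (ps/(ps-2)) * (R powr (2 * n) * 2 powr n)"
  show "integrable lborel (\<lambda>x::real^'n. c * (R\<^sup>2 + (norm x)\<^sup>2) powr (-real DIM(real^'n)))"
    using R by (intro integrable_mult_right integrable_bubble_weight) auto
  show "AE x in lborel. norm (P x powr (ps/(ps-2)) * indicator (- cball 0 R) x) \<le> norm (c * (R\<^sup>2 + (norm x)\<^sup>2) powr (-real DIM(real^'n)))"
  proof (rule AE_I2)
    fix x :: "real^'n"
    show "norm (P x powr (ps/(ps-2)) * indicator (- cball 0 R) x) \<le> norm (c * (R\<^sup>2 + (norm x)\<^sup>2) powr (-real DIM(real^'n)))"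
    proof (cases "norm x > R")
      case True
      hence x0: "norm x > 0" using R by linarith
      have e: "4 * s * (ps/(ps-2)) = 2 * n"
        using s N by (simp add: ps_def sobolev_crit_def n_def field_simps)
      have "P x powr (ps/(ps-2)) = B powr (ps/(ps-2)) * ((R / norm x) powr (4 * s)) powr (ps/(ps-2))"
        unfolding P_def B_def[symmetric] using B by (simp add: powr_mult)
      also have "((R / norm x) powr (4 * s)) powr (ps/(ps-2)) = (R / norm x) powr (2 * n)" unfolding powr_powr e ..
      also have "\<dots> = R powr (2 * n) * norm x powr (2 * (- n))" using R x0 by (simp add: powr_divide powr_minus_divide)
      also have "norm x powr (2 * (- n)) = ((norm x)\<^sup>2) powr (- n)" using x0 unfolding powr_powr[symmetric] by simp
      also have "\<dots> \<le> ((R\<^sup>2 + (norm x)\<^sup>2) / 2) powr (- n)"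
      proof (rule powr_mono2')
        have "R\<^sup>2 \<le> (norm x)\<^sup>2" using True R by (intro power_mono) auto
        thus "(R\<^sup>2 + (norm x)\<^sup>2) / 2 \<le> (norm x)\<^sup>2" by simp
        show "0 < (R\<^sup>2 + (norm x)\<^sup>2) / 2" using R by (simp add: add_pos_nonneg)
      qed (simp add: n_def)
      also have "\<dots> = 2 powr n * (R\<^sup>2 + (norm x)\<^sup>2) powr (- n)" by (simp add: powr_divide powr_minus field_simps)
      finally have "P x powr (ps/(ps-2)) \<le> c * (R\<^sup>2 + (norm x)\<^sup>2) powr (- n)" using R by (simp add: c_def mult_left_mono mult.assoc)
      thus ?thesis using True by (simp add: n_def c_def)
    qed (auto simp: indicator_def)
  qed
qed (simp add: P_def)

text \<open>In the ball the growth exponent p < ps leaves room for a small multiple of t^ps plus a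
  constant. Outside, P t is compared with d t^(ps-1): either it is smaller, and its dual power is at
  most \<delta> t^ps, or t is bounded by a power of P and the dual power is a multiple of
  P^(ps/(ps-2)).\<close>

lemma penalized_compact:
  assumes \<delta>: "\<delta> > 0"
  shows "\<exists>\<Psi>. integrable lborel \<Psi> \<and> (\<forall>x t. t \<ge> 0 \<longrightarrow> (f x (t\<^sup>2) * t) powr (ps/(ps-1)) \<le> \<delta> * t powr ps + \<Psi> x)"
proof -
  define r where "r = ps/(ps-1)"
  have r: "r > 0" "(ps-1) * r = ps" using ps_gt_2 by (auto simp: r_def)
  have "(p-1) * r < (ps-1) * r" using exponents r by (intro mult_strict_right_mono) auto
  hence "(p-1) * r < ps" using r by simp
  moreover have "(p-1) * r > 0" using r p_gt_2 by simp
  ultimately obtain C where C: "C \<ge> 0" "\<And>t. t \<ge> 0 \<Longrightarrow> (C0+1) powr r * t powr ((p-1) * r) \<le> \<delta> * t powr ps + C"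
    using powr_sublinear_bound[of "(C0+1) powr r" "(p-1) * r" ps \<delta>] \<delta> by auto
  \<comment> \<open>Normalised so that the dual power of d t^(ps-1) is exactly \<delta>
    t^ps.\<close>
  define d where "d = \<delta> powr (1/r)"
  have d: "d > 0" "d powr r = \<delta>" using \<delta> r by (auto simp: d_def powr_powr)
  define c where "c = (1/d) powr (r/(ps-2))"
  define \<Psi> where "\<Psi> x = C * indicator (cball 0 R) x + c * (P x powr (ps/(ps-2)) * indicator (- cball 0 R) x)" for x
  have ball: "integrable lborel (indicator (cball (0::real^'n) R) :: _ \<Rightarrow> real)"
    using emeasure_lborel_cball_finite[of "0::real^'n" R] by (intro integrable_real_indicator) auto
  have "integrable lborel \<Psi>" unfolding \<Psi>_def[abs_def]
    by (intro Bochner_Integration.integrable_add integrable_mult_right P_integrable ball)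
  moreover have "(f x (t\<^sup>2) * t) powr r \<le> \<delta> * t powr ps + \<Psi> x" if t: "t \<ge> 0" for x t
  proof (cases "norm x \<le> R")
    case True
    have tp: "(t\<^sup>2) powr ((p-2)/2) * t = t powr (p-1)"
      using power2_powr_half[OF t, of "p-2"] powr_mult_base[OF t, of "p-2"] by (simp add: mult.commute)
    have "f x (t\<^sup>2) * t \<le> (C0 + 1) * (t\<^sup>2) powr ((p-2)/2) * t"
      unfolding f_inside[OF True] using t by (intro mult_right_mono k_le_sub) auto
    also have "\<dots> = (C0 + 1) * t powr (p-1)" by (simp only: mult.assoc tp)
    finally have "(f x (t\<^sup>2) * t) powr r \<le> ((C0 + 1) * t powr (p-1)) powr r"
      using t r penalized_nonneg by (intro powr_mono2) auto
    also have "\<dots> = (C0+1) powr r * t powr ((p-1) * r)" using C0 by (simp add: powr_mult powr_powr)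
    also have "\<dots> \<le> \<delta> * t powr ps + C" by (rule C(2)[OF t])
    finally show ?thesis using True by (simp add: \<Psi>_def)
  next
    case False
    hence x: "norm x > R" by simp
    have le: "(f x (t\<^sup>2) * t) powr r \<le> (P x * t) powr r"
      using t r penalized_nonneg f_le_P[OF x] by (intro powr_mono2 mult_right_mono) auto
    have Psi: "\<Psi> x = c * P x powr (ps/(ps-2))" using False by (simp add: \<Psi>_def)
    show ?thesis
    proof (cases "P x \<le> d * t powr (ps-2)")
      case True
      have "(P x * t) powr r \<le> (d * t powr (ps-2) * t) powr r"
        using t r True P_nonneg by (intro powr_mono2 mult_right_mono) auto
      also have "d * t powr (ps-2) * t = d * t powr (ps-1)" using powr_mult_base[OF t, of "ps-2"] by (simp add: mult_ac)
      also have "(d * t powr (ps-1)) powr r = \<delta> * t powr ps" using d r by (simp add: powr_mult powr_powr)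
      finally show ?thesis using le by (simp add: Psi c_def add_increasing2)
    next
      case False
      have "t = (t powr (ps-2)) powr (1/(ps-2))" using t ps_gt_2 by (simp add: powr_powr)
      also have "\<dots> \<le> (P x / d) powr (1/(ps-2))" using False d ps_gt_2 by (intro powr_mono2) (auto simp: field_simps)
      finally have "(P x * t) powr r \<le> (P x * (P x / d) powr (1/(ps-2))) powr r"
        using t r P_nonneg by (intro powr_mono2 mult_left_mono) auto
      also have "P x * (P x / d) powr (1/(ps-2)) = (1/d) powr (1/(ps-2)) * (P x * P x powr (1/(ps-2)))"
        using P_nonneg[of x] d powr_mult[of "1/d" "P x" "1/(ps-2)"] by simp
      also have "P x * P x powr (1/(ps-2)) = P x powr ((ps-1)/(ps-2))"
      proof -
        have "1 + 1/(ps-2) = (ps-1)/(ps-2)" using ps_gt_2 by (simp add: field_simps)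
        thus ?thesis using powr_mult_base[OF P_nonneg[of x], of "1/(ps-2)"] by (simp only:)
      qed
      also have "((1/d) powr (1/(ps-2)) * P x powr ((ps-1)/(ps-2))) powr r = c * P x powr ((ps-1)/(ps-2) * r)"
        using d by (simp add: powr_mult powr_powr c_def)
      also have "(ps-1)/(ps-2) * r = ps/(ps-2)" using ps_gt_2 by (simp add: r_def)
      finally have "(f x (t\<^sup>2) * t) powr r \<le> \<Psi> x" using le unfolding Psi by linarith
      thus ?thesis using \<delta> by (simp add: add_increasing)
    qed
  qed
  ultimately show ?thesis unfolding r_def by blast
qed

lemma penalized_measurable: "(\<lambda>z. f (fst z) (snd z)) \<in> borel_measurable (borel \<Otimes>\<^sub>M borel)"
proof -
  have [measurable]: "P \<in> borel_measurable borel" unfolding P_def[abs_def] by measurable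
  show ?thesis unfolding f_def penalize_def by measurable
qed

sublocale mag_nl s ps Cs A V f "C0 + 1"
proof
  show "(\<lambda>z. f (fst z) (snd z)) \<in> borel_measurable (borel \<Otimes>\<^sub>M borel)" by (rule penalized_measurable)
  show "continuous_on {0..} (f x)" for x
    unfolding f_def penalize_def
    by (cases "norm x \<le> R") (auto intro!: continuous_intros continuous_on_subset[OF k_continuous])
  show "0 \<le> f x t" if "t \<ge> 0" for x t using that by (rule penalized_nonneg)
  show "f x t \<le> (C0 + 1) * t powr ((ps - 2)/2)" if "t \<ge> 0" for x t using f_le_k k_le_crit[OF that] by (rule order_trans)
  show "\<exists>\<Psi>. integrable lborel \<Psi> \<and> (\<forall>x t. t \<ge> 0 \<longrightarrow> (f x (t\<^sup>2) * t) powr (ps/(ps-1)) \<le> \<delta> * t powr ps + \<Psi> x)" if "\<delta> > 0" for \<delta>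
    using that by (rule penalized_compact)
qed

lemma Ff_inside:
  assumes "norm x \<le> R" "t \<ge> 0"
  shows "Ff x t = G t + lam * integral {0..t} (trunc_pow p q M)"
proof -
  have "Ff x t = integral {0..t} (\<lambda>\<tau>. g \<tau> + lam * trunc_pow p q M \<tau>)"
    unfolding Ff_eq_integral[OF assms(2)] f_inside[OF assms(1)] by (intro integral_cong) (simp add: k_eq)
  also have "\<dots> = integral {0..t} g + integral {0..t} (\<lambda>\<tau>. lam * trunc_pow p q M \<tau>)"
    by (intro integral_add integrable_continuous_real continuous_on_subset[OF g] continuous_on_mult_left
         continuous_on_subset[OF trunc_pow_continuous[OF p_gt_2 p_lt_q]]) auto
  finally show ?thesis using G assms by simp
qed

lemma trunc_primitive_nonneg: "integral {0..t} (trunc_pow p q M) \<ge> 0"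
  by (intro integral_nonneg integrable_continuous_real continuous_on_subset[OF trunc_pow_continuous[OF p_gt_2 p_lt_q]])
     (auto simp: trunc_pow_nonneg)

lemma AR_inside:
  assumes "norm x \<le> R" "t \<ge> 0" shows "\<theta>/2 * Ff x t \<le> t * f x t"
proof -
  let ?J = "integral {0..t} (trunc_pow p q M)"
  have "\<theta>/2 * G t \<le> t * g t" using g_AR[of t] assms G[of 0] by (cases "t = 0") auto
  moreover have "\<theta>/2 * ?J \<le> t * trunc_pow p q M t"
  proof -
    have "\<theta>/2 * ?J \<le> p/2 * ?J" using exponents trunc_primitive_nonneg by (intro mult_right_mono) auto
    also have "\<dots> \<le> t * trunc_pow p q M t" by (rule trunc_pow_AR[OF p_gt_2 p_lt_q assms(2)])
    finally show ?thesis .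
  qed
  hence "lam * (\<theta>/2 * ?J) \<le> lam * (t * trunc_pow p q M t)" using lam by (intro mult_left_mono)
  ultimately show ?thesis using assms by (simp add: Ff_inside f_inside k_eq algebra_simps)
qed

lemma Ff_outside: assumes "norm x > R" "t \<ge> 0" shows "Ff x t \<le> P x * t"
proof -
  have "integral {0..t} (f x) \<le> integral {0..t} (\<lambda>_. P x)"
    using f_le_P[OF assms(1)] by (intro integral_le integrable_continuous_real continuous_on_subset[OF f_cont]) auto
  thus ?thesis using assms by (simp add: Ff_eq_integral mult.commute)
qed

text \<open>Condition (g3) may fail where the cap is active. There the primitive is at most P t, and
  the assumed lower bound for V makes P at most (\<theta>-2)/(2\<theta>) V. The loss thus costs half
  of the coefficient 1/2 - 1/\<theta> = (\<theta>-2)/(2\<theta>), and the other half remains for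
  coercivity.\<close>

lemma AR_pointwise:
  assumes t: "t \<ge> 0" shows "Ff x t / 2 - f x t * t / \<theta> \<le> (\<theta>-2)/(4*\<theta>) * (V x * t)"
proof (cases "norm x \<le> R")
  case True
  have "Ff x t / 2 \<le> f x t * t / \<theta>" using AR_inside[OF True t] exponents by (simp add: field_simps)
  moreover have "(\<theta>-2)/(4*\<theta>) * (V x * t) \<ge> 0" using exponents V0 t by simp
  ultimately show ?thesis by linarith
next
  case False
  hence x: "norm x > R" by simp
  have "P x = (\<theta>-2)/(2*\<theta>) * (2 * \<theta> / (\<theta> - 2) * P x)" using exponents by (simp add: field_simps)
  also have "\<dots> \<le> (\<theta>-2)/(2*\<theta>) * V x" using V_ge_P[OF x] exponents by (intro mult_left_mono) auto
  finally have "P x * t \<le> (\<theta>-2)/(2*\<theta>) * V x * t" using t by (rule mult_right_mono)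
  moreover have "f x t * t / \<theta> \<ge> 0" using penalized_nonneg[OF t] exponents t by simp
  moreover have "(\<theta>-2)/(4*\<theta>) * (V x * t) = (\<theta>-2)/(2*\<theta>) * V x * t / 2" by simp
  ultimately show ?thesis using Ff_outside[OF x t] by linarith
qed

lemma AR_coercive:
  assumes u: "u \<in> E" shows "(\<theta>-2)/(4*\<theta>) * (nrm u)\<^sup>2 \<le> I u - D u u / \<theta>"
proof -
  let ?F = "\<lambda>x. Ff x ((cmod (u x))\<^sup>2)" and ?N = "\<lambda>x. Nn x (u x) \<bullet> u x" and ?V = "\<lambda>x. V x * (cmod (u x))\<^sup>2"
  have N: "?N x = f x ((cmod (u x))\<^sup>2) * (cmod (u x))\<^sup>2" for x by (simp add: Nn_def power2_norm_eq_inner)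
  have "(\<integral>x. ?F x / 2 - ?N x / \<theta> \<partial>lborel) \<le> (\<integral>x. (\<theta>-2)/(4*\<theta>) * ?V x \<partial>lborel)"
  proof (rule Bochner_Integration.integral_mono)
    show "integrable lborel (\<lambda>x. ?F x / 2 - ?N x / \<theta>)"
      by (intro Bochner_Integration.integrable_diff integrable_divide Ff_integrable Nn_integrable u)
    show "integrable lborel (\<lambda>x. (\<theta>-2)/(4*\<theta>) * ?V x)" by (intro integrable_mult_right E_V u)
    show "?F x / 2 - ?N x / \<theta> \<le> (\<theta>-2)/(4*\<theta>) * ?V x" for x unfolding N by (rule AR_pointwise) simp
  qed
  moreover have "(\<integral>x. ?F x / 2 - ?N x / \<theta> \<partial>lborel) = (\<integral>x. ?F x \<partial>lborel) / 2 - (\<integral>x. ?N x \<partial>lborel) / \<theta>"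
    by (subst Bochner_Integration.integral_diff) (auto intro!: integrable_divide Ff_integrable Nn_integrable u)
  moreover have "(\<integral>x. (\<theta>-2)/(4*\<theta>) * ?V x \<partial>lborel) = (\<theta>-2)/(4*\<theta>) * (\<integral>x. ?V x \<partial>lborel)" by simp
  moreover have "(\<theta>-2)/(4*\<theta>) * (\<integral>x. ?V x \<partial>lborel) \<le> (\<theta>-2)/(4*\<theta>) * (nrm u)\<^sup>2"
    unfolding nrm_sq ip_self using exponents by (intro mult_left_mono) auto
  moreover have "I u - D u u / \<theta> = (nrm u)\<^sup>2 / 2 - (\<integral>x. ?F x \<partial>lborel) / 2 - ((nrm u)\<^sup>2 - (\<integral>x. ?N x \<partial>lborel)) / \<theta>"
    by (simp add: I_def D_def nrm_sq)
  moreover have "(nrm u)\<^sup>2 / 2 - ((nrm u)\<^sup>2 - (\<integral>x. ?N x \<partial>lborel)) / \<theta> = 2 * ((\<theta>-2)/(4*\<theta>) * (nrm u)\<^sup>2) + (\<integral>x. ?N x \<partial>lborel) / \<theta>"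
    using exponents by (simp add: field_simps)
  ultimately show ?thesis by linarith
qed

text \<open>On the ball of radius 1/2 the tent is at least 1/2, so T tent has modulus at least T/2
  \<ge> 1 there and the lower bound for G applies. The growth exponent \<theta> > 2 makes this beat
  the quadratic energy for large T.\<close>

lemma tent_I_neg:
  assumes E: "tent \<in> E" and K: "(nrm tent)\<^sup>2 \<le> Ke" and T: "T \<ge> 2" "T\<^sup>2 * Ke < measure lborel (ball (0::real^'n) (1/2)) * (G 1 * (T/2) powr \<theta>)"
  shows "I (T *\<^sub>R tent) < 0"
proof -
  let ?F = "\<lambda>x. Ff x ((cmod ((T *\<^sub>R tent) x))\<^sup>2)" and ?B = "ball (0::real^'n) (1/2)"
  have G1: "G 1 > 0" using g_AR[of 1] exponents by (simp add: zero_less_mult_iff)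
  have fin: "emeasure lborel ?B < \<infinity>" using emeasure_lborel_ball_finite[of "0::real^'n" "1/2"] by auto
  have "(\<integral>x. G 1 * (T/2) powr \<theta> * indicator ?B x \<partial>lborel) \<le> (\<integral>x. ?F x \<partial>lborel)"
  proof (rule Bochner_Integration.integral_mono)
    show "integrable lborel (\<lambda>x. G 1 * (T/2) powr \<theta> * indicator ?B x)"
      using fin by (intro integrable_mult_right integrable_real_indicator) auto
    show "integrable lborel ?F" by (intro Ff_integrable E_scale E)
    fix x :: "real^'n"
    show "G 1 * (T/2) powr \<theta> * indicator ?B x \<le> ?F x"
    proof (cases "x \<in> ?B")
      case True
      define t where "t = (cmod ((T *\<^sub>R tent) x))\<^sup>2"
      have "T / 2 \<le> T * (1 - norm x)" using True T by (simp add: field_simps)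
      hence a: "T / 2 \<le> cmod ((T *\<^sub>R tent) x)" using T True by (simp add: cmod_tent max_def)
      hence t1: "(T/2)\<^sup>2 \<le> t" unfolding t_def using T by (intro power_mono) auto
      moreover have "1 \<le> (T/2)\<^sup>2" using T by (intro one_le_power) simp
      ultimately have t: "t \<ge> 1" by linarith
      have "G 1 * (T/2) powr \<theta> \<le> G 1 * t powr (\<theta>/2)"
      proof (rule mult_left_mono)
        have "(T/2) powr \<theta> = ((T/2)\<^sup>2) powr (\<theta>/2)" using power2_powr_half[of "T/2" \<theta>] T by simp
        also have "\<dots> \<le> t powr (\<theta>/2)" using t1 exponents by (intro powr_mono2) auto
        finally show "(T/2) powr \<theta> \<le> t powr (\<theta>/2)" .
      qed (use G1 in simp)
      also have "\<dots> \<le> G t" by (rule primitive_lower_bound[OF g G _ t]) (use g_AR in auto)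
      also have "\<dots> \<le> Ff x t" using True R t lam trunc_primitive_nonneg by (subst Ff_inside) auto
      finally show ?thesis using True by (simp add: t_def)
    qed (use Ff_nonneg in auto)
  qed
  hence "measure lborel ?B * (G 1 * (T/2) powr \<theta>) \<le> (\<integral>x. ?F x \<partial>lborel)" by (simp add: mult_ac)
  moreover have "(nrm (T *\<^sub>R tent))\<^sup>2 \<le> T\<^sup>2 * Ke" unfolding nrm_scale using K by (simp add: power_mult_distrib mult_left_mono)
  ultimately show ?thesis using T unfolding I_def by linarith
qed

end

section \<open>Solving the penalized problem and removing the penalization\<close>

context penalized
begin

lemma penalized_solution:
  assumes r: "r > 0" "(C0 + 1) * Cs powr (ps/2) * r powr (ps - 2) \<le> 1/2"
    and V1: "\<And>x. x \<in> ball 0 1 \<Longrightarrow> V x \<le> Vinf"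
    and Ke: "Ke = (\<integral>z. (cmod (magd A tent z))\<^sup>2 \<partial>KM s) + Vinf * (\<integral>(x::real^'n). (cmod (tent x))\<^sup>2 \<partial>lborel)"
    and T: "T \<ge> 2" "T\<^sup>2 * Ke < measure lborel (ball (0::real^'n) (1/2)) * (G 1 * (T/2) powr \<theta>)"
    and S: "S > 0" "(Cs * ((T\<^sup>2 * Ke / 2 + 1) / ((\<theta>-2)/(4*\<theta>)) + 1)\<^sup>2) powr (ps/2) \<le> S"
    and K: "K > 0" "2 * K \<le> M"
    and small: "(Cs * (C0 + 1) * K powr (p - ps) * 4 powr ps * S) powr (ps/2) \<le> S * 2 powr (-(ps * (ps/2) / (ps/2 - 1)))"
  obtains U where "U \<in> E" "\<And>\<phi>. \<phi> \<in> E \<Longrightarrow> D U \<phi> = 0" "\<not> (AE x in lborel. U x = 0)"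
    "AE x in lborel. cmod (U x) \<le> M"
proof -
  have tE: "tent \<in> E" by (rule tent_E[OF V1])
  have tK: "(nrm tent)\<^sup>2 \<le> Ke" unfolding Ke by (rule tent_nrm[OF V1])
  have eE: "T *\<^sub>R tent \<in> E" by (rule E_scale[OF tE])
  have eneg: "I (T *\<^sub>R tent) < 0" by (rule tent_I_neg[OF tE tK T])
  \<comment> \<open>Inside the ball of radius r the functional is nonnegative, so a point of
    negative energy lies outside.\<close>
  have en: "nrm (T *\<^sub>R tent) > r"
  proof (rule ccontr)
    assume "\<not> ?thesis"
    hence "(nrm (T *\<^sub>R tent))\<^sup>2 / 4 \<le> I (T *\<^sub>R tent)" by (intro I_lower[OF eE _ r(2)]) simp
    thus False using eneg zero_le_power2[of "nrm (T *\<^sub>R tent)"] by linarith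
  qed
  have path: "I (t *\<^sub>R (T *\<^sub>R tent)) \<le> T\<^sup>2 * Ke / 2" if t: "0 \<le> t" "t \<le> 1" for t
  proof -
    have "I (t *\<^sub>R (T *\<^sub>R tent)) \<le> t\<^sup>2 * (nrm (T *\<^sub>R tent))\<^sup>2 / 2" by (rule I_scale_le)
    also have "\<dots> \<le> 1 * (nrm (T *\<^sub>R tent))\<^sup>2 / 2" using t by (intro divide_right_mono mult_right_mono) (auto simp: power_le_one)
    also have "\<dots> \<le> T\<^sup>2 * Ke / 2" unfolding nrm_scale using tK by (simp add: power_mult_distrib mult_left_mono)
    finally show ?thesis .
  qed
  \<comment> \<open>The mountain range is a shell, as the discrete chain needs; at norm at least r/2
    the bound (nrm u)^2/4 gives r^2/16.\<close>
  have geo: "I u \<ge> r\<^sup>2/16" if u: "u \<in> E" "r/2 \<le> nrm u" "nrm u \<le> r" for u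
  proof -
    have "(r/2)\<^sup>2 \<le> (nrm u)\<^sup>2" using u r by (intro power_mono) auto
    thus ?thesis using I_lower[OF u(1,3) r(2)] by (simp add: power_divide)
  qed
  have pos: "r\<^sup>2/16 > 0" "(\<theta>-2)/(4*\<theta>) > 0" "1 \<le> \<theta>" using r exponents by auto
  have "\<exists>U\<in>E. (\<forall>\<phi>\<in>E. D U \<phi> = 0) \<and> \<not> (AE x in lborel. U x = 0) \<and>
    (\<integral>x. cmod (U x) powr ps \<partial>lborel) \<le> (Cs * ((T\<^sup>2 * Ke / 2 + 1) / ((\<theta>-2)/(4*\<theta>)) + 1)\<^sup>2) powr (ps/2)"
    by (rule mountain_pass_solution[OF r(1) pos(1) geo eE en less_imp_le[OF eneg] path pos(2,3) AR_coercive]) blast+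
  then obtain U where U: "U \<in> E" "\<And>\<phi>. \<phi> \<in> E \<Longrightarrow> D U \<phi> = 0" "\<not> (AE x in lborel. U x = 0)"
    "(\<integral>x. cmod (U x) powr ps \<partial>lborel) \<le> (Cs * ((T\<^sup>2 * Ke / 2 + 1) / ((\<theta>-2)/(4*\<theta>)) + 1)\<^sup>2) powr (ps/2)"
    by blast
  have "AE x in lborel. cmod (U x) \<le> 2 * K"
  proof (rule sup_bound[OF U(1,2) p_gt_2 exponents(3) _ _ S(1) order_trans[OF U(4) S(2)] K(1) small])
    show "f x t \<le> (C0 + 1) * t powr ((p-2)/2)" if "t \<ge> 0" for x t
      using f_le_k k_le_sub[OF that] by (rule order_trans)
  qed (use C0 in auto)
  hence "AE x in lborel. cmod (U x) \<le> M" by eventually_elim (use K in linarith)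
  with U that show thesis by blast
qed

text \<open>Outside the ball the decay estimate, raised to the power ps-2, turns into M^(ps-2)
  2^(2s) (R/|x|)^(4s), which is P up to the factor C0 + 1 of the critical growth bound; so the
  minimum in \<open>penalize\<close> is attained by \<open>k\<close>. The bound by M then undoes the
  truncation of the power.\<close>

lemma f_unpenalized:
  assumes U: "U \<in> E" "\<And>\<phi>. \<phi> \<in> E \<Longrightarrow> D U \<phi> = 0" and UM: "AE x in lborel. cmod (U x) \<le> M"
  shows "AE x in lborel. f x ((cmod (U x))\<^sup>2) = g ((cmod (U x))\<^sup>2) + lam * cmod (U x) powr (q-2)"
proof -
  define \<beta> where "\<beta> = real CARD('n) - 2 * s"
  have \<beta>: "\<beta> > 0" using N by (simp add: \<beta>_def)
  have \<beta>ps: "\<beta> * (ps - 2) = 4 * s" using \<beta> by (simp add: ps_def sobolev_crit_def \<beta>_def field_simps)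
  have R0: "R > 0" using R by simp
  have "AE x in lborel. cmod (U x) \<le> M * (2 * R\<^sup>2) powr (\<beta>/2) * bubble s R x"
    unfolding \<beta>_def
  proof (rule decay[OF U _ UM R0])
    show "f x t \<le> V x" if "t \<ge> 0" "norm x > R" for x t
    proof -
      have "1 * P x \<le> 2 * \<theta> / (\<theta> - 2) * P x" using exponents P_nonneg by (intro mult_right_mono) auto
      thus ?thesis using f_le_P[OF that(2), of t] V_ge_P[OF that(2)] by linarith
    qed
  qed (use M in auto)
  with UM show ?thesis
  proof eventually_elim
    case (elim x)
    define t where "t = (cmod (U x))\<^sup>2"
    have "f x t = k t"
    proof (cases "norm x \<le> R")
      case False
      hence x: "norm x > R" by simp
      hence x0: "norm x > 0" using R by linarith
      have "bubble s R x = (R\<^sup>2 + (norm x)\<^sup>2) powr (-(\<beta>/2))" by (simp add: bubble_def \<beta>_def)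
      also have "\<dots> \<le> (norm x)\<^sup>2 powr (-(\<beta>/2))" using x0 R \<beta> by (intro powr_mono2') auto
      also have "\<dots> = norm x powr (-\<beta>)" using power2_powr_half[of "norm x" "-\<beta>"] by simp
      finally have "M * (2 * R\<^sup>2) powr (\<beta>/2) * bubble s R x \<le> M * (2 * R\<^sup>2) powr (\<beta>/2) * norm x powr (-\<beta>)"
        using M by (intro mult_left_mono) auto
      with elim(2) have "cmod (U x) \<le> M * (2 * R\<^sup>2) powr (\<beta>/2) * norm x powr (-\<beta>)" by linarith
      hence "cmod (U x) powr (ps-2) \<le> (M * (2 * R\<^sup>2) powr (\<beta>/2) * norm x powr (-\<beta>)) powr (ps-2)"
        using ps_gt_2 by (intro powr_mono2) auto
      also have "\<dots> = M powr (ps-2) * ((2 * R\<^sup>2) powr (\<beta>/2)) powr (ps-2) * (norm x powr (-\<beta>)) powr (ps-2)"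
        using M by (simp add: powr_mult)
      also have "((2 * R\<^sup>2) powr (\<beta>/2)) powr (ps-2) = 2 powr (2 * s) * R powr (4 * s)"
      proof -
        have e: "\<beta>/2 * (ps-2) = 2 * s" using \<beta>ps by simp
        have "((2 * R\<^sup>2) powr (\<beta>/2)) powr (ps-2) = (2 * R\<^sup>2) powr (2 * s)" unfolding powr_powr e ..
        also have "\<dots> = 2 powr (2 * s) * (R\<^sup>2) powr (4 * s / 2)" by (simp add: powr_mult)
        finally show ?thesis using power2_powr_half[of R "4 * s"] R by simp
      qed
      also have "(norm x powr (-\<beta>)) powr (ps-2) = norm x powr (-(4 * s))"
        unfolding powr_powr mult_minus_left \<beta>ps ..
      also have "M powr (ps-2) * (2 powr (2 * s) * R powr (4 * s)) * norm x powr (-(4 * s)) = M powr (ps-2) * 2 powr (2 * s) * (R / norm x) powr (4 * s)"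
        using R x0 by (simp add: powr_divide powr_minus_divide)
      finally have "(C0 + 1) * cmod (U x) powr (ps-2) \<le> P x"
        using C0 by (simp add: P_def mult.assoc)
      moreover have "k t \<le> (C0 + 1) * cmod (U x) powr (ps-2)"
        using k_le_crit[of t] power2_powr_half[of "cmod (U x)" "ps-2"] by (simp add: t_def)
      ultimately show ?thesis using False by (simp add: f_def penalize_def)
    qed (simp add: f_inside)
    also have "\<dots> = g t + lam * t powr ((q-2)/2)"
    proof -
      have "t \<le> M\<^sup>2" unfolding t_def using elim(1) by (intro power_mono) auto
      thus ?thesis by (subst k_eq) (auto simp: trunc_pow_eq t_def)
    qed
    finally show ?case using power2_powr_half[of "cmod (U x)" "q-2"] by (simp add: t_def)
  qed
qed

text \<open>Boundedness of U is what makes the possibly supercritical term integrable against every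
  \<phi> in E: the excess power |U|^(q-ps) is at most M^(q-ps), and the critical remainder is
  handled by Young's inequality.\<close>

lemma critical_point_weak_solution:
  assumes U: "U \<in> E" "\<And>\<phi>. \<phi> \<in> E \<Longrightarrow> D U \<phi> = 0" and UM: "AE x in lborel. cmod (U x) \<le> M"
  shows "weak_solution s A V g lam q U"
  unfolding weak_solution_def
proof (intro conjI ballI U)
  fix \<phi> assume \<phi>: "\<phi> \<in> E"
  have unp: "AE x in lborel. f x ((cmod (U x))\<^sup>2) = g ((cmod (U x))\<^sup>2) + lam * cmod (U x) powr (q-2)"
    using assms by (rule f_unpenalized)
  note [measurable] = E_measurable[OF U(1)] E_measurable[OF \<phi>]
  have [measurable]: "(\<lambda>t. g (max 0 t)) \<in> borel_measurable borel" by (rule borel_measurable_continuous_onI[OF g_max_continuous])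
  let ?S = "\<lambda>x. cmod (U x) powr ps + cmod (\<phi> x) powr ps"
  have Si: "integrable lborel ?S" by (intro Bochner_Integration.integrable_add E_powr U \<phi>)
  have Young: "cmod (U x) powr (ps-2) * cmod (U x) * cmod (\<phi> x) \<le> ?S x" for x
    using powr_pred_mult_le[of "cmod (U x)" "cmod (\<phi> x)" ps] powr_mult_base[of "cmod (U x)" "ps-2"] ps_gt_2
    by (simp add: mult.commute)
  let ?g = "\<lambda>x. of_real (g ((cmod (U x))\<^sup>2)) * U x * cnj (\<phi> x)"
  let ?q = "\<lambda>x. of_real (cmod (U x) powr (q - 2)) * U x * cnj (\<phi> x)"
  have g_max: "g ((cmod (U x))\<^sup>2) = g (max 0 ((cmod (U x))\<^sup>2))" for x by (simp add: max_def)
  show gi: "integrable lborel ?g"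
  proof (rule Bochner_Integration.integrable_bound)
    show "integrable lborel (\<lambda>x. C0 * ?S x)" by (intro integrable_mult_right Si)
    show "?g \<in> borel_measurable lborel" unfolding g_max by measurable
    show "AE x in lborel. norm (?g x) \<le> norm (C0 * ?S x)"
    proof (rule AE_I2)
      fix x
      have "norm (?g x) = g ((cmod (U x))\<^sup>2) * (cmod (U x) * cmod (\<phi> x))" using g_nonneg[of "(cmod (U x))\<^sup>2"] by (simp add: norm_mult)
      also have "\<dots> \<le> C0 * ((cmod (U x))\<^sup>2) powr ((ps-2)/2) * (cmod (U x) * cmod (\<phi> x))" by (intro mult_right_mono g_le(1)) auto
      also have "\<dots> = C0 * (cmod (U x) powr (ps-2) * cmod (U x) * cmod (\<phi> x))" by (simp add: power2_powr_half)
      also have "\<dots> \<le> C0 * ?S x" using C0 Young by (intro mult_left_mono) auto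
      finally show "norm (?g x) \<le> norm (C0 * ?S x)" by (auto intro: order_trans[OF _ abs_ge_self])
    qed
  qed
  show qi: "integrable lborel ?q"
  proof (rule Bochner_Integration.integrable_bound)
    show "integrable lborel (\<lambda>x. M powr (q-ps) * ?S x)" by (intro integrable_mult_right Si)
    show "AE x in lborel. norm (?q x) \<le> norm (M powr (q-ps) * ?S x)"
      using UM
    proof eventually_elim
      case (elim x)
      have "norm (?q x) = cmod (U x) powr (q-ps) * (cmod (U x) powr (ps-2) * cmod (U x) * cmod (\<phi> x))"
        using powr_add[of "cmod (U x)" "q-ps" "ps-2"] by (simp add: norm_mult)
      also have "\<dots> \<le> M powr (q-ps) * ?S x"
        using Young elim exponents by (intro mult_mono powr_mono2) auto
      finally show ?case by (auto intro: order_trans[OF _ abs_ge_self])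
    qed
  qed measurable
  have "(\<integral>x. Nn x (U x) \<bullet> \<phi> x \<partial>lborel) = (\<integral>x. Re (?g x + of_real lam * ?q x) \<partial>lborel)"
  proof (rule integral_cong_AE)
    show "(\<lambda>x. Nn x (U x) \<bullet> \<phi> x) \<in> borel_measurable lborel" by measurable
    show "(\<lambda>x. Re (?g x + of_real lam * ?q x)) \<in> borel_measurable lborel" unfolding g_max by measurable
    show "AE x in lborel. Nn x (U x) \<bullet> \<phi> x = Re (?g x + of_real lam * ?q x)"
      using unp
    proof eventually_elim
      case (elim x)
      show ?case unfolding Nn_def elim inner_complex_def by (simp add: algebra_simps)
    qed
  qed
  also have "\<dots> = Re (\<integral>x. ?g x + of_real lam * ?q x \<partial>lborel)"
    by (intro integral_Re Bochner_Integration.integrable_add integrable_mult_right gi qi)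
  also have "(\<integral>x. ?g x + of_real lam * ?q x \<partial>lborel) = (\<integral>x. ?g x \<partial>lborel) + of_real lam * (\<integral>x. ?q x \<partial>lborel)"
    by (subst Bochner_Integration.integral_add) (auto intro!: gi qi integrable_mult_right)
  finally have "Re ((\<integral>x. ?g x \<partial>lborel) + of_real lam * (\<integral>x. ?q x \<partial>lborel)) = ip U \<phi>" using U(2)[OF \<phi>] by (simp add: D_def)
  thus "Re (mag_form s A U \<phi>) + Re ((\<integral>x. of_real (V x) * U x * cnj (\<phi> x) \<partial>lborel) - (\<integral>x. ?g x \<partial>lborel) - of_real lam * (\<integral>x. ?q x \<partial>lborel)) = 0"
    unfolding ip_eq[OF U(1) \<phi>] by simp
qed

end

theorem theorem1p1:
  fixes s q Vinf p \<theta> :: real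
    and A :: "real^'n \<Rightarrow> real^'n"
    and g G :: "real \<Rightarrow> real"
  assumes s: "0 < s" "s < 1"
    and N: "real CARD('n) > 2 * s"
    and q: "q \<ge> sobolev_crit CARD('n) s"
    and A: "continuous_on UNIV A"
    and Vinf: "Vinf > 0"
    and g: "continuous_on {0..} g"
    and G: "\<And>t. t \<ge> 0 \<Longrightarrow> G t = integral {0..t} g"
    and g1: "Limsup (at_right 0)
               (\<lambda>t. ereal (g t / t powr ((sobolev_crit CARD('n) s - 2) / 2))) < \<infinity>"
    and g2: "2 < p" "p < sobolev_crit CARD('n) s"
            "Limsup at_top (\<lambda>t. ereal (g t / t powr ((p - 2) / 2))) < \<infinity>"
    and g3: "2 < \<theta>" "\<theta> \<le> p"
            "\<And>t. t > 0 \<Longrightarrow> 0 < \<theta> / 2 * G t \<and> \<theta> / 2 * G t \<le> t * g t"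
  shows "\<exists>lam0 > 0. \<exists>\<Lambda>0 > 0. \<forall>lam. 0 \<le> lam \<and> lam < lam0 \<longrightarrow> (\<forall>\<Lambda> \<ge> \<Lambda>0.
           \<forall>V :: real^'n \<Rightarrow> real.
             continuous_on UNIV V \<and>
             (\<forall>x. V x \<ge> 0) \<and>
             (\<forall>x \<in> ball 0 1. V x \<le> Vinf) \<and>
             (\<exists>R0 > 1. 1 / R0 powr (4 * s) * (INF x \<in> {x. norm x \<ge> R0}. norm x powr (4 * s) * V x) \<ge> \<Lambda>)
             \<longrightarrow> (\<exists>u. u \<in> energy_space s A V \<and>
                       weak_solution s A V g lam q u \<and>
                       \<not> (AE x in lborel. u x = 0)))"
proof -
  define ps where "ps = sobolev_crit CARD('n) s"
  define Cs where "Cs = sob_const TYPE(real^'n) s"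
  have ps: "p < ps" "ps \<le> q" using g2 q by (auto simp: ps_def)
  \<comment> \<open>The zero potential gives access to the facts on ps and Cs before any V is
    fixed.\<close>
  interpret free: mag_space s ps Cs A "\<lambda>_. 0"
    by unfold_locales (use s N A in \<open>auto simp: ps_def Cs_def\<close>)
  note Cs = free.Cs_pos and ps2 = free.ps_gt_2
  obtain C0 where C0: "C0 > 0" "\<And>t. t \<ge> 0 \<Longrightarrow> g t \<le> C0 * t powr ((ps-2)/2)" "\<And>t. t \<ge> 0 \<Longrightarrow> g t \<le> C0 * t powr ((p-2)/2)"
    by (rule growth_bound[of "(p-2)/2" "(ps-2)/2" g]) (use g g1 g2 ps ps_def in auto)
  \<comment> \<open>Solves (C0 + 1) Cs^(ps/2) r^(ps-2) = 1/2.\<close>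
  define r where "r = (1 / (2 * ((C0 + 1) * Cs powr (ps/2)))) powr (1 / (ps-2))"
  have r: "r > 0" "(C0 + 1) * Cs powr (ps/2) * r powr (ps - 2) \<le> 1/2"
    using C0 Cs ps2 by (auto simp: r_def powr_powr)
  define Ke where "Ke = (\<integral>z. (cmod (magd A tent z))\<^sup>2 \<partial>KM s) + Vinf * (\<integral>(x::real^'n). (cmod (tent x))\<^sup>2 \<partial>lborel)"
  have Ke0: "Ke \<ge> 0" using Vinf by (simp add: Ke_def)
  define m where "m = measure lborel (ball (0::real^'n) (1/2)) * G 1"
  have "measure lborel (ball (0::real^'n) (1/2)) > 0" using content_ball_pos[of "1/2" "0::real^'n"] by simp
  hence m: "m > 0" using g3(1) g3(3)[of 1] by (auto simp: m_def zero_less_mult_iff)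
  \<comment> \<open>Makes T^(\<theta>-2) m / 2^\<theta> at least Ke + 1, so that the primitive
    exceeds the quadratic energy; the bound 2 keeps T/2 in the range where G grows.\<close>
  define T where "T = max 2 (((Ke + 1) * 2 powr \<theta> / m) powr (1 / (\<theta>-2)))"
  have T2: "T \<ge> 2" by (simp add: T_def)
  have T: "T\<^sup>2 * Ke < measure lborel (ball (0::real^'n) (1/2)) * (G 1 * (T/2) powr \<theta>)"
  proof -
    have "(Ke + 1) * 2 powr \<theta> / m = (((Ke + 1) * 2 powr \<theta> / m) powr (1 / (\<theta>-2))) powr (\<theta>-2)" using g3 Ke0 m by (simp add: powr_powr)
    also have "\<dots> \<le> T powr (\<theta>-2)" using g3 by (intro powr_mono2) (auto simp: T_def)
    finally have 1: "Ke + 1 \<le> m * (T powr (\<theta>-2) / 2 powr \<theta>)" using m by (simp add: field_simps)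
    have "T\<^sup>2 * Ke < T\<^sup>2 * (Ke + 1)" using T2 by simp
    also have "\<dots> \<le> T\<^sup>2 * (m * (T powr (\<theta>-2) / 2 powr \<theta>))" by (intro mult_left_mono 1) simp
    also have "\<dots> = m * ((T powr 2 * T powr (\<theta>-2)) / 2 powr \<theta>)" using T2 by (simp add: mult_ac)
    also have "T powr 2 * T powr (\<theta>-2) = T powr \<theta>" by (simp add: powr_add[symmetric])
    also have "T powr \<theta> / 2 powr \<theta> = (T/2) powr \<theta>" using T2 by (simp add: powr_divide)
    finally show ?thesis by (simp add: m_def mult_ac)
  qed
  \<comment> \<open>The critical integral bound delivered by the mountain pass with c =
    (\<theta>-2)/(4\<theta>) and b0 = T^2 Ke/2; the added 1 gives positivity. Nothing in it refers
    to V, lam or M, so M can be chosen afterwards.\<close>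
  define S where "S = (Cs * ((T\<^sup>2 * Ke / 2 + 1) / ((\<theta>-2)/(4*\<theta>)) + 1)\<^sup>2) powr (ps/2) + 1"
  have S: "S > 0" by (simp add: S_def add_nonneg_pos)
  define a b where "a = Cs * (C0 + 1) * 4 powr ps * S" and "b = S * 2 powr (-(ps * (ps/2) / (ps/2 - 1)))"
  have ab: "a > 0" "b > 0" using Cs C0 S by (auto simp: a_def b_def)
  \<comment> \<open>Solves the smallness condition of \<open>sup_bound\<close> with equality, which
    is possible because the exponent p - ps is not zero.\<close>
  define K where "K = (b powr (2/ps) / a) powr (1 / (p - ps))"
  have K: "K > 0" using ab by (simp add: K_def)
  have small: "(Cs * (C0 + 1) * K powr (p - ps) * 4 powr ps * S) powr (ps/2) \<le> b"
  proof -
    have "K powr (p - ps) = b powr (2/ps) / a" using ab ps by (simp add: K_def powr_powr)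
    hence "Cs * (C0 + 1) * K powr (p - ps) * 4 powr ps * S = b powr (2/ps)" using Cs C0 S by (simp add: a_def)
    thus ?thesis using ps2 ab by (simp add: powr_powr)
  qed
  define M where "M = max 1 (2 * K)"
  \<comment> \<open>The constant that (V3) has to provide for the cap; as it does not involve R0, it
    can serve as \<Lambda>0, and M^(-(q-p)) as lam0.\<close>
  define \<kappa> where "\<kappa> = 2 * \<theta> / (\<theta> - 2) * ((C0 + 1) * M powr (ps-2) * 2 powr (2 * s))"
  have \<kappa>: "\<kappa> > 0" using C0 g3 by (simp add: \<kappa>_def M_def)
  show ?thesis
  proof (rule exI[of _ "M powr (-(q-p))"], rule conjI[OF _ exI[where x=\<kappa>]], goal_cases)
    case 1 show ?case by (simp add: M_def)
  next
    case 2
    show ?case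
    proof (intro conjI allI impI)
      show "\<kappa> > 0" by (rule \<kappa>)
      fix lam \<Lambda> :: real and V :: "real^'n \<Rightarrow> real"
      assume lam: "0 \<le> lam \<and> lam < M powr (-(q-p))" and \<Lambda>: "\<kappa> \<le> \<Lambda>"
      assume "continuous_on UNIV V \<and> (\<forall>x. V x \<ge> 0) \<and> (\<forall>x \<in> ball 0 1. V x \<le> Vinf) \<and>
               (\<exists>R0 > 1. 1 / R0 powr (4 * s) * (INF x \<in> {x. norm x \<ge> R0}. norm x powr (4 * s) * V x) \<ge> \<Lambda>)"
      then obtain R0 where Vh: "continuous_on UNIV V" "\<And>x. V x \<ge> 0" "\<And>x. x \<in> ball 0 1 \<Longrightarrow> V x \<le> Vinf"
        and R0: "R0 > 1" "1 / R0 powr (4 * s) * (INF x \<in> {x. norm x \<ge> R0}. norm x powr (4 * s) * V x) \<ge> \<Lambda>" by blast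
      have V_large: "\<kappa> * (R0 / norm x) powr (4 * s) \<le> V x" if x: "norm x > R0" for x
      proof -
        have x0: "norm x > 0" using x R0 by linarith
        have "\<kappa> \<le> 1 / R0 powr (4 * s) * (INF x \<in> {x. norm x \<ge> R0}. norm x powr (4 * s) * V x)" using R0 \<Lambda> by linarith
        \<comment> \<open>Nonnegativity of V bounds the set from below, without which the real
          infimum would carry no information about its elements.\<close>
        also have "\<dots> \<le> 1 / R0 powr (4 * s) * (norm x powr (4 * s) * V x)"
          using x Vh by (intro mult_left_mono cINF_lower bdd_belowI2[of _ 0]) auto
        finally show ?thesis using R0 x0 by (simp add: powr_divide field_simps)
      qed
      interpret penalized s ps Cs A V g G \<theta> p q C0 lam M R0
      proof unfold_locales
        show "2 * \<theta> / (\<theta> - 2) * ((C0 + 1) * M powr (ps-2) * 2 powr (2 * s)) * (R0 / norm x) powr (4 * s) \<le> V x" if "norm x > R0" for x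
          using V_large[OF that] by (simp only: \<kappa>_def)
      qed (use s N A Vh g G g2 g3 ps C0 lam R0 in \<open>auto simp: ps_def Cs_def M_def\<close>)
      obtain U where U: "U \<in> E" "\<And>\<phi>. \<phi> \<in> E \<Longrightarrow> D U \<phi> = 0" "\<not> (AE x in lborel. U x = 0)"
        "AE x in lborel. cmod (U x) \<le> M"
        by (rule penalized_solution[OF r Vh(3) Ke_def T2 T S _ K _ small[unfolded b_def]]) (auto simp: S_def M_def)
      have weak: "weak_solution s A V g lam q U" using U(1,2,4) by (rule critical_point_weak_solution)
      show "\<exists>u. u \<in> E \<and> weak_solution s A V g lam q u \<and> \<not> (AE x in lborel. u x = 0)"
        using U(1,3) weak by blast
    qed
  qed
qed

end
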